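(* Let $I=[0,1]$ and let $f\colon I\to I$ be continuous. Suppose $\{I_i\}_{i\in\Lambda}$ is a finite partition of $I$ by intervals such that the restriction of $f$ to each $I_i$ is a $C^{1+\beta+\epsilon}$-diffeomorphism onto its image, with $\beta,\epsilon>0$, and that $f$ is expanding: there is $\alpha>1$ with $|f(x)-f(y)|\ge\alpha|x-y|$ for all $x,y\in I_i$, $i\in\Lambda$. Let $\Phi$ be the Ruelle–Perron–Frobenius operator of $f$ with Jacobian $w=|f'|$. Let $p\in[1,\infty)$, $q\in[1,\infty]$, $0<s<\beta<1/p$ and $1/p+1/p'=1$. Then $$r_{ess}(\Phi,\mathcal{B}^s_{p,q})\le e^{h_{top}(f)/p'}\,(\inf|f'|)^{-(1/p'+s)},$$ where $h_{top}(f)$ is the topological entropy of $f$. In particular $\Phi$ acts as a quasi-compact operator on $\mathcal{B}^s_{p,q}$ for $p$ sufficiently close to $1$.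
   Context: $I=[0,1]$ carries Lebesgue measure $m$, $|A|=m(A)$, and the dyadic grid $\mathcal{D}=(\mathcal{D}^k)_k$, $\mathcal{D}^k$ being the partition of $[0,1]$ into $2^k$ intervals of equal length. $C^{1+\gamma}$ means $C^1$ with $\gamma$-Hölder continuous derivative. Besov space. For $s>0$, $p\in[1,\infty)$, $q\in[1,\infty]$ put $a_Q=|Q|^{s-1/p}1_Q$. $\mathcal{B}^s_{p,q}=\mathcal{B}^s_{p,q}([0,1],m,\mathcal{D})$ is the space of $\psi\in L^p(m)$ that can be written $\psi=\sum_k\sum_{Q\in\mathcal{D}^k}c_Qa_Q$ (the series in $k$ converging in $L^p$) with $\big(\sum_k(\sum_{Q\in\mathcal{D}^k}|c_Q|^p)^{q/p}\big)^{1/q}<\infty$ (supremum over $k$ if $q=\infty$); its norm is the infimum of this quantity over all representations. Transfer operator: with $h_i\colon f(I_i)\to I_i$ the inverse branches, $(\Phi\psi)(x)=\sum_{i:\,x\in f(I_i)}|h_i'(x)|\,\psi(h_i(x))$. $r_{ess}$ denotes the essential spectral radius. For $p=1$, $1/p'=0$. *)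

theory Defs
  imports "HOL-Analysis.Analysis"
begin

text \<open>Function spaces are sets of functions and not of classes of functions;
  almost everywhere equal functions are at distance zero. Functions are complex valued, since
  spectra are considered below.\<close>

definition Lp_norm :: "'a measure \<Rightarrow> real \<Rightarrow> ('a \<Rightarrow> complex) \<Rightarrow> real" where
  "Lp_norm M p \<psi> = (LINT x|M. norm (\<psi> x) powr p) powr (1 / p)"

definition Lp_space :: "'a measure \<Rightarrow> real \<Rightarrow> ('a \<Rightarrow> complex) set" where
  "Lp_space M p = {\<psi> \<in> borel_measurable M. integrable M (\<lambda>x. norm (\<psi> x) powr p)}"

abbreviation leb01 :: "real measure" where
  "leb01 \<equiv> lebesgue_on {0..1}"

text \<open>The interval number \<open>j\<close>, for \<open>j < 2 ^ k\<close>, of the generation \<open>k\<close> of the dyadic grid; the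
  last interval is closed, so that each generation partitions \<open>[0, 1]\<close>.\<close>

definition dyadic :: "nat \<Rightarrow> nat \<Rightarrow> real set" where
  "dyadic k j = (if Suc j = 2 ^ k then {real j / 2 ^ k..1}
                 else {real j / 2 ^ k..<real (Suc j) / 2 ^ k})"

definition atom :: "real \<Rightarrow> real \<Rightarrow> real set \<Rightarrow> real \<Rightarrow> complex" where
  "atom s p Q x = complex_of_real (measure lebesgue Q powr (s - 1 / p) * indicator Q x)"

definition besov_series ::
    "real \<Rightarrow> real \<Rightarrow> (nat \<Rightarrow> nat \<Rightarrow> complex) \<Rightarrow> nat \<Rightarrow> real \<Rightarrow> complex" where
  "besov_series s p c K x = (\<Sum>k<K. \<Sum>j<2 ^ k. c k j * atom s p (dyadic k j) x)"

text \<open>Finiteness and value of the \<open>\<ell>\<^sup>q\<close> norm of a nonnegative sequence, \<open>q \<in> [1, \<infinity>]\<close>.\<close>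

definition lq_finite :: "ennreal \<Rightarrow> (nat \<Rightarrow> real) \<Rightarrow> bool" where
  "lq_finite q a \<longleftrightarrow>
     (if q = \<infinity> then bdd_above (range a) else summable (\<lambda>k. a k powr enn2real q))"

definition lq_norm :: "ennreal \<Rightarrow> (nat \<Rightarrow> real) \<Rightarrow> real" where
  "lq_norm q a =
     (if q = \<infinity> then (SUP k. a k) else (\<Sum>k. a k powr enn2real q) powr (1 / enn2real q))"

definition level_norm :: "real \<Rightarrow> (nat \<Rightarrow> nat \<Rightarrow> complex) \<Rightarrow> nat \<Rightarrow> real" where
  "level_norm p c k = (\<Sum>j<2 ^ k. norm (c k j) powr p) powr (1 / p)"

definition besov_rep ::
    "real \<Rightarrow> real \<Rightarrow> ennreal \<Rightarrow> (real \<Rightarrow> complex) \<Rightarrow> (nat \<Rightarrow> nat \<Rightarrow> complex) \<Rightarrow> bool" where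
  "besov_rep s p q \<psi> c \<longleftrightarrow>
     (\<lambda>K. Lp_norm leb01 p (\<lambda>x. \<psi> x - besov_series s p c K x)) \<longlonglongrightarrow> 0 \<and>
     lq_finite q (level_norm p c)"

definition besov_space :: "real \<Rightarrow> real \<Rightarrow> ennreal \<Rightarrow> (real \<Rightarrow> complex) set" where
  "besov_space s p q = {\<psi> \<in> Lp_space leb01 p. \<exists>c. besov_rep s p q \<psi> c}"

definition besov_norm :: "real \<Rightarrow> real \<Rightarrow> ennreal \<Rightarrow> (real \<Rightarrow> complex) \<Rightarrow> real" where
  "besov_norm s p q \<psi> = Inf {lq_norm q (level_norm p c) | c. besov_rep s p q \<psi> c}"

text \<open>Below \<open>V\<close> is a complex vector space of functions with a seminorm \<open>N\<close>, and stands for the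
  normed space obtained by identifying \<open>u\<close> and \<open>v\<close> whenever \<open>N (u - v) = 0\<close>. Hence all equalities
  between elements are up to \<open>N\<close>-null functions.\<close>

definition bounded_operator ::
    "('a \<Rightarrow> complex) set \<Rightarrow> (('a \<Rightarrow> complex) \<Rightarrow> real) \<Rightarrow>
     (('a \<Rightarrow> complex) \<Rightarrow> ('a \<Rightarrow> complex)) \<Rightarrow> bool" where
  "bounded_operator V N T \<longleftrightarrow>
     (\<forall>v\<in>V. T v \<in> V) \<and>
     (\<forall>u\<in>V. \<forall>v\<in>V. \<forall>a b.
        N (\<lambda>x. T (\<lambda>y. a * u y + b * v y) x - (a * T u x + b * T v x)) = 0) \<and>
     (\<exists>C. \<forall>v\<in>V. N (T v) \<le> C * N v)"

text \<open>Closedness of the range is not demanded, since on Banach spaces it follows from the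
  finite codimension.\<close>

definition fredholm ::
    "('a \<Rightarrow> complex) set \<Rightarrow> (('a \<Rightarrow> complex) \<Rightarrow> real) \<Rightarrow>
     (('a \<Rightarrow> complex) \<Rightarrow> ('a \<Rightarrow> complex)) \<Rightarrow> bool" where
  "fredholm V N T \<longleftrightarrow>
     bounded_operator V N T \<and>
     (\<exists>B. finite B \<and> B \<subseteq> {v \<in> V. N (T v) = 0} \<and>
        (\<forall>v\<in>V. N (T v) = 0 \<longrightarrow> (\<exists>c. N (\<lambda>x. v x - (\<Sum>b\<in>B. c b * b x)) = 0))) \<and>
     (\<exists>B. finite B \<and> B \<subseteq> V \<and>
        (\<forall>v\<in>V. \<exists>u\<in>V. \<exists>c. N (\<lambda>x. v x - (T u x + (\<Sum>b\<in>B. c b * b x))) = 0))"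

definition invertible_operator ::
    "('a \<Rightarrow> complex) set \<Rightarrow> (('a \<Rightarrow> complex) \<Rightarrow> real) \<Rightarrow>
     (('a \<Rightarrow> complex) \<Rightarrow> ('a \<Rightarrow> complex)) \<Rightarrow> bool" where
  "invertible_operator V N T \<longleftrightarrow>
     bounded_operator V N T \<and>
     (\<exists>S. bounded_operator V N S \<and>
        (\<forall>v\<in>V. N (\<lambda>x. S (T v) x - v x) = 0 \<and> N (\<lambda>x. T (S v) x - v x) = 0))"

definition op_spectrum ::
    "('a \<Rightarrow> complex) set \<Rightarrow> (('a \<Rightarrow> complex) \<Rightarrow> real) \<Rightarrow>
     (('a \<Rightarrow> complex) \<Rightarrow> ('a \<Rightarrow> complex)) \<Rightarrow> complex set" where
  "op_spectrum V N T = {z. \<not> invertible_operator V N (\<lambda>v x. z * v x - T v x)}"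

definition ess_spectrum ::
    "('a \<Rightarrow> complex) set \<Rightarrow> (('a \<Rightarrow> complex) \<Rightarrow> real) \<Rightarrow>
     (('a \<Rightarrow> complex) \<Rightarrow> ('a \<Rightarrow> complex)) \<Rightarrow> complex set" where
  "ess_spectrum V N T = {z. \<not> fredholm V N (\<lambda>v x. z * v x - T v x)}"

definition op_spectral_radius ::
    "('a \<Rightarrow> complex) set \<Rightarrow> (('a \<Rightarrow> complex) \<Rightarrow> real) \<Rightarrow>
     (('a \<Rightarrow> complex) \<Rightarrow> ('a \<Rightarrow> complex)) \<Rightarrow> ennreal" where
  "op_spectral_radius V N T = (SUP z\<in>op_spectrum V N T. ennreal (norm z))"

definition ess_spectral_radius ::
    "('a \<Rightarrow> complex) set \<Rightarrow> (('a \<Rightarrow> complex) \<Rightarrow> real) \<Rightarrow>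
     (('a \<Rightarrow> complex) \<Rightarrow> ('a \<Rightarrow> complex)) \<Rightarrow> ennreal" where
  "ess_spectral_radius V N T = (SUP z\<in>ess_spectrum V N T. ennreal (norm z))"

definition quasi_compact ::
    "('a \<Rightarrow> complex) set \<Rightarrow> (('a \<Rightarrow> complex) \<Rightarrow> real) \<Rightarrow>
     (('a \<Rightarrow> complex) \<Rightarrow> ('a \<Rightarrow> complex)) \<Rightarrow> bool" where
  "quasi_compact V N T \<longleftrightarrow>
     bounded_operator V N T \<and> ess_spectral_radius V N T < op_spectral_radius V N T"

text \<open>Bowen's definition, for a self-map of the (compact) set \<open>X\<close>. It is finite if
  the map is Lipschitz on a bounded \<open>X\<close> in a Euclidean space.\<close>

definition bowen_separated :: "('a::metric_space \<Rightarrow> 'a) \<Rightarrow> nat \<Rightarrow> real \<Rightarrow> 'a set \<Rightarrow> bool" where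
  "bowen_separated f n \<delta> E \<longleftrightarrow>
     (\<forall>x\<in>E. \<forall>y\<in>E. x \<noteq> y \<longrightarrow> (\<exists>i<n. dist ((f ^^ i) x) ((f ^^ i) y) > \<delta>))"

definition topological_entropy :: "('a::metric_space \<Rightarrow> 'a) \<Rightarrow> 'a set \<Rightarrow> ereal" where
  "topological_entropy f X =
     (SUP \<delta>\<in>{0<..}. limsup (\<lambda>n.
        SUP E\<in>{E. E \<subseteq> X \<and> finite E \<and> E \<noteq> {} \<and> bowen_separated f n \<delta> E}.
          ereal (ln (real (card E)) / real n)))"

definition holder_on :: "real \<Rightarrow> real set \<Rightarrow> (real \<Rightarrow> real) \<Rightarrow> bool" where
  "holder_on \<gamma> S g \<longleftrightarrow> (\<exists>C. \<forall>x\<in>S. \<forall>y\<in>S. \<bar>g x - g y\<bar> \<le> C * \<bar>x - y\<bar> powr \<gamma>)"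

text \<open>\<open>S\<close> is a nondegenerate interval; derivatives at endpoints that belong to \<open>S\<close> are one-sided.\<close>

definition C1_holder_on :: "real \<Rightarrow> real set \<Rightarrow> (real \<Rightarrow> real) \<Rightarrow> bool" where
  "C1_holder_on \<gamma> S g \<longleftrightarrow>
     (\<exists>g'. (\<forall>x\<in>S. (g has_real_derivative g' x) (at x within S)) \<and>
           continuous_on S g' \<and> holder_on \<gamma> S g')"

definition C1_holder_diffeo_on :: "real \<Rightarrow> real set \<Rightarrow> (real \<Rightarrow> real) \<Rightarrow> bool" where
  "C1_holder_diffeo_on \<gamma> S g \<longleftrightarrow>
     inj_on g S \<and> C1_holder_on \<gamma> S g \<and> C1_holder_on \<gamma> (g ` S) (the_inv_into S g)"

definition interval_partition :: "'i set \<Rightarrow> ('i \<Rightarrow> real set) \<Rightarrow> bool" where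
  "interval_partition \<Lambda> J \<longleftrightarrow>
     finite \<Lambda> \<and> (\<forall>i\<in>\<Lambda>. is_interval (J i) \<and> interior (J i) \<noteq> {}) \<and>
     disjoint_family_on J \<Lambda> \<and> (\<Union>i\<in>\<Lambda>. J i) = {0..1}"

definition min_expansion :: "'i set \<Rightarrow> ('i \<Rightarrow> real set) \<Rightarrow> (real \<Rightarrow> real) \<Rightarrow> real" where
  "min_expansion \<Lambda> J f =
     Inf {\<bar>vector_derivative f (at x within J i)\<bar> | i x. i \<in> \<Lambda> \<and> x \<in> J i}"

definition transfer_operator ::
    "'i set \<Rightarrow> ('i \<Rightarrow> real set) \<Rightarrow> (real \<Rightarrow> real) \<Rightarrow> (real \<Rightarrow> complex) \<Rightarrow> real \<Rightarrow> complex" where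
  "transfer_operator \<Lambda> J f \<psi> x =
     (\<Sum>i | i \<in> \<Lambda> \<and> x \<in> f ` J i.
        complex_of_real \<bar>vector_derivative (the_inv_into (J i) f) (at x within f ` J i)\<bar>
        * \<psi> (the_inv_into (J i) f x))"

end

theory Submission
  imports Defs
begin

text \<open>
  By almost everywhere convergence of dyadic averages, the Besov norm is equivalent to the weighted
  \<open>l\<^sup>q(l\<^sup>p)\<close> norm of the dyadic martingale differences. Split \<open>\<Phi>\<^sup>n\<close> into groups of inverse branches of
  \<open>f\<^sup>n\<close> with derivative comparable to \<open>2\<^sup>-\<^sup>m\<close> (bounded distortion). A group maps the martingale difference
  of level \<open>j\<close> essentially to level \<open>j - m\<close>: on coarser levels Jensen's inequality gives the factor
  \<open>(N 2\<^sup>-\<^sup>m)\<close> to the power \<open>1/p'\<close>, where \<open>N\<close> bounds the number of preimages under \<open>f\<^sup>n\<close>, and on finer levels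
  the Hoelder continuity of the derivative and the small number of boundary cells give additional exponential
  decay, because \<open>s < \<beta> \<le> 1/p\<close>. The Schur test then bounds \<open>\<Phi>\<^sup>n\<close> on high frequencies by a constant multiple of
  \<open>N\<close> to the power \<open>1/p'\<close> times \<open>(inf |f'|)\<close> to the power \<open>-n(1/p' + s)\<close>, with a constant independent of \<open>n\<close>,
  and \<open>N\<close> grows at most like \<open>exp (n (h + \<eta>))\<close> by the definition of topological entropy. The low frequencies form
  a finite-dimensional space, so a Neumann series shows that \<open>z - \<Phi>\<close> is Fredholm for every larger \<open>|z|\<close>.
\<close>

text \<open>The Neumann series needs an iterate whose norm off the low frequencies beats
  \<open>norm z ^ n\<close>, so every constant must be the same for all n, although the branches of
  the n-th iterate grow in number and their images shrink. Size, distortion and Hoelder constants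
  are uniform by bounded distortion and are collected in \<open>sys_const\<close>. The minimal
  length \<kappa> of domains and images is not uniform. It enters only the cutoff level
  \<open>L\<close>, that is, the rank of the part that is split off, and never a norm bound: a
  dyadic cell shorter than \<kappa> can meet a branch domain only if one of its endpoints lies in
  it, so overlaps are counted by preimages of two points instead of by branches. The same
  observation for cylinders of a fixed order links preimages with separated sets. Words whose domain
  has at most one point admit no such \<kappa>; they are discarded because they alter a function
  only on a finite set. The groups can be summed because group m carries the factor
  \<open>2^-(m(1 - 1/p + s))\<close>, a geometric series whose first term gives the rate.\<close>

section \<open>Power sums and the Schur test\<close>

lemma powr_weighted_sum_le:
  fixes \<mu> x :: "'i \<Rightarrow> real"
  assumes "finite I" and p: "p \<ge> 1" and \<mu>: "\<And>i. i \<in> I \<Longrightarrow> 0 \<le> \<mu> i" and x: "\<And>i. i \<in> I \<Longrightarrow> 0 \<le> x i"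
  shows "(\<Sum>i\<in>I. \<mu> i * x i) powr p \<le> (\<Sum>i\<in>I. \<mu> i) powr (p - 1) * (\<Sum>i\<in>I. \<mu> i * x i powr p)"
proof -
  \<comment> \<open>Jensen is used for the weights normalised by their sum \<open>M\<close>.
    Convexity of the power is taken on the positive half-line, so indices with zero weight or zero
    value are removed first; they contribute to neither sum of products, and dropping them only
    lowers the total weight.\<close>
  define I' where "I' = {i\<in>I. \<mu> i > 0 \<and> x i > 0}"
  have fin: "finite I'" and sub: "I' \<subseteq> I" using assms by (auto simp: I'_def)
  have z: "\<mu> i = 0 \<or> x i = 0" if "i \<in> I - I'" for i
    using that \<mu>[of i] x[of i] by (auto simp: I'_def)
  have e1: "(\<Sum>i\<in>I. \<mu> i * x i) = (\<Sum>i\<in>I'. \<mu> i * x i)"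
    using assms(1) sub z by (intro sum.mono_neutral_right) auto
  have e2: "(\<Sum>i\<in>I. \<mu> i * x i powr p) = (\<Sum>i\<in>I'. \<mu> i * x i powr p)"
    using assms(1) sub z by (intro sum.mono_neutral_right) auto
  have e3: "(\<Sum>i\<in>I'. \<mu> i) \<le> (\<Sum>i\<in>I. \<mu> i)"
    using assms(1) sub \<mu> by (intro sum_mono2) auto
  show ?thesis
  proof (cases "I' = {}")
    case True
    then show ?thesis unfolding e1 e2 by simp
  next
    case False
    define M where "M = (\<Sum>i\<in>I'. \<mu> i)"
    have M: "M > 0" unfolding M_def using False fin by (intro sum_pos) (auto simp: I'_def)
    have "(\<Sum>i\<in>I'. (\<mu> i / M) *\<^sub>R x i) powr p \<le> (\<Sum>i\<in>I'. (\<mu> i / M) * x i powr p)"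
      by (rule convex_on_sum[where C = "{0<..}" and f = "\<lambda>t. t powr p"])
        (use fin False powr_convex[OF p] M in \<open>auto simp: I'_def M_def sum_divide_distrib[symmetric]\<close>)
    then have "((\<Sum>i\<in>I'. \<mu> i * x i) / M) powr p \<le> (\<Sum>i\<in>I'. \<mu> i * x i powr p) / M"
      by (simp add: sum_divide_distrib)
    moreover have nn: "0 \<le> (\<Sum>i\<in>I'. \<mu> i * x i)" by (intro sum_nonneg) (auto simp: I'_def)
    ultimately have "(\<Sum>i\<in>I'. \<mu> i * x i) powr p \<le> M powr p * ((\<Sum>i\<in>I'. \<mu> i * x i powr p) / M)"
      using M by (simp add: powr_divide divide_le_eq mult.commute)
    also have "\<dots> = M powr (p - 1) * (\<Sum>i\<in>I'. \<mu> i * x i powr p)"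
      using M by (simp add: powr_diff)
    also have "\<dots> \<le> (\<Sum>i\<in>I. \<mu> i) powr (p - 1) * (\<Sum>i\<in>I'. \<mu> i * x i powr p)"
      using e3 M p by (intro mult_right_mono powr_mono2 sum_nonneg) (auto simp: M_def I'_def)
    finally show ?thesis unfolding e1 e2 .
  qed
qed

lemma powr_sum_le:
  fixes x :: "'i \<Rightarrow> real"
  assumes "finite I" "p \<ge> 1" "\<And>i. i \<in> I \<Longrightarrow> 0 \<le> x i"
  shows "(\<Sum>i\<in>I. x i) powr p \<le> real (card I) powr (p - 1) * (\<Sum>i\<in>I. x i powr p)"
  using powr_weighted_sum_le[of I p "\<lambda>_. 1" x] assms by simp

section \<open>Finite power norms and Minkowski's inequality\<close>

definition lpn :: "real \<Rightarrow> 'i set \<Rightarrow> ('i \<Rightarrow> real) \<Rightarrow> real" where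
  "lpn p I u = (\<Sum>i\<in>I. u i powr p) powr (1 / p)"

lemma lpn_nonneg: "0 \<le> lpn p I u"
  by (simp add: lpn_def)

lemma lpn_powr: "p \<ge> 1 \<Longrightarrow> lpn p I u powr p = (\<Sum>i\<in>I. u i powr p)"
  by (simp add: lpn_def powr_powr sum_nonneg)

lemma lpn_le_iff:
  "p \<ge> 1 \<Longrightarrow> 0 \<le> B \<Longrightarrow> lpn p I u \<le> B \<longleftrightarrow> (\<Sum>i\<in>I. u i powr p) \<le> B powr p"
  using powr_mono2[of p "lpn p I u" B] powr_less_mono2[of p B "lpn p I u"] lpn_nonneg[of p I u]
  by (simp add: lpn_powr[symmetric]) linarith

lemma lpn_mono:
  "p \<ge> 1 \<Longrightarrow> (\<And>i. i \<in> I \<Longrightarrow> 0 \<le> u i) \<Longrightarrow> (\<And>i. i \<in> I \<Longrightarrow> u i \<le> v i) \<Longrightarrow> lpn p I u \<le> lpn p I v"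
  unfolding lpn_def by (intro powr_mono2 sum_mono sum_nonneg) auto

lemma lpn_cmult:
  assumes "p \<ge> 1" "c \<ge> 0" "\<And>i. i \<in> I \<Longrightarrow> 0 \<le> u i"
  shows "lpn p I (\<lambda>i. c * u i) = c * lpn p I u"
proof -
  have "(\<Sum>i\<in>I. (c * u i) powr p) = c powr p * (\<Sum>i\<in>I. u i powr p)"
    using assms by (simp add: powr_mult sum_distrib_left)
  then show ?thesis
    using assms by (simp add: lpn_def powr_mult powr_powr sum_nonneg)
qed

text \<open>Minkowski from Jensen: \<open>u i + v i\<close> is the combination of
  \<open>u i / a\<close> and \<open>v i / b\<close> with weights a and b, and both quotients have
  norm at most 1.\<close>

lemma lpn_triangle:
  assumes "finite I" and p: "p \<ge> 1"
    and u: "\<And>i. i \<in> I \<Longrightarrow> 0 \<le> u i" and v: "\<And>i. i \<in> I \<Longrightarrow> 0 \<le> v i"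
  shows "lpn p I (\<lambda>i. u i + v i) \<le> lpn p I u + lpn p I v"
proof (rule field_le_epsilon)
  fix e :: real assume e: "e > 0"
  \<comment> \<open>The slack \<open>e / 2\<close> keeps both weights positive when a norm
    vanishes.\<close>
  define a where "a = lpn p I u + e / 2"
  define b where "b = lpn p I v + e / 2"
  have ab: "a > 0" "b > 0" using e lpn_nonneg[of p I] by (auto simp: a_def b_def add_nonneg_pos)
  have bound: "(\<Sum>i\<in>I. (w i / c) powr p) \<le> 1"
    if "c > 0" "lpn p I w \<le> c" "\<And>i. i \<in> I \<Longrightarrow> 0 \<le> w i" for w c
  proof -
    have "lpn p I (\<lambda>i. (1/c) * w i) \<le> 1"
      using that p by (subst lpn_cmult) (auto simp: divide_simps)
    then show ?thesis using p by (simp add: lpn_le_iff)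
  qed
  have "(\<Sum>i\<in>I. (u i + v i) powr p) \<le> (\<Sum>i\<in>I. (a + b) powr (p - 1) * (a * (u i / a) powr p + b * (v i / b) powr p))"
  proof (intro sum_mono)
    fix i assume i: "i \<in> I"
    have "(a * (u i / a) + b * (v i / b)) powr p
        \<le> (a + b) powr (p - 1) * (a * (u i / a) powr p + b * (v i / b) powr p)"
      using powr_weighted_sum_le[of "{0, 1::nat}" p "\<lambda>j. if j = 0 then a else b"
          "\<lambda>j. if j = 0 then u i / a else v i / b"] ab p u[OF i] v[OF i] by simp
    then show "(u i + v i) powr p \<le> (a + b) powr (p - 1) * (a * (u i / a) powr p + b * (v i / b) powr p)"
      using ab by simp
  qed
  also have "\<dots> = (a + b) powr (p - 1) * (a * (\<Sum>i\<in>I. (u i / a) powr p) + b * (\<Sum>i\<in>I. (v i / b) powr p))"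
    by (simp add: sum_distrib_left[symmetric] sum.distrib)
  also have "\<dots> \<le> (a + b) powr (p - 1) * (a * 1 + b * 1)"
    using ab u v e by (intro mult_left_mono add_mono bound) (auto simp: a_def b_def)
  also have "\<dots> = (a + b) powr p"
    using ab by (simp add: powr_diff)
  finally have "lpn p I (\<lambda>i. u i + v i) \<le> a + b"
    using p ab by (simp add: lpn_le_iff)
  then show "lpn p I (\<lambda>i. u i + v i) \<le> lpn p I u + lpn p I v + e"
    by (simp add: a_def b_def)
qed

lemma lpn_zero: "lpn p I (\<lambda>i. 0) = 0"
  by (simp add: lpn_def)

lemma lpn_sum:
  assumes "finite I" "p \<ge> 1" "\<And>i j. i \<in> I \<Longrightarrow> j \<in> J \<Longrightarrow> 0 \<le> u j i"
  shows "lpn p I (\<lambda>i. \<Sum>j\<in>J. u j i) \<le> (\<Sum>j\<in>J. lpn p I (u j))"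
  using assms(3)
proof (induction J rule: infinite_finite_induct)
  case (insert j J)
  have "lpn p I (\<lambda>i. u j i + (\<Sum>j\<in>J. u j i)) \<le> lpn p I (u j) + lpn p I (\<lambda>i. \<Sum>j\<in>J. u j i)"
    using insert assms by (intro lpn_triangle) (auto intro!: sum_nonneg)
  also have "lpn p I (\<lambda>i. \<Sum>j\<in>J. u j i) \<le> (\<Sum>j\<in>J. lpn p I (u j))"
    using insert by auto
  finally show ?case using insert by simp
qed (auto simp: lpn_zero)

lemma lpn_component:
  assumes "finite I" "p \<ge> 1" "i \<in> I" "0 \<le> u i"
  shows "u i \<le> lpn p I u"
proof -
  have "u i = (u i powr p) powr (1 / p)" using assms by (simp add: powr_powr)
  also have "\<dots> \<le> lpn p I u"
    unfolding lpn_def using assms by (intro powr_mono2 member_le_sum) auto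
  finally show ?thesis .
qed

text \<open>The \<open>l\<^sup>q\<close> norm of \<open>a\<close> is at most \<open>B\<close>, stated without presupposing convergence.\<close>

definition lqb :: "ennreal \<Rightarrow> (nat \<Rightarrow> real) \<Rightarrow> real \<Rightarrow> bool" where
  "lqb q a B \<longleftrightarrow> 0 \<le> B \<and> (if q = \<infinity> then \<forall>k. a k \<le> B else \<forall>K. lpn (enn2real q) {..<K} a \<le> B)"

lemma enn2real_ge_1: "q \<noteq> \<infinity> \<Longrightarrow> 1 \<le> (q::ennreal) \<Longrightarrow> 1 \<le> enn2real q"
  by (metis enn2real_1 enn2real_mono infinity_ennreal_def less_top)

context
  fixes q :: ennreal
  assumes q: "q \<ge> 1"
begin

lemma q_ge_1: "q \<noteq> \<infinity> \<Longrightarrow> enn2real q \<ge> 1"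
  using q by (rule enn2real_ge_1[rotated])

lemma lqb_component: "lqb q a B \<Longrightarrow> (\<And>k. 0 \<le> a k) \<Longrightarrow> a k \<le> B"
  unfolding lqb_def using lpn_component[OF _ q_ge_1, of "{..<Suc k}" k a]
  by (metis finite_lessThan lessI lessThan_iff order_trans)

lemma lqb_nonneg: "lqb q a B \<Longrightarrow> 0 \<le> B"
  by (simp add: lqb_def)

lemma lqb_mono:
  assumes "lqb q a B" "\<And>k. 0 \<le> a' k" "\<And>k. a' k \<le> a k" "B \<le> B'"
  shows "lqb q a' B'"
proof (cases "q = \<infinity>")
  case True
  have "a' k \<le> B'" for k
    using assms(1,4) assms(3)[of k] True by (auto simp: lqb_def dest!: spec[of _ k])
  then show ?thesis using True assms by (auto simp: lqb_def)
next
  case False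
  have "lpn (enn2real q) {..<K} a' \<le> B'" for K
    using lpn_mono[OF q_ge_1[OF False], of "{..<K}" a' a] assms False
    by (auto simp: lqb_def dest: spec[of _ K])
  then show ?thesis using False assms by (auto simp: lqb_def)
qed

lemma lqb_add:
  assumes "lqb q a B" "lqb q a' B'" "\<And>k. 0 \<le> a k" "\<And>k. 0 \<le> a' k"
  shows "lqb q (\<lambda>k. a k + a' k) (B + B')"
proof (cases "q = \<infinity>")
  case True
  then show ?thesis using assms by (auto simp: lqb_def intro: add_mono)
next
  case False
  then show ?thesis using assms
    by (auto simp: lqb_def intro!: order_trans[OF lpn_triangle[OF _ q_ge_1]] add_mono)
qed

lemma lqb_cmult:
  assumes "lqb q a B" "\<And>k. 0 \<le> a k" "0 \<le> c"
  shows "lqb q (\<lambda>k. c * a k) (c * B)"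
  using assms by (auto simp: lqb_def lpn_cmult[OF q_ge_1] mult_left_mono)

text \<open>Lower semicontinuity under pointwise convergence: each finite partial norm passes to the
  limit on its own, so no uniformity in k is asked for.\<close>

lemma lqb_limit:
  assumes "\<And>J. lqb q (x J) B" and lim: "\<And>k. (\<lambda>J. x J k) \<longlonglongrightarrow> y k" and nn: "\<And>J k. 0 \<le> x J k"
  shows "lqb q y B"
proof (cases "q = \<infinity>")
  case True
  then have "y k \<le> B" for k
    using assms(1) by (intro LIMSEQ_le_const2[OF lim]) (auto simp: lqb_def)
  then show ?thesis using True assms(1) by (auto simp: lqb_def)
next
  case False
  have "lpn (enn2real q) {..<K} y \<le> B" for K
  proof (rule LIMSEQ_le_const2)
    have "(\<lambda>J. \<Sum>k<K. x J k powr enn2real q) \<longlonglongrightarrow> (\<Sum>k<K. y k powr enn2real q)"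
      using q_ge_1[OF False] nn
      by (intro tendsto_sum tendsto_powr'[OF lim tendsto_const]) auto
    then show "(\<lambda>J. lpn (enn2real q) {..<K} (x J)) \<longlonglongrightarrow> lpn (enn2real q) {..<K} y"
      unfolding lpn_def using q_ge_1[OF False]
      by (intro tendsto_powr'[OF _ tendsto_const]) (auto simp: sum_nonneg)
    show "\<exists>N. \<forall>n\<ge>N. lpn (enn2real q) {..<K} (x n) \<le> B"
      using assms(1) False by (auto simp: lqb_def)
  qed
  then show ?thesis using False assms(1) by (auto simp: lqb_def)
qed

text \<open>Schur test. Jensen in each row costs the power \<open>r - 1\<close> of the row bound,
  and summing over k uses the column bound once; together this is R to the power r.\<close>

lemma lqb_schur_finite:
  assumes b: "lqb q b B" "\<And>j. 0 \<le> b j" and A: "\<And>k j. 0 \<le> A k j"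
    and row: "\<And>k. (\<Sum>j<J. A k j) \<le> R" and col: "\<And>j K. (\<Sum>k<K. A k j) \<le> R"
  shows "lqb q (\<lambda>k. \<Sum>j<J. A k j * b j) (R * B)"
proof (cases "q = \<infinity>")
  case True
  have R: "0 \<le> R" using col[of 0 0] by simp
  have "(\<Sum>j<J. A k j * b j) \<le> R * B" for k
  proof -
    have "(\<Sum>j<J. A k j * b j) \<le> (\<Sum>j<J. A k j * B)"
      using A lqb_component[OF b(1)] b by (intro sum_mono mult_left_mono) auto
    also have "\<dots> = (\<Sum>j<J. A k j) * B" by (simp add: sum_distrib_right)
    also have "\<dots> \<le> R * B" using row lqb_nonneg[OF b(1)] by (intro mult_right_mono) auto
    finally show ?thesis .
  qed
  then show ?thesis using True R lqb_nonneg[OF b(1)] by (auto simp: lqb_def)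
next
  case False
  define r where "r = enn2real q"
  have r: "r \<ge> 1" using q_ge_1[OF False] by (simp add: r_def)
  have R: "0 \<le> R" using col[of 0 0] by simp
  have B: "0 \<le> B" by (rule lqb_nonneg[OF b(1)])
  have bB: "(\<Sum>j<J. b j powr r) \<le> B powr r" for J
    using b(1) False r by (auto simp: lqb_def r_def lpn_le_iff)
  have "lpn r {..<K} (\<lambda>k. \<Sum>j<J. A k j * b j) \<le> R * B" for K
  proof -
    have "(\<Sum>k<K. (\<Sum>j<J. A k j * b j) powr r)
        \<le> (\<Sum>k<K. R powr (r - 1) * (\<Sum>j<J. A k j * b j powr r))"
    proof (intro sum_mono)
      fix k
      have "(\<Sum>j<J. A k j * b j) powr r \<le> (\<Sum>j<J. A k j) powr (r - 1) * (\<Sum>j<J. A k j * b j powr r)"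
        using A b r by (intro powr_weighted_sum_le) auto
      also have "\<dots> \<le> R powr (r - 1) * (\<Sum>j<J. A k j * b j powr r)"
        using A row r by (intro mult_right_mono powr_mono2 sum_nonneg) auto
      finally show "(\<Sum>j<J. A k j * b j) powr r \<le> R powr (r - 1) * (\<Sum>j<J. A k j * b j powr r)" .
    qed
    also have "\<dots> = R powr (r - 1) * (\<Sum>j<J. (\<Sum>k<K. A k j) * b j powr r)"
      by (simp add: sum_distrib_left sum_distrib_right sum.swap[of _ "{..<J}"] mult.assoc)
    also have "\<dots> \<le> R powr (r - 1) * (\<Sum>j<J. R * b j powr r)"
      using col by (intro mult_left_mono sum_mono mult_right_mono) auto
    also have "\<dots> = R powr (r - 1) * R * (\<Sum>j<J. b j powr r)"
      by (simp add: sum_distrib_left mult.assoc)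
    also have "\<dots> \<le> R powr (r - 1) * R * B powr r"
      using R bB by (intro mult_left_mono) auto
    also have "\<dots> = (R * B) powr r"
      using R B by (cases "R = 0") (auto simp: powr_diff powr_mult)
    finally show ?thesis using r R B by (simp add: lpn_le_iff)
  qed
  then show ?thesis using False R B by (auto simp: lqb_def r_def)
qed

text \<open>The error e may depend on k. This is what applications provide: x collects the level
  norms of a limit, and each level is continuous along the approximating partial sums, but not
  uniformly in the level.\<close>

lemma lqb_schur:
  assumes b: "lqb q b B" "\<And>j. 0 \<le> b j" and A: "\<And>k j. 0 \<le> A k j"
    and row: "\<And>k J. (\<Sum>j<J. A k j) \<le> R" and col: "\<And>j K. (\<Sum>k<K. A k j) \<le> R"
    and x: "\<And>k. 0 \<le> x k" and le: "\<And>k. \<exists>e. e \<longlonglongrightarrow> 0 \<and> (\<forall>J. x k \<le> (\<Sum>j<J. A k j * b j) + e J)"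
  shows "lqb q x (R * B)"
proof -
  have R: "0 \<le> R" using col[of 0 0] by simp
  have sm: "summable (\<lambda>j. A k j * b j)" for k
  proof (rule summableI_nonneg_bounded)
    show "(\<Sum>j<n. A k j * b j) \<le> R * B" for n
    proof -
      have "(\<Sum>j<n. A k j * b j) \<le> (\<Sum>j<n. A k j * B)"
        using A lqb_component[OF b(1)] b by (intro sum_mono mult_left_mono) auto
      also have "\<dots> = (\<Sum>j<n. A k j) * B" by (simp add: sum_distrib_right)
      also have "\<dots> \<le> R * B" using row lqb_nonneg[OF b(1)] by (intro mult_right_mono) auto
      finally show ?thesis .
    qed
  qed (use A b in auto)
  have lim: "(\<lambda>J. \<Sum>j<J. A k j * b j) \<longlonglongrightarrow> (\<Sum>j. A k j * b j)" for k
    using summable_LIMSEQ[OF sm] .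
  have 1: "lqb q (\<lambda>k. \<Sum>j. A k j * b j) (R * B)"
    by (rule lqb_limit[OF _ lim]) (use lqb_schur_finite[OF b A row col] A b in \<open>auto intro!: sum_nonneg\<close>)
  show ?thesis
  proof (rule lqb_mono[OF 1 x])
    fix k
    obtain e where e: "e \<longlonglongrightarrow> 0" "\<And>J. x k \<le> (\<Sum>j<J. A k j * b j) + e J" using le by blast
    have "(\<lambda>J. (\<Sum>j<J. A k j * b j) + e J) \<longlonglongrightarrow> (\<Sum>j. A k j * b j) + 0"
      by (intro tendsto_add lim e)
    then show "x k \<le> (\<Sum>j. A k j * b j)"
      using e(2) by (intro LIMSEQ_le_const) auto
  qed auto
qed

lemma lq_finite_iff:
  assumes "\<And>k. 0 \<le> a k"
  shows "lq_finite q a \<longleftrightarrow> (\<exists>B. lqb q a B)"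
proof (cases "q = \<infinity>")
  case True
  have "(\<exists>B. \<forall>k. a k \<le> B) \<Longrightarrow> (\<exists>B\<ge>0. \<forall>k. a k \<le> B)"
    using assms by (meson order_trans)
  then show ?thesis using True by (auto simp: lq_finite_def lqb_def bdd_above_def)
next
  case False
  define r where "r = enn2real q"
  have r: "r \<ge> 1" using q_ge_1[OF False] by (simp add: r_def)
  have "summable (\<lambda>k. a k powr r) \<longleftrightarrow> (\<exists>B\<ge>0. \<forall>K. lpn r {..<K} a \<le> B)"
  proof
    assume s: "summable (\<lambda>k. a k powr r)"
    have "\<forall>K. lpn r {..<K} a \<le> (\<Sum>k. a k powr r) powr (1/r)"
      unfolding lpn_def using r s by (auto intro!: powr_mono2 sum_nonneg sum_le_suminf)
    then show "\<exists>B\<ge>0. \<forall>K. lpn r {..<K} a \<le> B" by (metis powr_ge_zero)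
  next
    assume "\<exists>B\<ge>0. \<forall>K. lpn r {..<K} a \<le> B"
    then obtain B where "B \<ge> 0" "\<And>K. (\<Sum>k<K. a k powr r) \<le> B powr r"
      using r by (auto simp: lpn_le_iff)
    then show "summable (\<lambda>k. a k powr r)"
      by (intro summableI_nonneg_bounded) auto
  qed
  then show ?thesis using False by (simp add: lq_finite_def lqb_def r_def)
qed

lemma lqb_lq_norm:
  assumes "\<And>k. 0 \<le> a k" "lq_finite q a"
  shows "lqb q a (lq_norm q a)"
proof (cases "q = \<infinity>")
  case True
  have b: "bdd_above (range a)" using assms True by (simp add: lq_finite_def)
  then have "a k \<le> (SUP k. a k)" for k by (intro cSUP_upper) auto
  then show ?thesis using True assms(1)[of 0] order_trans[OF assms(1)[of 0]]
    by (auto simp: lq_norm_def lqb_def)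
next
  case False
  define r where "r = enn2real q"
  have r: "r \<ge> 1" using q_ge_1[OF False] by (simp add: r_def)
  have "summable (\<lambda>k. a k powr r)" using assms False by (simp add: lq_finite_def r_def)
  then have "lpn r {..<K} a \<le> (\<Sum>k. a k powr r) powr (1/r)" for K
    unfolding lpn_def using r by (auto intro!: powr_mono2 sum_nonneg sum_le_suminf)
  then show ?thesis using False by (simp add: lq_norm_def lqb_def r_def)
qed

lemma lq_norm_le:
  assumes "\<And>k. 0 \<le> a k" "lqb q a B"
  shows "lq_norm q a \<le> B"
proof (cases "q = \<infinity>")
  case True
  then show ?thesis using assms by (auto simp: lq_norm_def lqb_def intro!: cSUP_least)
next
  case False
  define r where "r = enn2real q"
  have r: "r \<ge> 1" using q_ge_1[OF False] by (simp add: r_def)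
  have B: "0 \<le> B" by (rule lqb_nonneg[OF assms(2)])
  have "(\<Sum>k<K. a k powr r) \<le> B powr r" for K
    using assms(2) False r B by (simp add: lqb_def r_def lpn_le_iff)
  moreover have "summable (\<lambda>k. a k powr r)"
    using lq_finite_iff[OF assms(1)] assms(2) False by (auto simp: lq_finite_def r_def)
  ultimately have "(\<Sum>k. a k powr r) \<le> B powr r"
    by (intro suminf_le_const) auto
  then have "(\<Sum>k. a k powr r) powr (1/r) \<le> (B powr r) powr (1/r)"
    using r \<open>summable _\<close> by (intro powr_mono2 suminf_nonneg) auto
  also have "\<dots> = B" using r B by (simp add: powr_powr)
  finally show ?thesis using False by (simp add: lq_norm_def r_def)
qed

lemma lq_norm_nonneg: "(\<And>k. 0 \<le> a k) \<Longrightarrow> lq_finite q a \<Longrightarrow> 0 \<le> lq_norm q a"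
  using lqb_lq_norm lqb_nonneg by blast

end

section \<open>Two-sided geometric sums\<close>

lemma sum_powr_abs_le:
  fixes r :: real and F :: "int set"
  assumes "finite F" "0 < r" "r < 1"
  shows "(\<Sum>i\<in>F. r ^ nat \<bar>i\<bar>) \<le> 2 / (1 - r)"
proof -
  have g: "(\<Sum>n\<in>G. r ^ n) \<le> 1 / (1 - r)" if "finite G" for G
    using sum_le_suminf[of "\<lambda>n. r ^ n" G] that assms by (simp add: suminf_geometric summable_geometric)
  have "(\<Sum>i\<in>F. r ^ nat \<bar>i\<bar>) \<le> (\<Sum>i\<in>{i\<in>F. i \<ge> 0}. r ^ nat \<bar>i\<bar>) + (\<Sum>i\<in>{i\<in>F. i < 0}. r ^ nat \<bar>i\<bar>)"
  proof -
    have "F = {i\<in>F. i \<ge> 0} \<union> {i\<in>F. i < 0}" by auto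
    then have "(\<Sum>i\<in>F. r ^ nat \<bar>i\<bar>) = (\<Sum>i\<in>{i\<in>F. i \<ge> 0} \<union> {i\<in>F. i < 0}. r ^ nat \<bar>i\<bar>)" by simp
    also have "\<dots> = (\<Sum>i\<in>{i\<in>F. i \<ge> 0}. r ^ nat \<bar>i\<bar>) + (\<Sum>i\<in>{i\<in>F. i < 0}. r ^ nat \<bar>i\<bar>)"
      using assms(1) by (intro sum.union_disjoint) auto
    finally show ?thesis by simp
  qed
  also have "(\<Sum>i\<in>{i\<in>F. i \<ge> 0}. r ^ nat \<bar>i\<bar>) = (\<Sum>n\<in>nat ` {i\<in>F. i \<ge> 0}. r ^ n)"
    by (subst sum.reindex) (auto simp: inj_on_def intro!: sum.cong)
  also have "(\<Sum>i\<in>{i\<in>F. i < 0}. r ^ nat \<bar>i\<bar>) = (\<Sum>n\<in>(\<lambda>i. nat (-i)) ` {i\<in>F. i < 0}. r ^ n)"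
    by (subst sum.reindex) (auto simp: inj_on_def intro!: sum.cong)
  also have "(\<Sum>n\<in>nat ` {i\<in>F. i \<ge> 0}. r ^ n) + \<dots> \<le> 1 / (1 - r) + 1 / (1 - r)"
    using assms by (intro add_mono g) auto
  finally show ?thesis by simp
qed

text \<open>Row and column sums of the Schur kernels have this form: for a fixed index the offset
  from the diagonal is injective in the other one.\<close>

lemma sum_geometric_shift_le:
  fixes r :: real and g :: "'a \<Rightarrow> int"
  assumes "finite F" "inj_on g F" "0 < r" "r < 1"
  shows "(\<Sum>i\<in>F. r ^ nat \<bar>g i\<bar>) \<le> 2 / (1 - r)"
  using sum_powr_abs_le[of "g ` F" r] assms by (simp add: sum.reindex)

section \<open>Dyadic averages and martingale differences\<close>

text \<open>Closed companion of \<open>dyadic\<close>, so that gauge integrals over intervals can be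
  split and combined; the two sets differ in at most the right endpoint.\<close>

definition cell :: "nat \<Rightarrow> nat \<Rightarrow> real set" where
  "cell k j = {real j / 2 ^ k..real (Suc j) / 2 ^ k}"

definition avg :: "nat \<Rightarrow> nat \<Rightarrow> (real \<Rightarrow> 'a::euclidean_space) \<Rightarrow> 'a" where
  "avg k j \<psi> = 2 ^ k *\<^sub>R integral (cell k j) \<psi>"

lemma cell_subset:
  assumes "j < 2 ^ k"
  shows "cell k j \<subseteq> {0..1}"
proof -
  have "real (Suc j) \<le> real (2 ^ k)" using assms by (subst of_nat_le_iff) simp
  then have "real (Suc j) / 2 ^ k \<le> 1" by (simp add: field_simps)
  then show ?thesis by (auto simp: cell_def)
qed

lemma abs_int_cell:
  fixes \<psi> :: "real \<Rightarrow> 'a::euclidean_space"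
  shows "\<psi> absolutely_integrable_on {0..1} \<Longrightarrow> j < 2 ^ k \<Longrightarrow>
    \<psi> absolutely_integrable_on cell k j"
  using absolutely_integrable_on_subinterval[where f = \<psi> and S = "{0..1}"] cell_subset[of j k] by (simp add: cell_def)

lemma int_cell:
  fixes \<psi> :: "real \<Rightarrow> 'a::euclidean_space"
  shows "\<psi> absolutely_integrable_on {0..1} \<Longrightarrow> j < 2 ^ k \<Longrightarrow>
    \<psi> integrable_on cell k j"
  using abs_int_cell[of \<psi> j k] by (simp add: absolutely_integrable_on_def)

lemma avg_add:
  fixes \<phi> \<psi> :: "real \<Rightarrow> 'a::euclidean_space"
  assumes "\<phi> absolutely_integrable_on {0..1}" "\<psi> absolutely_integrable_on {0..1}" "j < 2 ^ k"
  shows "avg k j (\<lambda>x. \<phi> x + \<psi> x) = avg k j \<phi> + avg k j \<psi>"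
  unfolding avg_def using assms by (simp add: integral_add int_cell scaleR_add_right)

lemma avg_cmult:
  fixes \<psi> :: "real \<Rightarrow> complex"
  shows "avg k j (\<lambda>x. c * \<psi> x) = c * avg k j \<psi>"
  unfolding avg_def by simp

lemma avg_sum:
  fixes \<psi> :: "'i \<Rightarrow> real \<Rightarrow> 'a::euclidean_space"
  assumes "finite I" "\<And>i. i \<in> I \<Longrightarrow> \<psi> i absolutely_integrable_on {0..1}" "j < 2 ^ k"
  shows "avg k j (\<lambda>x. \<Sum>i\<in>I. \<psi> i x) = (\<Sum>i\<in>I. avg k j (\<psi> i))"
  unfolding avg_def using assms by (simp add: integral_sum int_cell scaleR_sum_right)

lemma norm_avg_le:
  fixes \<psi> :: "real \<Rightarrow> 'a::euclidean_space"
  assumes "\<psi> absolutely_integrable_on {0..1}" "j < 2 ^ k"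
  shows "norm (avg k j \<psi>) \<le> avg k j (\<lambda>x. norm (\<psi> x))"
  unfolding avg_def
  using abs_int_cell[OF assms]
  by (simp add: absolutely_integrable_on_def integral_norm_bound_integral)

lemma avg_mono:
  fixes \<phi> \<psi> :: "real \<Rightarrow> real"
  assumes "\<phi> absolutely_integrable_on {0..1}" "\<psi> absolutely_integrable_on {0..1}" "j < 2 ^ k"
    "\<And>x. x \<in> {0..1} \<Longrightarrow> \<phi> x \<le> \<psi> x"
  shows "avg k j \<phi> \<le> avg k j \<psi>"
  unfolding avg_def real_scaleR_def using assms cell_subset[OF assms(3)]
  by (intro mult_left_mono integral_le int_cell) auto

lemma avg_le_integral:
  fixes \<psi> :: "real \<Rightarrow> real"
  assumes "\<psi> absolutely_integrable_on {0..1}" "j < 2 ^ k" "\<And>x. x \<in> {0..1} \<Longrightarrow> 0 \<le> \<psi> x"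
  shows "avg k j \<psi> \<le> 2 ^ k * integral {0..1} \<psi>"
  unfolding avg_def real_scaleR_def
  using assms set_lebesgue_integral_eq_integral(1)[OF assms(1)] cell_subset[OF assms(2)] int_cell[OF assms(1,2)]
  by (intro mult_left_mono integral_subset_le) auto

lemma avg_children:
  fixes \<psi> :: "real \<Rightarrow> 'a::euclidean_space"
  assumes "\<psi> absolutely_integrable_on {0..1}" "j < 2 ^ k"
  shows "2 *\<^sub>R avg k j \<psi> = avg (Suc k) (2 * j) \<psi> + avg (Suc k) (Suc (2 * j)) \<psi>"
proof -
  have "integral {real j / 2 ^ k..real (Suc (2 * j)) / 2 ^ Suc k} \<psi>
      + integral {real (Suc (2 * j)) / 2 ^ Suc k..real (Suc j) / 2 ^ k} \<psi>
      = integral {real j / 2 ^ k..real (Suc j) / 2 ^ k} \<psi>"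
    by (rule Henstock_Kurzweil_Integration.integral_combine)
      (use int_cell[OF assms] in \<open>auto simp: cell_def field_simps\<close>)
  moreover have "real (2 * j) / 2 ^ Suc k = real j / 2 ^ k"
    "real (Suc (Suc (2 * j))) / 2 ^ Suc k = real (Suc j) / 2 ^ k" by (auto simp: field_simps)
  ultimately show ?thesis
    by (simp add: avg_def cell_def scaleR_add_right[symmetric] del: of_nat_Suc)
qed

text \<open>On the unit interval the minimum matters only at 1, where the floor is
  \<open>2 ^ k\<close> although 1 belongs to the last interval.\<close>

definition dyadic_index :: "nat \<Rightarrow> real \<Rightarrow> nat" where
  "dyadic_index k x = min (nat \<lfloor>x * 2 ^ k\<rfloor>) (2 ^ k - 1)"

lemma dyadic_index_less: "dyadic_index k x < 2 ^ k"
proof -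
  have "(2::nat) ^ k - 1 < 2 ^ k" by simp
  then show ?thesis unfolding dyadic_index_def by linarith
qed

lemma real_of_Suc_eq_power: "Suc j = 2 ^ k \<Longrightarrow> real j + 1 = 2 ^ k"
proof -
  assume "Suc j = 2 ^ k"
  then have "real (Suc j) = real (2 ^ k)" by (rule arg_cong)
  then show ?thesis by simp
qed

lemma dyadic_subset_cell: "dyadic k j \<subseteq> cell k j"
proof (cases "Suc j = 2 ^ k")
  case True
  then have "real j + 1 = 2 ^ k" by (rule real_of_Suc_eq_power)
  then show ?thesis by (auto simp: cell_def dyadic_def True)
next
  case False
  then show ?thesis by (auto simp: cell_def dyadic_def)
qed

lemma cell_subset_dyadic:
  assumes "j < 2 ^ k"
  shows "{real j / 2 ^ k..<real (Suc j) / 2 ^ k} \<subseteq> dyadic k j"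
proof (cases "Suc j = 2 ^ k")
  case True
  then have "real j + 1 = 2 ^ k" by (rule real_of_Suc_eq_power)
  then show ?thesis by (auto simp: cell_def dyadic_def True)
next
  case False
  then show ?thesis by (auto simp: cell_def dyadic_def)
qed

lemma dyadic_subset: "j < 2 ^ k \<Longrightarrow> dyadic k j \<subseteq> {0..1}"
  using dyadic_subset_cell[of k j] cell_subset[of j k] by simp

lemma mem_dyadic_iff:
  assumes x: "x \<in> {0..1}" and j: "j < 2 ^ k"
  shows "x \<in> dyadic k j \<longleftrightarrow> j = dyadic_index k x"
proof -
  have nf: "real (nat \<lfloor>x * 2 ^ k\<rfloor>) \<le> x * 2 ^ k" "x * 2 ^ k < real (nat \<lfloor>x * 2 ^ k\<rfloor>) + 1"
    using x by auto
  show ?thesis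
  proof (cases "Suc j = 2 ^ k")
    case True
    have r: "real j + 1 = 2 ^ k" using True by (rule real_of_Suc_eq_power)
    have j': "2 ^ k - 1 = j" using True by simp
    have "x \<in> dyadic k j \<longleftrightarrow> real j \<le> x * 2 ^ k"
      using x True by (simp add: dyadic_def pos_divide_le_eq)
    also have "\<dots> \<longleftrightarrow> j \<le> nat \<lfloor>x * 2 ^ k\<rfloor>"
      using x by (simp add: le_nat_iff le_floor_iff)
    also have "\<dots> \<longleftrightarrow> j = dyadic_index k x"
      unfolding dyadic_index_def j' by (auto simp: min_def)
    finally show ?thesis .
  next
    case False
    then have "Suc j < 2 ^ k" using j by simp
    have "x \<in> dyadic k j \<longleftrightarrow> real j \<le> x * 2 ^ k \<and> x * 2 ^ k < real j + 1"
      using x False by (simp add: dyadic_def pos_divide_le_eq pos_less_divide_eq add.commute)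
    also have "\<dots> \<longleftrightarrow> \<lfloor>x * 2 ^ k\<rfloor> = int j"
      by (simp add: floor_eq_iff)
    also have "\<dots> \<longleftrightarrow> nat \<lfloor>x * 2 ^ k\<rfloor> = j" using x by auto
    also have "\<dots> \<longleftrightarrow> j = dyadic_index k x"
      using \<open>Suc j < 2 ^ k\<close> by (auto simp: dyadic_index_def min_def)
    finally show ?thesis .
  qed
qed

lemma dyadic_index_mem: "x \<in> {0..1} \<Longrightarrow> x \<in> dyadic k (dyadic_index k x)"
  using mem_dyadic_iff dyadic_index_less by blast

lemma dyadic_index_Suc:
  assumes x: "x \<in> {0..1}"
  shows "dyadic_index (Suc k) x div 2 = dyadic_index k x"
proof -
  have "\<lfloor>x * 2 ^ k\<rfloor> = \<lfloor>x * 2 ^ Suc k / real_of_int 2\<rfloor>" by simp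
  also have "\<dots> = \<lfloor>x * 2 ^ Suc k\<rfloor> div 2" by (subst floor_divide_real_eq_div) auto
  finally have "nat \<lfloor>x * 2 ^ k\<rfloor> = nat \<lfloor>x * 2 ^ Suc k\<rfloor> div 2"
    by (simp add: nat_div_distrib')
  \<comment> \<open>The cap at the last index commutes with halving; b stands for
    \<open>2 ^ k\<close>, and the two equations are the even and the odd case.\<close>
  moreover have "min (2 * n) (2 * b - 1) div 2 = min n (b - 1)" "min (Suc (2 * n)) (2 * b - 1) div 2 = min n (b - 1)"
    if "b > 0" for n b :: nat using that by (auto simp: min_def)
  then have "min n (2 * b - 1) div 2 = min (n div 2) (b - 1)" if "b > 0" for n b :: nat
    using that by (cases "even n") (auto elim!: evenE oddE)
  ultimately show ?thesis by (simp add: dyadic_index_def)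
qed

lemma dyadic_index_div:
  assumes x: "x \<in> {0..1}" and "k \<le> m"
  shows "dyadic_index m x div 2 ^ (m - k) = dyadic_index k x"
  using assms(2)
proof (induction m rule: dec_induct)
  case (step m)
  then have "dyadic_index (Suc m) x div 2 ^ (Suc m - k) = dyadic_index (Suc m) x div 2 div 2 ^ (m - k)"
    by (simp add: Suc_diff_le div_mult2_eq)
  then show ?case using step dyadic_index_Suc[OF x] by simp
qed simp

section \<open>Step functions on one generation of the grid\<close>

definition step :: "nat \<Rightarrow> (nat \<Rightarrow> complex) \<Rightarrow> real \<Rightarrow> complex" where
  "step k v x = (\<Sum>j<2 ^ k. v j * indicator (dyadic k j) x)"

lemma step_eq: "x \<in> {0..1} \<Longrightarrow> step k v x = v (dyadic_index k x)"
proof -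
  assume x: "x \<in> {0..1}"
  have "step k v x = (\<Sum>j<2 ^ k. if j = dyadic_index k x then v j else 0)"
    unfolding step_def using mem_dyadic_iff[OF x] by (intro sum.cong) (auto simp: indicator_def)
  then show ?thesis using dyadic_index_less by simp
qed

lemma dyadic_lmeasurable: "dyadic k j \<in> lmeasurable"
proof (rule bounded_set_imp_lmeasurable)
  show "bounded (dyadic k j)"
    using bounded_subset[OF bounded_closed_interval dyadic_subset_cell[unfolded cell_def]] .
  show "dyadic k j \<in> sets lebesgue"
    unfolding dyadic_def by (intro sets_completionI_sets) simp
qed

lemma measure_dyadic: "j < 2 ^ k \<Longrightarrow> measure lebesgue (dyadic k j) = 1 / 2 ^ k"
proof (cases "Suc j = 2 ^ k")
  case True
  then have r: "real j + 1 = 2 ^ k" by (rule real_of_Suc_eq_power)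
  show ?thesis using True r by (simp add: dyadic_def field_simps)
next
  case False
  then show ?thesis by (simp add: dyadic_def field_simps)
qed

lemma abs_int_indicator:
  fixes c :: complex and A :: "real set"
  assumes "A \<in> lmeasurable"
  shows "(\<lambda>x. c * indicator A x) absolutely_integrable_on {0..1}"
proof -
  have "(\<lambda>x. indicator A x *\<^sub>R c) absolutely_integrable_on UNIV"
    using integrable_indicator[of A lebesgue c] assms unfolding set_integrable_def
    by (auto simp: fmeasurable_def)
  moreover have "(\<lambda>x. indicator A x *\<^sub>R c) = (\<lambda>x. c * indicator A x)"
    by (auto simp: indicator_def)
  ultimately show ?thesis
    using absolutely_integrable_on_subinterval[where f = "\<lambda>x. c * indicator A x" and S = UNIV] by simp
qed

lemma abs_int_step: "step k v absolutely_integrable_on {0..1}"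
proof -
  have "(\<lambda>x. \<Sum>j<2 ^ k. v j * indicator (dyadic k j) x) absolutely_integrable_on {0..1}"
    by (intro absolutely_integrable_sum abs_int_indicator dyadic_lmeasurable) auto
  then show ?thesis by (simp add: step_def[abs_def])
qed

lemma avg_cong:
  fixes \<phi> \<psi> :: "real \<Rightarrow> 'a::euclidean_space"
  assumes "j < 2 ^ k" "\<And>x. x \<in> dyadic k j \<Longrightarrow> \<phi> x = \<psi> x"
  shows "avg k j \<phi> = avg k j \<psi>"
proof -
  have "integral (cell k j) \<phi> = integral (cell k j) \<psi>"
    proof (rule integral_spike)
    fix x assume "x \<in> cell k j - {real (Suc j) / 2 ^ k}"
    then have "x \<in> dyadic k j"
      using cell_subset_dyadic[OF assms(1)] by (auto simp: cell_def subset_iff)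
    then show "\<psi> x = \<phi> x" using assms(2) by simp
  qed simp
  then show ?thesis by (simp add: avg_def)
qed

lemma avg_const: "avg k j (\<lambda>x. c) = c"
  by (simp add: avg_def cell_def field_simps)

lemma avg_step:
  assumes "m \<le> k" "j < 2 ^ k"
  shows "avg k j (step m v) = v (j div 2 ^ (k - m))"
proof -
  have "avg k j (step m v) = avg k j (\<lambda>x. v (j div 2 ^ (k - m)))"
  proof (rule avg_cong[OF assms(2)])
    fix x assume x: "x \<in> dyadic k j"
    then have x1: "x \<in> {0..1}" using dyadic_subset assms by blast
    then have "j = dyadic_index k x" using x mem_dyadic_iff assms by blast
    then show "step m v x = v (j div 2 ^ (k - m))"
      using dyadic_index_div[OF x1 assms(1)] by (simp add: step_eq[OF x1])
  qed
  then show ?thesis by (simp add: avg_const)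
qed

text \<open>Value of the k-th martingale difference on cell j; \<open>j div 2\<close> is the parent
  cell. Level 0 carries the mean itself, so that the differences telescope to
  \<open>avg\<close>.\<close>

definition davg :: "nat \<Rightarrow> nat \<Rightarrow> (real \<Rightarrow> 'a::euclidean_space) \<Rightarrow> 'a" where
  "davg k j \<psi> = (if k = 0 then avg 0 j \<psi> else avg k j \<psi> - avg (k - 1) (j div 2) \<psi>)"

lemma div2_less: "j < 2 ^ k \<Longrightarrow> 0 < k \<Longrightarrow> j div 2 < 2 ^ (k - Suc 0)" for j k :: nat
  by (cases k) auto

lemma davg_add:
  fixes \<phi> \<psi> :: "real \<Rightarrow> 'a::euclidean_space"
  shows "\<phi> absolutely_integrable_on {0..1} \<Longrightarrow> \<psi> absolutely_integrable_on {0..1} \<Longrightarrow> j < 2 ^ k \<Longrightarrow>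
    davg k j (\<lambda>x. \<phi> x + \<psi> x) = davg k j \<phi> + davg k j \<psi>"
  by (auto simp: davg_def avg_add div2_less)

lemma davg_cmult:
  fixes \<psi> :: "real \<Rightarrow> complex"
  shows "davg k j (\<lambda>x. c * \<psi> x) = c * davg k j \<psi>"
  by (auto simp: davg_def avg_cmult algebra_simps)

lemma davg_sum:
  fixes \<psi> :: "'i \<Rightarrow> real \<Rightarrow> 'a::euclidean_space"
  assumes "finite I" "\<And>i. i \<in> I \<Longrightarrow> \<psi> i absolutely_integrable_on {0..1}" "j < 2 ^ k"
  shows "davg k j (\<lambda>x. \<Sum>i\<in>I. \<psi> i x) = (\<Sum>i\<in>I. davg k j (\<psi> i))"
  using assms by (auto simp: davg_def avg_sum div2_less sum_subtractf)

text \<open>The bound grows with the level. It serves to make each single level continuous for the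
  \<open>L^1\<close> norm when a limit is taken with k fixed.\<close>

lemma norm_davg_le:
  fixes \<psi> :: "real \<Rightarrow> 'a::euclidean_space"
  assumes "\<psi> absolutely_integrable_on {0..1}" "j < 2 ^ k"
  shows "norm (davg k j \<psi>) \<le> 2 * 2 ^ k * integral {0..1} (\<lambda>x. norm (\<psi> x))"
proof -
  have n: "(\<lambda>x. norm (\<psi> x)) absolutely_integrable_on {0..1}"
    using absolutely_integrable_norm[OF assms(1)] by (simp add: comp_def)
  then have nn: "0 \<le> integral {0..1} (\<lambda>x. norm (\<psi> x))"
    by (intro integral_nonneg) (auto simp: absolutely_integrable_on_def)
  have a: "norm (avg m i \<psi>) \<le> 2 ^ m * integral {0..1} (\<lambda>x. norm (\<psi> x))" if "i < 2 ^ m" for i m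
    using norm_avg_le[OF assms(1) that] avg_le_integral[OF n that] by simp
  show ?thesis
  proof (cases k)
    case 0
    then show ?thesis using a[of j 0] assms nn by (simp add: davg_def)
  next
    case (Suc m)
    have "norm (davg k j \<psi>) \<le> norm (avg k j \<psi>) + norm (avg m (j div 2) \<psi>)"
      by (simp add: davg_def Suc norm_triangle_ineq4)
    also have "\<dots> \<le> 2 ^ k * integral {0..1} (\<lambda>x. norm (\<psi> x)) + 2 ^ m * integral {0..1} (\<lambda>x. norm (\<psi> x))"
      using assms Suc by (intro add_mono a) auto
    also have "\<dots> \<le> 2 * 2 ^ k * integral {0..1} (\<lambda>x. norm (\<psi> x))"
      using nn by (simp add: Suc algebra_simps)
    finally show ?thesis .
  qed
qed

lemma davg_step_0:
  assumes "m < k" "j < 2 ^ k"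
  shows "davg k j (step m v) = 0"
proof -
  have "Suc (k - 1 - m) = k - m" using assms by simp
  then have "j div 2 ^ (k - m) = j div 2 div 2 ^ (k - 1 - m)"
    by (metis div_mult2_eq power_Suc)
  then show ?thesis
    using assms by (simp add: davg_def avg_step div2_less)
qed

lemma sum_davg:
  assumes x: "x \<in> {0..1}"
  shows "(\<Sum>k\<le>K. davg k (dyadic_index k x) \<psi>) = avg K (dyadic_index K x) \<psi>"
  by (induction K) (use x in \<open>auto simp: davg_def dyadic_index_Suc\<close>)

text \<open>This is the \<open>L^p\<close> norm of \<open>step k v\<close> on the unit interval; the
  prefactor is the measure of a cell to the power \<open>1/p\<close>.\<close>

definition en :: "real \<Rightarrow> nat \<Rightarrow> (nat \<Rightarrow> 'a::real_normed_vector) \<Rightarrow> real" where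
  "en p k v = 2 powr (- (real k / p)) * lpn p {..<2 ^ k} (\<lambda>j. norm (v j))"

lemma en_nonneg: "0 \<le> en p k v"
  by (simp add: en_def lpn_nonneg)

lemma en_cong: "(\<And>j. j < 2 ^ k \<Longrightarrow> norm (v j) = norm (w j)) \<Longrightarrow> en p k v = en p k w"
  by (simp add: en_def lpn_def)

lemma en_powr: "p \<ge> 1 \<Longrightarrow> en p k v powr p = (\<Sum>j<2 ^ k. norm (v j) powr p) / 2 ^ k"
  by (simp add: en_def powr_mult lpn_powr powr_powr powr_minus powr_realpow powr_divide lpn_nonneg divide_simps)

lemma en_le_iff: "p \<ge> 1 \<Longrightarrow> 0 \<le> B \<Longrightarrow> en p k v \<le> B \<longleftrightarrow> (\<Sum>j<2 ^ k. norm (v j) powr p) / 2 ^ k \<le> B powr p"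
  using powr_mono2[of p "en p k v" B] powr_less_mono2[of p B "en p k v"] en_nonneg[of p k v]
  by (simp add: en_powr[symmetric]) linarith

lemma en_triangle: "p \<ge> 1 \<Longrightarrow> en p k (\<lambda>j. u j + v j) \<le> en p k u + en p k v"
  unfolding en_def distrib_left[symmetric]
  by (intro mult_left_mono order_trans[OF lpn_mono lpn_triangle]) (auto simp: norm_triangle_ineq)

lemma en_diff: "p \<ge> 1 \<Longrightarrow> en p k (\<lambda>j. u j - v j) \<le> en p k u + en p k v"
  unfolding en_def distrib_left[symmetric]
  by (intro mult_left_mono order_trans[OF lpn_mono lpn_triangle]) (auto simp: norm_triangle_ineq4)

lemma en_sum: "p \<ge> 1 \<Longrightarrow> en p k (\<lambda>j. \<Sum>i\<in>I. u i j) \<le> (\<Sum>i\<in>I. en p k (u i))"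
  unfolding en_def sum_distrib_left[symmetric]
  by (intro mult_left_mono order_trans[OF lpn_mono lpn_sum]) (auto simp: norm_sum)

lemma en_cmult: "p \<ge> 1 \<Longrightarrow> en p k (\<lambda>j. c * u j) = norm c * en p k u"
  for c :: complex
  by (simp add: en_def norm_mult lpn_cmult)

lemma sum_double: "(\<Sum>i<2 * n. g i) = (\<Sum>j<n. g (2 * j) + g (Suc (2 * j)))"
  for g :: "nat \<Rightarrow> 'a::comm_monoid_add"
  by (induction n) (auto simp: algebra_simps)

text \<open>Conditional expectation onto a coarser generation is a contraction of
  \<open>L^p\<close>: a parent average is the mean of its two children, and the power is
  convex.\<close>

lemma en_avg_Suc:
  fixes \<psi> :: "real \<Rightarrow> 'a::euclidean_space"
  assumes p: "p \<ge> 1" and \<psi>: "\<psi> absolutely_integrable_on {0..1}"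
  shows "en p k (\<lambda>j. avg k j \<psi>) \<le> en p (Suc k) (\<lambda>j. avg (Suc k) j \<psi>)"
proof -
  have *: "2 * norm (avg k j \<psi>) powr p
      \<le> norm (avg (Suc k) (2 * j) \<psi>) powr p + norm (avg (Suc k) (Suc (2 * j)) \<psi>) powr p"
    if j: "j < 2 ^ k" for j
  proof -
    define a b where "a = norm (avg (Suc k) (2 * j) \<psi>)" and "b = norm (avg (Suc k) (Suc (2 * j)) \<psi>)"
    have "2 * norm (avg k j \<psi>) \<le> a + b"
      using norm_triangle_ineq[of "avg (Suc k) (2 * j) \<psi>" "avg (Suc k) (Suc (2 * j)) \<psi>"]
      unfolding a_def b_def avg_children[OF \<psi> j, symmetric] by simp
    then have "(2 * norm (avg k j \<psi>)) powr p \<le> (a + b) powr p"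
      using p by (intro powr_mono2) auto
    also have "\<dots> \<le> 2 powr (p - 1) * (a powr p + b powr p)"
      using powr_sum_le[of "{0, 1::nat}" p "\<lambda>i. if i = 0 then a else b"] p
      by (simp add: a_def b_def)
    finally have "2 powr (p - 1) * (2 * norm (avg k j \<psi>) powr p) \<le> 2 powr (p - 1) * (a powr p + b powr p)"
      by (simp add: powr_mult powr_diff)
    then show ?thesis by (simp add: a_def b_def)
  qed
  have "2 * (\<Sum>j<2 ^ k. norm (avg k j \<psi>) powr p) \<le> (\<Sum>j<2 ^ k.
      norm (avg (Suc k) (2 * j) \<psi>) powr p + norm (avg (Suc k) (Suc (2 * j)) \<psi>) powr p)"
    unfolding sum_distrib_left using * by (intro sum_mono) auto
  also have "\<dots> = (\<Sum>j<2 ^ Suc k. norm (avg (Suc k) j \<psi>) powr p)"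
    by (simp add: sum_double)
  finally show ?thesis using p
    by (simp add: en_le_iff en_nonneg en_powr field_simps)
qed

lemma en_avg_mono:
  fixes \<psi> :: "real \<Rightarrow> 'a::euclidean_space"
  assumes "p \<ge> 1" "\<psi> absolutely_integrable_on {0..1}" "k \<le> m"
  shows "en p k (\<lambda>j. avg k j \<psi>) \<le> en p m (\<lambda>j. avg m j \<psi>)"
  using assms(3)
  by (induction m rule: dec_induct) (use en_avg_Suc[OF assms(1,2)] order_trans in blast)+

text \<open>Both sides are the norm of one function, written on generation k + 1 and on generation
  k.\<close>

lemma en_div2:
  assumes "p \<ge> 1"
  shows "en p (Suc k) (\<lambda>j. v (j div 2)) = en p k v"
  unfolding en_def lpn_def
proof -
  have "(\<Sum>j<2 ^ Suc k. norm (v (j div 2)) powr p) = 2 * (\<Sum>j<2 ^ k. norm (v j) powr p)"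
    by (simp add: sum_double sum_distrib_left)
  then show "2 powr (- (real (Suc k) / p)) * (\<Sum>j<2 ^ Suc k. norm (v (j div 2)) powr p) powr (1 / p)
      = 2 powr (- (real k / p)) * (\<Sum>j<2 ^ k. norm (v j) powr p) powr (1 / p)"
    by (simp add: powr_mult sum_nonneg mult.assoc[symmetric] powr_add[symmetric] add_divide_distrib)
qed

lemma en_davg_le:
  fixes \<psi> :: "real \<Rightarrow> 'a::euclidean_space"
  assumes p: "p \<ge> 1" and \<psi>: "\<psi> absolutely_integrable_on {0..1}"
  shows "en p k (\<lambda>j. davg k j \<psi>) \<le> 2 * en p k (\<lambda>j. avg k j \<psi>)"
proof (cases k)
  case 0
  then show ?thesis using en_nonneg[of p 0 "\<lambda>j. avg 0 j \<psi>"] by (simp add: davg_def)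
next
  case (Suc m)
  have "en p k (\<lambda>j. davg k j \<psi>) = en p k (\<lambda>j. avg k j \<psi> - avg m (j div 2) \<psi>)"
    by (simp add: davg_def Suc)
  also have "\<dots> \<le> en p k (\<lambda>j. avg k j \<psi>) + en p k (\<lambda>j. avg m (j div 2) \<psi>)"
    by (rule en_diff[OF p])
  also have "en p k (\<lambda>j. avg m (j div 2) \<psi>) = en p m (\<lambda>j. avg m j \<psi>)"
    unfolding Suc by (rule en_div2[OF p])
  also have "\<dots> \<le> en p k (\<lambda>j. avg k j \<psi>)"
    using en_avg_mono[OF p \<psi>] Suc by simp
  finally show ?thesis by simp
qed

text \<open>For k above j the difference vanishes; for the other levels averaging is a contraction
  and the factor 2 comes from subtracting the parent average.\<close>

lemma en_davg_step_le:
  assumes p: "p \<ge> 1"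
  shows "en p k (\<lambda>i. davg k i (step j v)) \<le> 2 * en p j v"
proof (cases "k \<le> j")
  case True
  have "en p j (\<lambda>i. avg j i (step j v)) = en p j v"
    by (rule en_cong) (simp add: avg_step)
  then show ?thesis
    using en_davg_le[OF p abs_int_step, of k j v] en_avg_mono[OF p abs_int_step True, of j v] by linarith
next
  case False
  then have "en p k (\<lambda>i. davg k i (step j v)) = en p k (\<lambda>i. 0::complex)"
    by (intro en_cong) (simp add: davg_step_0)
  then show ?thesis using en_nonneg[of p j v] by (simp add: en_def lpn_zero)
qed

section \<open>Almost everywhere convergence of dyadic averages\<close>

text \<open>Lebesgue differentiation along dyadic intervals. The differentiation theorem controls
  averages over intervals that begin at x; applied to g and to its reflection it treats the parts of
  the dyadic interval to the right and to the left of x.\<close>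

lemma avg_tendsto_AE:
  fixes \<psi> :: "real \<Rightarrow> complex"
  assumes \<psi>: "\<psi> absolutely_integrable_on {0..1}"
  obtains N where "negligible N"
    "\<And>x. x \<in> {0..1} \<Longrightarrow> x \<notin> N \<Longrightarrow> (\<lambda>k. avg k (dyadic_index k x) \<psi>) \<longlonglongrightarrow> \<psi> x"
proof -
  define g where "g = (\<lambda>x. if x \<in> {0..1} then \<psi> x else 0)"
  have "g absolutely_integrable_on UNIV"
    using \<psi> absolutely_integrable_restrict_UNIV[of "{0..1}" \<psi>] by (simp add: g_def)
  then have gi: "g integrable_on {a..b}" for a b
    using absolutely_integrable_on_subinterval[where f = g and S = UNIV and a = a and b = b]
    by (simp add: absolutely_integrable_on_def)
  have gi': "(\<lambda>x. g (- x)) integrable_on {a..b}" for a b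
    using gi[of "-b" "-a"] Henstock_Kurzweil_Integration.integrable_reflect_real[where f = g and a = "-b" and b = "-a"] by simp
  have deriv: "\<exists>N. negligible N \<and> (\<forall>x e. x \<notin> N \<longrightarrow> 0 < e \<longrightarrow>
      (\<exists>d>0. \<forall>h. 0 < h \<and> h < d \<longrightarrow> norm (integral {x..x + h} w /\<^sub>R h - w x) < e))"
    if w: "\<And>a b. w integrable_on {a..b}" for w :: "real \<Rightarrow> complex"
  proof -
    have "\<And>a b. w integrable_on cbox a b" using w by simp
    then obtain N where N: "negligible N" "\<And>x e. x \<notin> N \<Longrightarrow> 0 < e \<Longrightarrow>
        \<exists>d>0. \<forall>h. 0 < h \<and> h < d \<longrightarrow> norm (integral (cbox x (x + h *\<^sub>R One)) w /\<^sub>R h ^ DIM(real) - w x) < e"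
      by (rule integrable_ccontinuous_explicit) blast
    have "\<exists>d>0. \<forall>h. 0 < h \<and> h < d \<longrightarrow> norm (integral {x..x + h} w /\<^sub>R h - w x) < e"
      if "x \<notin> N" "0 < e" for x e
      using N(2)[OF that] by simp
    then show ?thesis using N(1) by blast
  qed
  obtain N1 where N1: "negligible N1" "\<And>x e. x \<notin> N1 \<Longrightarrow> 0 < e \<Longrightarrow>
      \<exists>d>0. \<forall>h. 0 < h \<and> h < d \<longrightarrow> norm (integral {x..x + h} g /\<^sub>R h - g x) < e"
    using deriv[OF gi] by blast
  obtain N2 where N2: "negligible N2" "\<And>x e. x \<notin> N2 \<Longrightarrow> 0 < e \<Longrightarrow>
      \<exists>d>0. \<forall>h. 0 < h \<and> h < d \<longrightarrow> norm (integral {x..x + h} (\<lambda>x. g (- x)) /\<^sub>R h - g (- x)) < e"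
    using deriv[OF gi'] by blast
  have neg: "negligible (N1 \<union> uminus ` N2)"
    using N1(1) negligible_differentiable_image_negligible[OF order_refl N2(1), of uminus]
    by (simp add: negligible_Un linear_imp_differentiable_on linear_uminus)
  \<comment> \<open>Errors are stated for integrals and not for averages, because the two parts can
    have very different lengths and one of them can be empty; in this form they add up.\<close>
  have lin: "norm (I - h *\<^sub>R c) \<le> e * h" if "norm (I /\<^sub>R h - c) < e" "h > 0" for I c :: complex and h e
  proof -
    have "I - h *\<^sub>R c = h *\<^sub>R (I /\<^sub>R h - c)" using that by (simp add: scaleR_diff_right)
    then have "norm (I - h *\<^sub>R c) = h * norm (I /\<^sub>R h - c)" using that by simp
    then show ?thesis using that by (simp add: mult.commute mult_left_mono)
  qed
  show thesis
  proof (rule that[OF neg])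
    fix x :: real assume x: "x \<in> {0..1}" "x \<notin> N1 \<union> uminus ` N2"
    then have x2: "- x \<notin> N2" by force
    show "(\<lambda>k. avg k (dyadic_index k x) \<psi>) \<longlonglongrightarrow> \<psi> x"
    proof (rule LIMSEQ_I)
      fix e0 :: real assume "e0 > 0"
      define e where "e = e0 / 2"
      have e: "e > 0" using \<open>e0 > 0\<close> by (simp add: e_def)
      obtain d1 where d1: "d1 > 0" "\<And>h. 0 < h \<Longrightarrow> h < d1 \<Longrightarrow> norm (integral {x..x + h} g /\<^sub>R h - g x) < e"
        using N1(2)[of x e] x e by auto
      obtain d2 where d2: "d2 > 0" "\<And>h. 0 < h \<Longrightarrow> h < d2 \<Longrightarrow>
          norm (integral {- x..- x + h} (\<lambda>x. g (- x)) /\<^sub>R h - g x) < e"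
        using N2(2)[of "-x" e] x2 e by auto
      have R: "norm (integral {x..b} g - (b - x) *\<^sub>R g x) \<le> e * (b - x)" if "x \<le> b" "b - x < d1" for b
        using lin[OF d1(2)[of "b - x"]] that by (cases "b = x") auto
      have L: "norm (integral {a..x} g - (x - a) *\<^sub>R g x) \<le> e * (x - a)" if "a \<le> x" "x - a < d2" for a
        using lin[OF d2(2)[of "x - a"]] that integral_reflect_real[where f = g and a = a and b = x] by (cases "a = x") auto
      obtain K where K: "(1/2) ^ K < min d1 d2"
        using real_arch_pow_inv[of "min d1 d2" "1/2"] d1 d2 by auto
      have "norm (avg k (dyadic_index k x) \<psi> - \<psi> x) < e0" if k: "k \<ge> K" for k
      proof -
        define a b where "a = real (dyadic_index k x) / 2 ^ k" and "b = real (Suc (dyadic_index k x)) / 2 ^ k"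
        have ba: "b - a = (1/2) ^ k" by (simp add: a_def b_def field_simps)
        have ax: "a \<le> x" "x \<le> b"
          using dyadic_index_mem[OF x(1), of k] dyadic_subset_cell[of k "dyadic_index k x"]
          by (auto simp: a_def b_def cell_def subset_iff)
        have ab01: "{a..b} \<subseteq> {0..1}"
          using cell_subset[OF dyadic_index_less, of k x] by (simp add: a_def b_def cell_def)
        have "(1/2::real) ^ k \<le> (1/2) ^ K" using k by (intro power_decreasing) auto
        then have "b - a < d1" "b - a < d2" using K unfolding ba by linarith+
        then have small: "b - x < d1" "x - a < d2" using ax by linarith+
        have "integral {a..b} \<psi> = integral {a..b} g"
          using ab01 by (intro Henstock_Kurzweil_Integration.integral_cong) (auto simp: g_def)
        also have "\<dots> = integral {a..x} g + integral {x..b} g"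
          using Henstock_Kurzweil_Integration.integral_combine[OF ax gi] by simp
        finally have "integral {a..b} \<psi> - (b - a) *\<^sub>R \<psi> x
            = (integral {a..x} g - (x - a) *\<^sub>R g x) + (integral {x..b} g - (b - x) *\<^sub>R g x)"
          using x by (simp add: g_def algebra_simps)
        then have "norm (integral {a..b} \<psi> - (b - a) *\<^sub>R \<psi> x) \<le> e * (x - a) + e * (b - x)"
          using R[OF ax(2) small(1)] L[OF ax(1) small(2)] norm_triangle_mono by metis
        also have "\<dots> = e * (1/2) ^ k" by (simp add: ba[symmetric] algebra_simps)
        finally have le: "norm (integral {a..b} \<psi> - (1/2) ^ k *\<^sub>R \<psi> x) \<le> e * (1/2) ^ k" by (simp add: ba)
        have "avg k (dyadic_index k x) \<psi> - \<psi> x = 2 ^ k *\<^sub>R (integral {a..b} \<psi> - (1/2) ^ k *\<^sub>R \<psi> x)"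
          by (simp add: avg_def cell_def a_def b_def scaleR_diff_right power_mult_distrib[symmetric] del: of_nat_Suc)
        then have "norm (avg k (dyadic_index k x) \<psi> - \<psi> x) \<le> 2 ^ k * (e * (1/2) ^ k)"
          using le by (simp add: mult_left_mono)
        also have "\<dots> = e" by (simp add: power_one_over)
        finally show ?thesis using e by (simp add: e_def)
      qed
      then show "\<exists>no. \<forall>n\<ge>no. norm (avg n (dyadic_index n x) \<psi> - \<psi> x) < e0" by blast
    qed
  qed
qed

section \<open>Lebesgue integrals and power integrable functions on the unit interval\<close>

lemma sets01: "{0..1::real} \<inter> space lebesgue \<in> sets lebesgue"
  by simp

lemma abs_int_iff_integrable:
  fixes \<psi> :: "real \<Rightarrow> 'a::euclidean_space"
  shows "\<psi> absolutely_integrable_on {0..1} \<longleftrightarrow> integrable leb01 \<psi>"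
  by (simp add: set_integrable_def integrable_restrict_space)

lemma integral_leb01:
  fixes \<psi> :: "real \<Rightarrow> 'a::euclidean_space"
  assumes "\<psi> absolutely_integrable_on {0..1}"
  shows "(LINT x|leb01. \<psi> x) = integral {0..1} \<psi>"
  using set_lebesgue_integral_eq_integral(2)[OF assms]
  by (simp add: integral_restrict_space set_lebesgue_integral_def)

lemma measurable_norm_powr:
  fixes u :: "'a \<Rightarrow> complex"
  shows "u \<in> borel_measurable M \<Longrightarrow> (\<lambda>x. norm (u x) powr p) \<in> borel_measurable M"
  by measurable

lemma nn_integral_step:
  assumes "p \<ge> 1"
  shows "(\<integral>\<^sup>+x. ennreal (norm (step m w x) powr p) \<partial>leb01) = ennreal (en p m w powr p)"
proof -
  have "(\<integral>\<^sup>+x. ennreal (norm (step m w x) powr p) \<partial>leb01)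
      = (\<integral>\<^sup>+x. (\<Sum>j<2 ^ m. ennreal (norm (w j) powr p) * indicator (dyadic m j) x) \<partial>leb01)"
  proof (rule nn_integral_cong)
    fix x assume "x \<in> space leb01"
    then have x: "x \<in> {0..1}" by simp
    have "(\<Sum>j<2 ^ m. ennreal (norm (w j) powr p) * indicator (dyadic m j) x)
        = (\<Sum>j<2 ^ m. if j = dyadic_index m x then ennreal (norm (w j) powr p) else 0)"
      using mem_dyadic_iff[OF x] by (intro sum.cong) (auto simp: indicator_def)
    then show "ennreal (norm (step m w x) powr p) = (\<Sum>j<2 ^ m. ennreal (norm (w j) powr p) * indicator (dyadic m j) x)"
      using dyadic_index_less by (simp add: step_eq[OF x])
  qed
  also have "\<dots> = (\<Sum>j<2 ^ m. ennreal (norm (w j) powr p) * emeasure leb01 (dyadic m j))"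
  proof -
    have "dyadic m j \<in> sets leb01" if "j < 2 ^ m" for j
      using dyadic_lmeasurable[of m j] dyadic_subset[OF that] by (simp add: sets_restrict_space_iff fmeasurableD)
    then show ?thesis
      by (subst nn_integral_sum) (auto simp: nn_integral_cmult_indicator simp del: sum_mult_indicator)
  qed
  also have "\<dots> = (\<Sum>j<2 ^ m. ennreal (norm (w j) powr p * (1 / 2 ^ m)))"
  proof (intro sum.cong refl)
    fix j assume "j \<in> {..<(2::nat) ^ m}"
    then have j: "j < 2 ^ m" by simp
    have "emeasure leb01 (dyadic m j) = emeasure lebesgue (dyadic m j)"
      using dyadic_subset[OF j] by (intro emeasure_restrict_space) auto
    also have "\<dots> = ennreal (1 / 2 ^ m)"
      using emeasure_eq_measure2[OF dyadic_lmeasurable, of m j] measure_dyadic[OF j] by simp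
    finally show "ennreal (norm (w j) powr p) * emeasure leb01 (dyadic m j) = ennreal (norm (w j) powr p * (1 / 2 ^ m))"
      by (simp only: ennreal_mult'[symmetric] powr_ge_zero)
  qed
  also have "\<dots> = ennreal (en p m w powr p)"
    using assms by (simp add: sum_ennreal en_powr sum_divide_distrib)
  finally show ?thesis .
qed

lemma en_div_power:
  assumes "p \<ge> 1" "k \<le> m"
  shows "en p m (\<lambda>j. v (j div 2 ^ (m - k))) = en p k v"
  using assms(2)
proof (induction m rule: dec_induct)
  case (step m)
  have "(\<lambda>j. v (j div 2 ^ (Suc m - k))) = (\<lambda>j. (\<lambda>i. v (i div 2 ^ (m - k))) (j div 2))"
    using step by (auto simp: Suc_diff_le div_mult2_eq)
  then show ?case using step en_div2[OF assms(1), of m "\<lambda>i. v (i div 2 ^ (m - k))"] by simp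
qed simp

lemma Lp_norm_le:
  assumes p: "p \<ge> 1" and u: "u \<in> borel_measurable M" and "0 \<le> B"
    and le: "(\<integral>\<^sup>+x. ennreal (norm (u x) powr p) \<partial>M) \<le> ennreal (B powr p)"
  shows "u \<in> Lp_space M p" "Lp_norm M p u \<le> B"
proof -
  have m: "(\<lambda>x. norm (u x) powr p) \<in> borel_measurable M" using u by (rule measurable_norm_powr)
  have i: "integrable M (\<lambda>x. norm (u x) powr p)"
    using m le by (intro integrableI_bounded) (auto intro: le_less_trans)
  then show "u \<in> Lp_space M p" using u by (simp add: Lp_space_def)
  have "ennreal (LINT x|M. norm (u x) powr p) \<le> ennreal (B powr p)"
    using nn_integral_eq_integral[OF i] le by simp
  then have "(LINT x|M. norm (u x) powr p) \<le> B powr p" by (simp add: ennreal_le_iff)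
  then have "(LINT x|M. norm (u x) powr p) powr (1 / p) \<le> (B powr p) powr (1 / p)"
    using p by (intro powr_mono2) auto
  then show "Lp_norm M p u \<le> B" using p \<open>0 \<le> B\<close> by (simp add: Lp_norm_def powr_powr)
qed

definition partial_series :: "(real \<Rightarrow> complex) \<Rightarrow> nat \<Rightarrow> real \<Rightarrow> complex" where
  "partial_series \<psi> K x = (\<Sum>k<K. step k (\<lambda>j. davg k j \<psi>) x)"

lemma abs_int_partial_series: "partial_series \<psi> K absolutely_integrable_on {0..1}"
  unfolding partial_series_def[abs_def]
  by (intro absolutely_integrable_sum) (auto intro: abs_int_step)

lemma partial_series_Suc: "x \<in> {0..1} \<Longrightarrow> partial_series \<psi> (Suc K) x = avg K (dyadic_index K x) \<psi>"
  using sum_davg[of x \<psi> K] by (simp add: partial_series_def step_eq lessThan_Suc_atMost)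

text \<open>Fatou's lemma applied to the differences of the partial sums; no completeness of \<open>L\<^sup>p\<close> is needed.\<close>

lemma partial_series_Lp:
  fixes \<psi> :: "real \<Rightarrow> complex"
  assumes p: "p \<ge> 1" and \<psi>: "\<psi> absolutely_integrable_on {0..1}"
    and sm: "summable (\<lambda>k. en p k (\<lambda>j. davg k j \<psi>))"
  shows "\<psi> \<in> Lp_space leb01 p"
    and "(\<lambda>K. Lp_norm leb01 p (\<lambda>x. \<psi> x - partial_series \<psi> K x)) \<longlonglongrightarrow> 0"
    and "Lp_norm leb01 p \<psi> \<le> (\<Sum>k. en p k (\<lambda>j. davg k j \<psi>))"
proof -
  define u where "u = (\<lambda>k. en p k (\<lambda>j. davg k j \<psi>))"
  define t where "t = (\<lambda>K. \<Sum>k. u (k + K))"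
  have sm': "summable u" using sm by (simp add: u_def)
  have u0: "0 \<le> u k" for k by (simp add: u_def en_nonneg)
  have t0: "0 \<le> t K" for K
    unfolding t_def using summable_ignore_initial_segment[OF sm'] u0 by (intro suminf_nonneg)
  have tail: "(\<Sum>k\<in>{K..<M}. u k) \<le> t K" for K M
  proof (cases "K \<le> M")
    case True
    have "(\<Sum>k\<in>{K..<M}. u k) = (\<Sum>k<M - K. u (k + K))"
      using sum.shift_bounds_nat_ivl[of u 0 K "M - K"] True by (simp add: atLeast0LessThan)
    also have "\<dots> \<le> t K"
      unfolding t_def using summable_ignore_initial_segment[OF sm'] u0 by (intro sum_le_suminf) auto
    finally show ?thesis .
  qed (use t0 in auto)
  have tlim: "t \<longlonglongrightarrow> 0" unfolding t_def using suminf_exist_split2[OF sm'] .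
  obtain N where N: "negligible N"
    "\<And>x. x \<in> {0..1} \<Longrightarrow> x \<notin> N \<Longrightarrow> (\<lambda>k. avg k (dyadic_index k x) \<psi>) \<longlonglongrightarrow> \<psi> x"
    using avg_tendsto_AE[OF \<psi>] by blast
  have AE: "AE x in leb01. (\<lambda>M. partial_series \<psi> M x) \<longlonglongrightarrow> \<psi> x"
  proof (subst AE_restrict_space_iff[OF sets01], rule AE_I')
    show "N \<in> null_sets lebesgue" using N(1) by (simp add: negligible_iff_null_sets)
    show "{x \<in> space lebesgue. \<not> (x \<in> {0..1} \<longrightarrow> (\<lambda>M. partial_series \<psi> M x) \<longlonglongrightarrow> \<psi> x)} \<subseteq> N"
    proof (clarify, rule ccontr)
      fix x :: real assume x: "x \<in> {0..1}" "x \<notin> N" and n: "\<not> (\<lambda>M. partial_series \<psi> M x) \<longlonglongrightarrow> \<psi> x"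
      have "(\<lambda>M. partial_series \<psi> (Suc M) x) \<longlonglongrightarrow> \<psi> x"
        using N(2)[OF x] by (simp add: partial_series_Suc[OF x(1)])
      then show False
        using n LIMSEQ_imp_Suc[where f = "\<lambda>M. partial_series \<psi> M x"] by simp
    qed
  qed
  have meas: "\<psi> \<in> borel_measurable leb01" "\<And>K. partial_series \<psi> K \<in> borel_measurable leb01"
    using \<psi> abs_int_partial_series[of \<psi>] by (auto simp: abs_int_iff_integrable)
  have key: "(\<integral>\<^sup>+x. ennreal (norm (\<psi> x - partial_series \<psi> K x) powr p) \<partial>leb01) \<le> ennreal (t K powr p)" for K
  proof -
    have "(\<integral>\<^sup>+x. ennreal (norm (\<psi> x - partial_series \<psi> K x) powr p) \<partial>leb01)
        = (\<integral>\<^sup>+x. liminf (\<lambda>M. ennreal (norm (partial_series \<psi> M x - partial_series \<psi> K x) powr p)) \<partial>leb01)"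
    proof (rule nn_integral_cong_AE, use AE in eventually_elim)
      case (elim x)
      have "(\<lambda>M. ennreal (norm (partial_series \<psi> M x - partial_series \<psi> K x) powr p))
          \<longlonglongrightarrow> ennreal (norm (\<psi> x - partial_series \<psi> K x) powr p)"
        using p by (intro tendsto_ennrealI tendsto_powr' tendsto_norm tendsto_diff elim tendsto_const) auto
      then show ?case using lim_imp_Liminf[OF sequentially_bot] by metis
    qed
    also have "\<dots> \<le> liminf (\<lambda>M. \<integral>\<^sup>+x. ennreal (norm (partial_series \<psi> M x - partial_series \<psi> K x) powr p) \<partial>leb01)"
      using meas by (intro nn_integral_liminf) measurable
    also have "\<dots> \<le> ennreal (t K powr p)"
    proof (rule Liminf_le[OF sequentially_bot], rule eventually_sequentiallyI[of "Suc K"])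
      fix M assume M: "Suc K \<le> M"
      \<comment> \<open>All summands from K to \<open>M - 1\<close> are constant on the cells of
        generation \<open>M - 1\<close>, so the difference of the partial sums is a single step
        function there.\<close>
      define m where "m = M - 1"
      define w where "w = (\<lambda>j. \<Sum>k\<in>{K..<M}. davg k (j div 2 ^ (m - k)) \<psi>)"
      have eq: "partial_series \<psi> M x - partial_series \<psi> K x = step m w x" if x: "x \<in> {0..1}" for x
      proof -
        have "partial_series \<psi> M x - partial_series \<psi> K x = (\<Sum>k\<in>{K..<M}. step k (\<lambda>j. davg k j \<psi>) x)"
          using M sum_diff_nat_ivl[of 0 K M "\<lambda>k. step k (\<lambda>j. davg k j \<psi>) x"]
          by (simp add: partial_series_def atLeast0LessThan)
        also have "\<dots> = (\<Sum>k\<in>{K..<M}. davg k (dyadic_index m x div 2 ^ (m - k)) \<psi>)"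
        proof (intro sum.cong refl)
          fix k assume "k \<in> {K..<M}"
          then have "k \<le> m" using M by (auto simp: m_def)
          then show "step k (\<lambda>j. davg k j \<psi>) x = davg k (dyadic_index m x div 2 ^ (m - k)) \<psi>"
            by (simp add: step_eq[OF x] dyadic_index_div[OF x])
        qed
        also have "\<dots> = step m w x" by (simp add: step_eq[OF x] w_def)
        finally show ?thesis .
      qed
      have "(\<integral>\<^sup>+x. ennreal (norm (partial_series \<psi> M x - partial_series \<psi> K x) powr p) \<partial>leb01)
          = (\<integral>\<^sup>+x. ennreal (norm (step m w x) powr p) \<partial>leb01)"
        by (intro nn_integral_cong) (simp add: eq)
      also have "\<dots> = ennreal (en p m w powr p)" by (rule nn_integral_step[OF p])
      finally have step_int: "(\<integral>\<^sup>+x. ennreal (norm (partial_series \<psi> M x - partial_series \<psi> K x) powr p) \<partial>leb01)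
          = ennreal (en p m w powr p)" .
      have "en p m w \<le> (\<Sum>k\<in>{K..<M}. en p m (\<lambda>j. davg k (j div 2 ^ (m - k)) \<psi>))"
        unfolding w_def by (rule en_sum[OF p])
      also have "\<dots> = (\<Sum>k\<in>{K..<M}. u k)"
        unfolding u_def using M
        by (intro sum.cong refl en_div_power[OF p, where v = "\<lambda>j. davg _ j \<psi>"]) (auto simp: m_def)
      also have "\<dots> \<le> t K" by (rule tail)
      finally have "en p m w powr p \<le> t K powr p"
        using p by (intro powr_mono2) (auto simp: en_nonneg)
      then show "(\<integral>\<^sup>+x. ennreal (norm (partial_series \<psi> M x - partial_series \<psi> K x) powr p) \<partial>leb01)
          \<le> ennreal (t K powr p)"
        unfolding step_int by (rule ennreal_leI)
    qed
    finally show ?thesis .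
  qed
  have diff_meas: "(\<lambda>x. \<psi> x - partial_series \<psi> K x) \<in> borel_measurable leb01" for K
    using meas by measurable
  have "(\<lambda>x. \<psi> x - partial_series \<psi> 0 x) \<in> Lp_space leb01 p"
    by (rule Lp_norm_le(1)[OF p diff_meas t0 key])
  then show "\<psi> \<in> Lp_space leb01 p" by (simp add: partial_series_def)
  have "Lp_norm leb01 p (\<lambda>x. \<psi> x - partial_series \<psi> K x) \<le> t K" for K
    by (rule Lp_norm_le(2)[OF p diff_meas t0 key])
  from this[of 0] show "Lp_norm leb01 p \<psi> \<le> (\<Sum>k. en p k (\<lambda>j. davg k j \<psi>))"
    by (simp add: partial_series_def t_def u_def)
  have "Lp_norm leb01 p (\<lambda>x. \<psi> x - partial_series \<psi> K x) \<le> t K" for K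
    by (rule Lp_norm_le(2)[OF p diff_meas t0 key])
  then show "(\<lambda>K. Lp_norm leb01 p (\<lambda>x. \<psi> x - partial_series \<psi> K x)) \<longlonglongrightarrow> 0"
    by (intro tendsto_sandwich[OF _ _ tendsto_const tlim]) (auto simp: Lp_norm_def)
qed

text \<open>Converts convergence in \<open>L\<^sup>p\<close> into convergence in \<open>L\<^sup>1\<close> without Hoelder's inequality.\<close>

lemma young_norm_le:
  fixes a d p :: real
  assumes "p \<ge> 1" "0 < d" "0 \<le> a"
  shows "a \<le> d + d powr (1 - p) * a powr p"
proof (cases "a \<le> d")
  case True
  then show ?thesis by (simp add: add_increasing2)
next
  case False
  then have "a = a powr (1 - p) * a powr p" using assms by (simp add: powr_add[symmetric])
  also have "\<dots> \<le> d powr (1 - p) * a powr p"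
    using False assms by (intro mult_right_mono powr_mono2') auto
  finally show ?thesis using assms by simp
qed

lemma Lp_space_abs_int:
  assumes p: "p \<ge> 1" and u: "u \<in> Lp_space leb01 p"
  shows "u absolutely_integrable_on {0..1}"
    and "0 < d \<Longrightarrow> integral {0..1} (\<lambda>x. norm (u x)) \<le> d + d powr (1 - p) * Lp_norm leb01 p u powr p"
proof -
  have i: "integrable leb01 (\<lambda>x. norm (u x) powr p)" and m: "u \<in> borel_measurable leb01"
    using u by (auto simp: Lp_space_def)
  have fin: "integrable leb01 (\<lambda>x. c::real)" for c
  proof -
    have "(\<lambda>x::real. c) absolutely_integrable_on {0..1}"
      by (intro absolutely_integrable_continuous_real continuous_intros)
    then show ?thesis by (simp add: abs_int_iff_integrable)
  qed
  have iu: "integrable leb01 u"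
  proof (rule Bochner_Integration.integrable_bound)
    show "integrable leb01 (\<lambda>x. 1 + norm (u x) powr p)" using i fin by auto
    show "AE x in leb01. norm (u x) \<le> norm (1 + norm (u x) powr p)"
      using young_norm_le[OF p, of 1] by (intro AE_I2) simp
  qed (rule m)
  then show ai: "u absolutely_integrable_on {0..1}" by (simp add: abs_int_iff_integrable)
  assume d: "0 < d"
  have "(\<lambda>x. norm (u x)) absolutely_integrable_on {0..1}" using absolutely_integrable_norm[OF ai] by (simp add: comp_def)
  then have "integral {0..1} (\<lambda>x. norm (u x)) = (LINT x|leb01. norm (u x))" by (simp add: integral_leb01)
  also have "\<dots> \<le> (LINT x|leb01. d + d powr (1 - p) * norm (u x) powr p)"
    using iu i fin young_norm_le[OF p d] by (intro integral_mono) auto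
  also have "\<dots> = d + d powr (1 - p) * (LINT x|leb01. norm (u x) powr p)"
    using i fin by (simp add: measure_restrict_space)
  also have "(LINT x|leb01. norm (u x) powr p) = Lp_norm leb01 p u powr p"
    using p by (simp add: Lp_norm_def powr_powr)
  finally show "integral {0..1} (\<lambda>x. norm (u x)) \<le> d + d powr (1 - p) * Lp_norm leb01 p u powr p" .
qed

lemma Lp_space_diff_step:
  assumes p: "p \<ge> 1" and u: "u \<in> Lp_space leb01 p" and S: "S \<in> borel_measurable leb01"
    and B: "\<And>x. x \<in> {0..1} \<Longrightarrow> norm (S x) \<le> B"
  shows "(\<lambda>x. u x - S x) \<in> Lp_space leb01 p"
proof -
  have i: "integrable leb01 (\<lambda>x. norm (u x) powr p)" and m: "u \<in> borel_measurable leb01"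
    using u by (auto simp: Lp_space_def)
  have "(\<lambda>x::real. B powr p) absolutely_integrable_on {0..1}"
    by (intro absolutely_integrable_continuous_real continuous_intros)
  then have fin: "integrable leb01 (\<lambda>x. B powr p)" by (simp add: abs_int_iff_integrable)
  have "integrable leb01 (\<lambda>x. norm (u x - S x) powr p)"
  proof (rule Bochner_Integration.integrable_bound)
    show "integrable leb01 (\<lambda>x. 2 powr (p - 1) * (norm (u x) powr p + B powr p))" using i fin by auto
    show "AE x in leb01. norm (norm (u x - S x) powr p) \<le> norm (2 powr (p - 1) * (norm (u x) powr p + B powr p))"
    proof (intro AE_I2)
      fix x assume "x \<in> space leb01"
      then have x: "norm (S x) \<le> B" using B by simp
      have "norm (u x - S x) powr p \<le> (norm (u x) + B) powr p"
        using p x norm_triangle_ineq4[of "u x" "S x"] by (intro powr_mono2) auto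
      also have "\<dots> \<le> 2 powr (p - 1) * (norm (u x) powr p + B powr p)"
        using powr_sum_le[of "{0, 1::nat}" p "\<lambda>i. if i = 0 then norm (u x) else B"] p
          order_trans[OF norm_ge_zero x] by simp
      finally show "norm (norm (u x - S x) powr p) \<le> norm (2 powr (p - 1) * (norm (u x) powr p + B powr p))"
        by simp
    qed
    show "(\<lambda>x. norm (u x - S x) powr p) \<in> borel_measurable leb01"
      using m S by measurable
  qed
  then show ?thesis using m S by (auto simp: Lp_space_def)
qed

section \<open>Martingale description of the Besov space\<close>

text \<open>Contribution of level k to the martingale norm: the \<open>L^p\<close> norm of the k-th
  difference with the smoothness weight \<open>2^(ks)\<close>.\<close>

definition bl :: "real \<Rightarrow> real \<Rightarrow> (real \<Rightarrow> complex) \<Rightarrow> nat \<Rightarrow> real" where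
  "bl s p \<psi> k = 2 powr (real k * s) * en p k (\<lambda>j. davg k j \<psi>)"

lemma bl_nonneg: "0 \<le> bl s p \<psi> k"
  by (simp add: bl_def en_nonneg)

lemma besov_series_eq:
  "besov_series s p c K x = (\<Sum>k<K. step k (\<lambda>j. complex_of_real (2 powr (- (real k * (s - 1 / p)))) * c k j) x)"
proof -
  have "(1 / 2 ^ k :: real) powr (s - 1 / p) = 2 powr (- (real k * (s - 1 / p)))" for k :: nat
    by (simp add: powr_divide powr_minus_divide powr_realpow[symmetric] powr_powr)
  then have "c k j * atom s p (dyadic k j) x
      = complex_of_real (2 powr (- (real k * (s - 1 / p)))) * c k j * indicator (dyadic k j) x"
    if "j < 2 ^ k" for k j
    using measure_dyadic[OF that] by (simp add: atom_def of_real_indicator)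
  then show ?thesis unfolding besov_series_def step_def by (intro sum.cong refl) auto
qed

text \<open>The three powers of 2, from the smoothness weight, the height of the atoms and the
  measure of a cell, cancel exactly.\<close>

lemma en_level_norm:
  assumes "p \<ge> 1"
  shows "2 powr (real k * s) * en p k (\<lambda>j. complex_of_real (2 powr (- (real k * (s - 1 / p)))) * c k j) = level_norm p c k"
proof -
  have "2 powr (real k * s) * en p k (\<lambda>j. complex_of_real (2 powr (- (real k * (s - 1 / p)))) * c k j)
      = 2 powr (real k * s) * (2 powr (- (real k * (s - 1 / p))) * en p k (c k))"
    by (simp only: en_cmult[OF assms] norm_of_real) simp
  also have "\<dots> = (2 powr (real k * s) * 2 powr (- (real k * (s - 1 / p))) * 2 powr (- (real k / p))) * level_norm p c k"
    by (simp add: en_def level_norm_def lpn_def)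
  also have "2 powr (real k * s) * 2 powr (- (real k * (s - 1 / p))) * 2 powr (- (real k / p)) = (1::real)"
    by (simp add: powr_add[symmetric] algebra_simps)
  finally show ?thesis by simp
qed

lemma en_le_const:
  assumes "p \<ge> 1" "0 \<le> C" "\<And>j. j < 2 ^ k \<Longrightarrow> norm (w j) \<le> C"
  shows "en p k w \<le> C"
proof -
  have "(\<Sum>j<2 ^ k. norm (w j) powr p) \<le> (\<Sum>j<(2::nat) ^ k. C powr p)"
    using assms by (intro sum_mono powr_mono2) auto
  then show ?thesis using assms by (simp add: en_le_iff field_simps)
qed

lemma bl_add:
  assumes "p \<ge> 1" "\<phi> absolutely_integrable_on {0..1}" "\<psi> absolutely_integrable_on {0..1}"
  shows "bl s p (\<lambda>x. \<phi> x + \<psi> x) k \<le> bl s p \<phi> k + bl s p \<psi> k"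
proof -
  have "en p k (\<lambda>j. davg k j (\<lambda>x. \<phi> x + \<psi> x)) = en p k (\<lambda>j. davg k j \<phi> + davg k j \<psi>)"
    using assms by (intro en_cong) (simp add: davg_add)
  then show ?thesis using en_triangle[OF assms(1)]
    by (simp add: bl_def distrib_left[symmetric])
qed

lemma bl_cmult: "p \<ge> 1 \<Longrightarrow> bl s p (\<lambda>x. c * \<psi> x) k = norm c * bl s p \<psi> k"
  by (simp add: bl_def davg_cmult en_cmult)

text \<open>A fixed level is continuous in \<open>L^1\<close>, with an error that depends on k; this
  is the form in which \<open>lqb_schur\<close> takes its hypothesis.\<close>

lemma bl_limit_le:
  assumes p: "p \<ge> 1" and \<psi>: "\<psi> absolutely_integrable_on {0..1}"
    and S: "\<And>K. S K absolutely_integrable_on {0..1}"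
    and lim: "(\<lambda>K. integral {0..1} (\<lambda>x. norm (\<psi> x - S K x))) \<longlonglongrightarrow> 0"
  obtains e where "e \<longlonglongrightarrow> 0" "\<And>K. bl s p \<psi> k \<le> bl s p (S K) k + e K"
proof
  define e where "e = (\<lambda>K. 2 powr (real k * s) * (2 * 2 ^ k * integral {0..1} (\<lambda>x. norm (\<psi> x - S K x))))"
  have "e \<longlonglongrightarrow> 2 powr (real k * s) * (2 * 2 ^ k * 0)"
    unfolding e_def by (intro tendsto_mult tendsto_const lim)
  then show "e \<longlonglongrightarrow> 0" by simp
  fix K
  have d: "(\<lambda>x. \<psi> x - S K x) absolutely_integrable_on {0..1}"
    using \<psi> S by (rule set_integral_diff(1))
  then have dn: "(\<lambda>x. norm (\<psi> x - S K x)) absolutely_integrable_on {0..1}"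
    using absolutely_integrable_norm[OF d] by (simp add: comp_def)
  have "bl s p (\<lambda>x. S K x + (\<psi> x - S K x)) k \<le> bl s p (S K) k + bl s p (\<lambda>x. \<psi> x - S K x) k"
    by (rule bl_add[OF p S d])
  moreover have "bl s p (\<lambda>x. \<psi> x - S K x) k \<le> e K"
    unfolding bl_def e_def using dn
    by (intro mult_left_mono en_le_const[OF p] norm_davg_le[OF d])
      (auto simp: absolutely_integrable_on_def intro!: integral_nonneg mult_nonneg_nonneg)
  ultimately show "bl s p \<psi> k \<le> bl s p (S K) k + e K" by simp
qed

lemma bl_sum_le:
  assumes p: "p \<ge> 1" and "finite I" and S: "\<And>i. i \<in> I \<Longrightarrow> S i absolutely_integrable_on {0..1}"
  shows "bl s p (\<lambda>x. \<Sum>i\<in>I. S i x) k \<le> (\<Sum>i\<in>I. bl s p (S i) k)"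
proof -
  have "en p k (\<lambda>j. davg k j (\<lambda>x. \<Sum>i\<in>I. S i x)) = en p k (\<lambda>j. \<Sum>i\<in>I. davg k j (S i))"
    using assms by (intro en_cong) (simp add: davg_sum)
  then show ?thesis using en_sum[OF p, of k "\<lambda>i j. davg k j (S i)" I]
    by (simp add: bl_def sum_distrib_left[symmetric])
qed

lemma Lp_tendsto_L1:
  assumes p: "p \<ge> 1" and u: "\<And>K. u K \<in> Lp_space leb01 p" and lim: "(\<lambda>K. Lp_norm leb01 p (u K)) \<longlonglongrightarrow> 0"
  shows "(\<lambda>K. integral {0..1} (\<lambda>x. norm (u K x))) \<longlonglongrightarrow> 0"
proof (rule LIMSEQ_I)
  fix e :: real assume e: "e > 0"
  define d where "d = e / 2"
  have d: "d > 0" using e by (simp add: d_def)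
  have "(\<lambda>K. d powr (1 - p) * Lp_norm leb01 p (u K) powr p) \<longlonglongrightarrow> d powr (1 - p) * 0 powr p"
    using p by (intro tendsto_mult tendsto_const tendsto_powr' lim) (auto simp: Lp_norm_def)
  then have "(\<lambda>K. d powr (1 - p) * Lp_norm leb01 p (u K) powr p) \<longlonglongrightarrow> 0" using p by simp
  then obtain N where N: "\<And>K. K \<ge> N \<Longrightarrow> norm (d powr (1 - p) * Lp_norm leb01 p (u K) powr p) < d"
    using LIMSEQ_D[OF _ d] by fastforce
  have "norm (integral {0..1} (\<lambda>x. norm (u K x)) - 0) < e" if "K \<ge> N" for K
  proof -
    have "(\<lambda>x. norm (u K x)) integrable_on {0..1}"
      using Lp_space_abs_int(1)[OF p u] by (simp add: absolutely_integrable_on_def)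
    then have "0 \<le> integral {0..1} (\<lambda>x. norm (u K x))" by (intro integral_nonneg) auto
    moreover have "integral {0..1} (\<lambda>x. norm (u K x)) \<le> d + d powr (1 - p) * Lp_norm leb01 p (u K) powr p"
      by (rule Lp_space_abs_int(2)[OF p u d])
    ultimately show ?thesis using N[OF that] by (simp add: d_def)
  qed
  then show "\<exists>no. \<forall>n\<ge>no. norm (integral {0..1} (\<lambda>x. norm (u n x)) - 0) < e" by blast
qed

lemma norm_step_le: "x \<in> {0..1} \<Longrightarrow> norm (step k v x) \<le> (\<Sum>j<2 ^ k. norm (v j))"
  using dyadic_index_less[of k x] by (auto simp: step_eq intro!: member_le_sum[where f = "\<lambda>j. norm (v j)"])

context
  fixes s p :: real and q :: ennreal
  assumes p: "p \<ge> 1" and s: "s > 0" and q: "q \<ge> 1"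
begin

definition cn :: "(real \<Rightarrow> complex) \<Rightarrow> real" where
  "cn \<psi> = lq_norm q (bl s p \<psi>)"

definition canonical_coeff :: "(real \<Rightarrow> complex) \<Rightarrow> nat \<Rightarrow> nat \<Rightarrow> complex" where
  "canonical_coeff \<psi> k j = complex_of_real (2 powr (real k * (s - 1 / p))) * davg k j \<psi>"

lemma canonical_series: "besov_series s p (canonical_coeff \<psi>) K x = partial_series \<psi> K x"
proof -
  have "complex_of_real (2 powr (- (real k * (s - 1 / p)))) * complex_of_real (2 powr (real k * (s - 1 / p))) = 1" for k
    unfolding of_real_mult[symmetric] powr_add[symmetric] by simp
  then have "complex_of_real (2 powr (- (real k * (s - 1 / p)))) * canonical_coeff \<psi> k j = davg k j \<psi>" for k j
    unfolding canonical_coeff_def mult.assoc[symmetric] by simp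
  then show ?thesis by (simp add: besov_series_eq partial_series_def)
qed

lemma level_norm_canonical: "level_norm p (canonical_coeff \<psi>) k = bl s p \<psi> k"
proof -
  have "complex_of_real (2 powr (- (real k * (s - 1 / p)))) * complex_of_real (2 powr (real k * (s - 1 / p))) = 1"
    unfolding of_real_mult[symmetric] powr_add[symmetric] by simp
  then have "complex_of_real (2 powr (- (real k * (s - 1 / p)))) * canonical_coeff \<psi> k j = davg k j \<psi>" for j
    unfolding canonical_coeff_def mult.assoc[symmetric] by simp
  then show ?thesis using en_level_norm[OF p, of k s "canonical_coeff \<psi>"] by (simp add: bl_def)
qed

lemma summable_weighted:
  assumes b: "lqb q b B" "\<And>k. 0 \<le> b k"
  shows "summable (\<lambda>k. 2 powr (- (real k * s)) * b k)"
proof (rule summable_comparison_test)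
  show "\<exists>N. \<forall>n\<ge>N. norm (2 powr (- (real n * s)) * b n) \<le> (2 powr (-s)) ^ n * B"
    using lqb_component[OF q b] b(2)
    by (auto simp: powr_realpow[symmetric] powr_powr mult.commute intro!: mult_left_mono)
  show "summable (\<lambda>n. (2 powr (-s)) ^ n * B)"
    using s by (intro summable_mult2 summable_geometric) (auto simp: powr_less_one)
qed

lemma canonical_rep:
  assumes \<psi>: "\<psi> absolutely_integrable_on {0..1}" and fin: "lq_finite q (bl s p \<psi>)"
  shows "\<psi> \<in> Lp_space leb01 p" "besov_rep s p q \<psi> (canonical_coeff \<psi>)"
proof -
  have "summable (\<lambda>k. 2 powr (- (real k * s)) * bl s p \<psi> k)"
    using summable_weighted[OF lqb_lq_norm[OF q bl_nonneg fin]] bl_nonneg by blast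
  also have "(\<lambda>k. 2 powr (- (real k * s)) * bl s p \<psi> k) = (\<lambda>k. en p k (\<lambda>j. davg k j \<psi>))"
    by (simp add: bl_def mult.assoc[symmetric] powr_add[symmetric])
  finally have sm: "summable (\<lambda>k. en p k (\<lambda>j. davg k j \<psi>))" .
  show "\<psi> \<in> Lp_space leb01 p" by (rule partial_series_Lp(1)[OF p \<psi> sm])
  have "level_norm p (canonical_coeff \<psi>) = bl s p \<psi>" by (rule ext) (rule level_norm_canonical)
  then show "besov_rep s p q \<psi> (canonical_coeff \<psi>)"
    using partial_series_Lp(2)[OF p \<psi> sm] fin by (simp add: besov_rep_def canonical_series)
qed

text \<open>Schur bound of the kernel in \<open>rep_bound\<close>: 2 from
  \<open>en_davg_step_le\<close>, times the two-sided geometric sum with ratio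
  \<open>2^-s\<close>.\<close>

definition equiv_const :: real where
  "equiv_const = 2 * (2 / (1 - 2 powr (- s)))"

lemma equiv_const_pos: "equiv_const > 0"
  using s by (simp add: equiv_const_def powr_less_one)

text \<open>An atom layer of level m has no martingale differences on levels finer than m. On a
  coarser level k its difference is controlled by its \<open>L^p\<close> norm, and the smoothness
  weights turn this into the decay \<open>2^-((m - k)s)\<close>. The Schur test thus compares an
  arbitrary representation with the canonical one.\<close>

lemma rep_bound:
  assumes \<psi>: "\<psi> \<in> Lp_space leb01 p" and rep: "besov_rep s p q \<psi> c"
  shows "lqb q (bl s p \<psi>) (equiv_const * lq_norm q (level_norm p c))"
proof -
  define r where "r = 2 powr (- s)"
  have r: "0 < r" "r < 1" using s by (auto simp: r_def powr_less_one)
  define v where "v = (\<lambda>m j. complex_of_real (2 powr (- (real m * (s - 1 / p)))) * c m j)"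
  define S where "S = (\<lambda>K x. \<Sum>m<K. step m (v m) x)"
  define A where "A = (\<lambda>k m. if k \<le> m then 2 * r ^ (m - k) else 0 :: real)"
  have Seq: "besov_series s p c K = S K" for K
    by (rule ext) (simp add: besov_series_eq S_def v_def)
  have Sai: "S K absolutely_integrable_on {0..1}" for K
    unfolding S_def by (intro absolutely_integrable_sum) (auto intro: abs_int_step)
  have bn: "0 \<le> level_norm p c m" for m by (simp add: level_norm_def)
  have lqb: "lqb q (level_norm p c) (lq_norm q (level_norm p c))"
    using rep lqb_lq_norm[OF q bn] by (simp add: besov_rep_def)
  have Lp: "(\<lambda>x. \<psi> x - S K x) \<in> Lp_space leb01 p" for K
  proof (rule Lp_space_diff_step[OF p \<psi>, where B = "\<Sum>m<K. \<Sum>j<2 ^ m. norm (v m j)"])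
    show "S K \<in> borel_measurable leb01" using Sai by (auto simp: abs_int_iff_integrable)
    fix x :: real assume x: "x \<in> {0..1}"
    show "norm (S K x) \<le> (\<Sum>m<K. \<Sum>j<2 ^ m. norm (v m j))"
      unfolding S_def using norm_step_le[OF x] by (intro order_trans[OF norm_sum] sum_mono)
  qed
  have lim: "(\<lambda>K. integral {0..1} (\<lambda>x. norm (\<psi> x - S K x))) \<longlonglongrightarrow> 0"
    using rep by (intro Lp_tendsto_L1[OF p Lp]) (simp add: besov_rep_def Seq)
  have Ale: "A k m \<le> 2 * r ^ nat \<bar>int m - int k\<bar>" for k m
    using r by (auto simp: A_def nat_diff_distrib)
  have "(\<Sum>m<J. A k m) \<le> equiv_const" for k J
  proof -
    have "(\<Sum>m<J. A k m) \<le> 2 * (\<Sum>m<J. r ^ nat \<bar>int m - int k\<bar>)"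
      unfolding sum_distrib_left by (intro sum_mono Ale)
    also have "\<dots> \<le> equiv_const"
      unfolding equiv_const_def r_def[symmetric]
      using r by (intro mult_left_mono sum_geometric_shift_le) (auto simp: inj_on_def)
    finally show ?thesis .
  qed
  moreover have "(\<Sum>k<K. A k m) \<le> equiv_const" for m K
  proof -
    have "(\<Sum>k<K. A k m) \<le> 2 * (\<Sum>k<K. r ^ nat \<bar>int m - int k\<bar>)"
      unfolding sum_distrib_left by (intro sum_mono Ale)
    also have "\<dots> \<le> equiv_const"
      unfolding equiv_const_def r_def[symmetric]
      using r by (intro mult_left_mono sum_geometric_shift_le) (auto simp: inj_on_def)
    finally show ?thesis .
  qed
  moreover have "bl s p (step m (v m)) k \<le> A k m * level_norm p c m" for k m
  proof (cases "k \<le> m")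
    case True
    have "bl s p (step m (v m)) k \<le> 2 powr (real k * s) * (2 * en p m (v m))"
      unfolding bl_def by (intro mult_left_mono en_davg_step_le p) auto
    also have "\<dots> = 2 * (2 powr (real k * s) * 2 powr (- (real m * s))) * (2 powr (real m * s) * en p m (v m))"
      by (simp add: mult.assoc[symmetric] powr_minus)
    also have "2 powr (real m * s) * en p m (v m) = level_norm p c m"
      unfolding v_def by (rule en_level_norm[OF p])
    also have "2 powr (real k * s) * 2 powr (- (real m * s)) = r ^ (m - k)"
      using True by (simp add: r_def powr_realpow[symmetric] powr_powr powr_add[symmetric] of_nat_diff algebra_simps)
    finally show ?thesis using True by (simp add: A_def)
  next
    case False
    have "en p k (\<lambda>j. davg k j (step m (v m))) = en p k (\<lambda>j. 0 :: complex)"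
      using False by (intro en_cong) (simp add: davg_step_0)
    then show ?thesis using False by (simp add: bl_def A_def en_def lpn_zero)
  qed
  then have "bl s p (S K) k \<le> (\<Sum>m<K. A k m * level_norm p c m)" for K k
    unfolding S_def by (intro order_trans[OF bl_sum_le[OF p]] sum_mono) (auto intro: abs_int_step)
  moreover have "\<exists>e. e \<longlonglongrightarrow> 0 \<and> (\<forall>J. bl s p \<psi> k \<le> bl s p (S J) k + e J)" for k
    using bl_limit_le[OF p Lp_space_abs_int(1)[OF p \<psi>] Sai lim] by metis
  ultimately have "\<exists>e. e \<longlonglongrightarrow> 0 \<and> (\<forall>J. bl s p \<psi> k \<le> (\<Sum>m<J. A k m * level_norm p c m) + e J)" for k
    by (meson add_right_mono order_trans)
  then show ?thesis
    using \<open>\<And>k J. (\<Sum>m<J. A k m) \<le> equiv_const\<close> \<open>\<And>m K. (\<Sum>k<K. A k m) \<le> equiv_const\<close> r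
    by (intro lqb_schur[OF q lqb bn, where A = A]) (auto simp: A_def bl_nonneg)
qed

lemma besov_space_eq:
  "besov_space s p q = {\<psi>. \<psi> absolutely_integrable_on {0..1} \<and> lq_finite q (bl s p \<psi>)}"
proof (intro set_eqI iffI)
  fix \<psi> assume "\<psi> \<in> besov_space s p q"
  then obtain c where c: "\<psi> \<in> Lp_space leb01 p" "besov_rep s p q \<psi> c" by (auto simp: besov_space_def)
  have "lq_finite q (bl s p \<psi>)"
    using rep_bound[OF c] lq_finite_iff[OF q, of "bl s p \<psi>"] bl_nonneg by blast
  then show "\<psi> \<in> {\<psi>. \<psi> absolutely_integrable_on {0..1} \<and> lq_finite q (bl s p \<psi>)}"
    using Lp_space_abs_int(1)[OF p c(1)] by simp
next
  fix \<psi> assume "\<psi> \<in> {\<psi>. \<psi> absolutely_integrable_on {0..1} \<and> lq_finite q (bl s p \<psi>)}"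
  then have \<psi>: "\<psi> absolutely_integrable_on {0..1}" "lq_finite q (bl s p \<psi>)" by auto
  show "\<psi> \<in> besov_space s p q"
    unfolding besov_space_def using canonical_rep[OF \<psi>] by auto
qed

lemma lq_norm_level_nonneg: "besov_rep s p q \<psi> c \<Longrightarrow> 0 \<le> lq_norm q (level_norm p c)"
  by (rule lq_norm_nonneg[OF q]) (auto simp: besov_rep_def level_norm_def)

lemma besov_norm_le: "\<psi> \<in> besov_space s p q \<Longrightarrow> besov_norm s p q \<psi> \<le> cn \<psi>"
proof -
  assume "\<psi> \<in> besov_space s p q"
  then have "besov_rep s p q \<psi> (canonical_coeff \<psi>)" using canonical_rep(2) besov_space_eq by auto
  then have "besov_norm s p q \<psi> \<le> lq_norm q (level_norm p (canonical_coeff \<psi>))"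
    unfolding besov_norm_def using lq_norm_level_nonneg by (intro cInf_lower bdd_belowI[of _ 0]) auto
  also have "level_norm p (canonical_coeff \<psi>) = bl s p \<psi>" by (rule ext) (rule level_norm_canonical)
  finally show ?thesis by (simp add: cn_def)
qed

lemma cn_le:
  assumes "\<psi> \<in> besov_space s p q"
  shows "cn \<psi> \<le> equiv_const * besov_norm s p q \<psi>"
proof -
  have \<psi>: "\<psi> \<in> Lp_space leb01 p" and ex: "\<exists>c. besov_rep s p q \<psi> c"
    using assms by (auto simp: besov_space_def)
  have "cn \<psi> / equiv_const \<le> besov_norm s p q \<psi>"
    unfolding besov_norm_def
  proof (rule cInf_greatest)
    fix y assume "y \<in> {lq_norm q (level_norm p c) |c. besov_rep s p q \<psi> c}"
    then obtain c where c: "besov_rep s p q \<psi> c" "y = lq_norm q (level_norm p c)" by blast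
    have "cn \<psi> \<le> equiv_const * y"
      unfolding cn_def c(2) by (rule lq_norm_le[OF q bl_nonneg rep_bound[OF \<psi> c(1)]])
    then show "cn \<psi> / equiv_const \<le> y" using equiv_const_pos by (simp add: field_simps)
  qed (use ex in auto)
  then show ?thesis using equiv_const_pos by (simp add: field_simps)
qed

end

section \<open>Branches with comparable contraction\<close>

lemma card_le_nat_diff:
  fixes S :: "nat set" and M :: real
  assumes "finite S" "\<And>a b. a \<in> S \<Longrightarrow> b \<in> S \<Longrightarrow> \<bar>real a - real b\<bar> \<le> M" "0 \<le> M"
  shows "real (card S) \<le> M + 1"
proof (cases "S = {}")
  case False
  have "S \<subseteq> {Min S..Max S}" using assms(1) by auto
  then have "card S \<le> Suc (Max S) - Min S" using card_mono[of "{Min S..Max S}" S] by simp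
  moreover have "Min S \<le> Max S" using False assms(1) by simp
  ultimately have "real (card S) \<le> real (Max S) - real (Min S) + 1" by linarith
  moreover have "real (Max S) - real (Min S) \<le> M" using assms(2)[of "Max S" "Min S"] False assms(1) by simp
  ultimately show ?thesis by linarith
qed (use assms in auto)

lemma dyadic_index_diff:
  assumes "x \<in> {0..1}" "y \<in> {0..1}"
  shows "\<bar>real (dyadic_index j x) - real (dyadic_index j y)\<bar> \<le> \<bar>x - y\<bar> * 2 ^ j + 1"
proof -
  have *: "real (nat \<lfloor>z * 2 ^ j\<rfloor>) \<le> z * 2 ^ j" "z * 2 ^ j < real (nat \<lfloor>z * 2 ^ j\<rfloor>) + 1" if "z \<in> {0..1}" for z :: real
    using that by auto
  have "\<bar>real (nat \<lfloor>x * 2 ^ j\<rfloor>) - real (nat \<lfloor>y * 2 ^ j\<rfloor>)\<bar> \<le> \<bar>x * 2 ^ j - y * 2 ^ j\<bar> + 1"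
    using *[OF assms(1)] *[OF assms(2)] by linarith
  also have "\<bar>x * 2 ^ j - y * 2 ^ j\<bar> = \<bar>x - y\<bar> * 2 ^ j" by (simp add: left_diff_distrib[symmetric] abs_mult)
  finally show ?thesis unfolding dyadic_index_def by linarith
qed

lemma sum_avg:
  fixes \<psi> :: "real \<Rightarrow> real"
  assumes "\<psi> absolutely_integrable_on {0..1}"
  shows "(\<Sum>l<2 ^ k. avg k l \<psi>) = 2 ^ k * integral {0..1} \<psi>"
proof (induction k)
  case (Suc k)
  have "(\<Sum>l<2 ^ Suc k. avg (Suc k) l \<psi>) = (\<Sum>l<2 ^ k. avg (Suc k) (2 * l) \<psi> + avg (Suc k) (Suc (2 * l)) \<psi>)"
    by (simp add: sum_double)
  also have "\<dots> = (\<Sum>l<2 ^ k. 2 * avg k l \<psi>)"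
    using avg_children[OF assms] by (intro sum.cong) auto
  finally show ?case using Suc by (simp add: sum_distrib_left[symmetric])
qed (simp add: avg_def cell_def)

lemma dyadic_disjoint: "i < 2 ^ k \<Longrightarrow> j < 2 ^ k \<Longrightarrow> x \<in> dyadic k i \<Longrightarrow> x \<in> dyadic k j \<Longrightarrow> i = j"
  using mem_dyadic_iff dyadic_subset by (metis subsetD)

lemma dyadic_less:
  assumes "i < j" "j < 2 ^ k" "x \<in> dyadic k i" "y \<in> dyadic k j"
  shows "x < y"
proof -
  have "Suc i \<noteq> 2 ^ k" using assms by simp
  then have "x < real (Suc i) / 2 ^ k" using assms(3) by (simp add: dyadic_def)
  also have "\<dots> \<le> real j / 2 ^ k" using assms(1) by (intro divide_right_mono) auto
  also have "\<dots> \<le> y" using assms(4) dyadic_subset_cell[of k j] by (auto simp: cell_def)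
  finally show ?thesis .
qed

text \<open>Such a cell sticks out of P either on the left (\<open>L\<close>) or on the right
  (\<open>R\<close>). Two different cells of a generation are separated by order, so each kind
  occurs at most once.\<close>

lemma card_dyadic_boundary:
  assumes P: "is_interval P"
  shows "card {l. l < 2 ^ k \<and> dyadic k l \<inter> P \<noteq> {} \<and> \<not> dyadic k l \<subseteq> P} \<le> 2"
proof -
  define L where "L = {l. l < 2 ^ k \<and> (\<exists>u\<in>dyadic k l \<inter> P. \<exists>v\<in>dyadic k l. \<forall>x\<in>P. v < x)}"
  define R where "R = {l. l < 2 ^ k \<and> (\<exists>u\<in>dyadic k l \<inter> P. \<exists>v\<in>dyadic k l. \<forall>x\<in>P. x < v)}"
  have conv: "b \<in> P" if "a \<in> P" "c \<in> P" "a \<le> b" "b \<le> c" for a b c :: real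
    using P that unfolding is_interval_1 by blast
  have sub: "{l. l < 2 ^ k \<and> dyadic k l \<inter> P \<noteq> {} \<and> \<not> dyadic k l \<subseteq> P} \<subseteq> L \<union> R"
  proof
    fix l assume "l \<in> {l. l < 2 ^ k \<and> dyadic k l \<inter> P \<noteq> {} \<and> \<not> dyadic k l \<subseteq> P}"
    then obtain u v where l: "l < 2 ^ k" "u \<in> dyadic k l \<inter> P" "v \<in> dyadic k l" "v \<notin> P" by auto
    have "(\<forall>x\<in>P. v < x) \<or> (\<forall>x\<in>P. x < v)"
      using conv l(4) by (metis linorder_not_less less_eq_real_def)
    then show "l \<in> L \<union> R" using l unfolding L_def R_def by blast
  qed
  have "a = b" if "a \<in> L" "b \<in> L" for a b
    using that dyadic_less unfolding L_def by (smt (verit) Int_iff mem_Collect_eq nat_neq_iff)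
  moreover have "finite L" by (simp add: L_def)
  ultimately have L: "card L \<le> Suc 0" using card_le_Suc0_iff_eq by blast
  have "a = b" if "a \<in> R" "b \<in> R" for a b
    using that dyadic_less unfolding R_def by (smt (verit) Int_iff mem_Collect_eq nat_neq_iff)
  moreover have "finite R" by (simp add: R_def)
  ultimately have R: "card R \<le> Suc 0" using card_le_Suc0_iff_eq by blast
  have "card {l. l < 2 ^ k \<and> dyadic k l \<inter> P \<noteq> {} \<and> \<not> dyadic k l \<subseteq> P} \<le> card (L \<union> R)"
    by (rule card_mono[OF _ sub]) (auto simp: L_def R_def)
  also have "\<dots> \<le> card L + card R" by (rule card_Un_le)
  finally show ?thesis using L R by simp
qed

lemma card_dyadic_inside:
  assumes P: "P \<in> lmeasurable"
  shows "real (card {l. l < 2 ^ k \<and> dyadic k l \<subseteq> P}) \<le> 2 ^ k * measure lebesgue P"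
proof -
  define S where "S = {l. l < 2 ^ k \<and> dyadic k l \<subseteq> P}"
  have fin: "finite S" by (simp add: S_def)
  have "real (card S) / 2 ^ k = (\<Sum>l\<in>S. measure lebesgue (dyadic k l))"
    by (simp add: S_def measure_dyadic)
  also have "\<dots> = measure lebesgue (\<Union>l\<in>S. dyadic k l)"
    using fin dyadic_disjoint[of _ k]
    by (intro measure_UNION'[symmetric]) (auto simp: dyadic_lmeasurable pairwise_def disjnt_def S_def)
  also have "\<dots> \<le> measure lebesgue P"
    using fin by (intro measure_mono_fmeasurable[OF _ _ P]) (auto simp: S_def dyadic_lmeasurable fmeasurableD)
  finally show ?thesis by (simp add: S_def field_simps)
qed

text \<open>Reduces counting the sets that meet a short interval to counting those that contain one
  of two given points.\<close>

lemma long_interval_contains_endpoint: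
  assumes A: "is_interval A" and xy: "x \<in> A" "y \<in> A" "\<bar>x - y\<bar> > b - a" and z: "z \<in> A" "a \<le> z" "z \<le> b"
  shows "a \<in> A \<or> b \<in> (A::real set)"
proof -
  have conv: "v \<in> A" if "u \<in> A" "w \<in> A" "u \<le> v" "v \<le> w" for u v w :: real
    using A that unfolding is_interval_1 by blast
  have "x < a \<or> y < a \<or> b < x \<or> b < y" using xy by linarith
  then show ?thesis using conv[OF _ z(1), of x a] conv[OF _ z(1), of y a] conv[OF z(1), of x b] conv[OF z(1), of y b] xy z
    by linarith
qed

text \<open>Inverse branches of one iterate with derivatives comparable to \<open>2^-m\<close>. The
  estimates are expressed through c, N and m, where c will not depend on the iterate; \<kappa>
  decides from which level on the counting lemmas apply. \<open>disjoint\<close> says that distinct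
  branches have disjoint images, and \<open>mult\<close> bounds the preimages of a point.\<close>

locale branch_system =
  fixes W :: "'w set" and A :: "'w \<Rightarrow> real set" and h d :: "'w \<Rightarrow> real \<Rightarrow> real"
    and m N :: nat and c \<beta> \<kappa> :: real
  assumes finite_W: "finite W" and c: "1 \<le> c" and \<beta>: "0 < \<beta>"
    and A_sub: "w \<in> W \<Longrightarrow> A w \<subseteq> {0..1}" and A_int: "w \<in> W \<Longrightarrow> is_interval (A w)"
    and h_sub: "w \<in> W \<Longrightarrow> x \<in> A w \<Longrightarrow> h w x \<in> {0..1}"
    and deriv: "w \<in> W \<Longrightarrow> x \<in> A w \<Longrightarrow> (h w has_field_derivative d w x) (at x within A w)"
    and inj: "w \<in> W \<Longrightarrow> inj_on (h w) (A w)"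
    and d_le: "w \<in> W \<Longrightarrow> x \<in> A w \<Longrightarrow> \<bar>d w x\<bar> \<le> c / 2 ^ m"
    and d_ge: "w \<in> W \<Longrightarrow> x \<in> A w \<Longrightarrow> 1 / (c * 2 ^ m) \<le> \<bar>d w x\<bar>"
    and d_holder: "w \<in> W \<Longrightarrow> x \<in> A w \<Longrightarrow> y \<in> A w \<Longrightarrow>
      \<bar>\<bar>d w x\<bar> - \<bar>d w y\<bar>\<bar> \<le> c / 2 ^ m * \<bar>x - y\<bar> powr \<beta>"
    and A_long: "w \<in> W \<Longrightarrow> \<exists>x\<in>A w. \<exists>y\<in>A w. \<bar>x - y\<bar> > \<kappa>"
    and hA_long: "w \<in> W \<Longrightarrow> \<exists>x\<in>A w. \<exists>y\<in>A w. \<bar>h w x - h w y\<bar> > \<kappa>"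
    and disjoint: "w \<in> W \<Longrightarrow> w' \<in> W \<Longrightarrow> x \<in> A w \<Longrightarrow> y \<in> A w' \<Longrightarrow> h w x = h w' y \<Longrightarrow> w = w'"
    and mult: "card {w \<in> W. x \<in> A w} \<le> N"
begin

definition piece :: "nat \<Rightarrow> 'w \<Rightarrow> nat \<Rightarrow> real set" where
  "piece j w i = {x \<in> A w. h w x \<in> dyadic j i}"

text \<open>Contribution of the branch w to the image of the indicator of \<open>dyadic j i\<close>.
  On step functions \<open>T\<close> is a finite combination of these weights, see
  \<open>T_step\<close>.\<close>

definition G :: "nat \<Rightarrow> 'w \<Rightarrow> nat \<Rightarrow> real \<Rightarrow> real" where
  "G j w i x = (if x \<in> piece j w i then \<bar>d w x\<bar> else 0)"

definition T :: "(real \<Rightarrow> complex) \<Rightarrow> real \<Rightarrow> complex" where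
  "T \<phi> x = (\<Sum>w\<in>W. if x \<in> A w then complex_of_real \<bar>d w x\<bar> * \<phi> (h w x) else 0)"

lemma h_cont: "w \<in> W \<Longrightarrow> continuous_on (A w) (h w)"
  using deriv DERIV_continuous_on by blast

lemma h_lipschitz:
  assumes "w \<in> W" "x \<in> A w" "y \<in> A w"
  shows "\<bar>h w x - h w y\<bar> \<le> c / 2 ^ m * \<bar>x - y\<bar>"
proof -
  have "norm (h w x - h w y) \<le> c / 2 ^ m * norm (x - y)"
    using assms A_int[OF assms(1)] deriv d_le
    by (intro field_differentiable_bound[where S = "A w"]) (auto simp: is_interval_convex_1)
  then show ?thesis by simp
qed

lemma piece_sub: "w \<in> W \<Longrightarrow> piece j w i \<subseteq> {0..1}"
  using A_sub by (auto simp: piece_def)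

text \<open>A continuous injection of an interval is strictly monotone, so the preimage of a dyadic
  interval has no gaps.\<close>

lemma piece_interval:
  assumes w: "w \<in> W"
  shows "is_interval (piece j w i)"
proof -
  have dy: "is_interval (dyadic j i)" by (auto simp: dyadic_def is_interval_cc is_interval_co)
  have mono: "strict_mono_on (A w) (h w) \<or> strict_antimono_on (A w) (h w)"
    using injective_eq_monotone_map[OF A_int[OF w] h_cont[OF w]] inj[OF w] by simp
  show ?thesis unfolding is_interval_1
  proof (intro ballI allI impI)
    fix a b x assume ab: "a \<in> piece j w i" "b \<in> piece j w i" and x: "a \<le> x \<and> x \<le> b"
    then have aA: "a \<in> A w" "b \<in> A w" and q: "h w a \<in> dyadic j i" "h w b \<in> dyadic j i" by (auto simp: piece_def)
    have xA: "x \<in> A w" using A_int[OF w] aA x unfolding is_interval_1 by blast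
    have "(h w a \<le> h w x \<and> h w x \<le> h w b) \<or> (h w b \<le> h w x \<and> h w x \<le> h w a)"
      using mono
    proof
      assume "strict_mono_on (A w) (h w)"
      then show ?thesis using aA xA x by (metis strict_mono_on_leD)
    next
      assume "strict_antimono_on (A w) (h w)"
      then have "u < v \<Longrightarrow> u \<in> A w \<Longrightarrow> v \<in> A w \<Longrightarrow> h w v < h w u" for u v
        by (simp add: monotone_on_def)
      then show ?thesis using aA xA x by (metis less_eq_real_def)
    qed
    then have "h w x \<in> dyadic j i" using dy q unfolding is_interval_1 by blast
    then show "x \<in> piece j w i" using xA by (simp add: piece_def)
  qed
qed

lemma interval_lmeasurable: "is_interval S \<Longrightarrow> S \<subseteq> {0..1} \<Longrightarrow> (S::real set) \<in> lmeasurable"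
  by (intro measurable_convex bounded_subset[OF bounded_closed_interval]) (auto simp: is_interval_convex_1)

lemma piece_lmeasurable: "w \<in> W \<Longrightarrow> piece j w i \<in> lmeasurable"
  using interval_lmeasurable piece_interval piece_sub by blast

lemma h_piece_interval: "w \<in> W \<Longrightarrow> is_interval (h w ` piece j w i)"
proof -
  assume w: "w \<in> W"
  have "connected (h w ` piece j w i)"
    using piece_interval[OF w, of j i] h_cont[OF w]
    by (intro connected_continuous_image continuous_on_subset[OF h_cont[OF w]])
      (auto simp: is_interval_connected_1 piece_def)
  then show ?thesis by (simp add: is_interval_connected_1)
qed

lemma h_piece_sub: "i < 2 ^ j \<Longrightarrow> h w ` piece j w i \<subseteq> dyadic j i"
  by (auto simp: piece_def)

lemma h_piece_lmeasurable: "w \<in> W \<Longrightarrow> i < 2 ^ j \<Longrightarrow> h w ` piece j w i \<in> lmeasurable"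
  using interval_lmeasurable h_piece_interval h_piece_sub dyadic_subset by (meson order_trans)

lemma G_integral:
  assumes w: "w \<in> W" and i: "i < 2 ^ j"
  shows "G j w i absolutely_integrable_on {0..1}"
    and "integral {0..1} (G j w i) = measure lebesgue (h w ` piece j w i)"
proof -
  let ?P = "piece j w i"
  have der: "\<And>x. x \<in> ?P \<Longrightarrow> (h w has_field_derivative d w x) (at x within ?P)"
    using deriv[OF w] by (auto simp: piece_def intro: has_field_derivative_subset)
  have injP: "inj_on (h w) ?P" using inj[OF w] by (rule inj_on_subset) (auto simp: piece_def)
  have P: "?P \<in> sets lebesgue" using piece_lmeasurable[OF w] by (simp add: fmeasurableD)
  have hP: "h w ` ?P \<in> lmeasurable" by (rule h_piece_lmeasurable[OF w i])
  have one: "(\<lambda>x. 1::real) absolutely_integrable_on h w ` ?P"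
    using hP by (simp add: absolutely_integrable_on_iff_nonneg lmeasurable_iff_integrable_on)
  have "integral (h w ` ?P) (\<lambda>x. 1::real) = measure lebesgue (h w ` ?P)"
    using lmeasure_integral[OF hP] by simp
  then have *: "(\<lambda>x. \<bar>d w x\<bar> *\<^sub>R (1::real)) absolutely_integrable_on ?P"
    "integral ?P (\<lambda>x. \<bar>d w x\<bar> *\<^sub>R (1::real)) = measure lebesgue (h w ` ?P)"
    using has_absolute_integral_change_of_variables_real[OF P der injP, of "\<lambda>x. 1" "measure lebesgue (h w ` ?P)"] one
    by auto
  have Geq: "G j w i = (\<lambda>x. if x \<in> ?P then \<bar>d w x\<bar> *\<^sub>R (1::real) else 0)" by (auto simp: G_def)
  have sub: "?P \<inter> {0..1} = ?P" using piece_sub[OF w] by blast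
  show "G j w i absolutely_integrable_on {0..1}"
    using *(1) absolutely_integrable_restrict_UNIV[of ?P "\<lambda>x. \<bar>d w x\<bar> *\<^sub>R (1::real)"]
      absolutely_integrable_on_subinterval[where f = "G j w i" and S = UNIV]
    unfolding Geq by simp
  show "integral {0..1} (G j w i) = measure lebesgue (h w ` ?P)"
    using *(2) integral_restrict_Int[of "{0..1}" ?P "\<lambda>x. \<bar>d w x\<bar> *\<^sub>R (1::real)"] sub
    unfolding Geq by simp
qed

lemma G_nonneg: "0 \<le> G j w i x"
  by (simp add: G_def)

lemma G_le: "w \<in> W \<Longrightarrow> G j w i x \<le> c / 2 ^ m"
  using d_le c by (auto simp: G_def piece_def)

lemma avg_G_nonneg: "w \<in> W \<Longrightarrow> i < 2 ^ j \<Longrightarrow> l < 2 ^ k \<Longrightarrow> 0 \<le> avg k l (G j w i)"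
  using avg_mono[of "\<lambda>x. 0" "G j w i" l k] G_integral(1) G_nonneg
  by (simp add: avg_const absolutely_integrable_on_def)

lemma const_abs_int: "(\<lambda>x. a::real) absolutely_integrable_on {0..1::real}"
  by (intro absolutely_integrable_continuous_real continuous_intros)

lemma sum_i_G:
  assumes w: "w \<in> W"
  shows "(\<Sum>i<2 ^ j. G j w i x) = (if x \<in> A w then \<bar>d w x\<bar> else 0)"
proof (cases "x \<in> A w")
  case True
  have "(\<Sum>i<2 ^ j. G j w i x) = (\<Sum>i<2 ^ j. if i = dyadic_index j (h w x) then \<bar>d w x\<bar> else 0)"
    using True mem_dyadic_iff[OF h_sub[OF w True]] by (intro sum.cong) (auto simp: G_def piece_def)
  then show ?thesis using True dyadic_index_less by simp
qed (simp add: G_def piece_def)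

lemma T_step:
  "T (step j v) x = (\<Sum>(w, i)\<in>W \<times> {..<2 ^ j}. v i * complex_of_real (G j w i x))"
proof -
  have "(if x \<in> A w then complex_of_real \<bar>d w x\<bar> * step j v (h w x) else 0)
      = (\<Sum>i<2 ^ j. v i * complex_of_real (G j w i x))" if w: "w \<in> W" for w
  proof (cases "x \<in> A w")
    case True
    have "(\<Sum>i<2 ^ j. v i * complex_of_real (G j w i x))
        = (\<Sum>i<2 ^ j. if i = dyadic_index j (h w x) then v i * complex_of_real \<bar>d w x\<bar> else 0)"
      using True mem_dyadic_iff[OF h_sub[OF w True]] by (intro sum.cong) (auto simp: G_def piece_def)
    then show ?thesis using True dyadic_index_less by (simp add: step_eq[OF h_sub[OF w True]])
  qed (simp add: G_def piece_def)
  then show ?thesis by (simp add: T_def sum.cartesian_product[symmetric])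
qed

lemma of_real_abs_int:
  assumes "g absolutely_integrable_on {0..1::real}"
  shows "(\<lambda>x. v * complex_of_real (g x)) absolutely_integrable_on {0..1}"
  using assms unfolding abs_int_iff_integrable by (intro integrable_mult_right integrable_of_real)

lemma abs_int_T_step: "T (step j v) absolutely_integrable_on {0..1}"
proof -
  have "T (step j v) = (\<lambda>x. \<Sum>z\<in>W \<times> {..<2 ^ j}. v (snd z) * complex_of_real (G j (fst z) (snd z) x))"
    by (rule ext) (simp add: T_step case_prod_unfold)
  then show ?thesis using finite_W G_integral(1)
    by (auto intro!: absolutely_integrable_sum of_real_abs_int)
qed

lemma avg_of_real: "avg k l (\<lambda>x. complex_of_real (g x)) = complex_of_real (avg k l g)"
  if "g integrable_on cell k l" for g :: "real \<Rightarrow> real"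
  using that integral_linear[OF that bounded_linear_of_real[where 'a = complex]]
  by (simp add: avg_def o_def scaleR_conv_of_real)

lemma avg_T_step:
  assumes "l < 2 ^ k"
  shows "avg k l (T (step j v)) = (\<Sum>(w, i)\<in>W \<times> {..<2 ^ j}. v i * complex_of_real (avg k l (G j w i)))"
proof -
  have "T (step j v) = (\<lambda>x. \<Sum>z\<in>W \<times> {..<2 ^ j}. v (snd z) * complex_of_real (G j (fst z) (snd z) x))"
    by (rule ext) (simp add: T_step case_prod_unfold)
  then have "avg k l (T (step j v)) = (\<Sum>z\<in>W \<times> {..<2 ^ j}. avg k l (\<lambda>x. v (snd z) * complex_of_real (G j (fst z) (snd z) x)))"
    using finite_W G_integral(1) assms by (auto intro!: avg_sum of_real_abs_int)
  also have "\<dots> = (\<Sum>z\<in>W \<times> {..<2 ^ j}. v (snd z) * complex_of_real (avg k l (G j (fst z) (snd z))))"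
    using int_cell[OF G_integral(1) assms] by (intro sum.cong) (auto simp: avg_cmult avg_of_real)
  finally show ?thesis by (simp add: case_prod_unfold)
qed

text \<open>Row bound of the averaging kernel: over each point at most N branches are defined, each
  with derivative at most \<open>c / 2^m\<close>.\<close>

lemma sum_avg_G_le:
  assumes l: "l < 2 ^ k"
  shows "(\<Sum>(w, i)\<in>W \<times> {..<2 ^ j}. avg k l (G j w i)) \<le> real N * (c / 2 ^ m)"
proof -
  have "(\<Sum>(w, i)\<in>W \<times> {..<2 ^ j}. avg k l (G j w i))
      = avg k l (\<lambda>x. \<Sum>z\<in>W \<times> {..<2 ^ j}. G j (fst z) (snd z) x)"
    using finite_W G_integral(1) l by (subst avg_sum) (auto simp: case_prod_unfold)
  also have "\<dots> \<le> avg k l (\<lambda>x. real N * (c / 2 ^ m))"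
  proof (rule avg_mono[OF _ const_abs_int l])
    show "(\<lambda>x. \<Sum>z\<in>W \<times> {..<2 ^ j}. G j (fst z) (snd z) x) absolutely_integrable_on {0..1}"
      using finite_W G_integral(1) by (auto intro!: absolutely_integrable_sum)
    fix x
    have "(\<Sum>z\<in>W \<times> {..<2 ^ j}. G j (fst z) (snd z) x) = (\<Sum>w\<in>W. if x \<in> A w then \<bar>d w x\<bar> else 0)"
      by (simp add: sum.cartesian_product' sum_i_G)
    also have "\<dots> \<le> (\<Sum>w\<in>W. if x \<in> A w then c / 2 ^ m else 0)"
      using d_le by (intro sum_mono) auto
    also have "\<dots> = real (card {w \<in> W. x \<in> A w}) * (c / 2 ^ m)"
      using finite_W by (simp add: sum.If_cases Int_def)
    also have "\<dots> \<le> real N * (c / 2 ^ m)"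
      using mult c by (intro mult_right_mono) auto
    finally show "(\<Sum>z\<in>W \<times> {..<2 ^ j}. G j (fst z) (snd z) x) \<le> real N * (c / 2 ^ m)" .
  qed
  finally show ?thesis by (simp add: avg_const)
qed

text \<open>Column bound of the averaging kernel: by change of variables the integrals measure
  disjoint subsets of one dyadic cell.\<close>

lemma sum_integral_G_le:
  assumes i: "i < 2 ^ j"
  shows "(\<Sum>w\<in>W. integral {0..1} (G j w i)) \<le> 1 / 2 ^ j"
proof -
  have "(\<Sum>w\<in>W. integral {0..1} (G j w i)) = (\<Sum>w\<in>W. measure lebesgue (h w ` piece j w i))"
    using i by (simp add: G_integral(2))
  also have "\<dots> = measure lebesgue (\<Union>w\<in>W. h w ` piece j w i)"
    using finite_W h_piece_lmeasurable i disjoint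
    by (intro measure_UNION'[symmetric]) (fastforce simp: pairwise_def disjnt_def piece_def)+
  also have "\<dots> \<le> measure lebesgue (dyadic j i)"
    using finite_W h_piece_lmeasurable i h_piece_sub
    by (intro measure_mono_fmeasurable[OF _ _ dyadic_lmeasurable]) (auto intro!: fmeasurableD simp: piece_def)
  finally show ?thesis using i by (simp add: measure_dyadic)
qed

text \<open>Jensen for the kernel of averages of \<open>G\<close>: the row bound enters with the
  power \<open>p - 1\<close>, the column bound with the power 1. This interpolates between the fact
  that mass does not increase, for p = 1, and the supremum bound \<open>c N / 2^m\<close>.\<close>

lemma en_avg_T_step:
  assumes p: "p \<ge> 1"
  shows "en p k (\<lambda>l. avg k l (T (step j v))) \<le> (c * real N / 2 ^ m) powr (1 - 1 / p) * en p j v"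
proof -
  let ?Z = "W \<times> {..<(2::nat) ^ j}"
  let ?a = "\<lambda>l z. avg k l (G j (fst z) (snd z))"
  have fin: "finite ?Z" using finite_W by simp
  have a0: "0 \<le> ?a l z" if "z \<in> ?Z" "l < 2 ^ k" for l z
    using that by (auto intro: avg_G_nonneg)
  define R where "R = c * real N / 2 ^ m"
  have R: "0 \<le> R" using c by (simp add: R_def)
  have "(\<Sum>l<2 ^ k. norm (avg k l (T (step j v))) powr p)
      \<le> (\<Sum>l<2 ^ k. R powr (p - 1) * (\<Sum>z\<in>?Z. ?a l z * norm (v (snd z)) powr p))"
  proof (intro sum_mono)
    fix l assume "l \<in> {..<(2::nat) ^ k}"
    then have l: "l < 2 ^ k" by simp
    have "norm (avg k l (T (step j v))) \<le> (\<Sum>z\<in>?Z. norm (v (snd z) * complex_of_real (?a l z)))"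
      unfolding avg_T_step[OF l] case_prod_unfold by (rule norm_sum)
    also have "\<dots> = (\<Sum>z\<in>?Z. ?a l z * norm (v (snd z)))"
      using a0[OF _ l] by (intro sum.cong) (auto simp: norm_mult mult.commute)
    finally have "norm (avg k l (T (step j v))) powr p \<le> (\<Sum>z\<in>?Z. ?a l z * norm (v (snd z))) powr p"
      using p by (intro powr_mono2) auto
    also have "\<dots> \<le> (\<Sum>z\<in>?Z. ?a l z) powr (p - 1) * (\<Sum>z\<in>?Z. ?a l z * norm (v (snd z)) powr p)"
      using p fin a0[OF _ l] by (intro powr_weighted_sum_le) auto
    also have "\<dots> \<le> R powr (p - 1) * (\<Sum>z\<in>?Z. ?a l z * norm (v (snd z)) powr p)"
      using p a0[OF _ l] sum_avg_G_le[OF l, of j]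
      by (intro mult_right_mono powr_mono2 sum_nonneg) (auto simp: R_def case_prod_unfold mult.commute)
    finally show "norm (avg k l (T (step j v))) powr p \<le> R powr (p - 1) * (\<Sum>z\<in>?Z. ?a l z * norm (v (snd z)) powr p)" .
  qed
  also have "\<dots> = R powr (p - 1) * (\<Sum>z\<in>?Z. (\<Sum>l<2 ^ k. ?a l z) * norm (v (snd z)) powr p)"
    by (simp add: sum_distrib_left[symmetric] sum_distrib_right sum.swap[of _ ?Z])
  also have "(\<Sum>z\<in>?Z. (\<Sum>l<2 ^ k. ?a l z) * norm (v (snd z)) powr p)
      = (\<Sum>z\<in>?Z. 2 ^ k * integral {0..1} (G j (fst z) (snd z)) * norm (v (snd z)) powr p)"
    by (intro sum.cong refl) (auto simp: sum_avg G_integral(1))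
  also have "\<dots> = 2 ^ k * (\<Sum>i<2 ^ j. (\<Sum>w\<in>W. integral {0..1} (G j w i)) * norm (v i) powr p)"
    by (simp add: sum.cartesian_product' sum.swap[of _ W] sum_distrib_left sum_distrib_right mult.assoc)
  also have "\<dots> \<le> 2 ^ k * (\<Sum>i<2 ^ j. 1 / 2 ^ j * norm (v i) powr p)"
    using sum_integral_G_le by (intro mult_left_mono sum_mono mult_right_mono) auto
  also have "(\<Sum>i<2 ^ j. 1 / 2 ^ j * norm (v i) powr p) = en p j v powr p"
    using p by (simp add: en_powr sum_divide_distrib)
  finally have "(\<Sum>l<2 ^ k. norm (avg k l (T (step j v))) powr p) / 2 ^ k \<le> R powr (p - 1) * en p j v powr p"
    using R by (simp add: field_simps mult_right_mono)
  also have "\<dots> = (R powr (1 - 1 / p) * en p j v) powr p"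
    using p by (simp add: powr_mult powr_powr algebra_simps)
  finally show ?thesis using p by (simp add: en_le_iff en_nonneg R_def)
qed

end

section \<open>Fine levels: oscillation inside the pieces and cells on their boundary\<close>

lemma avg_bounds:
  fixes \<psi> :: "real \<Rightarrow> real"
  assumes \<psi>: "\<psi> absolutely_integrable_on {0..1}" and l: "l < 2 ^ k"
    and b: "\<And>x. x \<in> dyadic k l \<Longrightarrow> L \<le> \<psi> x" "\<And>x. x \<in> dyadic k l \<Longrightarrow> \<psi> x \<le> U"
  shows "L \<le> avg k l \<psi>" "avg k l \<psi> \<le> U"
proof -
  let ?e = "real (Suc l) / 2 ^ k"
  have dy: "x \<in> dyadic k l" if "x \<in> cell k l" "x \<noteq> ?e" for x
    using that cell_subset_dyadic[OF l] by (auto simp: cell_def subset_iff)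
  have i: "(\<psi> has_integral integral (cell k l) \<psi>) (cell k l)" using int_cell[OF \<psi> l] by (rule integrable_integral)
  have spike: "((\<lambda>x. if x = ?e then a else \<psi> x) has_integral integral (cell k l) \<psi>) (cell k l)" for a
    by (rule has_integral_spike_finite[OF _ _ i, of "{?e}"]) auto
  have const: "((\<lambda>x. a) has_integral a / 2 ^ k) (cell k l)" for a :: real
    using has_integral_const_real[of a "real l / 2 ^ k" ?e] by (simp add: cell_def field_simps)
  have "L / 2 ^ k \<le> integral (cell k l) \<psi>"
    by (rule has_integral_le[OF const spike[of L]]) (use b dy in auto)
  then show "L \<le> avg k l \<psi>" by (simp add: avg_def field_simps)
  have "integral (cell k l) \<psi> \<le> U / 2 ^ k"
    by (rule has_integral_le[OF spike[of U] const]) (use b dy in auto)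
  then show "avg k l \<psi> \<le> U" by (simp add: avg_def field_simps)
qed

lemma dyadic_Suc_subset:
  assumes "l < 2 ^ Suc k"
  shows "dyadic (Suc k) l \<subseteq> dyadic k (l div 2)"
proof
  fix x assume x: "x \<in> dyadic (Suc k) l"
  then have x01: "x \<in> {0..1}" using dyadic_subset[OF assms] by blast
  then have "l = dyadic_index (Suc k) x" using x mem_dyadic_iff assms by blast
  then have "l div 2 = dyadic_index k x" using dyadic_index_Suc[OF x01] by simp
  then show "x \<in> dyadic k (l div 2)" using dyadic_index_mem[OF x01] by simp
qed

lemma dyadic_nonempty: "l < 2 ^ k \<Longrightarrow> real l / 2 ^ k \<in> dyadic k l"
  using cell_subset_dyadic[of l k] by (auto simp: subset_iff divide_strict_right_mono)

lemma dyadic_dist: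
  assumes "x \<in> dyadic k l" "y \<in> dyadic k l"
  shows "\<bar>x - y\<bar> \<le> 1 / 2 ^ k"
proof -
  have "x \<in> cell k l" "y \<in> cell k l" using assms dyadic_subset_cell[of k l] by auto
  moreover have "real (Suc l) / 2 ^ k = real l / 2 ^ k + 1 / 2 ^ k" by (simp add: add_divide_distrib)
  ultimately have "real l / 2 ^ k \<le> x" "x \<le> real l / 2 ^ k + 1 / 2 ^ k"
    "real l / 2 ^ k \<le> y" "y \<le> real l / 2 ^ k + 1 / 2 ^ k" unfolding cell_def by auto
  then show ?thesis by linarith
qed

context branch_system
begin

text \<open>On a cell inside a piece the weight oscillates only by the Hoelder condition. On the other cells it
  is bounded by its maximum; a piece, being an interval, meets at most two of them.\<close>

definition osc_bound :: "nat \<Rightarrow> nat \<Rightarrow> nat \<Rightarrow> 'w \<Rightarrow> nat \<Rightarrow> real" where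
  "osc_bound K l j w i = c / 2 ^ m * (if dyadic K l \<subseteq> piece j w i then 2 * (1 / 2 ^ K) powr \<beta>
     else if dyadic K l \<inter> piece j w i \<noteq> {} then 1 else 0)"

lemma osc_bound_nonneg: "0 \<le> osc_bound K l j w i"
  using c by (simp add: osc_bound_def)

text \<open>The averages over a cell and over its parent both lie between bounds for the weight on
  the parent. Inside a piece the weight stays within the Hoelder bound of its value at
  \<open>x0\<close>, above and below, hence the factor 2 in \<open>osc_bound\<close>.\<close>

lemma davg_G_le:
  assumes w: "w \<in> W" and i: "i < 2 ^ j" and l: "l < 2 ^ Suc K"
  shows "\<bar>davg (Suc K) l (G j w i)\<bar> \<le> osc_bound K (l div 2) j w i"
proof -
  let ?Q = "dyadic K (l div 2)"
  let ?P = "piece j w i"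
  note ai = G_integral(1)[OF w i]
  have l2: "l div 2 < 2 ^ K" using l by simp
  note sub = dyadic_Suc_subset[OF l]
  have two: "\<bar>davg (Suc K) l (G j w i)\<bar> \<le> U - L"
    if "\<And>x. x \<in> ?Q \<Longrightarrow> L \<le> G j w i x" "\<And>x. x \<in> ?Q \<Longrightarrow> G j w i x \<le> U" for L U
  proof -
    have "L \<le> avg (Suc K) l (G j w i)" "avg (Suc K) l (G j w i) \<le> U"
      using avg_bounds[OF ai l, of L U] that sub by blast+
    moreover have "L \<le> avg K (l div 2) (G j w i)" "avg K (l div 2) (G j w i) \<le> U"
      using avg_bounds[OF ai l2 that] by blast+
    ultimately show ?thesis by (simp add: davg_def)
  qed
  consider "?Q \<subseteq> ?P" | "\<not> ?Q \<subseteq> ?P" "?Q \<inter> ?P \<noteq> {}" | "\<not> ?Q \<subseteq> ?P" "?Q \<inter> ?P = {}" by blast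
  then show ?thesis
  proof cases
    case 1
    define x0 where "x0 = real (l div 2) / 2 ^ K"
    have x0: "x0 \<in> ?Q" unfolding x0_def by (rule dyadic_nonempty[OF l2])
    define C where "C = c / 2 ^ m * (1 / 2 ^ K) powr \<beta>"
    have near: "\<bar>G j w i x - G j w i x0\<bar> \<le> C" if x: "x \<in> ?Q" for x
    proof -
      have A: "x \<in> A w" "x0 \<in> A w" using 1 x x0 by (auto simp: piece_def)
      have "\<bar>G j w i x - G j w i x0\<bar> = \<bar>\<bar>d w x\<bar> - \<bar>d w x0\<bar>\<bar>" using 1 x x0 by (simp add: G_def subset_iff)
      also have "\<dots> \<le> c / 2 ^ m * \<bar>x - x0\<bar> powr \<beta>" by (rule d_holder[OF w A])
      also have "\<dots> \<le> C"
        unfolding C_def using c \<beta> dyadic_dist[OF x x0] by (intro mult_left_mono powr_mono2) auto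
      finally show ?thesis .
    qed
    have "\<bar>davg (Suc K) l (G j w i)\<bar> \<le> (G j w i x0 + C) - (G j w i x0 - C)"
      by (rule two) (use near in \<open>auto simp: abs_le_iff algebra_simps\<close>)
    then show ?thesis using 1 by (simp add: osc_bound_def C_def mult_ac)
  next
    case 2
    then show ?thesis using two[of 0 "c / 2 ^ m"] G_nonneg G_le[OF w] by (simp add: osc_bound_def)
  next
    case 3
    then have "G j w i x = 0" if "x \<in> ?Q" for x using that by (auto simp: G_def)
    then show ?thesis using two[of 0 0] 3 by (simp add: osc_bound_def)
  qed
qed

text \<open>A branch domain is longer than the cell, so a branch meeting the cell is defined at one
  of its endpoints: at most 2N branches. Each of them maps its part of the cell into length
  \<open>c / 2^(m + K)\<close>, at most c cells of generation j, and therefore meets at most c + 2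
  of them.\<close>

lemma card_pieces_meeting:
  assumes l: "l < 2 ^ K" and small: "1 / 2 ^ K \<le> \<kappa>" and jK: "j \<le> K + m"
  shows "real (card {z \<in> W \<times> {..<2 ^ j}. dyadic K l \<inter> piece j (fst z) (snd z) \<noteq> {}}) \<le> 2 * real N * (c + 2)"
proof -
  define a b where "a = real l / 2 ^ K" and "b = real (Suc l) / 2 ^ K"
  have ba: "b - a = 1 / 2 ^ K" by (simp add: a_def b_def field_simps)
  define Wl where "Wl = {w \<in> W. A w \<inter> dyadic K l \<noteq> {}}"
  define I where "I = (\<lambda>w. {i. i < 2 ^ j \<and> dyadic K l \<inter> piece j w i \<noteq> {}})"
  have cellab: "dyadic K l \<subseteq> {a..b}" using dyadic_subset_cell[of K l] by (simp add: cell_def a_def b_def)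
  have "Wl \<subseteq> {w \<in> W. a \<in> A w} \<union> {w \<in> W. b \<in> A w}"
  proof
    fix w assume "w \<in> Wl"
    then obtain z where w: "w \<in> W" and z: "z \<in> A w" "a \<le> z" "z \<le> b" using cellab unfolding Wl_def by fastforce
    obtain x y where xy: "x \<in> A w" "y \<in> A w" "\<bar>x - y\<bar> > \<kappa>" using A_long[OF w] by blast
    then have "\<bar>x - y\<bar> > b - a" using small ba by simp
    then show "w \<in> {w \<in> W. a \<in> A w} \<union> {w \<in> W. b \<in> A w}"
      using long_interval_contains_endpoint[OF A_int[OF w] xy(1,2) _ z] w by blast
  qed
  then have "card Wl \<le> card ({w \<in> W. a \<in> A w} \<union> {w \<in> W. b \<in> A w})"
    using finite_W by (intro card_mono) auto
  also have "\<dots> \<le> card {w \<in> W. a \<in> A w} + card {w \<in> W. b \<in> A w}" by (rule card_Un_le)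
  finally have Wl: "card Wl \<le> 2 * N" using mult[of a] mult[of b] by linarith
  have I: "real (card (I w)) \<le> c + 2" if w: "w \<in> W" for w
  proof -
    have "\<bar>real i - real i'\<bar> \<le> c + 1" if ii: "i \<in> I w" "i' \<in> I w" for i i'
    proof -
      obtain x y where x: "x \<in> dyadic K l" "x \<in> A w" "h w x \<in> dyadic j i"
        and y: "y \<in> dyadic K l" "y \<in> A w" "h w y \<in> dyadic j i'"
        using ii by (auto simp: I_def piece_def)
      have "i = dyadic_index j (h w x)" "i' = dyadic_index j (h w y)"
        using mem_dyadic_iff[OF h_sub[OF w x(2)]] mem_dyadic_iff[OF h_sub[OF w y(2)]] x y ii by (auto simp: I_def)
      then have "\<bar>real i - real i'\<bar> \<le> \<bar>h w x - h w y\<bar> * 2 ^ j + 1"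
        using dyadic_index_diff[OF h_sub[OF w x(2)] h_sub[OF w y(2)]] by simp
      also have "\<bar>h w x - h w y\<bar> \<le> c / 2 ^ m * (1 / 2 ^ K)"
        using h_lipschitz[OF w x(2) y(2)] dyadic_dist[OF x(1) y(1)] c
        by (meson mult_left_mono order_trans divide_nonneg_pos zero_less_power zero_less_numeral le_numeral_extra(1))
      also have "c / 2 ^ m * (1 / 2 ^ K) * 2 ^ j = c * (2 ^ j / 2 ^ (K + m))"
        by (simp add: power_add)
      also have "\<dots> \<le> c * 1" using c jK by (intro mult_left_mono) (auto simp: power_increasing)
      finally show ?thesis by simp
    qed
    then show ?thesis using card_le_nat_diff[of "I w" "c + 1"] c by (simp add: I_def)
  qed
  have "{z \<in> W \<times> {..<2 ^ j}. dyadic K l \<inter> piece j (fst z) (snd z) \<noteq> {}} \<subseteq> (SIGMA w:Wl. I w)"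
    by (auto simp: Wl_def I_def piece_def)
  then have "card {z \<in> W \<times> {..<2 ^ j}. dyadic K l \<inter> piece j (fst z) (snd z) \<noteq> {}} \<le> card (SIGMA w:Wl. I w)"
    using finite_W by (intro card_mono) (auto simp: Wl_def I_def)
  also have "\<dots> = (\<Sum>w\<in>Wl. card (I w))" using finite_W by (simp add: Wl_def I_def)
  finally have "real (card {z \<in> W \<times> {..<2 ^ j}. dyadic K l \<inter> piece j (fst z) (snd z) \<noteq> {}}) \<le> (\<Sum>w\<in>Wl. real (card (I w)))"
    by (simp flip: of_nat_sum)
  also have "\<dots> \<le> (\<Sum>w\<in>Wl. c + 2)" using I by (intro sum_mono) (auto simp: Wl_def)
  also have "\<dots> = real (card Wl) * (c + 2)" by simp
  also have "\<dots> \<le> 2 * real N * (c + 2)" using Wl c by (intro mult_right_mono) auto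
  finally show ?thesis .
qed

text \<open>The same argument on the image side. Images of distinct branches are disjoint, so each
  of the two endpoints belongs to at most one of them.\<close>

lemma card_branches_meeting:
  assumes i: "i < 2 ^ j" and small: "1 / 2 ^ j \<le> \<kappa>"
  shows "card {w \<in> W. piece j w i \<noteq> {}} \<le> 2"
proof -
  define a b where "a = real i / 2 ^ j" and "b = real (Suc i) / 2 ^ j"
  have ba: "b - a = 1 / 2 ^ j" by (simp add: a_def b_def field_simps)
  have cellab: "dyadic j i \<subseteq> {a..b}" using dyadic_subset_cell[of j i] by (simp add: cell_def a_def b_def)
  have one: "card {w \<in> W. x \<in> h w ` A w} \<le> 1" for x
  proof -
    have "\<forall>u\<in>{w \<in> W. x \<in> h w ` A w}. \<forall>v\<in>{w \<in> W. x \<in> h w ` A w}. u = v" using disjoint by auto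
    moreover have "finite {w \<in> W. x \<in> h w ` A w}" using finite_W by simp
    ultimately show ?thesis using card_le_Suc0_iff_eq[of "{w \<in> W. x \<in> h w ` A w}"] by simp
  qed
  have "{w \<in> W. piece j w i \<noteq> {}} \<subseteq> {w \<in> W. a \<in> h w ` A w} \<union> {w \<in> W. b \<in> h w ` A w}"
  proof
    fix w assume "w \<in> {w \<in> W. piece j w i \<noteq> {}}"
    then obtain z where w: "w \<in> W" and z: "z \<in> A w" "a \<le> h w z" "h w z \<le> b" using cellab by (auto simp: piece_def)
    obtain x y where xy: "x \<in> A w" "y \<in> A w" "\<bar>h w x - h w y\<bar> > \<kappa>" using hA_long[OF w] by blast
    have "connected (h w ` A w)"
      using A_int[OF w] h_cont[OF w] by (intro connected_continuous_image) (auto simp: is_interval_connected_1)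
    then have "is_interval (h w ` A w)" by (simp add: is_interval_connected_1)
    moreover have "\<bar>h w x - h w y\<bar> > b - a" using xy small ba by simp
    ultimately show "w \<in> {w \<in> W. a \<in> h w ` A w} \<union> {w \<in> W. b \<in> h w ` A w}"
      using long_interval_contains_endpoint[of "h w ` A w" "h w x" "h w y" b a "h w z"] w xy z by blast
  qed
  then have "card {w \<in> W. piece j w i \<noteq> {}} \<le> card ({w \<in> W. a \<in> h w ` A w} \<union> {w \<in> W. b \<in> h w ` A w})"
    using finite_W by (intro card_mono) auto
  also have "\<dots> \<le> card {w \<in> W. a \<in> h w ` A w} + card {w \<in> W. b \<in> h w ` A w}" by (rule card_Un_le)
  finally show ?thesis using one[of a] one[of b] by linarith
qed

text \<open>The derivative is at least \<open>1 / (c 2^m)\<close> on the piece and its integral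
  there is the measure of a subset of one dyadic cell.\<close>

lemma measure_piece_le:
  assumes w: "w \<in> W" and i: "i < 2 ^ j"
  shows "measure lebesgue (piece j w i) \<le> c * 2 ^ m / 2 ^ j"
proof -
  let ?P = "piece j w i"
  have P: "?P \<in> lmeasurable" by (rule piece_lmeasurable[OF w])
  have PI: "((\<lambda>x. 1) has_integral measure lebesgue ?P) ?P"
    using P has_integral_restrict_UNIV[of ?P "\<lambda>x. 1::real"]
    by (simp add: lmeasurable_iff_has_integral indicator_def[abs_def] of_bool_def)
  have "integral {0..1} (\<lambda>x. if x \<in> ?P then 1 / (c * 2 ^ m) else 0) \<le> integral {0..1} (G j w i)"
  proof (rule integral_le)
    have "(\<lambda>x. if x \<in> ?P then 1 / (c * 2 ^ m) else 0) = (\<lambda>x. 1 / (c * 2 ^ m) * indicat_real ?P x)" by (auto simp: indicator_def)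
    moreover have "indicat_real ?P integrable_on {0..1}"
      using P integrable_on_subcbox[of "indicat_real ?P" UNIV 0 1] by (auto simp: lmeasurable_iff_has_integral dest: has_integral_integrable)
    ultimately show "(\<lambda>x. if x \<in> ?P then 1 / (c * 2 ^ m) else 0) integrable_on {0..1}"
      using integrable_on_cmult_left[of "indicat_real ?P" "{0..1}" "1 / (c * 2 ^ m)"] by simp
    show "G j w i integrable_on {0..1}" using G_integral(1)[OF w i] by (simp add: absolutely_integrable_on_def)
  qed (use d_ge[OF w] in \<open>auto simp: G_def piece_def\<close>)
  also have "\<dots> = measure lebesgue (h w ` ?P)" by (rule G_integral(2)[OF w i])
  also have "\<dots> \<le> measure lebesgue (dyadic j i)"
    using h_piece_sub[OF i, of w] h_piece_lmeasurable[OF w i] by (intro measure_mono_fmeasurable) (auto simp: dyadic_lmeasurable fmeasurableD)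
  also have "\<dots> = 1 / 2 ^ j" by (rule measure_dyadic[OF i])
  also have "integral {0..1} (\<lambda>x. if x \<in> ?P then 1 / (c * 2 ^ m) else 0) = integral ?P (\<lambda>x. 1 / (c * 2 ^ m))"
    using integral_restrict_Int[of "{0..1}" ?P "\<lambda>x. 1 / (c * 2 ^ m)"] piece_sub[OF w, of j i]
    by (simp add: Int_absorb2)
  also have "\<dots> = measure lebesgue ?P / (c * 2 ^ m)"
    using integral_unique[OF PI] by simp
  finally show ?thesis using c by (simp add: field_simps)
qed

text \<open>Cells inside the piece are counted through its measure and carry the Hoelder factor; the
  at most two cells on its boundary carry the full weight.\<close>

lemma sum_osc_bound_powr_le:
  assumes p: "p \<ge> 1" and w: "w \<in> W" and i: "i < 2 ^ j"
  shows "(\<Sum>l<2 ^ K. osc_bound K l j w i powr p)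
    \<le> (c / 2 ^ m) powr p * (2 powr p * ((1 / 2 ^ K) powr \<beta>) powr p * (2 ^ K * (c * 2 ^ m / 2 ^ j)) + 2)"
proof -
  let ?P = "piece j w i"
  define In where "In = {l. l < 2 ^ K \<and> dyadic K l \<subseteq> ?P}"
  define Bd where "Bd = {l. l < 2 ^ K \<and> dyadic K l \<inter> ?P \<noteq> {} \<and> \<not> dyadic K l \<subseteq> ?P}"
  have fin: "finite In" "finite Bd" and dis: "In \<inter> Bd = {}" by (auto simp: In_def Bd_def)
  have "(\<Sum>l<2 ^ K. osc_bound K l j w i powr p) = (\<Sum>l\<in>In \<union> Bd. osc_bound K l j w i powr p)"
    by (rule sum.mono_neutral_right) (use p in \<open>auto simp: In_def Bd_def osc_bound_def\<close>)
  also have "\<dots> = (\<Sum>l\<in>In. osc_bound K l j w i powr p) + (\<Sum>l\<in>Bd. osc_bound K l j w i powr p)"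
    by (rule sum.union_disjoint[OF fin dis])
  also have "(\<Sum>l\<in>In. osc_bound K l j w i powr p) = (\<Sum>l\<in>In. (c / 2 ^ m) powr p * (2 powr p * ((1 / 2 ^ K) powr \<beta>) powr p))"
    by (intro sum.cong refl) (simp add: In_def osc_bound_def powr_mult del: times_divide_eq_left)
  also have "(\<Sum>l\<in>Bd. osc_bound K l j w i powr p) = (\<Sum>l\<in>Bd. (c / 2 ^ m) powr p)"
    by (intro sum.cong refl) (auto simp: Bd_def osc_bound_def)
  also have "(\<Sum>l\<in>In. (c / 2 ^ m) powr p * (2 powr p * ((1 / 2 ^ K) powr \<beta>) powr p)) + (\<Sum>l\<in>Bd. (c / 2 ^ m) powr p)
      = (c / 2 ^ m) powr p * (2 powr p * ((1 / 2 ^ K) powr \<beta>) powr p * real (card In) + real (card Bd))"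
    by (simp add: algebra_simps)
  also have "\<dots> \<le> (c / 2 ^ m) powr p * (2 powr p * ((1 / 2 ^ K) powr \<beta>) powr p * (2 ^ K * (c * 2 ^ m / 2 ^ j)) + 2)"
  proof (intro mult_left_mono add_mono)
    have "real (card In) \<le> 2 ^ K * measure lebesgue ?P"
      unfolding In_def by (rule card_dyadic_inside[OF piece_lmeasurable[OF w]])
    also have "\<dots> \<le> 2 ^ K * (c * 2 ^ m / 2 ^ j)" by (intro mult_left_mono measure_piece_le w i) auto
    finally show "real (card In) \<le> 2 ^ K * (c * 2 ^ m / 2 ^ j)" .
    show "real (card Bd) \<le> 2"
      using card_dyadic_boundary[OF piece_interval[OF w, of j i], of K] by (simp add: Bd_def)
  qed auto
  finally show ?thesis .
qed

text \<open>The factors are: the pieces over a cell in Jensen's inequality, the size c of the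
  weight, the interior and boundary terms, and the at most two branches whose image meets a
  cell.\<close>

definition high_const :: "real \<Rightarrow> real" where
  "high_const p = ((2 * (c + 2)) powr (p - 1) * c powr p * (2 powr p * c + 2) * 2) powr (1 / p)"

text \<open>The ratio \<open>\<tau>\<close> is the size of the output cells in units of the natural
  scale \<open>2^-(j - m)\<close>. Cells inside a piece gain \<open>(2^-K) powr \<beta>\<close> from
  the Hoelder condition. Boundary cells gain nothing pointwise, but there are at most two per piece,
  against about \<open>1 / \<tau>\<close> cells in a piece of full size.\<close>

lemma en_davg_T_step_high:
  assumes p: "p \<ge> 1" and \<beta>p: "\<beta> * p \<le> 1" and smallK: "1 / 2 ^ K \<le> \<kappa>" and smallj: "1 / 2 ^ j \<le> \<kappa>"
    and jK: "j \<le> K + m" and mj: "m \<le> j"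
  shows "en p (Suc K) (\<lambda>l. davg (Suc K) l (T (step j v)))
    \<le> high_const p * (real N / 2 ^ m) powr (1 - 1 / p) * (2 ^ j / (2 ^ m * 2 ^ K)) powr \<beta> * en p j v"
proof -
  let ?Z = "W \<times> {..<(2::nat) ^ j}"
  define \<tau> where "\<tau> = (2 ^ j / (2 ^ m * 2 ^ K) :: real)"
  define M where "M = 2 * real N * (c + 2)"
  define X where "X = (c / 2 ^ m) powr p * (2 powr p * ((1 / 2 ^ K) powr \<beta>) powr p * (2 ^ K * (c * 2 ^ m / 2 ^ j)) + 2)"
  let ?E = "\<lambda>l z. osc_bound K l j (fst z) (snd z)"
  have fin: "finite ?Z" using finite_W by simp
  have M0: "0 \<le> M" using c by (simp add: M_def)
  have \<tau>: "0 < \<tau>" "\<tau> \<le> 1"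
    using jK power_increasing[of j "K + m" "2::real"] by (auto simp: \<tau>_def power_add mult.commute)
  have mj': "(2::real) ^ m / 2 ^ j \<le> 1" using mj by (simp add: power_increasing)
  have Kt: "1 / 2 ^ K = \<tau> * (2 ^ m / 2 ^ j)" by (simp add: \<tau>_def)
  have davg_T: "davg (Suc K) l (T (step j v)) = (\<Sum>z\<in>?Z. v (snd z) * complex_of_real (davg (Suc K) l (G j (fst z) (snd z))))"
    if l: "l < 2 ^ Suc K" for l
    using l by (simp add: davg_def avg_T_step case_prod_unfold sum_subtractf[symmetric] right_diff_distrib)
  have point: "norm (davg (Suc K) l (T (step j v))) powr p \<le> M powr (p - 1) * (\<Sum>z\<in>?Z. norm (v (snd z)) powr p * ?E (l div 2) z powr p)"
    if l: "l < 2 ^ Suc K" for l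
  proof -
    \<comment> \<open>Only pieces that meet the parent cell contribute. Jensen over these costs
      their number, which is bounded in terms of N and c, and not the number of all pieces.\<close>
    define Zl where "Zl = {z \<in> ?Z. dyadic K (l div 2) \<inter> piece j (fst z) (snd z) \<noteq> {}}"
    have l2: "l div 2 < 2 ^ K" using l by simp
    have nz: "?E (l div 2) z = 0" if "z \<in> ?Z - Zl" for z
      using that dyadic_nonempty[OF l2] by (auto simp: osc_bound_def Zl_def)
    have "norm (davg (Suc K) l (T (step j v))) \<le> (\<Sum>z\<in>?Z. norm (v (snd z)) * ?E (l div 2) z)"
      unfolding davg_T[OF l] using davg_G_le[OF _ _ l]
      by (intro order_trans[OF norm_sum] sum_mono) (auto simp: norm_mult intro!: mult_left_mono)
    also have "\<dots> = (\<Sum>z\<in>Zl. norm (v (snd z)) * ?E (l div 2) z)"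
      by (rule sum.mono_neutral_right[OF fin]) (use nz in \<open>auto simp: Zl_def\<close>)
    finally have "norm (davg (Suc K) l (T (step j v))) powr p \<le> (\<Sum>z\<in>Zl. norm (v (snd z)) * ?E (l div 2) z) powr p"
      using p by (intro powr_mono2) auto
    also have "\<dots> \<le> real (card Zl) powr (p - 1) * (\<Sum>z\<in>Zl. (norm (v (snd z)) * ?E (l div 2) z) powr p)"
      using p fin osc_bound_nonneg by (intro powr_sum_le) (auto simp: Zl_def)
    also have "\<dots> \<le> M powr (p - 1) * (\<Sum>z\<in>Zl. (norm (v (snd z)) * ?E (l div 2) z) powr p)"
      using p card_pieces_meeting[OF l2 smallK jK]
      by (intro mult_right_mono powr_mono2 sum_nonneg) (auto simp: Zl_def M_def)
    also have "(\<Sum>z\<in>Zl. (norm (v (snd z)) * ?E (l div 2) z) powr p) = (\<Sum>z\<in>?Z. (norm (v (snd z)) * ?E (l div 2) z) powr p)"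
      by (rule sum.mono_neutral_left[OF fin]) (use nz p in \<open>auto simp: Zl_def\<close>)
    also have "\<dots> = (\<Sum>z\<in>?Z. norm (v (snd z)) powr p * ?E (l div 2) z powr p)"
      by (intro sum.cong refl powr_mult)
    finally show ?thesis .
  qed
  have "(\<Sum>l<2 ^ Suc K. norm (davg (Suc K) l (T (step j v))) powr p)
      \<le> (\<Sum>l<2 ^ Suc K. M powr (p - 1) * (\<Sum>z\<in>?Z. norm (v (snd z)) powr p * ?E (l div 2) z powr p))"
    using point by (intro sum_mono) simp
  also have "\<dots> = 2 * (\<Sum>l<2 ^ K. M powr (p - 1) * (\<Sum>z\<in>?Z. norm (v (snd z)) powr p * ?E l z powr p))"
    by (simp add: sum_double sum_distrib_left)
  also have "\<dots> = 2 * M powr (p - 1) * (\<Sum>z\<in>?Z. norm (v (snd z)) powr p * (\<Sum>l<2 ^ K. ?E l z powr p))"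
    by (simp add: sum_distrib_left[symmetric] sum.swap[of _ ?Z] mult.assoc)
  also have "\<dots> \<le> 2 * M powr (p - 1) * (\<Sum>z\<in>?Z. norm (v (snd z)) powr p * (if piece j (fst z) (snd z) \<noteq> {} then X else 0))"
  proof (intro mult_left_mono sum_mono)
    fix z assume z: "z \<in> ?Z"
    show "(\<Sum>l<2 ^ K. ?E l z powr p) \<le> (if piece j (fst z) (snd z) \<noteq> {} then X else 0)"
    proof (cases "piece j (fst z) (snd z) = {}")
      case True
      then have "?E l z powr p = 0" if "l < 2 ^ K" for l
        using dyadic_nonempty[OF that] by (auto simp: osc_bound_def)
      then show ?thesis using True by simp
    next
      case False
      then show ?thesis using sum_osc_bound_powr_le[OF p, of "fst z" "snd z" j K] z by (auto simp: X_def)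
    qed
  qed (use M0 in auto)
  also have "(\<Sum>z\<in>?Z. norm (v (snd z)) powr p * (if piece j (fst z) (snd z) \<noteq> {} then X else 0))
      = (\<Sum>i<2 ^ j. norm (v i) powr p * X * real (card {w \<in> W. piece j w i \<noteq> {}}))"
  proof -
    have "(\<Sum>w\<in>W. norm (v i) powr p * (if piece j w i \<noteq> {} then X else 0))
        = norm (v i) powr p * X * real (card {w \<in> W. piece j w i \<noteq> {}})" for i
      using finite_W by (simp add: sum_distrib_left[symmetric] sum.If_cases Int_def mult_ac)
    then show ?thesis unfolding sum.cartesian_product' fst_conv snd_conv by (subst sum.swap) simp
  qed
  also have "2 * M powr (p - 1) * (\<Sum>i<2 ^ j. norm (v i) powr p * X * real (card {w \<in> W. piece j w i \<noteq> {}}))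
      \<le> 2 * M powr (p - 1) * (\<Sum>i<2 ^ j. norm (v i) powr p * X * 2)"
    using card_branches_meeting[OF _ smallj] c
    by (intro mult_left_mono sum_mono) (auto simp: X_def intro!: mult_nonneg_nonneg add_nonneg_nonneg)
  also have "\<dots> = 2 * M powr (p - 1) * X * 2 * 2 ^ j * en p j v powr p"
    using p by (simp add: en_powr sum_distrib_left[symmetric] sum_distrib_right[symmetric] mult_ac)
  finally have 1: "(\<Sum>l<2 ^ Suc K. norm (davg (Suc K) l (T (step j v))) powr p) / 2 ^ Suc K
      \<le> M powr (p - 1) * 2 * (X * 2 ^ j / 2 ^ K) * en p j v powr p"
    by (simp add: field_simps)
  have 2: "X * 2 ^ j / 2 ^ K \<le> (c / 2 ^ m) powr p * (2 ^ m * \<tau> powr (\<beta> * p) * (2 powr p * c + 2))"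
  proof -
    have "X * 2 ^ j / 2 ^ K = (c / 2 ^ m) powr p * (2 powr p * ((1 / 2 ^ K) powr (\<beta> * p)) * (c * 2 ^ m) + 2 * 2 ^ j * (1 / 2 ^ K))"
      by (simp add: X_def powr_powr field_simps)
    also have "\<dots> \<le> (c / 2 ^ m) powr p * (2 powr p * (\<tau> powr (\<beta> * p)) * (c * 2 ^ m) + 2 * 2 ^ m * \<tau> powr (\<beta> * p))"
    proof (intro mult_left_mono add_mono mult_right_mono)
      have "1 / 2 ^ K \<le> \<tau>" using Kt mj' \<tau> mult_left_mono[OF mj', of \<tau>] by simp
      then show "(1 / 2 ^ K) powr (\<beta> * p) \<le> \<tau> powr (\<beta> * p)" using \<beta> p by (intro powr_mono2) auto
      \<comment> \<open>Here \<beta> <= 1/p enters: the boundary contribution of order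
        \<open>\<tau>\<close> is absorbed by the Hoelder rate, because \<open>\<tau>\<close> is at
        most 1.\<close>
      have "\<tau> powr 1 \<le> \<tau> powr (\<beta> * p)" using \<tau> \<beta>p by (intro powr_mono') auto
      then have "\<tau> \<le> \<tau> powr (\<beta> * p)" using \<tau> by simp
      then show "2 * 2 ^ j * (1 / 2 ^ K) \<le> 2 * 2 ^ m * \<tau> powr (\<beta> * p)" by (simp add: Kt)
    qed (use c in auto)
    finally show ?thesis by (simp add: algebra_simps)
  qed
  have "(\<Sum>l<2 ^ Suc K. norm (davg (Suc K) l (T (step j v))) powr p) / 2 ^ Suc K
      \<le> M powr (p - 1) * 2 * ((c / 2 ^ m) powr p * (2 ^ m * \<tau> powr (\<beta> * p) * (2 powr p * c + 2))) * en p j v powr p"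
    using 2 by (intro order_trans[OF 1] mult_right_mono mult_left_mono) auto
  also have "\<dots> = (high_const p * (real N / 2 ^ m) powr (1 - 1 / p) * \<tau> powr \<beta> * en p j v) powr p"
  proof -
    have e1: "high_const p powr p = (2 * (c + 2)) powr (p - 1) * c powr p * (2 powr p * c + 2) * 2"
      using p c by (simp add: high_const_def powr_powr)
    have e2: "((real N / 2 ^ m) powr (1 - 1 / p)) powr p = real N powr (p - 1) / (2 ^ m) powr (p - 1)"
      using p by (simp add: powr_powr powr_divide algebra_simps)
    have e3: "(c / 2 ^ m) powr p * 2 ^ m = c powr p / (2 ^ m) powr (p - 1)"
      using c by (simp add: powr_divide powr_diff)
    have e4: "M powr (p - 1) = (2 * (c + 2)) powr (p - 1) * real N powr (p - 1)"
      using c by (simp add: M_def powr_mult[symmetric] mult_ac)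
    have "M powr (p - 1) * 2 * ((c / 2 ^ m) powr p * (2 ^ m * \<tau> powr (\<beta> * p) * (2 powr p * c + 2))) * en p j v powr p
        = M powr (p - 1) * 2 * ((c / 2 ^ m) powr p * 2 ^ m) * \<tau> powr (\<beta> * p) * (2 powr p * c + 2) * en p j v powr p"
      by (simp only: mult_ac)
    also have "\<dots> = high_const p powr p * ((real N / 2 ^ m) powr (1 - 1 / p)) powr p * (\<tau> powr \<beta>) powr p * en p j v powr p"
      unfolding e1 e2 e3 e4 powr_powr[of \<tau> \<beta> p] by simp
    finally show ?thesis by (simp only: powr_mult)
  qed
  finally show ?thesis
    using p by (simp add: en_le_iff en_nonneg \<tau>_def high_const_def)
qed

end

section \<open>Transfer operators of a family of branches\<close>

definition transfer :: "'w set \<Rightarrow> ('w \<Rightarrow> real set) \<Rightarrow> ('w \<Rightarrow> real \<Rightarrow> real) \<Rightarrow> ('w \<Rightarrow> real \<Rightarrow> real) \<Rightarrow>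
    (real \<Rightarrow> complex) \<Rightarrow> real \<Rightarrow> complex" where
  "transfer W A h d \<phi> x = (\<Sum>w\<in>W. if x \<in> A w then complex_of_real \<bar>d w x\<bar> * \<phi> (h w x) else 0)"

lemma transfer_add: "transfer W A h d (\<lambda>x. \<phi> x + \<psi> x) x = transfer W A h d \<phi> x + transfer W A h d \<psi> x"
  unfolding transfer_def sum.distrib[symmetric] by (intro sum.cong) (auto simp: distrib_left)

lemma transfer_diff: "transfer W A h d (\<lambda>x. \<phi> x - \<psi> x) x = transfer W A h d \<phi> x - transfer W A h d \<psi> x"
  unfolding transfer_def sum_subtractf[symmetric] by (intro sum.cong) (auto simp: right_diff_distrib)

lemma transfer_cmult: "transfer W A h d (\<lambda>x. a * \<phi> x) x = a * transfer W A h d \<phi> x"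
  unfolding transfer_def sum_distrib_left by (intro sum.cong) auto

lemma transfer_sum: "transfer W A h d (\<lambda>x. \<Sum>i\<in>I. \<phi> i x) x = (\<Sum>i\<in>I. transfer W A h d (\<phi> i) x)"
  unfolding transfer_def by (subst sum.swap, intro sum.cong) (auto simp: sum_distrib_left)

text \<open>Change of variables branch by branch. The loss of \<open>card W\<close> in the norm
  bound is harmless, as that bound serves to pass to limits; the exact integral later gives
  preservation of mass.\<close>

lemma transfer_L1:
  fixes \<psi> :: "real \<Rightarrow> complex"
  assumes "finite W" and \<psi>: "\<psi> absolutely_integrable_on {0..1}"
    and A: "\<And>w. w \<in> W \<Longrightarrow> is_interval (A w)" "\<And>w. w \<in> W \<Longrightarrow> A w \<subseteq> {0..1}"
    and h: "\<And>w x. w \<in> W \<Longrightarrow> x \<in> A w \<Longrightarrow> h w x \<in> {0..1}"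
    and der: "\<And>w x. w \<in> W \<Longrightarrow> x \<in> A w \<Longrightarrow> (h w has_field_derivative d w x) (at x within A w)"
    and inj: "\<And>w. w \<in> W \<Longrightarrow> inj_on (h w) (A w)"
  shows "transfer W A h d \<psi> absolutely_integrable_on {0..1}"
    and "integral {0..1} (\<lambda>x. norm (transfer W A h d \<psi> x)) \<le> real (card W) * integral {0..1} (\<lambda>x. norm (\<psi> x))"
    and "integral {0..1} (transfer W A h d \<psi>) = (\<Sum>w\<in>W. integral (h w ` A w) \<psi>)"
proof -
  define F where "F = (\<lambda>w x. if x \<in> A w then complex_of_real \<bar>d w x\<bar> * \<psi> (h w x) else 0)"
  have T: "transfer W A h d \<psi> = (\<lambda>x. \<Sum>w\<in>W. F w x)" by (rule ext) (simp add: transfer_def F_def)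
  have main: "F w absolutely_integrable_on {0..1} \<and> integral {0..1} (F w) = integral (h w ` A w) \<psi>
      \<and> integral {0..1} (\<lambda>x. norm (F w x)) \<le> integral {0..1} (\<lambda>x. norm (\<psi> x))" if w: "w \<in> W" for w
  proof -
    have Am: "A w \<in> sets lebesgue"
      using A[OF w] by (intro fmeasurableD measurable_convex bounded_subset[OF bounded_closed_interval])
        (auto simp: is_interval_convex_1)
    have "connected (h w ` A w)"
      using A(1)[OF w] DERIV_continuous_on[OF der[OF w]]
      by (intro connected_continuous_image) (auto simp: is_interval_connected_1)
    then have hm: "h w ` A w \<in> lmeasurable"
      using h[OF w] by (intro measurable_convex bounded_subset[OF bounded_closed_interval[of 0 1]])
        (auto simp: is_interval_connected_1 simp flip: is_interval_convex_1)
    have sub: "h w ` A w \<subseteq> {0..1}" using h[OF w] by blast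
    have \<psi>h: "\<psi> absolutely_integrable_on h w ` A w"
      using \<psi> hm sub by (rule set_integrable_subset[OF _ fmeasurableD])
    have cv: "(\<lambda>x. \<bar>d w x\<bar> *\<^sub>R \<psi> (h w x)) absolutely_integrable_on A w"
      "integral (A w) (\<lambda>x. \<bar>d w x\<bar> *\<^sub>R \<psi> (h w x)) = integral (h w ` A w) \<psi>"
      using has_absolute_integral_change_of_variables_real[OF Am der[OF w] inj[OF w], of \<psi> "integral (h w ` A w) \<psi>"] \<psi>h
      by auto
    have \<psi>n: "(\<lambda>x. norm (\<psi> x)) absolutely_integrable_on h w ` A w"
      using absolutely_integrable_norm[OF \<psi>h] by (simp add: comp_def)
    have \<psi>n1: "(\<lambda>x. norm (\<psi> x)) absolutely_integrable_on {0..1}"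
      using absolutely_integrable_norm[OF \<psi>] by (simp add: comp_def)
    have cvn: "integral (A w) (\<lambda>x. \<bar>d w x\<bar> *\<^sub>R norm (\<psi> (h w x))) = integral (h w ` A w) (\<lambda>x. norm (\<psi> x))"
      using has_absolute_integral_change_of_variables_real[OF Am der[OF w] inj[OF w], of "\<lambda>x. norm (\<psi> x)" "integral (h w ` A w) (\<lambda>x. norm (\<psi> x))"] \<psi>n
      by auto
    have Feq: "F w = (\<lambda>x. if x \<in> A w then \<bar>d w x\<bar> *\<^sub>R \<psi> (h w x) else 0)"
      by (auto simp: F_def scaleR_conv_of_real)
    have Fn: "(\<lambda>x. norm (F w x)) = (\<lambda>x. if x \<in> A w then \<bar>d w x\<bar> *\<^sub>R norm (\<psi> (h w x)) else 0)"
      by (auto simp: F_def norm_mult)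
    have int: "A w \<inter> {0..1} = A w" using A(2)[OF w] by blast
    have "F w absolutely_integrable_on {0..1}"
      using cv(1) absolutely_integrable_restrict_UNIV[of "A w" "\<lambda>x. \<bar>d w x\<bar> *\<^sub>R \<psi> (h w x)"]
        absolutely_integrable_on_subinterval[where f = "F w" and S = UNIV]
      unfolding Feq by simp
    moreover have "integral {0..1} (F w) = integral (h w ` A w) \<psi>"
      using cv(2) integral_restrict_Int[of "{0..1}" "A w" "\<lambda>x. \<bar>d w x\<bar> *\<^sub>R \<psi> (h w x)"] int unfolding Feq by simp
    moreover have "integral {0..1} (\<lambda>x. norm (F w x)) = integral (h w ` A w) (\<lambda>x. norm (\<psi> x))"
      using cvn integral_restrict_Int[of "{0..1}" "A w" "\<lambda>x. \<bar>d w x\<bar> *\<^sub>R norm (\<psi> (h w x))"] int unfolding Fn by simp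
    moreover have "integral (h w ` A w) (\<lambda>x. norm (\<psi> x)) \<le> integral {0..1} (\<lambda>x. norm (\<psi> x))"
      using \<psi>n \<psi>n1 sub by (intro integral_subset_le) (auto simp: absolutely_integrable_on_def)
    ultimately show ?thesis by simp
  qed
  show ai: "transfer W A h d \<psi> absolutely_integrable_on {0..1}"
    unfolding T using main assms(1) by (intro absolutely_integrable_sum) auto
  have Fi: "F w integrable_on {0..1}" "(\<lambda>x. norm (F w x)) integrable_on {0..1}" if "w \<in> W" for w
    using main[OF that] by (auto simp: absolutely_integrable_on_def)
  have "integral {0..1} (transfer W A h d \<psi>) = (\<Sum>w\<in>W. integral {0..1} (F w))"
    unfolding T using Fi assms(1) by (intro integral_sum) auto
  then show "integral {0..1} (transfer W A h d \<psi>) = (\<Sum>w\<in>W. integral (h w ` A w) \<psi>)"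
    using main by simp
  have "integral {0..1} (\<lambda>x. norm (transfer W A h d \<psi> x)) \<le> integral {0..1} (\<lambda>x. \<Sum>w\<in>W. norm (F w x))"
  proof (rule integral_le)
    show "(\<lambda>x. norm (transfer W A h d \<psi> x)) integrable_on {0..1}" using ai by (simp add: absolutely_integrable_on_def)
    show "(\<lambda>x. \<Sum>w\<in>W. norm (F w x)) integrable_on {0..1}" using Fi assms(1) by (intro integrable_sum) auto
  qed (simp add: T norm_sum)
  also have "\<dots> = (\<Sum>w\<in>W. integral {0..1} (\<lambda>x. norm (F w x)))"
    using Fi assms(1) by (intro integral_sum) auto
  also have "\<dots> \<le> (\<Sum>w\<in>W. integral {0..1} (\<lambda>x. norm (\<psi> x)))" using main by (intro sum_mono) auto
  finally show "integral {0..1} (\<lambda>x. norm (transfer W A h d \<psi> x)) \<le> real (card W) * integral {0..1} (\<lambda>x. norm (\<psi> x))"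
    by simp
qed

lemma (in branch_system) T_eq_transfer: "T = transfer W A h d"
  by (intro ext) (simp add: T_def transfer_def)

section \<open>Images of step functions lie in the Besov space\<close>

lemma lq_finite_geometric:
  assumes q: "q \<ge> 1" and a: "\<And>k. 0 \<le> a k" "\<And>k. a k \<le> C * r ^ k" and r: "0 < r" "r < 1" and C: "0 \<le> C"
  shows "lq_finite q a"
proof (cases "q = \<infinity>")
  case True
  have "a k \<le> C" for k
    using a(2)[of k] C mult_left_mono[of "r ^ k" 1 C] power_le_one[of r k] r by simp
  then show ?thesis using True by (auto simp: lq_finite_def intro!: bdd_aboveI[of _ C])
next
  case False
  define b where "b = enn2real q"
  have b: "b \<ge> 1" using q_ge_1[OF q False] by (simp add: b_def)
  have "summable (\<lambda>k. a k powr b)"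
  proof (rule summable_comparison_test)
    have "norm (a k powr b) \<le> C powr b * (r powr b) ^ k" for k
    proof -
      have "a k powr b \<le> (C * r ^ k) powr b" using a b by (intro powr_mono2) auto
      also have "\<dots> = C powr b * (r powr b) ^ k"
        using r by (simp add: powr_mult powr_realpow[symmetric] powr_powr mult.commute)
      finally show ?thesis by simp
    qed
    then show "\<exists>N. \<forall>n\<ge>N. norm (a n powr b) \<le> C powr b * (r powr b) ^ n" by blast
    have "r powr b < 1 powr b" using r b by (intro powr_less_mono2) auto
    then show "summable (\<lambda>n. C powr b * (r powr b) ^ n)"
      by (intro summable_mult summable_geometric) simp
  qed
  then show ?thesis using False by (simp add: lq_finite_def b_def)
qed

context branch_system
begin

definition piece_const :: "real \<Rightarrow> nat \<Rightarrow> real" where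
  "piece_const p j = c / 2 ^ m * (2 powr p * (c * 2 ^ m / 2 ^ j) + 2) powr (1 / p)"

lemma en_davg_G_le:
  assumes p: "p \<ge> 1" and \<beta>p: "\<beta> * p \<le> 1" and w: "w \<in> W" and i: "i < 2 ^ j"
  shows "en p (Suc K) (\<lambda>l. davg (Suc K) l (G j w i)) \<le> piece_const p j * (1 / 2 ^ K) powr \<beta>"
proof -
  define t where "t = ((1 / 2 ^ K) powr \<beta>) powr p"
  have "(\<Sum>l<2 ^ Suc K. norm (davg (Suc K) l (G j w i)) powr p) \<le> (\<Sum>l<2 ^ Suc K. osc_bound K (l div 2) j w i powr p)"
    using davg_G_le[OF w i] p by (intro sum_mono powr_mono2) auto
  also have "\<dots> = 2 * (\<Sum>l<2 ^ K. osc_bound K l j w i powr p)" by (simp add: sum_double sum_distrib_left)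
  finally have "(\<Sum>l<2 ^ Suc K. norm (davg (Suc K) l (G j w i)) powr p) / 2 ^ Suc K \<le> (\<Sum>l<2 ^ K. osc_bound K l j w i powr p) / 2 ^ K"
    by (simp add: field_simps)
  also have "\<dots> \<le> (c / 2 ^ m) powr p * (2 powr p * t * (2 ^ K * (c * 2 ^ m / 2 ^ j)) + 2) / 2 ^ K"
    unfolding t_def by (intro divide_right_mono sum_osc_bound_powr_le p w i) auto
  also have "\<dots> = (c / 2 ^ m) powr p * (2 powr p * t * (c * 2 ^ m / 2 ^ j) + 2 * (1 / 2 ^ K))"
    by (simp add: field_simps)
  also have "\<dots> \<le> (c / 2 ^ m) powr p * (2 powr p * t * (c * 2 ^ m / 2 ^ j) + 2 * t)"
  proof (intro mult_left_mono add_left_mono)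
    have "(1 / 2 ^ K :: real) powr 1 \<le> (1 / 2 ^ K) powr (\<beta> * p)" using \<beta>p by (intro powr_mono') auto
    then show "1 / 2 ^ K \<le> t" by (simp add: t_def powr_powr)
  qed auto
  also have "\<dots> = (c / 2 ^ m) powr p * (2 powr p * (c * 2 ^ m / 2 ^ j) + 2) * t" by (simp add: algebra_simps)
  also have "\<dots> = (piece_const p j * (1 / 2 ^ K) powr \<beta>) powr p"
  proof -
    have "piece_const p j powr p = (c / 2 ^ m) powr p * (2 powr p * (c * 2 ^ m / 2 ^ j) + 2)"
    proof -
      define X where "X = 2 powr p * (c * 2 ^ m / 2 ^ j) + 2"
      have "0 \<le> X" using c by (simp add: X_def)
      then have "(X powr (1 / p)) powr p = X" using p by (simp add: powr_powr)
      then show ?thesis by (simp only: piece_const_def powr_mult X_def)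
    qed
    then show ?thesis by (simp only: powr_mult t_def)
  qed
  finally show ?thesis using p c by (simp add: en_le_iff piece_const_def)
qed

text \<open>Qualitative companion of \<open>en_davg_T_step_high\<close> for a single step function,
  at every level and whatever \<kappa> is. The constant depends on j, v and the branches; what
  counts is the exponential decay, since \<open>s < \<beta>\<close>. It handles the finite rank
  part.\<close>

lemma bl_T_step_geometric:
  assumes p: "p \<ge> 1" and \<beta>p: "\<beta> * p \<le> 1"
  shows "\<exists>C\<ge>0. \<forall>k. bl s p (T (step j v)) k \<le> C * (2 powr (s - \<beta>)) ^ k"
proof -
  let ?Z = "W \<times> {..<(2::nat) ^ j}"
  define C where "C = 2 powr \<beta> * (\<Sum>z\<in>?Z. norm (v (snd z)) * piece_const p j)"
  have C0: "0 \<le> C" using c by (auto simp: C_def piece_const_def intro!: sum_nonneg mult_nonneg_nonneg)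
  have "bl s p (T (step j v)) (Suc K) \<le> C * (2 powr (s - \<beta>)) ^ Suc K" for K
  proof -
    have "davg (Suc K) l (T (step j v)) = (\<Sum>z\<in>?Z. v (snd z) * complex_of_real (davg (Suc K) l (G j (fst z) (snd z))))"
      if l: "l < 2 ^ Suc K" for l
      using l by (simp add: davg_def avg_T_step case_prod_unfold sum_subtractf[symmetric] right_diff_distrib)
    then have "en p (Suc K) (\<lambda>l. davg (Suc K) l (T (step j v)))
        = en p (Suc K) (\<lambda>l. \<Sum>z\<in>?Z. v (snd z) * complex_of_real (davg (Suc K) l (G j (fst z) (snd z))))"
      by (intro en_cong) simp
    also have "\<dots> \<le> (\<Sum>z\<in>?Z. en p (Suc K) (\<lambda>l. v (snd z) * complex_of_real (davg (Suc K) l (G j (fst z) (snd z)))))"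
      by (rule en_sum[OF p])
    also have "\<dots> = (\<Sum>z\<in>?Z. norm (v (snd z)) * en p (Suc K) (\<lambda>l. davg (Suc K) l (G j (fst z) (snd z))))"
    proof (intro sum.cong refl)
      fix z
      have "en p (Suc K) (\<lambda>l. complex_of_real (davg (Suc K) l (G j (fst z) (snd z)))) = en p (Suc K) (\<lambda>l. davg (Suc K) l (G j (fst z) (snd z)))"
        by (simp add: en_def)
      then show "en p (Suc K) (\<lambda>l. v (snd z) * complex_of_real (davg (Suc K) l (G j (fst z) (snd z))))
          = norm (v (snd z)) * en p (Suc K) (\<lambda>l. davg (Suc K) l (G j (fst z) (snd z)))"
        by (simp add: en_cmult[OF p])
    qed
    also have "\<dots> \<le> (\<Sum>z\<in>?Z. norm (v (snd z)) * (piece_const p j * (1 / 2 ^ K) powr \<beta>))"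
      by (intro sum_mono mult_left_mono en_davg_G_le[OF p \<beta>p]) auto
    also have "\<dots> = (\<Sum>z\<in>?Z. norm (v (snd z)) * piece_const p j) * (1 / 2 ^ K) powr \<beta>"
      by (simp add: sum_distrib_right mult.assoc)
    finally have "bl s p (T (step j v)) (Suc K)
        \<le> 2 powr (real (Suc K) * s) * ((\<Sum>z\<in>?Z. norm (v (snd z)) * piece_const p j) * (1 / 2 ^ K) powr \<beta>)"
      unfolding bl_def by (intro mult_left_mono) auto
    also have "\<dots> = (\<Sum>z\<in>?Z. norm (v (snd z)) * piece_const p j) * (2 powr (real (Suc K) * s) * (1 / 2 ^ K) powr \<beta>)"
      by (simp only: mult_ac)
    also have "2 powr (real (Suc K) * s) * (1 / 2 ^ K) powr \<beta> = 2 powr \<beta> * (2 powr (s - \<beta>)) ^ Suc K"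
    proof -
      have "(1 / 2 ^ K :: real) = 2 powr (- real K)" by (simp add: powr_minus_divide powr_realpow)
      then have "2 powr (real (Suc K) * s) * (1 / 2 ^ K) powr \<beta> = 2 powr (real (Suc K) * s + - real K * \<beta>)"
        by (simp only: powr_powr powr_add)
      also have "real (Suc K) * s + - real K * \<beta> = \<beta> + (s - \<beta>) * real (Suc K)" by (simp add: algebra_simps)
      also have "2 powr (\<beta> + (s - \<beta>) * real (Suc K)) = 2 powr \<beta> * (2 powr (s - \<beta>)) powr real (Suc K)"
        by (simp only: powr_powr powr_add)
      also have "(2 powr (s - \<beta>)) powr real (Suc K) = (2 powr (s - \<beta>)) ^ Suc K"
        by (rule powr_realpow) simp
      finally show ?thesis .
    qed
    finally show ?thesis by (simp only: C_def mult_ac)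
  qed
  then have "bl s p (T (step j v)) k \<le> (C + bl s p (T (step j v)) 0) * (2 powr (s - \<beta>)) ^ k" for k
    using C0 bl_nonneg[of s p "T (step j v)" 0]
    by (cases k) (auto simp: distrib_right intro: order_trans add_increasing2)
  then show ?thesis using C0 bl_nonneg[of s p "T (step j v)" 0]
    by (intro exI[of _ "C + bl s p (T (step j v)) 0"]) auto
qed

end

text \<open>Constant of a single group, times the two-sided geometric sum over the distance of input
  and output levels, times the geometric sum over the groups m.\<close>

definition schur_const :: "real \<Rightarrow> real \<Rightarrow> real \<Rightarrow> real \<Rightarrow> real" where
  "schur_const c p s \<beta> = (2 * c + 2 powr \<beta> * branch_system.high_const c p)
     * (2 / (1 - 2 powr (- min s (\<beta> - s)))) * (1 / (1 - 2 powr (- (1 - 1 / p + s))))"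

text \<open>\<open>mm\<close> sorts the branches by contraction. All groups share N, c, \<beta> and
  \<kappa>; empty groups satisfy the conditions vacuously, so m may range over all naturals.\<close>

locale branch_family =
  fixes W :: "'w set" and A :: "'w \<Rightarrow> real set" and h d :: "'w \<Rightarrow> real \<Rightarrow> real"
    and mm :: "'w \<Rightarrow> nat" and N :: nat and c \<beta> \<kappa> :: real
  assumes finite_W: "finite W"
    and systems: "\<And>m. branch_system {w \<in> W. mm w = m} A h d m N c \<beta> \<kappa>"
begin

abbreviation (input) "TT \<equiv> transfer W A h d"

lemma L1:
  assumes \<psi>: "\<psi> absolutely_integrable_on {0..1}"
  shows "TT \<psi> absolutely_integrable_on {0..1}"
    and "integral {0..1} (\<lambda>x. norm (TT \<psi> x)) \<le> real (card W) * integral {0..1} (\<lambda>x. norm (\<psi> x))"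
proof -
  have 1: "w \<in> W \<Longrightarrow> w \<in> {v \<in> W. mm v = mm w}" for w by simp
  note facts = branch_system.A_int[OF systems 1] branch_system.A_sub[OF systems 1]
    branch_system.h_sub[OF systems 1] branch_system.deriv[OF systems 1] branch_system.inj[OF systems 1]
  show "TT \<psi> absolutely_integrable_on {0..1}"
    by (rule transfer_L1(1)[OF finite_W \<psi> facts])
  show "integral {0..1} (\<lambda>x. norm (TT \<psi> x)) \<le> real (card W) * integral {0..1} (\<lambda>x. norm (\<psi> x))"
    by (rule transfer_L1(2)[OF finite_W \<psi> facts])
qed

lemma TT_groups: "TT \<phi> x = (\<Sum>m\<in>mm ` W. transfer {w \<in> W. mm w = m} A h d \<phi> x)"
  unfolding transfer_def by (rule sum.group[symmetric]) (use finite_W in auto)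

lemma c_ge_1: "1 \<le> c"
  using systems branch_system.c by blast

lemma high_const_nonneg: "0 \<le> branch_system.high_const c p"
  unfolding branch_system.high_const_def[OF systems] by simp

text \<open>A group sends level j to level j - m up to exponential tails. Towards coarser levels the
  decay comes from the smoothness weight alone, with rate s; towards finer levels the gain \<beta>
  is reduced by the growth of that weight, with rate \<beta> - s.\<close>

lemma bl_group_step_le:
  assumes p: "p \<ge> 1" and \<beta>p: "\<beta> * p \<le> 1" and s: "0 < s" "s < \<beta>" and mj: "m \<le> j" and small: "1 / 2 ^ (j - m) \<le> \<kappa>"
  shows "bl s p (transfer {w \<in> W. mm w = m} A h d (step j v)) k
    \<le> (2 * c + 2 powr \<beta> * branch_system.high_const c p) * (real N powr (1 - 1 / p) * (2 powr (- (1 - 1 / p + s))) ^ m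
       * (2 powr (- min s (\<beta> - s))) ^ nat \<bar>int k + int m - int j\<bar>) * (2 powr (real j * s) * en p j v)"
proof -
  interpret branch_system "{w \<in> W. mm w = m}" A h d m N c \<beta> \<kappa> by (rule systems)
  define \<theta> where "\<theta> = min s (\<beta> - s)"
  define H where "H = high_const p"
  define E where "E = en p j v"
  have H: "0 \<le> H" unfolding H_def by (rule high_const_nonneg)
  have E: "0 \<le> E" by (simp add: E_def en_nonneg)
  have p': "0 \<le> 1 - 1 / p" using p by simp
  define X where "X = real N powr (1 - 1 / p) * 2 powr (- (real m * (1 - 1 / p)))"
  have X: "(real N / 2 ^ m) powr (1 - 1 / p) = X" "0 \<le> X"
  proof -
    have "(2 ^ m :: real) powr (1 - 1 / p) = 2 powr (real m * (1 - 1 / p))"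
      by (simp add: powr_realpow[symmetric] powr_powr)
    then show "(real N / 2 ^ m) powr (1 - 1 / p) = X"
      by (simp add: X_def powr_divide powr_minus_divide)
    show "0 \<le> X" by (simp add: X_def)
  qed
  \<comment> \<open>Signed distance of the output level k from the expected level j - m.\<close>
  define i where "i = int k + int m - int j"
  have "en p k (\<lambda>l. davg k l (T (step j v))) * 2 powr (real k * s)
      \<le> (2 * c + 2 powr \<beta> * H) * X * 2 powr (- (real m * s)) * 2 powr (- \<theta> * \<bar>real_of_int i\<bar>) * (2 powr (real j * s) * E)"
  proof (cases "k + m \<le> j")
    case True
    have "en p k (\<lambda>l. davg k l (T (step j v))) \<le> 2 * en p k (\<lambda>l. avg k l (T (step j v)))"
      by (rule en_davg_le[OF p abs_int_T_step])
    also have "\<dots> \<le> 2 * ((c * real N / 2 ^ m) powr (1 - 1 / p) * E)"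
      unfolding E_def by (intro mult_left_mono en_avg_T_step p) auto
    also have "(c * real N / 2 ^ m) powr (1 - 1 / p) = c powr (1 - 1 / p) * X"
      by (simp add: X(1)[symmetric] powr_mult[symmetric])
    also have "2 * (c powr (1 - 1 / p) * X * E) \<le> 2 * (c * X * E)"
      using c X E p powr_mono[of "1 - 1 / p" 1 c] by (intro mult_left_mono mult_right_mono) auto
    also have "\<dots> \<le> (2 * c + 2 powr \<beta> * H) * X * E"
      using H X E by (simp add: algebra_simps)
    finally have 1: "en p k (\<lambda>l. davg k l (T (step j v))) * 2 powr (real k * s) \<le> (2 * c + 2 powr \<beta> * H) * X * E * 2 powr (real k * s)"
      by (rule mult_right_mono) simp
    have "real k + real m \<le> real j" using True by linarith
    then have "\<bar>real_of_int i\<bar> = real j - real k - real m" by (simp add: i_def)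
    then have rk: "real k = real j - real m - \<bar>real_of_int i\<bar>" by linarith
    have "real k * s = - (real m * s) + real j * s - s * \<bar>real_of_int i\<bar>"
      by (subst rk) (simp add: algebra_simps)
    then have "2 powr (real k * s) = 2 powr (- (real m * s)) * 2 powr (real j * s) * 2 powr (- s * \<bar>real_of_int i\<bar>)"
      by (simp add: powr_add[symmetric])
    also have "\<dots> \<le> 2 powr (- (real m * s)) * 2 powr (real j * s) * 2 powr (- \<theta> * \<bar>real_of_int i\<bar>)"
      by (intro mult_left_mono powr_mono) (auto simp: \<theta>_def intro!: mult_right_mono)
    finally have "(2 * c + 2 powr \<beta> * H) * X * E * 2 powr (real k * s)
        \<le> (2 * c + 2 powr \<beta> * H) * X * E * (2 powr (- (real m * s)) * 2 powr (real j * s) * 2 powr (- \<theta> * \<bar>real_of_int i\<bar>))"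
      using H X E c by (intro mult_left_mono) auto
    from order_trans[OF 1 this] show ?thesis by (simp only: mult_ac)
  next
    case False
    \<comment> \<open>Since m <= j, this case excludes k = 0, so k has a parent level K, and j <= K
      + m is what the fine level estimate requires.\<close>
    then obtain K where K: "k = Suc K" "j \<le> K + m" using mj by (cases k) auto
    have "(1 / 2 ^ K :: real) \<le> 1 / 2 ^ (j - m)" using K by (intro divide_left_mono power_increasing) auto
    then have sK: "1 / 2 ^ K \<le> \<kappa>" using small by linarith
    have "(1 / 2 ^ j :: real) \<le> 1 / 2 ^ (j - m)" by (intro divide_left_mono power_increasing) auto
    then have sj: "1 / 2 ^ j \<le> \<kappa>" using small by linarith
    \<comment> \<open>The parent level is one below k, whence \<open>1 - i\<close> in place of
      \<open>- i\<close> and the factor \<open>2 powr \<beta>\<close> in the constant.\<close>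
    have "(2::real) ^ j / (2 ^ m * 2 ^ K) = 2 powr (1 - real_of_int i)"
      using K by (simp add: i_def powr_diff powr_add powr_realpow field_simps)
    then have \<tau>: "(2 ^ j / (2 ^ m * 2 ^ K)) powr \<beta> = 2 powr \<beta> * 2 powr (- \<beta> * real_of_int i)"
      by (simp add: powr_powr powr_add[symmetric] algebra_simps)
    have "en p k (\<lambda>l. davg k l (T (step j v))) \<le> H * X * (2 powr \<beta> * 2 powr (- \<beta> * real_of_int i)) * E"
      using en_davg_T_step_high[OF p \<beta>p sK sj K(2) mj, of v] unfolding X(1) \<tau> K(1) H_def E_def by simp
    also have "\<dots> \<le> (2 * c + 2 powr \<beta> * H) * X * 2 powr (- \<beta> * real_of_int i) * E"
      using c X E by (simp add: algebra_simps)
    finally have 1: "en p k (\<lambda>l. davg k l (T (step j v))) * 2 powr (real k * s)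
        \<le> (2 * c + 2 powr \<beta> * H) * X * 2 powr (- \<beta> * real_of_int i) * E * 2 powr (real k * s)"
      by (rule mult_right_mono) simp
    have ex: "- \<beta> * real_of_int i + real k * s = - (real m * s) + real j * s + - (\<beta> - s) * \<bar>real_of_int i\<bar>"
      using K by (simp add: i_def algebra_simps)
    have "2 powr (- \<beta> * real_of_int i) * 2 powr (real k * s)
        = 2 powr (- (real m * s)) * 2 powr (real j * s) * 2 powr (- (\<beta> - s) * \<bar>real_of_int i\<bar>)"
      by (simp only: powr_add[symmetric] ex)
    also have "\<dots> \<le> 2 powr (- (real m * s)) * 2 powr (real j * s) * 2 powr (- \<theta> * \<bar>real_of_int i\<bar>)"
    proof (intro mult_left_mono powr_mono)
      have "\<theta> * \<bar>real_of_int i\<bar> \<le> (\<beta> - s) * \<bar>real_of_int i\<bar>"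
        by (rule mult_right_mono) (auto simp: \<theta>_def)
      then show "- (\<beta> - s) * \<bar>real_of_int i\<bar> \<le> - \<theta> * \<bar>real_of_int i\<bar>" by (simp only: mult_minus_left neg_le_iff_le)
    qed auto
    finally have "(2 * c + 2 powr \<beta> * H) * X * E * (2 powr (- \<beta> * real_of_int i) * 2 powr (real k * s))
        \<le> (2 * c + 2 powr \<beta> * H) * X * E * (2 powr (- (real m * s)) * 2 powr (real j * s) * 2 powr (- \<theta> * \<bar>real_of_int i\<bar>))"
      using H X E c by (intro mult_left_mono) auto
    moreover have "en p k (\<lambda>l. davg k l (T (step j v))) * 2 powr (real k * s)
        \<le> (2 * c + 2 powr \<beta> * H) * X * E * (2 powr (- \<beta> * real_of_int i) * 2 powr (real k * s))"
      using 1 by (simp only: mult_ac)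
    ultimately have "en p k (\<lambda>l. davg k l (T (step j v))) * 2 powr (real k * s)
        \<le> (2 * c + 2 powr \<beta> * H) * X * E * (2 powr (- (real m * s)) * 2 powr (real j * s) * 2 powr (- \<theta> * \<bar>real_of_int i\<bar>))"
      by (rule order_trans[rotated])
    then show ?thesis by (simp only: mult_ac)
  qed
  also have "2 powr (- \<theta> * \<bar>real_of_int i\<bar>) = (2 powr (- \<theta>)) ^ nat \<bar>i\<bar>"
    by (simp add: powr_realpow[symmetric] powr_powr)
  also have "(2 * c + 2 powr \<beta> * H) * X * 2 powr (- (real m * s)) * (2 powr (- \<theta>)) ^ nat \<bar>i\<bar> * (2 powr (real j * s) * E)
     = (2 * c + 2 powr \<beta> * H) * (real N powr (1 - 1 / p) * (2 powr (- (1 - 1 / p + s))) ^ m * (2 powr (- \<theta>)) ^ nat \<bar>i\<bar>) * (2 powr (real j * s) * E)"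
  proof -
    have "2 powr (- (real m * (1 - 1 / p))) * 2 powr (- (real m * s)) = (2 powr (- (1 - 1 / p + s))) ^ m"
      by (simp add: powr_realpow[symmetric] powr_powr powr_add[symmetric] algebra_simps)
    then have "X * 2 powr (- (real m * s)) = real N powr (1 - 1 / p) * (2 powr (- (1 - 1 / p + s))) ^ m"
      by (simp add: X_def)
    then show ?thesis by (simp add: mult.assoc[symmetric])
  qed
  finally show ?thesis
    by (simp only: bl_def T_eq_transfer H_def E_def \<theta>_def i_def mult.commute[of "en p k _"])
qed

text \<open>Without the first \<open>L\<close> differences the Schur kernel is supported on input
  levels j >= L. There, for every group, cells of generation j - m are no longer than \<kappa>, as
  \<open>bl_group_step_le\<close> demands. The parameter \<rho> carries the contraction of the
  slowest branch into the bound.\<close>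

theorem lqb_high_frequency:
  assumes p: "p \<ge> 1" and \<beta>p: "\<beta> * p \<le> 1" and s: "0 < s" "s < \<beta>" and q: "q \<ge> 1"
    and L: "\<And>w. w \<in> W \<Longrightarrow> mm w \<le> L \<and> 1 / 2 ^ (L - mm w) \<le> \<kappa>"
    and \<rho>: "\<And>w. w \<in> W \<Longrightarrow> 1 / 2 ^ mm w \<le> \<rho>"
    and \<psi>: "\<psi> absolutely_integrable_on {0..1}" "lq_finite q (bl s p \<psi>)"
  shows "lqb q (bl s p (TT (\<lambda>x. \<psi> x - partial_series \<psi> L x)))
    (schur_const c p s \<beta> * real N powr (1 - 1 / p) * \<rho> powr (1 - 1 / p + s) * lq_norm q (bl s p \<psi>))"
proof -
  define r where "r = 2 powr (- min s (\<beta> - s))"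
  define \<sigma> where "\<sigma> = 1 - 1 / p + s"
  define C0 where "C0 = 2 * c + 2 powr \<beta> * branch_system.high_const c p"
  define Np where "Np = real N powr (1 - 1 / p)"
  define M where "M = mm ` W"
  define R where "R = schur_const c p s \<beta> * Np * \<rho> powr \<sigma>"
  have "1 / p \<le> 1" using p by simp
  then have \<sigma>: "0 < \<sigma>" unfolding \<sigma>_def using s by linarith
  have r: "0 < r" "r < 1" using s by (auto simp: r_def powr_less_one)
  have C0: "0 \<le> C0" using c_ge_1 high_const_nonneg by (simp add: C0_def)
  have finM: "finite M" using finite_W by (simp add: M_def)
  define t where "t = 2 powr (- \<sigma>)"
  have t: "0 < t" "t < 1" using \<sigma> by (auto simp: t_def powr_less_one)
  \<comment> \<open>Only exponents that occur are summed, so the series starts at the smallest one.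
    Its first term is \<open>(1 / 2 ^ m0) powr \<sigma>\<close>, at most
    \<open>\<rho> powr \<sigma>\<close>; this is the factor that decays with the iterate.\<close>
  have geo: "(\<Sum>m\<in>M. t ^ m) \<le> \<rho> powr \<sigma> * (1 / (1 - t))"
  proof (cases "M = {}")
    case True
    then show ?thesis using t by simp
  next
    case False
    define m0 where "m0 = Min M"
    have m0: "m0 \<in> M" "\<And>m. m \<in> M \<Longrightarrow> m0 \<le> m" using False finM by (auto simp: m0_def)
    have "(\<Sum>m\<in>M. t ^ m) = t ^ m0 * (\<Sum>m\<in>M. t ^ (m - m0))"
      using m0(2) by (simp add: sum_distrib_left power_add[symmetric])
    also have "(\<Sum>m\<in>M. t ^ (m - m0)) = (\<Sum>n\<in>(\<lambda>m. m - m0) ` M. t ^ n)"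
      using m0(2) by (subst sum.reindex) (auto simp: inj_on_def dest!: m0(2) intro: eq_diff_iff[THEN iffD1])
    also have "\<dots> \<le> 1 / (1 - t)"
      using sum_le_suminf[of "\<lambda>n. t ^ n" "(\<lambda>m. m - m0) ` M"] finM t by (simp add: suminf_geometric summable_geometric)
    finally have le: "(\<Sum>m\<in>M. t ^ m) \<le> t ^ m0 * (1 / (1 - t))" using t by (simp add: divide_right_mono)
    have "(1 / 2 ^ m0 :: real) = 2 powr (- real m0)" by (simp add: powr_minus_divide powr_realpow)
    then have "t ^ m0 = (1 / 2 ^ m0) powr \<sigma>"
      using t(1) by (simp add: t_def powr_realpow[symmetric] powr_powr mult.commute)
    also have "(1 / 2 ^ m0 :: real) powr \<sigma> \<le> \<rho> powr \<sigma>"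
      using m0(1) \<rho> \<sigma> by (intro powr_mono2) (auto simp: M_def)
    finally have "t ^ m0 * (1 / (1 - t)) \<le> \<rho> powr \<sigma> * (1 / (1 - t))" using t by (intro mult_right_mono) auto
    then show ?thesis using le by linarith
  qed
  define B where "B = (\<lambda>k j. if L \<le> j then C0 * Np * (\<Sum>m\<in>M. t ^ m * r ^ nat \<bar>int k + int m - int j\<bar>) else 0)"
  have B0: "0 \<le> B k j" for k j using C0 t r by (auto simp: B_def Np_def intro!: mult_nonneg_nonneg sum_nonneg)
  have Bbound: "(\<Sum>z\<in>Z. C0 * Np * (\<Sum>m\<in>M. t ^ m * r ^ nat \<bar>g z m\<bar>)) \<le> R"
    if Z: "finite Z" "\<And>m. inj_on (\<lambda>z. g z m) Z" for Z :: "nat set" and g :: "nat \<Rightarrow> nat \<Rightarrow> int"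
  proof -
    have "(\<Sum>z\<in>Z. C0 * Np * (\<Sum>m\<in>M. t ^ m * r ^ nat \<bar>g z m\<bar>)) = C0 * Np * (\<Sum>m\<in>M. t ^ m * (\<Sum>z\<in>Z. r ^ nat \<bar>g z m\<bar>))"
      unfolding sum_distrib_left by (subst sum.swap) (simp add: mult.assoc)
    also have "\<dots> \<le> C0 * Np * (\<Sum>m\<in>M. t ^ m * (2 / (1 - r)))"
      using C0 t r Z by (intro mult_left_mono sum_mono sum_geometric_shift_le) (auto simp: Np_def)
    also have "\<dots> = C0 * Np * (2 / (1 - r)) * (\<Sum>m\<in>M. t ^ m)"
      unfolding sum_distrib_right[symmetric] by (simp only: mult_ac)
    also have "\<dots> \<le> C0 * Np * (2 / (1 - r)) * (\<rho> powr \<sigma> * (1 / (1 - t)))"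
      using C0 r geo by (intro mult_left_mono) (auto simp: Np_def)
    also have "\<dots> = R" by (simp add: R_def schur_const_def C0_def r_def t_def \<sigma>_def)
    finally show ?thesis .
  qed
  have R0: "0 \<le> R" using Bbound[of "{}"] by simp
  have row: "(\<Sum>j<J. B k j) \<le> R" for k J
  proof -
    have "(\<Sum>j<J. B k j) \<le> (\<Sum>j<J. C0 * Np * (\<Sum>m\<in>M. t ^ m * r ^ nat \<bar>int k + int m - int j\<bar>))"
      using C0 t r by (intro sum_mono) (auto simp: B_def Np_def intro!: mult_nonneg_nonneg sum_nonneg)
    also have "\<dots> \<le> R" by (rule Bbound) (auto simp: inj_on_def)
    finally show ?thesis .
  qed
  have col: "(\<Sum>k<K. B k j) \<le> R" for j K
  proof -
    have "(\<Sum>k<K. B k j) \<le> (\<Sum>k<K. C0 * Np * (\<Sum>m\<in>M. t ^ m * r ^ nat \<bar>int k + int m - int j\<bar>))"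
      using C0 t r by (intro sum_mono) (auto simp: B_def Np_def intro!: mult_nonneg_nonneg sum_nonneg)
    also have "\<dots> \<le> R" by (rule Bbound) (auto simp: inj_on_def)
    finally show ?thesis .
  qed
  define D where "D = (\<lambda>j. step j (\<lambda>i. davg j i \<psi>))"
  \<comment> \<open>Partial sums of the high frequency part, indexed from 0 so that they match the
    rows of the kernel \<open>B\<close>, which vanishes for j below \<open>L\<close>.\<close>
  define S where "S = (\<lambda>J x. \<Sum>j<J. if L \<le> j then D j x else 0)"
  have Dai: "D j absolutely_integrable_on {0..1}" for j by (simp add: D_def abs_int_step)
  have stepbl: "bl s p (TT (D j)) k \<le> B k j * bl s p \<psi> j" if j: "L \<le> j" for j k
  proof -
    have TTD: "TT (D j) = (\<lambda>x. \<Sum>m\<in>M. transfer {w \<in> W. mm w = m} A h d (D j) x)"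
      by (rule ext) (simp add: TT_groups M_def)
    have "bl s p (TT (D j)) k \<le> (\<Sum>m\<in>M. bl s p (transfer {w \<in> W. mm w = m} A h d (D j)) k)"
      using branch_system.abs_int_T_step[OF systems] branch_system.T_eq_transfer[OF systems]
      unfolding TTD by (intro bl_sum_le[OF p finM]) (simp add: D_def)
    also have "\<dots> \<le> (\<Sum>m\<in>M. C0 * (Np * t ^ m * r ^ nat \<bar>int k + int m - int j\<bar>) * bl s p \<psi> j)"
    proof (intro sum_mono)
      fix m assume "m \<in> M"
      then have m: "m \<le> L" "1 / 2 ^ (L - m) \<le> \<kappa>" using L by (auto simp: M_def)
      then have mj: "m \<le> j" using j by simp
      have "(1 / 2 ^ (j - m) :: real) \<le> 1 / 2 ^ (L - m)" using j by (intro divide_left_mono power_increasing) auto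
      then have "1 / 2 ^ (j - m) \<le> \<kappa>" using m by linarith
      from bl_group_step_le[OF p \<beta>p s mj this, of "\<lambda>i. davg j i \<psi>" k]
      show "bl s p (transfer {w \<in> W. mm w = m} A h d (D j)) k \<le> C0 * (Np * t ^ m * r ^ nat \<bar>int k + int m - int j\<bar>) * bl s p \<psi> j"
        by (simp add: D_def C0_def Np_def t_def r_def \<sigma>_def bl_def)
    qed
    also have "\<dots> = B k j * bl s p \<psi> j"
      using j by (simp add: B_def sum_distrib_left sum_distrib_right mult_ac)
    finally show ?thesis .
  qed
  have Sai: "S J absolutely_integrable_on {0..1}" for J
  proof -
    have "(\<lambda>x. if L \<le> j then D j x else 0) absolutely_integrable_on {0..1}" for j
      using Dai[of j] by (cases "L \<le> j") auto
    then show ?thesis unfolding S_def by (intro absolutely_integrable_sum) auto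
  qed
  have sumbl: "bl s p (TT (S J)) k \<le> (\<Sum>j<J. B k j * bl s p \<psi> j)" for J k
  proof -
    define I where "I = {j. j < J \<and> L \<le> j}"
    have S: "S J = (\<lambda>x. \<Sum>j\<in>I. D j x)"
      by (rule ext) (simp add: S_def I_def sum.If_cases Int_def)
    have TTS: "TT (S J) = (\<lambda>x. \<Sum>j\<in>I. TT (D j) x)" unfolding S by (rule ext) (rule transfer_sum)
    have "bl s p (TT (S J)) k \<le> (\<Sum>j\<in>I. bl s p (TT (D j)) k)"
      using L1(1)[OF Dai] unfolding TTS by (intro bl_sum_le[OF p]) (auto simp: I_def)
    also have "\<dots> \<le> (\<Sum>j\<in>I. B k j * bl s p \<psi> j)" by (intro sum_mono stepbl) (simp add: I_def)
    also have "\<dots> \<le> (\<Sum>j<J. B k j * bl s p \<psi> j)"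
      using B0 bl_nonneg by (intro sum_mono2) (auto simp: I_def)
    finally show ?thesis .
  qed
  let ?\<phi> = "\<lambda>x. \<psi> x - partial_series \<psi> L x"
  have \<phi>ai: "?\<phi> absolutely_integrable_on {0..1}" using \<psi>(1) abs_int_partial_series by (rule set_integral_diff(1))
  have Lp\<psi>: "\<psi> \<in> Lp_space leb01 p" and rep: "besov_rep s p q \<psi> (canonical_coeff s p \<psi>)"
    using canonical_rep[OF p s(1) q \<psi>] by auto
  have Lpd: "(\<lambda>x. \<psi> x - partial_series \<psi> J x) \<in> Lp_space leb01 p" for J
  proof (rule Lp_space_diff_step[OF p Lp\<psi>, where B = "\<Sum>k<J. \<Sum>j<2 ^ k. norm (davg k j \<psi>)"])
    show "partial_series \<psi> J \<in> borel_measurable leb01"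
      using abs_int_partial_series by (auto simp: abs_int_iff_integrable)
    fix x :: real assume x: "x \<in> {0..1}"
    show "norm (partial_series \<psi> J x) \<le> (\<Sum>k<J. \<Sum>j<2 ^ k. norm (davg k j \<psi>))"
      unfolding partial_series_def using norm_step_le[OF x] by (intro order_trans[OF norm_sum] sum_mono)
  qed
  have limL1: "(\<lambda>J. integral {0..1} (\<lambda>x. norm (\<psi> x - partial_series \<psi> J x))) \<longlonglongrightarrow> 0"
    using rep canonical_series[OF p s(1) q] by (intro Lp_tendsto_L1[OF p Lpd]) (simp add: besov_rep_def)
  have Sdiff: "?\<phi> x - S J x = \<psi> x - partial_series \<psi> J x" if "L \<le> J" for x J
  proof -
    have "partial_series \<psi> J x = (\<Sum>j<J. if L \<le> j then D j x else 0) + (\<Sum>j<J. if L \<le> j then 0 else D j x)"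
      unfolding partial_series_def sum.distrib[symmetric] by (intro sum.cong) (auto simp: D_def)
    also have "(\<Sum>j<J. if L \<le> j then 0 else D j x) = partial_series \<psi> L x"
      unfolding partial_series_def using that by (intro sum.mono_neutral_cong_right) (auto simp: D_def)
    finally show ?thesis by (simp add: S_def)
  qed
  have Slim: "(\<lambda>J. integral {0..1} (\<lambda>x. norm (?\<phi> x - S J x))) \<longlonglongrightarrow> 0"
    by (rule Lim_transform_eventually[OF limL1]) (rule eventually_sequentiallyI[of L], simp only: Sdiff)
  \<comment> \<open>The limit is carried through the operator in \<open>L^1\<close>, where
    boundedness is at hand; boundedness on the Besov space is itself a consequence of this
    theorem.\<close>
  have TSlim: "(\<lambda>J. integral {0..1} (\<lambda>x. norm (TT ?\<phi> x - TT (S J) x))) \<longlonglongrightarrow> 0"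
  proof (rule tendsto_sandwich[OF _ _ tendsto_const])
    show "\<forall>\<^sub>F J in sequentially. integral {0..1} (\<lambda>x. norm (TT ?\<phi> x - TT (S J) x))
        \<le> real (card W) * integral {0..1} (\<lambda>x. norm (?\<phi> x - S J x))"
    proof (rule always_eventually, rule allI)
      fix J
      have "(\<lambda>x. ?\<phi> x - S J x) absolutely_integrable_on {0..1}" using \<phi>ai Sai by (rule set_integral_diff(1))
      from L1(2)[OF this] show "integral {0..1} (\<lambda>x. norm (TT ?\<phi> x - TT (S J) x))
        \<le> real (card W) * integral {0..1} (\<lambda>x. norm (?\<phi> x - S J x))"
        by (simp only: transfer_diff[of W A h d ?\<phi> "S J"])
    qed
    show "(\<lambda>J. real (card W) * integral {0..1} (\<lambda>x. norm (?\<phi> x - S J x))) \<longlonglongrightarrow> 0"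
      using tendsto_mult[OF tendsto_const Slim] by simp
    show "\<forall>\<^sub>F J in sequentially. 0 \<le> integral {0..1} (\<lambda>x. norm (TT ?\<phi> x - TT (S J) x))"
    proof (rule always_eventually, rule allI)
      fix J
      have "(\<lambda>x. TT ?\<phi> x - TT (S J) x) absolutely_integrable_on {0..1}"
        using L1(1)[OF \<phi>ai] L1(1)[OF Sai] by (rule set_integral_diff(1))
      then show "0 \<le> integral {0..1} (\<lambda>x. norm (TT ?\<phi> x - TT (S J) x))"
        by (intro integral_nonneg) (auto simp: absolutely_integrable_on_def)
    qed
  qed
  have "\<exists>e. e \<longlonglongrightarrow> 0 \<and> (\<forall>J. bl s p (TT ?\<phi>) k \<le> bl s p (TT (S J)) k + e J)" for k
    using bl_limit_le[OF p L1(1)[OF \<phi>ai] L1(1)[OF Sai] TSlim] by metis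
  then have "\<exists>e. e \<longlonglongrightarrow> 0 \<and> (\<forall>J. bl s p (TT ?\<phi>) k \<le> (\<Sum>j<J. B k j * bl s p \<psi> j) + e J)" for k
    using sumbl by (meson add_right_mono order_trans)
  then have "lqb q (bl s p (TT ?\<phi>)) (R * lq_norm q (bl s p \<psi>))"
    by (intro lqb_schur[OF q lqb_lq_norm[OF q bl_nonneg \<psi>(2)] bl_nonneg B0 row col bl_nonneg])
  then show ?thesis by (simp add: R_def Np_def \<sigma>_def)
qed

lemma lq_finite_bl_TT_step:
  assumes p: "p \<ge> 1" and \<beta>p: "\<beta> * p \<le> 1" and s: "s < \<beta>" and q: "q \<ge> 1"
  shows "lq_finite q (bl s p (TT (step j v)))"
proof -
  define M where "M = mm ` W"
  have finM: "finite M" using finite_W by (simp add: M_def)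
  have "\<exists>C\<ge>0. \<forall>k. bl s p (transfer {w \<in> W. mm w = m} A h d (step j v)) k \<le> C * (2 powr (s - \<beta>)) ^ k" for m
    using branch_system.bl_T_step_geometric[OF systems p \<beta>p] by (simp add: branch_system.T_eq_transfer[OF systems])
  then obtain C where C: "\<And>m. 0 \<le> C m"
    "\<And>m k. bl s p (transfer {w \<in> W. mm w = m} A h d (step j v)) k \<le> C m * (2 powr (s - \<beta>)) ^ k"
    by metis
  have TTD: "TT (step j v) = (\<lambda>x. \<Sum>m\<in>M. transfer {w \<in> W. mm w = m} A h d (step j v) x)"
    by (rule ext) (simp add: TT_groups M_def)
  have "bl s p (TT (step j v)) k \<le> (\<Sum>m\<in>M. C m) * (2 powr (s - \<beta>)) ^ k" for k
  proof -
    have "bl s p (TT (step j v)) k \<le> (\<Sum>m\<in>M. bl s p (transfer {w \<in> W. mm w = m} A h d (step j v)) k)"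
      using branch_system.abs_int_T_step[OF systems] branch_system.T_eq_transfer[OF systems]
      unfolding TTD by (intro bl_sum_le[OF p finM]) simp
    also have "\<dots> \<le> (\<Sum>m\<in>M. C m * (2 powr (s - \<beta>)) ^ k)" by (intro sum_mono C(2))
    finally show ?thesis by (simp add: sum_distrib_right)
  qed
  then show ?thesis
    using s C(1) by (intro lq_finite_geometric[OF q bl_nonneg]) (auto intro!: sum_nonneg simp: powr_less_one)
qed

end

section \<open>Iterates of an expanding map\<close>

text \<open>\<open>lam\<close> bounds derivatives and appears in the final rate; \<alpha> compares
  distances of points and drives distortion and separation. Here g and d are the inverse branches
  and their derivatives.\<close>

locale expanding_branches =
  fixes \<Lambda> :: "'i set" and J :: "'i \<Rightarrow> real set" and f :: "real \<Rightarrow> real"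
    and g d :: "'i \<Rightarrow> real \<Rightarrow> real" and \<alpha> lam Lc Hc \<beta> :: real
  assumes finite_\<Lambda>: "finite \<Lambda>"
    and J_int: "i \<in> \<Lambda> \<Longrightarrow> is_interval (J i)" and J_sub: "i \<in> \<Lambda> \<Longrightarrow> J i \<subseteq> {0..1}"
    and J_disj: "i \<in> \<Lambda> \<Longrightarrow> j \<in> \<Lambda> \<Longrightarrow> x \<in> J i \<Longrightarrow> x \<in> J j \<Longrightarrow> i = j"
    and J_cover: "x \<in> {0..1} \<Longrightarrow> \<exists>i\<in>\<Lambda>. x \<in> J i"
    and f01: "x \<in> {0..1} \<Longrightarrow> f x \<in> {0..1}"
    and f_cont: "i \<in> \<Lambda> \<Longrightarrow> continuous_on (J i) f"
    and fg: "i \<in> \<Lambda> \<Longrightarrow> x \<in> f ` J i \<Longrightarrow> g i x \<in> J i" "i \<in> \<Lambda> \<Longrightarrow> x \<in> f ` J i \<Longrightarrow> f (g i x) = x"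
    and gf: "i \<in> \<Lambda> \<Longrightarrow> x \<in> J i \<Longrightarrow> g i (f x) = x"
    and g_der: "i \<in> \<Lambda> \<Longrightarrow> x \<in> f ` J i \<Longrightarrow> (g i has_field_derivative d i x) (at x within f ` J i)"
    and d_le: "i \<in> \<Lambda> \<Longrightarrow> x \<in> f ` J i \<Longrightarrow> \<bar>d i x\<bar> \<le> 1 / lam"
    and d_ge: "i \<in> \<Lambda> \<Longrightarrow> x \<in> f ` J i \<Longrightarrow> 1 / Lc \<le> \<bar>d i x\<bar>"
    and d_holder: "i \<in> \<Lambda> \<Longrightarrow> x \<in> f ` J i \<Longrightarrow> y \<in> f ` J i \<Longrightarrow> \<bar>d i x - d i y\<bar> \<le> Hc * \<bar>x - y\<bar> powr \<beta>"
    and expand: "i \<in> \<Lambda> \<Longrightarrow> x \<in> J i \<Longrightarrow> y \<in> J i \<Longrightarrow> \<alpha> * \<bar>x - y\<bar> \<le> \<bar>f x - f y\<bar>"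
    and \<alpha>: "\<alpha> > 1" and lam: "lam \<ge> 1" and Lc: "Lc > 0" and Hc: "Hc \<ge> 0" and \<beta>: "\<beta> > 0"
begin

text \<open>Words list inverse branches in the order of application: the head acts first, so it is
  the last symbol in the forward itinerary of \<open>wbr w x\<close>. The empty word has domain
  \<open>UNIV\<close>; domains lie in the unit interval from length 1 on.\<close>

primrec wdom :: "'i list \<Rightarrow> real set" where
  "wdom [] = UNIV"
| "wdom (i # w) = {x \<in> f ` J i. g i x \<in> wdom w}"

primrec wbr :: "'i list \<Rightarrow> real \<Rightarrow> real" where
  "wbr [] x = x"
| "wbr (i # w) x = wbr w (g i x)"

primrec wder :: "'i list \<Rightarrow> real \<Rightarrow> real" where
  "wder [] x = 1"
| "wder (i # w) x = wder w (g i x) * d i x"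

definition words :: "nat \<Rightarrow> 'i list set" where
  "words n = {w. set w \<subseteq> \<Lambda> \<and> length w = n}"

lemma finite_words: "finite (words n)"
  unfolding words_def using finite_\<Lambda> by (rule finite_lists_length_eq)

lemma words_Suc: "words (Suc n) = (\<lambda>(i, w). i # w) ` (\<Lambda> \<times> words n)"
proof (intro set_eqI iffI)
  fix w assume "w \<in> words (Suc n)"
  then obtain i v where "w = i # v" "i \<in> \<Lambda>" "v \<in> words n"
    by (cases w) (auto simp: words_def)
  then show "w \<in> (\<lambda>(i, w). i # w) ` (\<Lambda> \<times> words n)" by (intro image_eqI[of _ _ "(i, v)"]) auto
qed (auto simp: words_def)

abbreviation (input) "TR \<equiv> transfer \<Lambda> (\<lambda>i. f ` J i) g d"

lemma transfer_iterate: "(TR ^^ n) \<psi> = transfer (words n) wdom wbr wder \<psi>"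
proof (induction n)
  case 0
  have "words 0 = {[]}" by (auto simp: words_def)
  then show ?case by (intro ext) (simp add: transfer_def)
next
  case (Suc n)
  show ?case
  proof
    fix x
    have inj: "inj_on (\<lambda>(i, w). i # w) (\<Lambda> \<times> words n)" by (auto simp: inj_on_def)
    have "transfer (words (Suc n)) wdom wbr wder \<psi> x
        = (\<Sum>(i, w)\<in>\<Lambda> \<times> words n. if x \<in> wdom (i # w) then complex_of_real \<bar>wder (i # w) x\<bar> * \<psi> (wbr (i # w) x) else 0)"
      unfolding transfer_def words_Suc by (subst sum.reindex[OF inj]) (simp add: case_prod_unfold)
    also have "\<dots> = (\<Sum>i\<in>\<Lambda>. \<Sum>w\<in>words n. if x \<in> wdom (i # w) then complex_of_real \<bar>wder (i # w) x\<bar> * \<psi> (wbr (i # w) x) else 0)"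
      by (rule sum.cartesian_product[symmetric])
    also have "\<dots> = TR (transfer (words n) wdom wbr wder \<psi>) x"
      unfolding transfer_def by (intro sum.cong refl) (auto simp: sum_distrib_left abs_mult intro!: sum.cong)
    finally show "(TR ^^ Suc n) \<psi> x = transfer (words (Suc n)) wdom wbr wder \<psi> x" using Suc by simp
  qed
qed

lemma g01: "i \<in> \<Lambda> \<Longrightarrow> x \<in> f ` J i \<Longrightarrow> g i x \<in> {0..1}"
  using fg(1)[of i x] J_sub[of i] by blast

lemma fJ01: "i \<in> \<Lambda> \<Longrightarrow> f ` J i \<subseteq> {0..1}"
  using J_sub by (intro image_subsetI f01) blast

lemma g_contract:
  assumes "i \<in> \<Lambda>" "x \<in> f ` J i" "y \<in> f ` J i"
  shows "\<bar>g i x - g i y\<bar> \<le> \<bar>x - y\<bar> / \<alpha>"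
  using expand[OF assms(1) fg(1)[OF assms(1,2)] fg(1)[OF assms(1,3)]] fg(2)[OF assms(1,2)] fg(2)[OF assms(1,3)] \<alpha>
  by (simp add: field_simps)

lemma wdom_sub: "set w \<subseteq> \<Lambda> \<Longrightarrow> w \<noteq> [] \<Longrightarrow> wdom w \<subseteq> {0..1}"
  using fJ01 by (cases w) auto

lemma wdom_interval: "set w \<subseteq> \<Lambda> \<Longrightarrow> is_interval (wdom w)"
proof (induction w)
  case (Cons i w)
  then have i: "i \<in> \<Lambda>" and IH: "is_interval (wdom w)" by auto
  have eq: "wdom (i # w) = f ` (J i \<inter> wdom w)"
  proof (intro set_eqI iffI)
    fix x assume "x \<in> wdom (i # w)"
    then have x: "x \<in> f ` J i" "g i x \<in> wdom w" by auto
    then have "x = f (g i x)" "g i x \<in> J i" using fg[OF i] by auto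
    then show "x \<in> f ` (J i \<inter> wdom w)" using x by blast
  next
    fix x assume "x \<in> f ` (J i \<inter> wdom w)"
    then show "x \<in> wdom (i # w)" using gf[OF i] by auto
  qed
  have "connected (J i \<inter> wdom w)"
    using is_interval_Int[OF J_int[OF i] IH] by (simp add: is_interval_connected_1)
  then have "connected (wdom (i # w))"
    unfolding eq using f_cont[OF i] by (intro connected_continuous_image) (auto intro: continuous_on_subset)
  then show ?case by (simp add: is_interval_connected_1)
qed (simp add: is_interval_univ)

lemma wbr01: "set w \<subseteq> \<Lambda> \<Longrightarrow> w \<noteq> [] \<Longrightarrow> x \<in> wdom w \<Longrightarrow> wbr w x \<in> {0..1}"
proof (induction w arbitrary: x)
  case (Cons i w)
  then show ?case using g01 by (cases "w = []") auto
qed simp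

lemma wbr_der: "set w \<subseteq> \<Lambda> \<Longrightarrow> x \<in> wdom w \<Longrightarrow> (wbr w has_field_derivative wder w x) (at x within wdom w)"
proof (induction w arbitrary: x)
  case Nil
  have "wbr [] = (\<lambda>x. x)" by (rule ext) simp
  then show ?case by simp
next
  case (Cons i w)
  then have i: "i \<in> \<Lambda>" and x: "x \<in> f ` J i" "g i x \<in> wdom w" by auto
  have 1: "(g i has_field_derivative d i x) (at x within wdom (i # w))"
    by (rule has_field_derivative_subset[OF g_der[OF i x(1)]]) auto
  have 2: "(wbr w has_field_derivative wder w (g i x)) (at (g i x) within g i ` wdom (i # w))"
    using Cons x by (intro has_field_derivative_subset[OF Cons.IH]) auto
  have "wbr (i # w) = wbr w \<circ> g i" by (rule ext) simp
  moreover have "wder (i # w) x = wder w (g i x) * d i x" by simp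
  ultimately show ?case using DERIV_image_chain[OF 2 1] by (simp only:)
qed

lemma wbr_inj: "set w \<subseteq> \<Lambda> \<Longrightarrow> inj_on (wbr w) (wdom w)"
proof (induction w)
  case (Cons i w)
  then have i: "i \<in> \<Lambda>" by simp
  show ?case
  proof (rule inj_onI)
    fix x y assume "x \<in> wdom (i # w)" "y \<in> wdom (i # w)" "wbr (i # w) x = wbr (i # w) y"
    then have xy: "x \<in> f ` J i" "y \<in> f ` J i" "g i x \<in> wdom w" "g i y \<in> wdom w" "wbr w (g i x) = wbr w (g i y)"
      by auto
    have "inj_on (wbr w) (wdom w)" using Cons by simp
    then have "g i x = g i y" using xy by (auto dest: inj_onD)
    have "x = f (g i x)" using fg(2)[OF i xy(1)] by (rule sym)
    also have "\<dots> = f (g i y)" by (simp only: \<open>g i x = g i y\<close>)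
    also have "\<dots> = y" by (rule fg(2)[OF i xy(2)])
    finally show "x = y" .
  qed
qed (simp add: inj_on_def)

text \<open>Cylinders of equal order are disjoint. By induction the tails agree, injectivity
  identifies the intermediate points, and these lie in one partition interval only.\<close>

lemma wbr_eq:
  "w \<in> words n \<Longrightarrow> v \<in> words n \<Longrightarrow> x \<in> wdom w \<Longrightarrow> y \<in> wdom v \<Longrightarrow> wbr w x = wbr v y \<Longrightarrow> w = v"
proof (induction n arbitrary: w v x y)
  case (Suc n)
  obtain i w' j v' where wv: "w = i # w'" "v = j # v'" "i \<in> \<Lambda>" "j \<in> \<Lambda>" "w' \<in> words n" "v' \<in> words n"
    using Suc.prems(1,2) by (auto simp: words_Suc)
  have xy: "x \<in> f ` J i" "g i x \<in> wdom w'" "y \<in> f ` J j" "g j y \<in> wdom v'" "wbr w' (g i x) = wbr v' (g j y)"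
    using Suc.prems wv by auto
  have eq: "w' = v'" using Suc.IH[OF wv(5,6) xy(2,4,5)] .
  then have "g i x = g j y"
    using wbr_inj[of w'] wv(5) xy by (auto simp: words_def dest: inj_onD)
  then have "i = j" using J_disj[OF wv(3,4), of "g i x"] fg(1)[OF wv(3) xy(1)] fg(1)[OF wv(4) xy(3)] by simp
  then show ?case using eq wv by simp
qed (simp add: words_def)

lemma wder_le: "set w \<subseteq> \<Lambda> \<Longrightarrow> x \<in> wdom w \<Longrightarrow> \<bar>wder w x\<bar> \<le> (1 / lam) ^ length w"
proof (induction w arbitrary: x)
  case (Cons i w)
  then have i: "i \<in> \<Lambda>" and x: "x \<in> f ` J i" "g i x \<in> wdom w" and IH: "\<bar>wder w (g i x)\<bar> \<le> (1 / lam) ^ length w" by simp_all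
  have "\<bar>wder w (g i x)\<bar> * \<bar>d i x\<bar> \<le> (1 / lam) ^ length w * (1 / lam)"
    using lam by (intro mult_mono IH d_le[OF i x(1)]) auto
  then show ?case by (simp add: abs_mult mult.commute)
qed simp

lemma wder_nonzero: "set w \<subseteq> \<Lambda> \<Longrightarrow> x \<in> wdom w \<Longrightarrow> wder w x \<noteq> 0"
proof (induction w arbitrary: x)
  case (Cons i w)
  then have i: "i \<in> \<Lambda>" and x: "x \<in> f ` J i" and IH: "wder w (g i x) \<noteq> 0" by simp_all
  have "0 < 1 / Lc" using Lc by simp
  then have "0 < \<bar>d i x\<bar>" using d_ge[OF i x] by linarith
  then show ?case using IH by simp
qed simp

text \<open>Sum of the geometric series of one-step distortions \<open>Hc * Lc\<close> along
  contracting orbits. It solves \<open>D = D * \<alpha> powr (- \<beta>) + Hc * Lc\<close>, which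
  closes the induction in \<open>wder_distortion\<close>.\<close>

definition dist_const :: real where
  "dist_const = Hc * Lc / (1 - \<alpha> powr (- \<beta>))"

lemma \<alpha>\<beta>: "0 < \<alpha> powr (- \<beta>)" "\<alpha> powr (- \<beta>) < 1"
  using \<alpha> \<beta> by (auto simp: powr_less_one)

lemma dist_const_nonneg: "0 \<le> dist_const"
  using Hc Lc \<alpha>\<beta> by (simp add: dist_const_def)

text \<open>The lower bound \<open>1 / Lc\<close> on the derivative turns the additive Hoelder
  estimate into a relative one, and \<open>1 + t <= exp t\<close> makes it multiplicative.\<close>

lemma d_distortion:
  assumes "i \<in> \<Lambda>" "x \<in> f ` J i" "y \<in> f ` J i"
  shows "\<bar>d i x\<bar> \<le> \<bar>d i y\<bar> * exp (Hc * Lc * \<bar>x - y\<bar> powr \<beta>)"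
proof -
  have "\<bar>d i x\<bar> \<le> \<bar>d i y\<bar> + Hc * \<bar>x - y\<bar> powr \<beta>"
    using d_holder[OF assms] by linarith
  also have "Hc * \<bar>x - y\<bar> powr \<beta> = (1 / Lc) * (Hc * Lc * \<bar>x - y\<bar> powr \<beta>)" using Lc by simp
  also have "\<dots> \<le> \<bar>d i y\<bar> * (Hc * Lc * \<bar>x - y\<bar> powr \<beta>)"
    using d_ge[OF assms(1,3)] Hc Lc by (intro mult_right_mono) auto
  also have "\<bar>d i y\<bar> + \<dots> = \<bar>d i y\<bar> * (1 + Hc * Lc * \<bar>x - y\<bar> powr \<beta>)" by (simp add: algebra_simps)
  also have "\<dots> \<le> \<bar>d i y\<bar> * exp (Hc * Lc * \<bar>x - y\<bar> powr \<beta>)"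
    by (intro mult_left_mono exp_ge_add_one_self) auto
  finally show ?thesis by simp
qed

lemma wder_distortion:
  "set w \<subseteq> \<Lambda> \<Longrightarrow> x \<in> wdom w \<Longrightarrow> y \<in> wdom w \<Longrightarrow>
    \<bar>wder w x\<bar> \<le> \<bar>wder w y\<bar> * exp (dist_const * \<bar>x - y\<bar> powr \<beta>)"
proof (induction w arbitrary: x y)
  case Nil
  then show ?case using dist_const_nonneg by simp
next
  case (Cons i w)
  then have i: "i \<in> \<Lambda>" and x: "x \<in> f ` J i" "g i x \<in> wdom w" and y: "y \<in> f ` J i" "g i y \<in> wdom w" by auto
  have "\<bar>g i x - g i y\<bar> powr \<beta> \<le> (\<bar>x - y\<bar> / \<alpha>) powr \<beta>"
    using g_contract[OF i x(1) y(1)] \<beta> by (intro powr_mono2) auto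
  also have "\<dots> = \<bar>x - y\<bar> powr \<beta> * \<alpha> powr (- \<beta>)"
    by (simp add: powr_divide powr_minus_divide)
  finally have le: "\<bar>g i x - g i y\<bar> powr \<beta> \<le> \<bar>x - y\<bar> powr \<beta> * \<alpha> powr (- \<beta>)" .
  have "\<bar>wder w (g i x)\<bar> \<le> \<bar>wder w (g i y)\<bar> * exp (dist_const * \<bar>g i x - g i y\<bar> powr \<beta>)"
    using Cons x y by auto
  also have "\<dots> \<le> \<bar>wder w (g i y)\<bar> * exp (dist_const * (\<bar>x - y\<bar> powr \<beta> * \<alpha> powr (- \<beta>)))"
    using le dist_const_nonneg by (intro mult_left_mono) (auto intro: mult_left_mono)
  finally have 1: "\<bar>wder w (g i x)\<bar> \<le> \<bar>wder w (g i y)\<bar> * exp (dist_const * (\<bar>x - y\<bar> powr \<beta> * \<alpha> powr (- \<beta>)))" .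
  have "\<bar>wder (i # w) x\<bar> \<le> (\<bar>wder w (g i y)\<bar> * exp (dist_const * (\<bar>x - y\<bar> powr \<beta> * \<alpha> powr (- \<beta>))))
      * (\<bar>d i y\<bar> * exp (Hc * Lc * \<bar>x - y\<bar> powr \<beta>))"
    using mult_mono[OF 1 d_distortion[OF i x(1) y(1)]] by (simp add: abs_mult)
  also have "\<dots> = \<bar>wder (i # w) y\<bar> * exp ((dist_const * \<alpha> powr (- \<beta>) + Hc * Lc) * \<bar>x - y\<bar> powr \<beta>)"
    by (simp add: abs_mult exp_add[symmetric] algebra_simps)
  also have "dist_const * \<alpha> powr (- \<beta>) + Hc * Lc = dist_const"
    using \<alpha>\<beta> by (simp add: dist_const_def field_simps)
  finally show ?case .
qed

text \<open>A branch domain can shrink to a point when the image of one partition interval meets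
  another only in an endpoint; no positive \<kappa> is exceeded by the length of such a
  domain.\<close>

definition nd :: "'i list \<Rightarrow> bool" where
  "nd w \<longleftrightarrow> (\<exists>x\<in>wdom w. \<exists>y\<in>wdom w. x \<noteq> y)"

definition nwords :: "nat \<Rightarrow> 'i list set" where
  "nwords n = {w \<in> words n. nd w}"

lemma finite_nwords: "finite (nwords n)"
  using finite_words by (simp add: nwords_def)

text \<open>Unspecified if the domain of \<open>w\<close> is empty; used only for words in \<open>nwords n\<close>. The exponent
  \<open>wexp w\<close> sorts the branches of an iterate into groups to which \<open>branch_system\<close> applies.\<close>

definition base_pt :: "'i list \<Rightarrow> real" where
  "base_pt w = (SOME x. x \<in> wdom w)"

definition wexp :: "'i list \<Rightarrow> nat" where
  "wexp w = nat \<lfloor>- log 2 \<bar>wder w (base_pt w)\<bar>\<rfloor>"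

lemma base_pt: "w \<in> nwords n \<Longrightarrow> base_pt w \<in> wdom w"
  unfolding base_pt_def by (rule someI_ex) (auto simp: nwords_def nd_def)

lemma wexp:
  assumes w: "w \<in> nwords n"
  shows "\<bar>wder w (base_pt w)\<bar> \<le> 1 / 2 ^ wexp w" "1 / 2 ^ wexp w < 2 * \<bar>wder w (base_pt w)\<bar>"
proof -
  define D where "D = \<bar>wder w (base_pt w)\<bar>"
  have sw: "set w \<subseteq> \<Lambda>" using w by (auto simp: nwords_def words_def)
  have D0: "0 < D" unfolding D_def using wder_nonzero[OF sw base_pt[OF w]] by simp
  have "D \<le> (1 / lam) ^ length w" unfolding D_def by (rule wder_le[OF sw base_pt[OF w]])
  also have "\<dots> \<le> 1" using lam by (intro power_le_one) auto
  finally have "log 2 D \<le> 0" using D0 by simp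
  then have e: "real (wexp w) \<le> - log 2 D" "- log 2 D < real (wexp w) + 1"
    unfolding wexp_def D_def[symmetric] by linarith+
  have Deq: "D = 2 powr (log 2 D)" using D0 by simp
  have pw: "(1 / 2 ^ wexp w :: real) = 2 powr (- real (wexp w))"
    by (simp add: powr_minus_divide powr_realpow)
  show "\<bar>wder w (base_pt w)\<bar> \<le> 1 / 2 ^ wexp w"
    unfolding D_def[symmetric] pw using e Deq by (metis powr_mono le_minus_iff one_le_numeral)
  have "1 / 2 ^ wexp w < 2 powr (1 + log 2 D)" unfolding pw using e by (intro powr_less_mono) auto
  also have "\<dots> = 2 * D" using D0 by (simp add: powr_add)
  finally show "1 / 2 ^ wexp w < 2 * \<bar>wder w (base_pt w)\<bar>" by (simp add: D_def)
qed

text \<open>Chosen to dominate three constants at once: the upper bound, the lower bound with the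
  factor 2 lost by rounding in \<open>wexp\<close>, and the Hoelder bound. It is free of n.\<close>

definition sys_const :: real where
  "sys_const = 2 * exp (2 * dist_const) * (1 + dist_const)"

lemma sys_const_ge: "1 \<le> sys_const" "2 * exp dist_const \<le> sys_const"
  "dist_const * exp (2 * dist_const) \<le> sys_const"
proof -
  have a: "exp dist_const \<le> exp (2 * dist_const)" "1 \<le> exp (2 * dist_const)" "1 \<le> exp dist_const"
    using dist_const_nonneg by auto
  have b: "2 * exp (2 * dist_const) * 1 \<le> sys_const"
    unfolding sys_const_def using dist_const_nonneg by (intro mult_left_mono) auto
  then show "1 \<le> sys_const" "2 * exp dist_const \<le> sys_const" using a by linarith+
  have "dist_const * exp (2 * dist_const) \<le> (1 + dist_const) * (2 * exp (2 * dist_const))"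
    using dist_const_nonneg by (intro mult_mono) auto
  then show "dist_const * exp (2 * dist_const) \<le> sys_const" by (simp add: sys_const_def mult_ac)
qed

lemma wder_bounds:
  assumes n: "n \<ge> 1" and w: "w \<in> nwords n" and x: "x \<in> wdom w"
  shows "\<bar>wder w x\<bar> \<le> exp dist_const / 2 ^ wexp w" "1 / (sys_const * 2 ^ wexp w) \<le> \<bar>wder w x\<bar>"
proof -
  have sw: "set w \<subseteq> \<Lambda>" "w \<noteq> []" using w n by (auto simp: nwords_def words_def)
  note b = base_pt[OF w]
  have "{x, base_pt w} \<subseteq> {0..1}" using wdom_sub[OF sw] x b by blast
  then have "\<bar>x - base_pt w\<bar> \<le> 1" by auto
  then have "\<bar>x - base_pt w\<bar> powr \<beta> \<le> 1 powr \<beta>" using \<beta> by (intro powr_mono2) auto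
  then have p1: "\<bar>x - base_pt w\<bar> powr \<beta> \<le> 1" by simp
  then have e: "exp (dist_const * \<bar>x - base_pt w\<bar> powr \<beta>) \<le> exp dist_const"
    using dist_const_nonneg by (simp add: mult_left_le)
  have "\<bar>wder w x\<bar> \<le> \<bar>wder w (base_pt w)\<bar> * exp dist_const"
    by (rule order_trans[OF wder_distortion[OF sw(1) x b] mult_left_mono[OF e]]) simp
  moreover have *: "\<bar>wder w (base_pt w)\<bar> \<le> \<bar>wder w x\<bar> * exp dist_const"
    by (rule order_trans[OF wder_distortion[OF sw(1) b x, unfolded abs_minus_commute[of "base_pt w" x]] mult_left_mono[OF e]]) simp
  moreover have "\<bar>wder w (base_pt w)\<bar> * exp dist_const \<le> 1 / 2 ^ wexp w * exp dist_const"
    by (intro mult_right_mono wexp(1)[OF w]) auto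
  ultimately show "\<bar>wder w x\<bar> \<le> exp dist_const / 2 ^ wexp w" by simp
  have "1 / 2 ^ wexp w < 2 * (\<bar>wder w x\<bar> * exp dist_const)"
    using wexp(2)[OF w] * by linarith
  also have "\<dots> \<le> \<bar>wder w x\<bar> * sys_const" using mult_left_mono[OF sys_const_ge(2), of "\<bar>wder w x\<bar>"] by (simp add: mult_ac)
  finally show "1 / (sys_const * 2 ^ wexp w) \<le> \<bar>wder w x\<bar>" using sys_const_ge(1) by (simp add: field_simps)
qed

lemma wder_holder:
  assumes n: "n \<ge> 1" and w: "w \<in> nwords n" and x: "x \<in> wdom w" and y: "y \<in> wdom w"
  shows "\<bar>\<bar>wder w x\<bar> - \<bar>wder w y\<bar>\<bar> \<le> sys_const / 2 ^ wexp w * \<bar>x - y\<bar> powr \<beta>"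
proof -
  have sw: "set w \<subseteq> \<Lambda>" "w \<noteq> []" using w n by (auto simp: nwords_def words_def)
  have one: "\<bar>wder w x\<bar> - \<bar>wder w y\<bar> \<le> sys_const / 2 ^ wexp w * \<bar>x - y\<bar> powr \<beta>"
    if x: "x \<in> wdom w" and y: "y \<in> wdom w" for x y
  proof -
    define t where "t = dist_const * \<bar>x - y\<bar> powr \<beta>"
    have "{x, y} \<subseteq> {0..1}" using wdom_sub[OF sw] x y by blast
    then have "\<bar>x - y\<bar> powr \<beta> \<le> 1 powr \<beta>" using \<beta> by (intro powr_mono2) auto
    then have t: "0 \<le> t" "t \<le> dist_const" using dist_const_nonneg by (auto simp: t_def mult_left_le)
    \<comment> \<open>Yields \<open>exp t - 1 <= t * exp t\<close>, which converts multiplicative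
      distortion back into a Hoelder estimate.\<close>
    have "1 - t \<le> exp (- t)" using exp_ge_add_one_self[of "-t"] by simp
    then have "(1 - t) * exp t \<le> exp (- t) * exp t" by (intro mult_right_mono) auto
    then have e: "exp t - 1 \<le> t * exp t" by (simp add: exp_minus algebra_simps)
    also have "\<dots> \<le> t * exp dist_const" using t by (intro mult_left_mono) auto
    finally have e: "exp t - 1 \<le> t * exp dist_const" .
    have "\<bar>wder w x\<bar> - \<bar>wder w y\<bar> \<le> \<bar>wder w y\<bar> * (exp t - 1)"
      using wder_distortion[OF sw(1) x y] by (simp add: t_def right_diff_distrib)
    also have "\<dots> \<le> (exp dist_const / 2 ^ wexp w) * (t * exp dist_const)"
      using wder_bounds(1)[OF n w y] e t by (intro mult_mono) auto
    also have "\<dots> = dist_const * exp (2 * dist_const) / 2 ^ wexp w * \<bar>x - y\<bar> powr \<beta>"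
      by (simp add: t_def exp_double power2_eq_square)
    also have "\<dots> \<le> sys_const / 2 ^ wexp w * \<bar>x - y\<bar> powr \<beta>"
      using sys_const_ge(3) by (intro mult_right_mono divide_right_mono) auto
    finally show ?thesis .
  qed
  show ?thesis using one[OF x y] one[OF y x] by (simp add: abs_le_iff abs_minus_commute)
qed

lemma min_length:
  obtains \<kappa> where "\<kappa> > 0" "\<And>w. w \<in> nwords n \<Longrightarrow> \<exists>x\<in>wdom w. \<exists>y\<in>wdom w. \<bar>x - y\<bar> > \<kappa>"
    "\<And>w. w \<in> nwords n \<Longrightarrow> \<exists>x\<in>wdom w. \<exists>y\<in>wdom w. \<bar>wbr w x - wbr w y\<bar> > \<kappa>"
proof -
  have "\<exists>l>0. \<exists>x\<in>wdom w. \<exists>y\<in>wdom w. \<bar>x - y\<bar> \<ge> l \<and> \<bar>wbr w x - wbr w y\<bar> \<ge> l" if w: "w \<in> nwords n" for w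
  proof -
    obtain x y where xy: "x \<in> wdom w" "y \<in> wdom w" "x \<noteq> y" using w by (auto simp: nwords_def nd_def)
    then have "wbr w x \<noteq> wbr w y"
      using wbr_inj[of w] w by (auto simp: nwords_def words_def dest: inj_onD)
    then show ?thesis
      using xy by (intro exI[of _ "min \<bar>x - y\<bar> \<bar>wbr w x - wbr w y\<bar>"] conjI bexI[of _ x] bexI[of _ y]) auto
  qed
  then have "\<forall>w\<in>nwords n. \<exists>l. l > 0 \<and> (\<exists>x\<in>wdom w. \<exists>y\<in>wdom w. \<bar>x - y\<bar> \<ge> l \<and> \<bar>wbr w x - wbr w y\<bar> \<ge> l)"
    by blast
  from bchoice[OF this] obtain l where l: "\<And>w. w \<in> nwords n \<Longrightarrow> l w > 0 \<and>
      (\<exists>x\<in>wdom w. \<exists>y\<in>wdom w. \<bar>x - y\<bar> \<ge> l w \<and> \<bar>wbr w x - wbr w y\<bar> \<ge> l w)" by blast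
  \<comment> \<open>Halving makes the inequalities strict; the inserted 1 keeps the minimum
    meaningful if there are no words.\<close>
  define \<kappa> where "\<kappa> = Min (insert 1 (l ` nwords n)) / 2"
  have fin: "finite (insert 1 (l ` nwords n))" using finite_nwords by simp
  have pos: "Min (insert 1 (l ` nwords n)) > 0" using fin l by (subst Min_gr_iff) auto
  have lt: "\<kappa> < l w" if "w \<in> nwords n" for w
  proof -
    have "Min (insert 1 (l ` nwords n)) \<le> l w" using fin that by (intro Min_le) auto
    then show ?thesis using pos by (simp add: \<kappa>_def)
  qed
  show thesis
  proof (rule that[of \<kappa>])
    show "\<kappa> > 0" using pos by (simp add: \<kappa>_def)
    show "\<exists>x\<in>wdom w. \<exists>y\<in>wdom w. \<bar>x - y\<bar> > \<kappa>" if "w \<in> nwords n" for w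
      using l[OF that] lt[OF that] by (meson less_le_trans)
    show "\<exists>x\<in>wdom w. \<exists>y\<in>wdom w. \<bar>wbr w x - wbr w y\<bar> > \<kappa>" if "w \<in> nwords n" for w
      using l[OF that] lt[OF that] by (meson less_le_trans)
  qed
qed

text \<open>The discarded words act on the finite set \<open>Z\<close>, which integrals over cells
  do not see.\<close>

lemma davg_iterate:
  assumes "n \<ge> 1" and j: "j < 2 ^ k"
  shows "davg k j ((TR ^^ n) \<psi>) = davg k j (transfer (nwords n) wdom wbr wder \<psi>)"
proof -
  define Z where "Z = (\<Union>w\<in>words n - nwords n. wdom w)"
  have "finite (wdom w)" if "w \<in> words n - nwords n" for w
  proof -
    have eq: "x = y" if "x \<in> wdom w" "y \<in> wdom w" for x y
      using that \<open>w \<in> words n - nwords n\<close> by (auto simp: nwords_def nd_def)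
    show ?thesis
    proof (cases "wdom w = {}")
      case False
      then obtain a where "a \<in> wdom w" by blast
      then have "wdom w \<subseteq> {a}" using eq by blast
      then show ?thesis by (rule finite_subset) simp
    qed simp
  qed
  then have Z: "finite Z" using finite_words by (auto simp: Z_def)
  have eq: "(TR ^^ n) \<psi> x = transfer (nwords n) wdom wbr wder \<psi> x" if "x \<notin> Z" for x
    unfolding transfer_iterate transfer_def
    by (rule sum.mono_neutral_right) (use that finite_words in \<open>auto simp: nwords_def Z_def\<close>)
  have "avg m l ((TR ^^ n) \<psi>) = avg m l (transfer (nwords n) wdom wbr wder \<psi>)" for m l
    unfolding avg_def using Z eq by (intro arg_cong[where f = "(*\<^sub>R) _"] integral_spike[of Z]) auto
  then show ?thesis by (simp add: davg_def)
qed

text \<open>\<open>L\<close> is fixed before p, s and q: it is determined by the exponents of the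
  words and by \<kappa>. The constant \<open>schur_const sys_const p s \<beta>\<close> does not
  involve n.\<close>

theorem iterate_high_frequency:
  assumes n: "n \<ge> 1" and N: "\<And>x. card {w \<in> nwords n. x \<in> wdom w} \<le> N"
  obtains L where "\<And>p s q \<psi>. p \<ge> 1 \<Longrightarrow> \<beta> * p \<le> 1 \<Longrightarrow> 0 < s \<Longrightarrow> s < \<beta> \<Longrightarrow> q \<ge> 1 \<Longrightarrow>
    \<psi> absolutely_integrable_on {0..1} \<Longrightarrow> lq_finite q (bl s p \<psi>) \<Longrightarrow>
    lqb q (bl s p ((TR ^^ n) (\<lambda>x. \<psi> x - partial_series \<psi> L x)))
      (schur_const sys_const p s \<beta> * real N powr (1 - 1 / p) * (2 * (1 / lam) ^ n) powr (1 - 1 / p + s) * lq_norm q (bl s p \<psi>))"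
    "\<And>p s q j v. p \<ge> 1 \<Longrightarrow> \<beta> * p \<le> 1 \<Longrightarrow> s < \<beta> \<Longrightarrow> q \<ge> 1 \<Longrightarrow> lq_finite q (bl s p ((TR ^^ n) (step j v)))"
proof -
  obtain \<kappa> where \<kappa>: "\<kappa> > 0" "\<And>w. w \<in> nwords n \<Longrightarrow> \<exists>x\<in>wdom w. \<exists>y\<in>wdom w. \<bar>x - y\<bar> > \<kappa>"
    "\<And>w. w \<in> nwords n \<Longrightarrow> \<exists>x\<in>wdom w. \<exists>y\<in>wdom w. \<bar>wbr w x - wbr w y\<bar> > \<kappa>"
    using min_length[of n] by blast
  have sw: "set w \<subseteq> \<Lambda>" "w \<noteq> []" "w \<in> words n" "length w = n" if "w \<in> nwords n" for w
    using that n by (auto simp: nwords_def words_def)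
  have exp_le: "exp dist_const \<le> sys_const" using sys_const_ge(2) by (smt (verit) exp_gt_zero)
  interpret branch_family "nwords n" wdom wbr wder wexp N sys_const \<beta> \<kappa>
  proof (unfold_locales, goal_cases)
    case 1
    show ?case by (rule finite_nwords)
  next
    case (2 m)
    then show ?case using finite_nwords by simp
  next
    case (3 m)
    show ?case by (rule sys_const_ge(1))
  next
    case (4 m)
    show ?case by (rule \<beta>)
  next
    case (5 m w)
    then show ?case using wdom_sub sw by simp
  next
    case (6 m w)
    then show ?case using wdom_interval sw by simp
  next
    case (7 m w x)
    then show ?case using wbr01 sw by simp
  next
    case (8 m w x)
    then show ?case using wbr_der sw by simp
  next
    case (9 m w)
    then show ?case using wbr_inj sw by simp
  next
    case (10 m w x)
    then have "\<bar>wder w x\<bar> \<le> exp dist_const / 2 ^ m" using wder_bounds(1)[OF n] by auto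
    also have "\<dots> \<le> sys_const / 2 ^ m" using exp_le by (intro divide_right_mono) auto
    finally show ?case .
  next
    case (11 m w x)
    then show ?case using wder_bounds(2)[OF n] by auto
  next
    case (12 m w x y)
    then show ?case using wder_holder[OF n] by auto
  next
    case (13 m w)
    then show ?case using \<kappa>(2) by simp
  next
    case (14 m w)
    then show ?case using \<kappa>(3) by simp
  next
    case (15 m w w' x y)
    then show ?case using wbr_eq[of w n w' x y] sw by auto
  next
    case (16 m x)
    have "card {w \<in> {w \<in> nwords n. wexp w = m}. x \<in> wdom w} \<le> card {w \<in> nwords n. x \<in> wdom w}"
      using finite_nwords by (intro card_mono) auto
    then show ?case using N[of x] by simp
  qed
  obtain l0 where l0: "(1/2) ^ l0 < \<kappa>" using real_arch_pow_inv[OF \<kappa>(1), of "1/2"] by auto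
  \<comment> \<open>The sum of the exponents is a convenient upper bound for each of them;
    \<open>l0\<close> adds the room needed to get below \<kappa>.\<close>
  define L where "L = (\<Sum>w\<in>nwords n. wexp w) + l0"
  have L: "wexp w \<le> L \<and> 1 / 2 ^ (L - wexp w) \<le> \<kappa>" if w: "w \<in> nwords n" for w
  proof -
    have "wexp w \<le> (\<Sum>w\<in>nwords n. wexp w)" using finite_nwords w by (intro member_le_sum) auto
    then have "wexp w \<le> L" "l0 \<le> L - wexp w" by (auto simp: L_def)
    then have "(1 / 2 ^ (L - wexp w) :: real) \<le> 1 / 2 ^ l0" by (intro divide_left_mono power_increasing) auto
    then show ?thesis using l0 \<open>wexp w \<le> L\<close> by (simp add: power_one_over)
  qed
  \<comment> \<open>The factor 2 is the rounding in \<open>wexp\<close>.\<close>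
  have \<rho>: "1 / 2 ^ wexp w \<le> 2 * (1 / lam) ^ n" if w: "w \<in> nwords n" for w
    using wexp(2)[OF w] wder_le[OF sw(1)[OF w] base_pt[OF w]] sw(4)[OF w] by simp
  have bl_eq: "bl s p ((TR ^^ n) \<phi>) = bl s p (transfer (nwords n) wdom wbr wder \<phi>)" for s p \<phi>
    unfolding bl_def using davg_iterate[OF n] by (intro ext arg_cong2[where f = "(*)"] refl en_cong) simp
  show thesis
  proof (rule that)
    show "lq_finite q (bl s p ((TR ^^ n) (step j v)))" if "p \<ge> 1" "\<beta> * p \<le> 1" "s < \<beta>" "q \<ge> 1"
      for p s :: real and q :: ennreal and j v
      unfolding bl_eq by (rule lq_finite_bl_TT_step[OF that])
    fix p s :: real and q :: ennreal and \<psi> :: "real \<Rightarrow> complex"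
    assume as: "p \<ge> 1" "\<beta> * p \<le> 1" "0 < s" "s < \<beta>" "q \<ge> 1"
      and \<psi>: "\<psi> absolutely_integrable_on {0..1}" "lq_finite q (bl s p \<psi>)"
    show "lqb q (bl s p ((TR ^^ n) (\<lambda>x. \<psi> x - partial_series \<psi> L x)))
      (schur_const sys_const p s \<beta> * real N powr (1 - 1 / p) * (2 * (1 / lam) ^ n) powr (1 - 1 / p + s) * lq_norm q (bl s p \<psi>))"
      unfolding bl_eq by (rule lqb_high_frequency[OF as L \<rho> \<psi>])
  qed
qed

end

section \<open>Topological entropy and the number of preimages\<close>

context expanding_branches
begin

lemma wbr_append: "wbr (u @ v) x = wbr v (wbr u x)"
  by (induction u arbitrary: x) auto

lemma wdom_append: "x \<in> wdom (u @ v) \<longleftrightarrow> x \<in> wdom u \<and> wbr u x \<in> wdom v"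
  by (induction u arbitrary: x) auto

lemma iterate_wbr: "set w \<subseteq> \<Lambda> \<Longrightarrow> x \<in> wdom w \<Longrightarrow> (f ^^ length w) (wbr w x) = x"
proof (induction w arbitrary: x)
  case (Cons i w)
  then have i: "i \<in> \<Lambda>" and x: "x \<in> f ` J i" "g i x \<in> wdom w" by auto
  have "(f ^^ length w) (wbr w (g i x)) = g i x" using Cons x by simp
  then show ?case using fg(2)[OF i x(1)] by simp
qed simp

definition bowen_close :: "nat \<Rightarrow> real \<Rightarrow> real \<Rightarrow> real \<Rightarrow> bool" where
  "bowen_close n \<delta> y e \<longleftrightarrow> (\<forall>i<n. \<bar>(f ^^ i) y - (f ^^ i) e\<bar> \<le> \<delta>)"

lemma nwordsD: "w \<in> nwords n \<Longrightarrow> set w \<subseteq> \<Lambda> \<and> length w = n \<and> w \<in> words n"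
  by (simp add: nwords_def words_def)

text \<open>An interval shorter than every cylinder of order \<open>M\<close> that meets such a cylinder has one of its
  endpoints in it.\<close>

lemma card_words_near:
  assumes long: "\<And>v. v \<in> nwords M \<Longrightarrow> \<exists>x\<in>wdom v. \<exists>y\<in>wdom v. \<bar>wbr v x - wbr v y\<bar> > 2 * \<delta>"
  shows "card {v \<in> nwords M. \<exists>y\<in>wdom v. \<bar>wbr v y - e\<bar> \<le> \<delta>} \<le> 2"
proof -
  have one: "card {v \<in> nwords M. a \<in> wbr v ` wdom v} \<le> 1" for a
  proof -
    have "u = v" if "u \<in> nwords M" "v \<in> nwords M" "a \<in> wbr u ` wdom u" "a \<in> wbr v ` wdom v" for u v
      using that wbr_eq[of u M v] nwordsD by auto
    then have "\<forall>u\<in>{v \<in> nwords M. a \<in> wbr v ` wdom v}. \<forall>v\<in>{v \<in> nwords M. a \<in> wbr v ` wdom v}. u = v" by blast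
    moreover have "finite {v \<in> nwords M. a \<in> wbr v ` wdom v}" using finite_nwords by simp
    ultimately show ?thesis using card_le_Suc0_iff_eq[of "{v \<in> nwords M. a \<in> wbr v ` wdom v}"] by simp
  qed
  have "{v \<in> nwords M. \<exists>y\<in>wdom v. \<bar>wbr v y - e\<bar> \<le> \<delta>}
      \<subseteq> {v \<in> nwords M. e - \<delta> \<in> wbr v ` wdom v} \<union> {v \<in> nwords M. e + \<delta> \<in> wbr v ` wdom v}"
  proof
    fix v assume "v \<in> {v \<in> nwords M. \<exists>y\<in>wdom v. \<bar>wbr v y - e\<bar> \<le> \<delta>}"
    then obtain y where v: "v \<in> nwords M" and y: "y \<in> wdom v" "e - \<delta> \<le> wbr v y" "wbr v y \<le> e + \<delta>" by auto
    have sv: "set v \<subseteq> \<Lambda>" using nwordsD[OF v] by simp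
    obtain a b where ab: "a \<in> wdom v" "b \<in> wdom v" "\<bar>wbr v a - wbr v b\<bar> > 2 * \<delta>" using long[OF v] by blast
    have "connected (wbr v ` wdom v)"
      using wdom_interval[OF sv] DERIV_continuous_on[OF wbr_der[OF sv]]
      by (intro connected_continuous_image) (auto simp: is_interval_connected_1)
    then have int: "is_interval (wbr v ` wdom v)" by (simp add: is_interval_connected_1)
    have "e - \<delta> \<in> wbr v ` wdom v \<or> e + \<delta> \<in> wbr v ` wdom v"
      by (rule long_interval_contains_endpoint[OF int, of "wbr v a" "wbr v b" "e + \<delta>" "e - \<delta>" "wbr v y"])
        (use ab y in auto)
    then show "v \<in> {v \<in> nwords M. e - \<delta> \<in> wbr v ` wdom v} \<union> {v \<in> nwords M. e + \<delta> \<in> wbr v ` wdom v}"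
      using v by blast
  qed
  then have "card {v \<in> nwords M. \<exists>y\<in>wdom v. \<bar>wbr v y - e\<bar> \<le> \<delta>}
      \<le> card ({v \<in> nwords M. e - \<delta> \<in> wbr v ` wdom v} \<union> {v \<in> nwords M. e + \<delta> \<in> wbr v ` wdom v})"
    using finite_nwords by (intro card_mono) auto
  also have "\<dots> \<le> card {v \<in> nwords M. e - \<delta> \<in> wbr v ` wdom v} + card {v \<in> nwords M. e + \<delta> \<in> wbr v ` wdom v}"
    by (rule card_Un_le)
  finally show ?thesis using one[of "e - \<delta>"] one[of "e + \<delta>"] by linarith
qed

text \<open>Induction on the blocks. Closeness at time 0 leaves two choices for the block visited
  first, by \<open>card_words_near\<close>; the remaining letters describe a point that is close to
  the orbit of \<open>(f ^^ M) e\<close> for k blocks.\<close>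

lemma card_words_bowen_close:
  assumes long: "\<And>v. v \<in> nwords M \<Longrightarrow> \<exists>x\<in>wdom v. \<exists>y\<in>wdom v. \<bar>wbr v x - wbr v y\<bar> > 2 * \<delta>" and M: "M \<ge> 1"
  shows "card {w \<in> nwords (k * M). \<exists>x\<in>wdom w. bowen_close (k * M) \<delta> (wbr w x) e} \<le> 2 ^ k"
proof (induction k arbitrary: e)
  case 0
  have "{w \<in> nwords (0 * M). \<exists>x\<in>wdom w. bowen_close (0 * M) \<delta> (wbr w x) e} \<subseteq> {[]}"
    by (auto simp: nwords_def words_def)
  from card_mono[OF _ this] show ?case by simp
next
  case (Suc k)
  define S where "S = {w \<in> nwords (k * M). \<exists>x\<in>wdom w. bowen_close (k * M) \<delta> (wbr w x) ((f ^^ M) e)}"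
  define V where "V = {v \<in> nwords M. \<exists>y\<in>wdom v. \<bar>wbr v y - e\<bar> \<le> \<delta>}"
  have "{w \<in> nwords (Suc k * M). \<exists>x\<in>wdom w. bowen_close (Suc k * M) \<delta> (wbr w x) e} \<subseteq> (\<lambda>(u, v). u @ v) ` (S \<times> V)"
  proof
    fix w assume "w \<in> {w \<in> nwords (Suc k * M). \<exists>x\<in>wdom w. bowen_close (Suc k * M) \<delta> (wbr w x) e}"
    then obtain x where w: "w \<in> nwords (Suc k * M)" and x: "x \<in> wdom w" and cl: "bowen_close (Suc k * M) \<delta> (wbr w x) e" by auto
    \<comment> \<open>The last M letters are applied last by \<open>wbr\<close>, hence describe the
      first M forward iterates.\<close>
    define u v where "u = take (k * M) w" and "v = drop (k * M) w"
    have uv: "w = u @ v" by (simp add: u_def v_def)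
    have lw: "length w = k * M + M" "set w \<subseteq> \<Lambda>" using nwordsD[OF w] by auto
    have lu: "length u = k * M" "set u \<subseteq> \<Lambda>" and lv: "length v = M" "set v \<subseteq> \<Lambda>"
      using lw by (auto simp: u_def v_def dest: in_set_takeD in_set_dropD)
    obtain a b where ab: "a \<in> wdom w" "b \<in> wdom w" "a \<noteq> b" using w unfolding nwords_def nd_def by blast
    have ab': "a \<in> wdom u" "b \<in> wdom u" "wbr u a \<in> wdom v" "wbr u b \<in> wdom v"
      using ab unfolding uv wdom_append by auto
    then have "wbr u a \<noteq> wbr u b" using wbr_inj[OF lu(2)] ab(3) by (auto dest: inj_onD)
    then have u: "u \<in> nwords (k * M)" and v: "v \<in> nwords M"
      using lu lv ab' ab(3) by (auto simp: nwords_def words_def nd_def)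
    define y where "y = wbr u x"
    have xu: "x \<in> wdom u" and yv: "y \<in> wdom v" using x unfolding uv wdom_append y_def by auto
    have z: "wbr w x = wbr v y" unfolding uv wbr_append y_def by simp
    have fz: "(f ^^ M) (wbr w x) = y" using iterate_wbr[OF lv(2) yv] lv(1) z by simp
    have "\<bar>(f ^^ 0) (wbr w x) - (f ^^ 0) e\<bar> \<le> \<delta>"
      using cl M unfolding bowen_close_def by (auto dest!: spec[of _ 0])
    then have "v \<in> V" using v yv z by (auto simp: V_def)
    have "bowen_close (k * M) \<delta> y ((f ^^ M) e)"
      unfolding bowen_close_def
    proof (intro allI impI)
      fix i assume "i < k * M"
      then have "i + M < Suc k * M" by simp
      then have "\<bar>(f ^^ (i + M)) (wbr w x) - (f ^^ (i + M)) e\<bar> \<le> \<delta>" using cl unfolding bowen_close_def by blast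
      then show "\<bar>(f ^^ i) y - (f ^^ i) ((f ^^ M) e)\<bar> \<le> \<delta>" unfolding funpow_add o_def fz .
    qed
    then have "u \<in> S" using u xu by (auto simp: S_def y_def)
    then show "w \<in> (\<lambda>(u, v). u @ v) ` (S \<times> V)" using \<open>v \<in> V\<close> uv by (intro image_eqI[of _ _ "(u, v)"]) simp_all
  qed
  moreover have fin: "finite (S \<times> V)" using finite_nwords by (auto simp: S_def V_def)
  ultimately have "card {w \<in> nwords (Suc k * M). \<exists>x\<in>wdom w. bowen_close (Suc k * M) \<delta> (wbr w x) e} \<le> card (S \<times> V)"
    by (rule surj_card_le[rotated])
  also have "\<dots> = card S * card V" by (rule card_cartesian_product)
  also have "\<dots> \<le> 2 ^ k * 2"
    using Suc.IH[of "(f ^^ M) e"] card_words_near[OF long, where e = e] unfolding S_def V_def by (intro mult_le_mono) auto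
  finally show ?case by simp
qed

text \<open>Count the preimages by a maximal separated subset: along each of the \<open>k\<close> blocks of length \<open>M\<close> a point
  within Bowen distance \<open>\<delta>\<close> leaves at most two choices for the cylinder.\<close>

lemma card_preimages_le:
  assumes long: "\<And>v. v \<in> nwords M \<Longrightarrow> \<exists>x\<in>wdom v. \<exists>y\<in>wdom v. \<bar>wbr v x - wbr v y\<bar> > 2 * \<delta>" and M: "M \<ge> 1"
    and \<delta>: "\<delta> > 0" and k: "k \<ge> 1"
    and C: "\<And>E. E \<subseteq> {0..1} \<Longrightarrow> finite E \<Longrightarrow> E \<noteq> {} \<Longrightarrow> bowen_separated f (k * M) \<delta> E \<Longrightarrow> real (card E) \<le> C" "C \<ge> 0"
  shows "real (card {w \<in> nwords (k * M). x \<in> wdom w}) \<le> 2 ^ k * C"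
proof (cases "{w \<in> nwords (k * M). x \<in> wdom w} = {}")
  case False
  define n where "n = k * M"
  have n: "n \<ge> 1" using k M by (simp add: n_def)
  define S where "S = {w \<in> nwords n. x \<in> wdom w}"
  define Y where "Y = (\<lambda>w. wbr w x) ` S"
  have finS: "finite S" using finite_nwords by (simp add: S_def)
  then have finY: "finite Y" by (simp add: Y_def)
  have Y01: "Y \<subseteq> {0..1}"
  proof
    fix y assume "y \<in> Y"
    then obtain w where w: "w \<in> nwords n" "x \<in> wdom w" "y = wbr w x" by (auto simp: Y_def S_def)
    have "w \<noteq> []" using nwordsD[OF w(1)] n by auto
    then show "y \<in> {0..1}" using wbr01[of w x] nwordsD[OF w(1)] w by simp
  qed
  have Yne: "Y \<noteq> {}" using False by (auto simp: Y_def S_def n_def)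
  define F where "F = {E. E \<subseteq> Y \<and> bowen_separated f n \<delta> E}"
  have finF: "finite F" using finY by (auto simp: F_def)
  have "{} \<in> F" by (simp add: F_def bowen_separated_def)
  then have "Max (card ` F) \<in> card ` F" using finF by (intro Max_in) auto
  then obtain E where E: "E \<in> F" "card E = Max (card ` F)" by auto
  have Emax: "card E' \<le> card E" if "E' \<in> F" for E' using E(2) finF that by simp
  have EY: "E \<subseteq> Y" "bowen_separated f n \<delta> E" and finE: "finite E" using E(1) finY finite_subset by (auto simp: F_def)
  have near: "\<exists>e\<in>E. bowen_close n \<delta> y e" if y: "y \<in> Y" for y
  proof (cases "y \<in> E")
    case True
    then show ?thesis using \<delta> by (intro bexI[of _ y]) (auto simp: bowen_close_def)
  next
    case False
    have "insert y E \<notin> F" using Emax[of "insert y E"] False finE by auto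
    then have "\<not> bowen_separated f n \<delta> (insert y E)" using y EY(1) by (auto simp: F_def)
    then obtain a b where ab: "a \<in> insert y E" "b \<in> insert y E" "a \<noteq> b"
      "\<forall>i<n. dist ((f ^^ i) a) ((f ^^ i) b) \<le> \<delta>" unfolding bowen_separated_def by (meson not_less)
    have nE: "\<not> (a \<in> E \<and> b \<in> E)" using EY(2) ab(3,4) unfolding bowen_separated_def by (meson not_less)
    have "bowen_close n \<delta> a b" "bowen_close n \<delta> b a" using ab(4) by (auto simp: bowen_close_def dist_real_def abs_minus_commute)
    then show ?thesis using nE ab by auto
  qed
  then have Ene: "E \<noteq> {}" using Yne by auto
  have "inj_on (\<lambda>w. wbr w x) S"
  proof (rule inj_onI)
    fix u v assume "u \<in> S" "v \<in> S" "wbr u x = wbr v x"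
    then show "u = v" using wbr_eq[of u n v x x] nwordsD by (auto simp: S_def)
  qed
  have "S \<subseteq> (\<Union>e\<in>E. {w \<in> nwords n. \<exists>x\<in>wdom w. bowen_close n \<delta> (wbr w x) e})"
    using near by (fastforce simp: Y_def S_def)
  then have "card S \<le> card (\<Union>e\<in>E. {w \<in> nwords n. \<exists>x\<in>wdom w. bowen_close n \<delta> (wbr w x) e})"
    using finE finite_nwords by (intro card_mono) auto
  also have "\<dots> \<le> (\<Sum>e\<in>E. card {w \<in> nwords n. \<exists>x\<in>wdom w. bowen_close n \<delta> (wbr w x) e})"
    by (rule card_UN_le[OF finE])
  also have "\<dots> \<le> (\<Sum>e\<in>E. 2 ^ k)"
    unfolding n_def by (intro sum_mono card_words_bowen_close[OF long M])
  also have "\<dots> = card E * 2 ^ k" by simp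
  finally have "real (card S) \<le> real (card E) * 2 ^ k" by (metis of_nat_le_iff of_nat_mult of_nat_numeral of_nat_power)
  also have "\<dots> \<le> C * 2 ^ k"
    using C(1)[of E] EY finE Ene Y01 by (intro mult_right_mono) (auto simp: n_def)
  finally show ?thesis by (simp add: S_def n_def mult.commute)
next
  case True
  show ?thesis unfolding True using C(2) by simp
qed

text \<open>Distinguishes points by their itinerary and the position of the last iterate. It makes the entropy
  finite, so that \<open>real_of_ereal\<close> in the theorem does not hit its junk value.\<close>

lemma card_separated_le:
  assumes \<delta>: "\<delta> > 0" and n: "n \<ge> 1" and E: "E \<subseteq> {0..1}" "finite E" "bowen_separated f n \<delta> E"
  shows "card E \<le> card \<Lambda> ^ n * (nat \<lfloor>1 / \<delta>\<rfloor> + 1)"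
proof -
  define \<iota> where "\<iota> = (\<lambda>z. SOME i. i \<in> \<Lambda> \<and> z \<in> J i)"
  have \<iota>: "\<iota> z \<in> \<Lambda> \<and> z \<in> J (\<iota> z)" if "z \<in> {0..1}" for z
    unfolding \<iota>_def using someI_ex[of "\<lambda>i. i \<in> \<Lambda> \<and> z \<in> J i"] J_cover[OF that] by blast
  have it: "(f ^^ l) z \<in> {0..1}" if "z \<in> {0..1}" for l z
    by (induction l) (use that f01 in auto)
  define \<Phi> where "\<Phi> = (\<lambda>z. (map (\<lambda>l. \<iota> ((f ^^ l) z)) [0..<n], nat \<lfloor>(f ^^ (n - 1)) z / \<delta>\<rfloor>))"
  have "inj_on \<Phi> E"
  proof (rule inj_onI, rule ccontr)
    fix z z' assume z: "z \<in> E" "z' \<in> E" "\<Phi> z = \<Phi> z'" "z \<noteq> z'"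
    then have z01: "z \<in> {0..1}" "z' \<in> {0..1}" using E(1) by auto
    have same: "\<iota> ((f ^^ l) z) = \<iota> ((f ^^ l) z')" if "l < n" for l
      using z(3) that by (auto simp: \<Phi>_def)
    define a b where "a = (f ^^ (n - 1)) z / \<delta>" and "b = (f ^^ (n - 1)) z' / \<delta>"
    have "0 \<le> a" "0 \<le> b" using it[OF z01(1), of "n - 1"] it[OF z01(2), of "n - 1"] \<delta> by (auto simp: a_def b_def)
    moreover have "nat \<lfloor>a\<rfloor> = nat \<lfloor>b\<rfloor>" using z(3) by (simp add: \<Phi>_def a_def b_def)
    ultimately have "\<bar>a - b\<bar> < 1" by linarith
    then have "\<bar>a - b\<bar> * \<delta> < 1 * \<delta>" using \<delta> by (intro mult_strict_right_mono) auto
    moreover have "\<bar>a - b\<bar> * \<delta> = \<bar>(f ^^ (n - 1)) z - (f ^^ (n - 1)) z'\<bar>"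
      using \<delta> by (simp add: a_def b_def diff_divide_distrib[symmetric])
    ultimately have last: "\<bar>(f ^^ (n - 1)) z - (f ^^ (n - 1)) z'\<bar> < \<delta>" by simp
    \<comment> \<open>Points with equal symbols lie on one branch, where f increases distances. So
      the distance at time n - 1 dominates all earlier ones, and two points with the same code would
      not be separated.\<close>
    have expand_step: "\<bar>(f ^^ l) z - (f ^^ l) z'\<bar> \<le> \<bar>(f ^^ Suc l) z - (f ^^ Suc l) z'\<bar>" if "l < n" for l
    proof -
      define i where "i = \<iota> ((f ^^ l) z)"
      have i: "i \<in> \<Lambda>" "(f ^^ l) z \<in> J i" "(f ^^ l) z' \<in> J i"
        using \<iota>[OF it[OF z01(1)], of l] \<iota>[OF it[OF z01(2)], of l] same[OF that] by (auto simp: i_def)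
      have "1 * \<bar>(f ^^ l) z - (f ^^ l) z'\<bar> \<le> \<alpha> * \<bar>(f ^^ l) z - (f ^^ l) z'\<bar>"
        using \<alpha> by (intro mult_right_mono) auto
      also have "\<dots> \<le> \<bar>f ((f ^^ l) z) - f ((f ^^ l) z')\<bar>" by (rule expand[OF i])
      finally show ?thesis by simp
    qed
    have small: "\<bar>(f ^^ l) z - (f ^^ l) z'\<bar> \<le> \<bar>(f ^^ (n - 1)) z - (f ^^ (n - 1)) z'\<bar>" if "l \<le> n - 1" for l
      using that
    proof (induction rule: inc_induct)
      case (step l)
      then have "l < n" by simp
      from order_trans[OF expand_step[OF this] step.IH] show ?case .
    qed simp
    have "\<bar>(f ^^ l) z - (f ^^ l) z'\<bar> < \<delta>" if "l < n" for l
      using small[of l] last that by linarith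
    then show False using E(3) z(1,2,4) unfolding bowen_separated_def dist_real_def by (meson less_asym)
  qed
  moreover have "\<Phi> ` E \<subseteq> words n \<times> {..nat \<lfloor>1 / \<delta>\<rfloor>}"
  proof (rule image_subsetI)
    fix z assume "z \<in> E"
    then have z: "z \<in> {0..1}" using E(1) by auto
    have "(f ^^ (n - 1)) z / \<delta> \<le> 1 / \<delta>" using it[OF z, of "n - 1"] \<delta> by (intro divide_right_mono) auto
    then have "nat \<lfloor>(f ^^ (n - 1)) z / \<delta>\<rfloor> \<le> nat \<lfloor>1 / \<delta>\<rfloor>" by (intro nat_mono floor_mono)
    moreover have "set (map (\<lambda>l. \<iota> ((f ^^ l) z)) [0..<n]) \<subseteq> \<Lambda>" using \<iota>[OF it[OF z]] by auto
    ultimately show "\<Phi> z \<in> words n \<times> {..nat \<lfloor>1 / \<delta>\<rfloor>}" by (simp add: \<Phi>_def words_def)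
  qed
  ultimately have "card E \<le> card (words n \<times> {..nat \<lfloor>1 / \<delta>\<rfloor>})"
    using finite_words by (intro card_inj_on_le[of \<Phi>]) auto
  also have "\<dots> = card \<Lambda> ^ n * (nat \<lfloor>1 / \<delta>\<rfloor> + 1)"
    using card_lists_length_eq[OF finite_\<Lambda>, of n] by (simp add: card_cartesian_product words_def)
  finally show ?thesis .
qed

definition h_top :: real where
  "h_top = real_of_ereal (topological_entropy f {0..1})"

lemma card_\<Lambda>: "card \<Lambda> \<ge> 1"
proof -
  have "\<exists>i\<in>\<Lambda>. 0 \<in> J i" by (rule J_cover) simp
  then have "\<Lambda> \<noteq> {}" by blast
  then show ?thesis using finite_\<Lambda> by (simp add: Suc_le_eq card_gt_0_iff)
qed

text \<open>Squeezed between 0, which one-point separated sets give, and the logarithm of the number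
  of branches, by \<open>card_separated_le\<close>.\<close>

lemma topological_entropy_eq: "topological_entropy f {0..1} = ereal h_top"
proof -
  define X where "X = (\<lambda>\<delta> n. SUP E\<in>{E. E \<subseteq> {0..1} \<and> finite E \<and> E \<noteq> {} \<and> bowen_separated f n \<delta> E}.
      ereal (ln (real (card E)) / real n))"
  have te: "topological_entropy f {0..1} = (SUP \<delta>\<in>{0<..}. limsup (X \<delta>))"
    by (simp add: topological_entropy_def X_def)
  have "0 \<le> X 1 n" for n
  proof -
    have "ereal (ln (real (card {0::real})) / real n) \<le> X 1 n"
      unfolding X_def by (rule SUP_upper) (auto simp: bowen_separated_def)
    then show ?thesis by (simp add: zero_ereal_def)
  qed
  then have "0 \<le> limsup (X 1)" by (intro le_Limsup) auto
  also have "\<dots> \<le> topological_entropy f {0..1}" unfolding te by (rule SUP_upper) simp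
  finally have lo: "0 \<le> topological_entropy f {0..1}" .
  have "topological_entropy f {0..1} \<le> ereal (ln (real (card \<Lambda>)))"
    unfolding te
  proof (rule SUP_least)
    fix \<delta> :: real assume "\<delta> \<in> {0<..}"
    then have \<delta>: "\<delta> > 0" by simp
    define c where "c = real (nat \<lfloor>1 / \<delta>\<rfloor> + 1)"
    have c: "c \<ge> 1" by (simp add: c_def)
    have "X \<delta> n \<le> ereal (ln (real (card \<Lambda>)) + ln c / real n)" if n: "n \<ge> 1" for n
      unfolding X_def
    proof (rule SUP_least)
      fix E assume "E \<in> {E. E \<subseteq> {0..1} \<and> finite E \<and> E \<noteq> {} \<and> bowen_separated f n \<delta> E}"
      then have E: "E \<subseteq> {0..1}" "finite E" "E \<noteq> {}" "bowen_separated f n \<delta> E" by auto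
      have "real (card E) \<le> real (card \<Lambda> ^ n * (nat \<lfloor>1 / \<delta>\<rfloor> + 1))"
        using card_separated_le[OF \<delta> n E(1,2,4)] by (rule of_nat_mono)
      also have "\<dots> = real (card \<Lambda>) ^ n * c" by (simp add: c_def distrib_left)
      finally have le: "real (card E) \<le> real (card \<Lambda>) ^ n * c" .
      have "0 < real (card E)" using E by (simp add: card_gt_0_iff)
      then have "ln (real (card E)) \<le> ln (real (card \<Lambda>) ^ n * c)" using le by simp
      also have "\<dots> = real n * ln (real (card \<Lambda>)) + ln c"
        using card_\<Lambda> c by (simp add: ln_mult ln_realpow)
      finally have "ln (real (card E)) / real n \<le> (real n * ln (real (card \<Lambda>)) + ln c) / real n"
        by (intro divide_right_mono) auto
      also have "\<dots> = ln (real (card \<Lambda>)) + ln c / real n" using n by (simp add: add_divide_distrib)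
      finally show "ereal (ln (real (card E)) / real n) \<le> ereal (ln (real (card \<Lambda>)) + ln c / real n)" by simp
    qed
    then have "limsup (X \<delta>) \<le> limsup (\<lambda>n. ereal (ln (real (card \<Lambda>)) + ln c / real n))"
      by (intro Limsup_mono eventually_sequentiallyI[of 1])
    also have "\<dots> = ereal (ln (real (card \<Lambda>)))"
    proof (rule lim_imp_Limsup)
      have "(\<lambda>n. ln (real (card \<Lambda>)) + ln c / real n) \<longlonglongrightarrow> ln (real (card \<Lambda>)) + 0"
        by (intro tendsto_add tendsto_const lim_const_over_n)
      then show "(\<lambda>n. ereal (ln (real (card \<Lambda>)) + ln c / real n)) \<longlonglongrightarrow> ereal (ln (real (card \<Lambda>)))" by simp
    qed simp
    finally show "limsup (X \<delta>) \<le> ereal (ln (real (card \<Lambda>)))" .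
  qed
  then show ?thesis using lo unfolding h_top_def
    by (cases "topological_entropy f {0..1}") auto
qed

lemma card_separated_entropy:
  assumes \<eta>: "\<eta> > 0" and \<delta>: "\<delta> > 0"
  obtains n0 where "\<And>n E. n \<ge> n0 \<Longrightarrow> E \<subseteq> {0..1} \<Longrightarrow> finite E \<Longrightarrow> E \<noteq> {} \<Longrightarrow> bowen_separated f n \<delta> E \<Longrightarrow>
    real (card E) \<le> exp (real n * (h_top + \<eta>))"
proof -
  define X where "X = (\<lambda>n. SUP E\<in>{E. E \<subseteq> {0..1} \<and> finite E \<and> E \<noteq> {} \<and> bowen_separated f n \<delta> E}.
      ereal (ln (real (card E)) / real n))"
  have "limsup X \<le> topological_entropy f {0..1}"
    unfolding topological_entropy_def X_def by (rule SUP_upper2[of \<delta>]) (use \<delta> in auto)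
  also have "\<dots> < ereal (h_top + \<eta>)" unfolding topological_entropy_eq using \<eta> by simp
  finally have "\<forall>\<^sub>F n in sequentially. X n < ereal (h_top + \<eta>)" by (rule Limsup_lessD)
  then obtain n1 where n1: "\<And>n. n \<ge> n1 \<Longrightarrow> X n < ereal (h_top + \<eta>)"
    unfolding eventually_sequentially by blast
  show thesis
  proof (rule that[of "max n1 1"])
    fix n E assume n: "max n1 1 \<le> n" and E: "E \<subseteq> {0..1}" "finite E" "E \<noteq> {}" "bowen_separated f n \<delta> E"
    have "ereal (ln (real (card E)) / real n) \<le> X n"
      unfolding X_def using E by (intro SUP_upper) auto
    also have "\<dots> < ereal (h_top + \<eta>)" using n1 n by simp
    finally have "ln (real (card E)) < real n * (h_top + \<eta>)" using n by (simp add: field_simps)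
    moreover have "0 < real (card E)" using E by (simp add: card_gt_0_iff)
    ultimately show "real (card E) \<le> exp (real n * (h_top + \<eta>))"
      by (metis exp_le_cancel_iff exp_ln less_imp_le)
  qed
qed

text \<open>The block length M is chosen so that the factor 2 per block is at most
  \<open>exp (M * \<eta> / 2)\<close>. M determines the cylinder length and with it \<delta>; only
  then is the number k of blocks taken large enough for the entropy bound with
  \<open>\<eta> / 2\<close> at scale \<delta>.\<close>

theorem multiplicity_entropy:
  assumes \<eta>: "\<eta> > 0"
  obtains n N where "n \<ge> n1" "n \<ge> 1" "\<And>x. card {w \<in> nwords n. x \<in> wdom w} \<le> N"
    "real N \<le> exp (real n * (h_top + \<eta>))"
proof -
  obtain M :: nat where M: "real M > 2 * ln 2 / \<eta>" using reals_Archimedean2 by blast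
  have "0 < 2 * ln 2 / \<eta>" using \<eta> by simp
  then have M1: "M \<ge> 1" using M by (cases M) auto
  obtain \<kappa> where \<kappa>: "\<kappa> > 0" "\<And>w. w \<in> nwords M \<Longrightarrow> \<exists>x\<in>wdom w. \<exists>y\<in>wdom w. \<bar>x - y\<bar> > \<kappa>"
    "\<And>w. w \<in> nwords M \<Longrightarrow> \<exists>x\<in>wdom w. \<exists>y\<in>wdom w. \<bar>wbr w x - wbr w y\<bar> > \<kappa>"
    using min_length[of M] by blast
  define \<delta> where "\<delta> = \<kappa> / 2"
  have \<delta>: "\<delta> > 0" using \<kappa> by (simp add: \<delta>_def)
  have long: "\<exists>x\<in>wdom v. \<exists>y\<in>wdom v. \<bar>wbr v x - wbr v y\<bar> > 2 * \<delta>" if "v \<in> nwords M" for v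
    using \<kappa>(3)[OF that] by (simp add: \<delta>_def)
  have "\<eta> / 2 > 0" using \<eta> by simp
  then obtain n0 where n0: "\<And>n E. n \<ge> n0 \<Longrightarrow> E \<subseteq> {0..1} \<Longrightarrow> finite E \<Longrightarrow> E \<noteq> {} \<Longrightarrow> bowen_separated f n \<delta> E \<Longrightarrow>
      real (card E) \<le> exp (real n * (h_top + \<eta> / 2))"
    using card_separated_entropy[OF _ \<delta>] by blast
  define k where "k = max (max n0 n1) 1"
  define n where "n = k * M"
  have "k * 1 \<le> k * M" using M1 by (intro mult_le_mono2)
  then have n: "k \<le> n" by (simp add: n_def)
  define C where "C = exp (real n * (h_top + \<eta> / 2))"
  have bd: "real (card {w \<in> nwords n. x \<in> wdom w}) \<le> 2 ^ k * C" for x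
    unfolding n_def
  proof (rule card_preimages_le[OF long M1 \<delta>])
    have "n0 \<le> k" by (simp add: k_def)
    then have "n0 \<le> n" using n by linarith
    then show "real (card E) \<le> C" if "E \<subseteq> {0..1}" "finite E" "E \<noteq> {}" "bowen_separated f (k * M) \<delta> E" for E
      using n0[of n E] that by (simp add: C_def n_def)
  qed (auto simp: C_def k_def)
  have "(2::real) ^ k = exp (real k * ln 2)" by (simp add: exp_of_nat_mult)
  then have "2 ^ k * C = exp (real k * ln 2 + real n * (h_top + \<eta> / 2))" by (simp add: C_def exp_add)
  also have "\<dots> \<le> exp (real n * (h_top + \<eta>))"
  proof -
    have "ln 2 \<le> real M * \<eta> / 2" using M \<eta> by (simp add: field_simps)
    then have "real k * ln 2 \<le> real k * (real M * \<eta> / 2)" by (intro mult_left_mono) auto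
    then show ?thesis by (simp add: n_def algebra_simps)
  qed
  finally have "2 ^ k * C \<le> exp (real n * (h_top + \<eta>))" .
  moreover have C0: "0 \<le> 2 ^ k * C" by (simp add: C_def)
  ultimately have "real (nat \<lfloor>2 ^ k * C\<rfloor>) \<le> exp (real n * (h_top + \<eta>))" by linarith
  moreover have "card {w \<in> nwords n. x \<in> wdom w} \<le> nat \<lfloor>2 ^ k * C\<rfloor>" for x
    using bd[of x] by (simp add: le_nat_floor)
  ultimately show thesis using n by (intro that[of n "nat \<lfloor>2 ^ k * C\<rfloor>"]) (auto simp: k_def)
qed

end

section \<open>A Fredholm criterion on complete seminormed spaces\<close>

text \<open>Elimination by induction on D. If some vector of K is annihilated by the first D
  functionals but not by the next one, it joins B and corrects the remainders; otherwise B already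
  works. Thus K is finite dimensional modulo the common kernel of the functionals.\<close>

lemma finite_separating_set:
  fixes \<phi> :: "nat \<Rightarrow> ('a \<Rightarrow> complex) \<Rightarrow> complex"
  assumes K: "\<And>u v a b. u \<in> K \<Longrightarrow> v \<in> K \<Longrightarrow> (\<lambda>x. a * u x + b * v x) \<in> K"
    and \<phi>: "\<And>j u v a b. j < D \<Longrightarrow> u \<in> K \<Longrightarrow> v \<in> K \<Longrightarrow> \<phi> j (\<lambda>x. a * u x + b * v x) = a * \<phi> j u + b * \<phi> j v"
  shows "\<exists>B. finite B \<and> B \<subseteq> K \<and> (\<forall>v\<in>K. \<exists>c. (\<lambda>x. v x - (\<Sum>b\<in>B. c b * b x)) \<in> K \<and> (\<forall>j<D. \<phi> j (\<lambda>x. v x - (\<Sum>b\<in>B. c b * b x)) = 0))"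
  using \<phi>
proof (induction D)
  case 0
  show ?case by (rule exI[of _ "{}"]) auto
next
  case (Suc D)
  define rem where "rem = (\<lambda>(B :: ('a \<Rightarrow> complex) set) c v x. v x - (\<Sum>b\<in>B. c b * b x) :: complex)"
  have "\<exists>B. finite B \<and> B \<subseteq> K \<and> (\<forall>v\<in>K. \<exists>c. rem B c v \<in> K \<and> (\<forall>j<D. \<phi> j (rem B c v) = 0))"
    unfolding rem_def using Suc.IH[OF Suc.prems] by simp
  then obtain B where B: "finite B" "B \<subseteq> K" and span: "\<forall>v\<in>K. \<exists>c. rem B c v \<in> K \<and> (\<forall>j<D. \<phi> j (rem B c v) = 0)"
    by (elim exE conjE) (rule that)
  show ?case
  proof (cases "\<exists>b0\<in>K. (\<forall>j<D. \<phi> j b0 = 0) \<and> \<phi> D b0 \<noteq> 0")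
    case False
    have "\<exists>c. rem B c v \<in> K \<and> (\<forall>j<Suc D. \<phi> j (rem B c v) = 0)" if v: "v \<in> K" for v
    proof -
      obtain c where c: "rem B c v \<in> K" "\<forall>j<D. \<phi> j (rem B c v) = 0" using bspec[OF span v] by (elim exE conjE) (rule that)
      then have "\<phi> D (rem B c v) = 0" using False by (metis (no_types))
      then show ?thesis using c by (intro exI[of _ c]) (simp add: less_Suc_eq)
    qed
    then show ?thesis using B unfolding rem_def by (intro exI[of _ B] conjI ballI) simp_all
  next
    case True
    then obtain b0 where b0: "b0 \<in> K" "\<forall>j<D. \<phi> j b0 = 0" "\<phi> D b0 \<noteq> 0"
      by (elim bexE conjE) (rule that)
    show ?thesis
    proof (intro exI[of _ "insert b0 B"] conjI ballI)
      fix v assume v: "v \<in> K"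
      obtain c where cc: "rem B c v \<in> K" "\<forall>j<D. \<phi> j (rem B c v) = 0"
        using bspec[OF span v] by (elim exE conjE) (rule that)
      then have c: "(\<lambda>x. v x - (\<Sum>b\<in>B. c b * b x)) \<in> K"
        "\<And>j. j < D \<Longrightarrow> \<phi> j (\<lambda>x. v x - (\<Sum>b\<in>B. c b * b x)) = 0" by (simp_all add: rem_def)
      define v' where "v' = (\<lambda>x. v x - (\<Sum>b\<in>B. c b * b x))"
      define t where "t = \<phi> D v' / \<phi> D b0"
      \<comment> \<open>If \<open>b0\<close> already belongs to B its coefficient is increased by t,
        otherwise it is new with coefficient t.\<close>
      define c' where "c' = (if b0 \<in> B then c(b0 := c b0 + t) else c(b0 := t))"
      have sum: "(\<Sum>b\<in>insert b0 B. c' b * b x) = (\<Sum>b\<in>B. c b * b x) + t * b0 x" for x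
      proof (cases "b0 \<in> B")
        case True
        have "(\<Sum>b\<in>B. c' b * b x) = c' b0 * b0 x + (\<Sum>b\<in>B - {b0}. c' b * b x)"
          using B True by (simp add: sum.remove)
        also have "(\<Sum>b\<in>B - {b0}. c' b * b x) = (\<Sum>b\<in>B - {b0}. c b * b x)"
          using True by (intro sum.cong) (auto simp: c'_def)
        also have "c' b0 * b0 x + \<dots> = t * b0 x + (c b0 * b0 x + (\<Sum>b\<in>B - {b0}. c b * b x))"
          using True by (simp add: c'_def algebra_simps)
        also have "c b0 * b0 x + (\<Sum>b\<in>B - {b0}. c b * b x) = (\<Sum>b\<in>B. c b * b x)"
          using B True by (simp add: sum.remove)
        finally show ?thesis using True by (simp add: insert_absorb)
      next
        case False
        then have "(\<Sum>b\<in>B. c' b * b x) = (\<Sum>b\<in>B. c b * b x)" by (intro sum.cong) (auto simp: c'_def)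
        then show ?thesis using False B by (simp add: c'_def)
      qed
      have eq: "(\<lambda>x. v x - (\<Sum>b\<in>insert b0 B. c' b * b x)) = (\<lambda>x. 1 * v' x + (- t) * b0 x)"
        unfolding sum by (auto simp: v'_def algebra_simps)
      have v'K: "v' \<in> K" using c(1) by (simp add: v'_def)
      have "\<forall>j<Suc D. \<phi> j (\<lambda>x. 1 * v' x + (- t) * b0 x) = 0"
      proof (intro allI impI)
        fix j assume that: "j < Suc D"
        have "\<phi> j (\<lambda>x. 1 * v' x + (- t) * b0 x) = 1 * \<phi> j v' + (- t) * \<phi> j b0"
          using that by (intro Suc.prems v'K b0)
        then show "\<phi> j (\<lambda>x. 1 * v' x + (- t) * b0 x) = 0" using that c(2) b0 by (cases "j = D") (auto simp: t_def v'_def[symmetric])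
      qed
      moreover have "(\<lambda>x. 1 * v' x + (- t) * b0 x) \<in> K" by (intro K v'K b0)
      ultimately show "\<exists>c. (\<lambda>x. v x - (\<Sum>b\<in>insert b0 B. c b * b x)) \<in> K
          \<and> (\<forall>j<Suc D. \<phi> j (\<lambda>x. v x - (\<Sum>b\<in>insert b0 B. c b * b x)) = 0)"
        by (intro exI[of _ c']) (simp only: eq simp_thms)
    qed (use B b0 in auto)
  qed
qed

text \<open>M carries the estimates, N is the norm in which the result is stated, and the two are
  linked by comparison in both directions. Completeness is given as convergence of absolutely
  convergent series, the form that the Neumann series uses.\<close>

locale complete_seminormed =
  fixes V :: "('a \<Rightarrow> complex) set" and M N :: "('a \<Rightarrow> complex) \<Rightarrow> real" and C :: real
  assumes V_ne: "V \<noteq> {}"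
    and V_lin: "u \<in> V \<Longrightarrow> v \<in> V \<Longrightarrow> (\<lambda>x. a * u x + b * v x) \<in> V"
    and M_nonneg: "u \<in> V \<Longrightarrow> 0 \<le> M u"
    and M_triangle: "u \<in> V \<Longrightarrow> v \<in> V \<Longrightarrow> M (\<lambda>x. u x + v x) \<le> M u + M v"
    and M_scale: "u \<in> V \<Longrightarrow> M (\<lambda>x. c * u x) = norm c * M u"
    and N_nonneg: "u \<in> V \<Longrightarrow> 0 \<le> N u" and N_le: "u \<in> V \<Longrightarrow> N u \<le> M u" and M_le: "u \<in> V \<Longrightarrow> M u \<le> C * N u"
    and complete: "(\<And>n. w n \<in> V) \<Longrightarrow> summable (\<lambda>n. M (w n)) \<Longrightarrow>
      \<exists>v\<in>V. (\<lambda>n. M (\<lambda>x. v x - (\<Sum>i<n. w i x))) \<longlonglongrightarrow> 0"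
begin

lemma V_zero: "(\<lambda>x. 0) \<in> V"
  using V_ne V_lin[of _ _ 0 0] by auto

lemma V_add: "u \<in> V \<Longrightarrow> v \<in> V \<Longrightarrow> (\<lambda>x. u x + v x) \<in> V"
  using V_lin[of u v 1 1] by simp

lemma V_diff: "u \<in> V \<Longrightarrow> v \<in> V \<Longrightarrow> (\<lambda>x. u x - v x) \<in> V"
  using V_lin[of u v 1 "-1"] by simp

lemma V_scale: "u \<in> V \<Longrightarrow> (\<lambda>x. c * u x) \<in> V"
  using V_lin[of u u c 0] by simp

lemma V_sum: "finite I \<Longrightarrow> (\<And>i. i \<in> I \<Longrightarrow> u i \<in> V) \<Longrightarrow> (\<lambda>x. \<Sum>i\<in>I. u i x) \<in> V"
  by (induction I rule: finite_induct) (auto simp: V_zero intro: V_add)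

lemma M_diff: "u \<in> V \<Longrightarrow> v \<in> V \<Longrightarrow> M (\<lambda>x. u x - v x) \<le> M u + M v"
  using M_triangle[of u "\<lambda>x. -1 * v x"] M_scale[of v "-1"] V_scale[of v "-1"] by simp

lemma M_zero: "M (\<lambda>x. 0) = 0"
  using M_scale[OF V_zero, of 0] by simp

lemma null_iff: "u \<in> V \<Longrightarrow> N u = 0 \<longleftrightarrow> M u = 0"
  using N_nonneg[of u] N_le[of u] M_le[of u] M_nonneg[of u] by auto

lemma bounded_operatorI:
  assumes T: "\<And>v. v \<in> V \<Longrightarrow> T v \<in> V" "\<And>u v a b. T (\<lambda>x. a * u x + b * v x) = (\<lambda>x. a * T u x + b * T v x)"
    and B: "\<And>v. v \<in> V \<Longrightarrow> M (T v) \<le> B * M v"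
  shows "bounded_operator V N T"
  unfolding bounded_operator_def
proof (intro conjI ballI allI)
  show "T v \<in> V" if "v \<in> V" for v using that by (rule T(1))
  show "N (\<lambda>x. T (\<lambda>y. a * u y + b * v y) x - (a * T u x + b * T v x)) = 0" for u v a b
    using null_iff[OF V_zero] M_zero by (simp add: T(2))
  have "N (T v) \<le> (\<bar>B\<bar> * \<bar>C\<bar>) * N v" if v: "v \<in> V" for v
  proof -
    have "N (T v) \<le> M (T v)" using T(1)[OF v] by (rule N_le)
    also have "\<dots> \<le> B * M v" by (rule B[OF v])
    also have "\<dots> \<le> \<bar>B\<bar> * M v" using M_nonneg[OF v] by (intro mult_right_mono) auto
    finally have le: "N (T v) \<le> \<bar>B\<bar> * M v" .
    have "M v \<le> \<bar>C\<bar> * N v" using M_le[OF v] mult_right_mono[OF abs_ge_self N_nonneg[OF v], of C] by linarith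
    then have "\<bar>B\<bar> * M v \<le> \<bar>B\<bar> * (\<bar>C\<bar> * N v)" by (intro mult_left_mono) auto
    then show ?thesis using le by (simp add: mult.assoc)
  qed
  then show "\<exists>C. \<forall>v\<in>V. N (T v) \<le> C * N v" by blast
qed

text \<open>The solution u is the sum of all \<open>(R ^^ k) v\<close>. Limits exist up to null
  functions, so the equation is obtained in the form that its defect has seminorm 0.\<close>

lemma neumann:
  assumes R: "\<And>v. v \<in> V \<Longrightarrow> R v \<in> V" "\<And>u v. u \<in> V \<Longrightarrow> v \<in> V \<Longrightarrow> R (\<lambda>x. u x + v x) = (\<lambda>x. R u x + R v x)"
    "\<And>u v. u \<in> V \<Longrightarrow> v \<in> V \<Longrightarrow> R (\<lambda>x. u x - v x) = (\<lambda>x. R u x - R v x)"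
    and r: "\<And>v. v \<in> V \<Longrightarrow> M (R v) \<le> r * M v" "0 \<le> r" "r < 1" and v: "v \<in> V"
  shows "\<exists>u\<in>V. M (\<lambda>x. u x - R u x - v x) = 0"
proof -
  define w where "w = (\<lambda>k. (R ^^ k) v)"
  have wV: "w k \<in> V" for k by (induction k) (auto simp: w_def v R)
  have wM: "M (w k) \<le> r ^ k * M v" for k
  proof (induction k)
    case (Suc k)
    have "M (w (Suc k)) \<le> r * M (w k)" using r(1)[OF wV[of k]] by (simp add: w_def)
    also have "\<dots> \<le> r * (r ^ k * M v)" using Suc r by (intro mult_left_mono) auto
    finally show ?case by simp
  qed (simp add: w_def)
  have "summable (\<lambda>k. M (w k))"
  proof (rule summable_comparison_test)
    show "\<exists>N. \<forall>n\<ge>N. norm (M (w n)) \<le> r ^ n * M v" using wM M_nonneg[OF wV] by simp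
    show "summable (\<lambda>n. r ^ n * M v)" using r by (intro summable_mult2 summable_geometric) auto
  qed
  then obtain u where u: "u \<in> V" "(\<lambda>n. M (\<lambda>x. u x - (\<Sum>i<n. w i x))) \<longlonglongrightarrow> 0"
    using complete[of w] wV by blast
  define S where "S = (\<lambda>n x. \<Sum>i<n. w i x)"
  have SV: "S n \<in> V" for n unfolding S_def using wV by (intro V_sum) auto
  have RS: "R (S n) = (\<lambda>x. S (Suc n) x - v x)" for n
  proof (induction n)
    case 0
    have "R (\<lambda>x. v x - v x) = (\<lambda>x. 0)" unfolding R(3)[OF v v] by simp
    then show ?case by (simp add: S_def w_def)
  next
    case (Suc n)
    have "S (Suc n) = (\<lambda>x. S n x + w n x)" by (auto simp: S_def)
    then have "R (S (Suc n)) = (\<lambda>x. R (S n) x + R (w n) x)" using R(2)[OF SV wV] by simp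
    then show ?case unfolding Suc.IH by (auto simp: S_def w_def)
  qed
  have uS: "(\<lambda>x. u x - S n x) \<in> V" for n by (intro V_diff u SV)
  have bd: "M (\<lambda>x. u x - R u x - v x) \<le> M (\<lambda>x. u x - S (Suc n) x) + r * M (\<lambda>x. u x - S n x)" for n
  proof -
    have eq: "(\<lambda>x. u x - R u x - v x) = (\<lambda>x. (u x - S (Suc n) x) - R (\<lambda>x. u x - S n x) x)"
      unfolding R(3)[OF u(1) SV] RS by auto
    have "M (\<lambda>x. u x - R u x - v x) \<le> M (\<lambda>x. u x - S (Suc n) x) + M (R (\<lambda>x. u x - S n x))"
      unfolding eq by (intro M_diff uS R)
    then show ?thesis using r(1)[OF uS[of n]] by linarith
  qed
  have lim: "(\<lambda>n. M (\<lambda>x. u x - S n x)) \<longlonglongrightarrow> 0" using u(2) by (simp add: S_def)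
  have "(\<lambda>n. M (\<lambda>x. u x - S (Suc n) x) + r * M (\<lambda>x. u x - S n x)) \<longlonglongrightarrow> 0 + r * 0"
    by (intro tendsto_add tendsto_mult tendsto_const lim LIMSEQ_Suc[OF lim])
  then have "M (\<lambda>x. u x - R u x - v x) \<le> 0"
    by (intro LIMSEQ_le_const[of _ 0]) (use bd in auto)
  moreover have "(\<lambda>x. u x - R u x - v x) \<in> V" by (intro V_diff u R v)
  ultimately show ?thesis using M_nonneg u(1) by (intro bexI[of _ u]) (auto intro: antisym)
qed

text \<open>\<open>T^n\<close> is \<open>R\<close> plus a finite rank operator, with
  \<open>R\<close> small against \<open>z^n\<close>, so \<open>z^n - R\<close> is bijective up to
  null functions. The kernel of \<open>z - T\<close> lies in that of \<open>z^n - T^n\<close>, where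
  the functionals separate. The range of \<open>z - T\<close> contains that of
  \<open>z^n - T^n\<close>, by factorisation, and the latter misses at most the span of the D
  vectors in \<open>B2\<close>.\<close>

theorem fredholm_finite_rank_perturbation:
  fixes \<phi> :: "nat \<Rightarrow> ('a \<Rightarrow> complex) \<Rightarrow> complex"
  assumes T: "\<And>v. v \<in> V \<Longrightarrow> T v \<in> V" "\<And>u v a b. T (\<lambda>x. a * u x + b * v x) = (\<lambda>x. a * T u x + b * T v x)"
    and TB: "\<And>v. v \<in> V \<Longrightarrow> M (T v) \<le> B * M v"
    and e: "\<And>j. j < D \<Longrightarrow> e j \<in> V"
    and \<phi>: "\<And>j u v a b. j < D \<Longrightarrow> u \<in> V \<Longrightarrow> v \<in> V \<Longrightarrow> \<phi> j (\<lambda>x. a * u x + b * v x) = a * \<phi> j u + b * \<phi> j v"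
    and small: "\<And>v. v \<in> V \<Longrightarrow> M ((T ^^ n) (\<lambda>x. v x - (\<Sum>j<D. \<phi> j v * e j x))) \<le> r * norm z ^ n * M v"
    and r: "0 \<le> r" "r < 1" and z: "z \<noteq> 0"
  shows "fredholm V N (\<lambda>v x. z * v x - T v x)"
proof -
  define \<zeta> where "\<zeta> = z ^ n"
  have \<zeta>: "\<zeta> \<noteq> 0" using z by (simp add: \<zeta>_def)
  have TnV: "(T ^^ k) v \<in> V" if "v \<in> V" for v k by (induction k) (auto simp: that T)
  have Tnlin: "(T ^^ k) (\<lambda>x. a * u x + b * v x) = (\<lambda>x. a * (T ^^ k) u x + b * (T ^^ k) v x)" for k u v a b
    by (induction k) (auto simp: T(2))
  have Tndiff: "(T ^^ k) (\<lambda>x. u x - v x) = (\<lambda>x. (T ^^ k) u x - (T ^^ k) v x)" for k u v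
    using Tnlin[of k 1 u "-1" v] by simp
  have Tnzero: "(T ^^ k) (\<lambda>x. 0) = (\<lambda>x. 0)" for k
    using Tnlin[of k 0 "\<lambda>x. 0" 0 "\<lambda>x. 0"] by simp
  have Tnsum: "(T ^^ k) (\<lambda>x. \<Sum>j<m. c j * u j x) = (\<lambda>x. \<Sum>j<m. c j * (T ^^ k) (u j) x)" for k c u and m :: nat
  proof (induction m)
    case (Suc m)
    show ?case using Tnlin[of k 1 "\<lambda>x. \<Sum>j<m. c j * u j x" "c m" "u m"] Suc by simp
  qed (simp add: Tnzero)
  define P where "P = (\<lambda>v x. \<Sum>j<D. \<phi> j v * e j x)"
  have PV: "P v \<in> V" for v unfolding P_def by (intro V_sum V_scale e) auto
  have Plin: "P (\<lambda>x. a * u x + b * v x) = (\<lambda>x. a * P u x + b * P v x)" if "u \<in> V" "v \<in> V" for u v a b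
    using that by (auto simp: P_def \<phi> sum_distrib_left sum.distrib[symmetric] algebra_simps intro!: sum.cong)
  define R where "R = (\<lambda>v. (T ^^ n) (\<lambda>x. v x - P v x))"
  have RV: "R v \<in> V" if "v \<in> V" for v unfolding R_def by (intro TnV V_diff that PV)
  have Rlin: "R (\<lambda>x. a * u x + b * v x) = (\<lambda>x. a * R u x + b * R v x)" if "u \<in> V" "v \<in> V" for u v a b
  proof -
    have "(\<lambda>x. (a * u x + b * v x) - P (\<lambda>x. a * u x + b * v x) x) = (\<lambda>x. a * (u x - P u x) + b * (v x - P v x))"
      unfolding Plin[OF that] by (auto simp: algebra_simps)
    then show ?thesis by (simp add: R_def Tnlin)
  qed
  have RM: "M (R v) \<le> r * norm \<zeta> * M v" if "v \<in> V" for v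
    using small[OF that] by (simp add: R_def P_def \<zeta>_def norm_power)
  have TnR: "(T ^^ n) v = (\<lambda>x. R v x + (\<Sum>j<D. \<phi> j v * (T ^^ n) (e j) x))" for v
    unfolding R_def Tndiff P_def Tnsum by auto
  have solve: "\<exists>u\<in>V. M (\<lambda>x. \<zeta> * u x - R u x - v x) = 0" if v: "v \<in> V" for v
  proof -
    define R' where "R' = (\<lambda>u x. (1 / \<zeta>) * R u x)"
    have "\<exists>u\<in>V. M (\<lambda>x. u x - R' u x - (1 / \<zeta>) * v x) = 0"
    proof (rule neumann[where r = r])
      show "R' u \<in> V" if "u \<in> V" for u unfolding R'_def by (intro V_scale RV that)
      show "R' (\<lambda>x. u x + v x) = (\<lambda>x. R' u x + R' v x)" if "u \<in> V" "v \<in> V" for u v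
        using Rlin[OF that, of 1 1] by (auto simp: R'_def algebra_simps add_divide_distrib diff_divide_distrib)
      show "R' (\<lambda>x. u x - v x) = (\<lambda>x. R' u x - R' v x)" if "u \<in> V" "v \<in> V" for u v
        using Rlin[OF that, of 1 "-1"] by (auto simp: R'_def algebra_simps add_divide_distrib diff_divide_distrib)
      show "M (R' u) \<le> r * M u" if "u \<in> V" for u
      proof -
        have "M (R' u) = norm (1 / \<zeta>) * M (R u)" unfolding R'_def by (rule M_scale[OF RV[OF that]])
        also have "\<dots> \<le> norm (1 / \<zeta>) * (r * norm \<zeta> * M u)" by (intro mult_left_mono RM[OF that]) auto
        also have "\<dots> = r * M u" using \<zeta> by (simp add: norm_divide)
        finally show ?thesis .
      qed
      show "(\<lambda>x. (1 / \<zeta>) * v x) \<in> V" by (intro V_scale v)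
    qed (use r in auto)
    then obtain u where u: "u \<in> V" "M (\<lambda>x. u x - R' u x - (1 / \<zeta>) * v x) = 0" by blast
    have "(\<lambda>x. u x - R' u x - (1 / \<zeta>) * v x) \<in> V" unfolding R'_def by (intro V_diff u V_scale RV v)
    from M_scale[OF this, of \<zeta>] u(2) have "M (\<lambda>x. \<zeta> * (u x - R' u x - (1 / \<zeta>) * v x)) = 0" by simp
    moreover have "(\<lambda>x. \<zeta> * (u x - R' u x - (1 / \<zeta>) * v x)) = (\<lambda>x. \<zeta> * u x - R u x - v x)"
      using \<zeta> by (auto simp: R'_def algebra_simps)
    ultimately show ?thesis using u(1) by auto
  qed
  have unique: "M v = 0" if v: "v \<in> V" and n0: "M (\<lambda>x. \<zeta> * v x - R v x) = 0" for v
  proof -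
    have "M (\<lambda>x. (\<zeta> * v x - R v x) + R v x) \<le> M (\<lambda>x. \<zeta> * v x - R v x) + M (R v)"
      by (intro M_triangle V_diff V_scale RV v)
    then have "M (\<lambda>x. \<zeta> * v x) \<le> M (R v)" using n0 by simp
    then have "norm \<zeta> * M v \<le> r * norm \<zeta> * M v" using M_scale[OF v] RM[OF v] by simp
    then have "norm \<zeta> * ((1 - r) * M v) \<le> 0" by (simp add: algebra_simps)
    then have "(1 - r) * M v \<le> 0" using \<zeta> by (simp add: mult_le_0_iff)
    then show ?thesis using r M_nonneg[OF v] by (simp add: mult_le_0_iff)
  qed
  define Q where "Q = (\<lambda>v x. z * v x - T v x)"
  have QV: "Q v \<in> V" if "v \<in> V" for v unfolding Q_def by (intro V_diff V_scale T that)
  have Qlin: "Q (\<lambda>x. a * u x + b * v x) = (\<lambda>x. a * Q u x + b * Q v x)" for u v a b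
    unfolding Q_def T(2) by (auto simp: algebra_simps)
  have bounded: "bounded_operator V N Q"
  proof (rule bounded_operatorI[OF QV Qlin])
    fix v assume v: "v \<in> V"
    have "M (Q v) \<le> M (\<lambda>x. z * v x) + M (T v)" unfolding Q_def by (intro M_diff V_scale T v)
    then show "M (Q v) \<le> (norm z + B) * M v" using M_scale[OF v] TB[OF v] by (simp add: algebra_simps)
  qed
  define Kr where "Kr = {v \<in> V. N (Q v) = 0}"
  have KrM: "v \<in> Kr \<longleftrightarrow> v \<in> V \<and> M (Q v) = 0" for v
    using null_iff[OF QV] by (auto simp: Kr_def)
  have Krlin: "(\<lambda>x. a * u x + b * v x) \<in> Kr" if "u \<in> Kr" "v \<in> Kr" for u v a b
  proof -
    have uv: "u \<in> V" "v \<in> V" "M (Q u) = 0" "M (Q v) = 0" using that KrM by auto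
    have "M (\<lambda>x. a * Q u x + b * Q v x) \<le> M (\<lambda>x. a * Q u x) + M (\<lambda>x. b * Q v x)"
      by (intro M_triangle V_scale QV uv)
    also have "\<dots> = 0" using M_scale[OF QV[OF uv(1)]] M_scale[OF QV[OF uv(2)]] uv by simp
    finally have "M (\<lambda>x. a * Q u x + b * Q v x) \<le> 0" .
    moreover have "(\<lambda>x. a * Q u x + b * Q v x) \<in> V" by (intro V_lin QV uv)
    ultimately have "M (\<lambda>x. a * Q u x + b * Q v x) = 0" using M_nonneg by (auto intro: antisym)
    then show ?thesis unfolding KrM Qlin using V_lin uv by simp
  qed
  have power: "M (\<lambda>x. z ^ k * v x - (T ^^ k) v x) = 0" if v: "v \<in> Kr" for v k
  proof (induction k)
    case (Suc k)
    have vV: "v \<in> V" "M (Q v) = 0" using v KrM by auto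
    have dV: "(\<lambda>x. z ^ k * v x - (T ^^ k) v x) \<in> V" by (intro V_diff V_scale TnV vV)
    have Tv: "T (\<lambda>x. z ^ k * v x - (T ^^ k) v x) = (\<lambda>x. z ^ k * T v x - T ((T ^^ k) v) x)"
      using T(2)[of "z ^ k" v "-1" "(T ^^ k) v"] by simp
    have eq: "(\<lambda>x. z ^ Suc k * v x - (T ^^ Suc k) v x) = (\<lambda>x. z ^ k * Q v x + T (\<lambda>x. z ^ k * v x - (T ^^ k) v x) x)"
      unfolding Tv by (auto simp: Q_def algebra_simps)
    have "M (\<lambda>x. z ^ Suc k * v x - (T ^^ Suc k) v x) \<le> M (\<lambda>x. z ^ k * Q v x) + M (T (\<lambda>x. z ^ k * v x - (T ^^ k) v x))"
      unfolding eq by (intro M_triangle V_scale QV T vV dV)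
    also have "\<dots> \<le> 0" using M_scale[OF QV[OF vV(1)]] vV TB[OF dV] Suc by simp
    finally have "M (\<lambda>x. z ^ Suc k * v x - (T ^^ Suc k) v x) \<le> 0" .
    moreover have "(\<lambda>x. z ^ Suc k * v x - (T ^^ Suc k) v x) \<in> V" by (intro V_diff V_scale TnV vV)
    ultimately show ?case using M_nonneg by (auto intro: antisym)
  qed (simp add: M_zero)
  \<comment> \<open>On the kernel \<open>T^n\<close> is multiplication by \<open>\<zeta>\<close> up
    to null functions; when all functionals vanish it also equals \<open>R\<close>, and
    \<open>unique\<close> applies.\<close>
  have ker: "M v = 0" if v: "v \<in> Kr" and l: "\<And>j. j < D \<Longrightarrow> \<phi> j v = 0" for v
  proof (rule unique)
    show "v \<in> V" using v KrM by simp
    have "(T ^^ n) v = (\<lambda>x. R v x + (\<Sum>j<D. \<phi> j v * (T ^^ n) (e j) x))" by (rule TnR)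
    also have "\<dots> = R v" using l by simp
    finally have "(T ^^ n) v = R v" .
    then show "M (\<lambda>x. \<zeta> * v x - R v x) = 0" using power[OF v, of n] by (simp add: \<zeta>_def)
  qed
  have "\<exists>B. finite B \<and> B \<subseteq> Kr \<and> (\<forall>v\<in>Kr. \<exists>c. (\<lambda>x. v x - (\<Sum>b\<in>B. c b * b x)) \<in> Kr
      \<and> (\<forall>j<D. \<phi> j (\<lambda>x. v x - (\<Sum>b\<in>B. c b * b x)) = 0))"
    by (rule finite_separating_set[OF Krlin \<phi>]) (simp_all add: Kr_def)
  then obtain B1 where B1: "finite B1" "B1 \<subseteq> Kr" "\<forall>v\<in>Kr. \<exists>c. (\<lambda>x. v x - (\<Sum>b\<in>B1. c b * b x)) \<in> Kr
      \<and> (\<forall>j<D. \<phi> j (\<lambda>x. v x - (\<Sum>b\<in>B1. c b * b x)) = 0)"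
    by (elim exE conjE) (rule that)
  have dim: "\<exists>c. N (\<lambda>x. v x - (\<Sum>b\<in>B1. c b * b x)) = 0" if v: "v \<in> V" "N (Q v) = 0" for v
  proof -
    have vK: "v \<in> Kr" using v by (simp add: Kr_def)
    obtain c where c: "(\<lambda>x. v x - (\<Sum>b\<in>B1. c b * b x)) \<in> Kr"
      "\<forall>j<D. \<phi> j (\<lambda>x. v x - (\<Sum>b\<in>B1. c b * b x)) = 0"
      using bspec[OF B1(3) vK] by (elim exE conjE) (rule that)
    have "M (\<lambda>x. v x - (\<Sum>b\<in>B1. c b * b x)) = 0" using c(2) by (intro ker[OF c(1)]) simp
    moreover have "(\<lambda>x. v x - (\<Sum>b\<in>B1. c b * b x)) \<in> V" using c(1) by (simp add: Kr_def)
    ultimately have "N (\<lambda>x. v x - (\<Sum>b\<in>B1. c b * b x)) = 0" using null_iff by blast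
    then show ?thesis by (intro exI[of _ c])
  qed
  \<comment> \<open>Cofactor in the factorisation of \<open>z^k - T^k\<close> by
    \<open>z - T\<close>.\<close>
  define Y where "Y = (\<lambda>k u x. \<Sum>i<k. z ^ (k - 1 - i) * (T ^^ i) u x)"
  have YSuc: "Y (Suc k) u = (\<lambda>x. z * Y k u x + 1 * (T ^^ k) u x)" for k u
  proof
    fix x
    have "(\<Sum>i<k. z ^ (k - i) * (T ^^ i) u x) = z * Y k u x"
      unfolding Y_def sum_distrib_left
    proof (intro sum.cong refl)
      fix i assume "i \<in> {..<k}"
      then have "k - i = Suc (k - 1 - i)" by auto
      then show "z ^ (k - i) * (T ^^ i) u x = z * (z ^ (k - 1 - i) * (T ^^ i) u x)" by simp
    qed
    then show "Y (Suc k) u x = z * Y k u x + 1 * (T ^^ k) u x" by (simp add: Y_def)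
  qed
  have YV: "Y k u \<in> V" if "u \<in> V" for k u
  proof (induction k)
    case (Suc k)
    then show ?case unfolding YSuc by (intro V_lin TnV that)
  qed (simp add: Y_def V_zero)
  have tele: "Q (Y k u) = (\<lambda>x. z ^ k * u x - (T ^^ k) u x)" for k u
  proof (induction k)
    case 0
    have "Y 0 u = (\<lambda>x. 0)" by (auto simp: Y_def)
    then show ?case using Tnzero[of 1] by (simp add: Q_def)
  next
    case (Suc k)
    show ?case unfolding YSuc Qlin Suc.IH by (auto simp: Q_def algebra_simps)
  qed
  define B2 where "B2 = (\<lambda>j. (T ^^ n) (e j)) ` {..<D}"
  have codim: "\<exists>u\<in>V. \<exists>c. N (\<lambda>x. v x - (Q u x + (\<Sum>b\<in>B2. c b * b x))) = 0" if v: "v \<in> V" for v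
  proof -
    obtain u where u: "u \<in> V" "M (\<lambda>x. \<zeta> * u x - R u x - v x) = 0" using solve[OF v] by blast
    \<comment> \<open>Different j may give the same vector of \<open>B2\<close>, so the coefficients
      over each fibre are added.\<close>
    define c where "c = (\<lambda>b. \<Sum>j\<in>{j. j < D \<and> (T ^^ n) (e j) = b}. \<phi> j u)"
    have sumB: "(\<Sum>b\<in>B2. c b * b x) = (\<Sum>j<D. \<phi> j u * (T ^^ n) (e j) x)" for x
    proof -
      have "(\<Sum>j<D. \<phi> j u * (T ^^ n) (e j) x)
          = (\<Sum>b\<in>B2. \<Sum>j\<in>{j \<in> {..<D}. (T ^^ n) (e j) = b}. \<phi> j u * (T ^^ n) (e j) x)"
        unfolding B2_def by (rule sum.group[symmetric]) auto
      also have "\<dots> = (\<Sum>b\<in>B2. c b * b x)"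
        unfolding c_def sum_distrib_right by (intro sum.cong) auto
      finally show ?thesis by simp
    qed
    have eq: "(\<lambda>x. v x - (Q (Y n u) x + (\<Sum>b\<in>B2. c b * b x))) = (\<lambda>x. (-1) * (\<zeta> * u x - R u x - v x))"
      unfolding tele sumB TnR[of u] by (auto simp: \<zeta>_def algebra_simps)
    have wV: "(\<lambda>x. \<zeta> * u x - R u x - v x) \<in> V" by (intro V_diff V_scale RV u v)
    have "M (\<lambda>x. (-1) * (\<zeta> * u x - R u x - v x)) = 0" using M_scale[OF wV, of "-1"] u(2) by simp
    then have "N (\<lambda>x. (-1) * (\<zeta> * u x - R u x - v x)) = 0" using null_iff[OF V_scale[OF wV]] by blast
    then show ?thesis using YV[OF u(1)] unfolding eq[symmetric] by blast
  qed
  have B2V: "finite B2" "B2 \<subseteq> V" using e TnV by (auto simp: B2_def)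
  have "\<exists>B. finite B \<and> B \<subseteq> {v \<in> V. N (Q v) = 0} \<and>
      (\<forall>v\<in>V. N (Q v) = 0 \<longrightarrow> (\<exists>c. N (\<lambda>x. v x - (\<Sum>b\<in>B. c b * b x)) = 0))"
    using B1(1,2) dim by (intro exI[of _ B1] conjI ballI impI) (simp_all add: Kr_def)
  moreover have "\<exists>B. finite B \<and> B \<subseteq> V \<and>
      (\<forall>v\<in>V. \<exists>u\<in>V. \<exists>c. N (\<lambda>x. v x - (Q u x + (\<Sum>b\<in>B. c b * b x))) = 0)"
    using B2V codim by (intro exI[of _ B2] conjI ballI) simp_all
  ultimately have "fredholm V N Q"
    unfolding fredholm_def using bounded by (intro conjI)
  then show ?thesis by (simp add: Q_def)
qed

end

section \<open>Completeness of the Besov space\<close>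

lemma bl_tendsto:
  assumes p: "p \<ge> 1" and \<psi>: "\<psi> absolutely_integrable_on {0..1}"
    and S: "\<And>K. S K absolutely_integrable_on {0..1}"
    and lim: "(\<lambda>K. integral {0..1} (\<lambda>x. norm (\<psi> x - S K x))) \<longlonglongrightarrow> 0"
  shows "(\<lambda>K. bl s p (S K) k) \<longlonglongrightarrow> bl s p \<psi> k"
proof -
  obtain e1 where e1: "e1 \<longlonglongrightarrow> 0" "\<And>K. bl s p \<psi> k \<le> bl s p (S K) k + e1 K"
    using bl_limit_le[OF p \<psi> S lim] by blast
  define z where "z = (\<lambda>x::real. 0::complex)"
  have z: "z absolutely_integrable_on {0..1}" by (simp add: z_def)
  have dai: "(\<lambda>x. S K x - \<psi> x) absolutely_integrable_on {0..1}" for K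
    using S \<psi> by (rule set_integral_diff(1))
  have lim': "(\<lambda>K. integral {0..1} (\<lambda>x. norm (z x - (S K x - \<psi> x)))) \<longlonglongrightarrow> 0"
    using lim by (simp add: z_def)
  define e2 where "e2 = (\<lambda>K. 2 powr (real k * s) * (2 * 2 ^ k * integral {0..1} (\<lambda>x. norm (\<psi> x - S K x))))"
  have "e2 \<longlonglongrightarrow> 2 powr (real k * s) * (2 * 2 ^ k * 0)"
    unfolding e2_def by (intro tendsto_mult tendsto_const lim)
  then have e2lim: "e2 \<longlonglongrightarrow> 0" by simp
  have e2: "bl s p (S K) k \<le> bl s p \<psi> k + e2 K" for K
  proof -
    have n: "(\<lambda>x. norm (S K x - \<psi> x)) absolutely_integrable_on {0..1}"
      using absolutely_integrable_norm[OF dai] by (simp add: comp_def)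
    have "bl s p (\<lambda>x. S K x - \<psi> x) k \<le> 2 powr (real k * s) * (2 * 2 ^ k * integral {0..1} (\<lambda>x. norm (S K x - \<psi> x)))"
      unfolding bl_def using n
      by (intro mult_left_mono en_le_const[OF p] norm_davg_le[OF dai])
        (auto simp: absolutely_integrable_on_def intro!: integral_nonneg mult_nonneg_nonneg)
    also have "\<dots> = e2 K" by (simp add: e2_def norm_minus_commute)
    finally have "bl s p (\<lambda>x. S K x - \<psi> x) k \<le> e2 K" .
    moreover have "bl s p (\<lambda>x. \<psi> x + (S K x - \<psi> x)) k \<le> bl s p \<psi> k + bl s p (\<lambda>x. S K x - \<psi> x) k"
      by (rule bl_add[OF p \<psi> dai])
    ultimately show ?thesis by simp
  qed
  show ?thesis
  proof (rule tendsto_sandwich)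
    show "(\<lambda>K. bl s p \<psi> k - e1 K) \<longlonglongrightarrow> bl s p \<psi> k" using tendsto_diff[OF tendsto_const e1(1)] by simp
    show "(\<lambda>K. bl s p \<psi> k + e2 K) \<longlonglongrightarrow> bl s p \<psi> k" using tendsto_add[OF tendsto_const e2lim] by simp
    show "\<forall>\<^sub>F K in sequentially. bl s p \<psi> k - e1 K \<le> bl s p (S K) k"
      using e1(2) by (intro always_eventually allI) (simp add: algebra_simps)
  qed (use e2 in auto)
qed

text \<open>Riesz-Fischer in \<open>L^1\<close>: the sum of the norms is finite almost everywhere
  and twice this sum dominates the remainders.\<close>

lemma L1_series_limit:
  fixes w :: "nat \<Rightarrow> real \<Rightarrow> complex"
  assumes w: "\<And>n. w n absolutely_integrable_on {0..1}" and sm: "summable (\<lambda>n. integral {0..1} (\<lambda>x. norm (w n x)))"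
  obtains v where "v absolutely_integrable_on {0..1}"
    "(\<lambda>n. integral {0..1} (\<lambda>x. norm (v x - (\<Sum>i<n. w i x)))) \<longlonglongrightarrow> 0"
proof -
  have wi: "integrable leb01 (w n)" for n using w by (simp add: abs_int_iff_integrable)
  have wn: "(\<lambda>x. norm (w n x)) absolutely_integrable_on {0..1}" for n
    using absolutely_integrable_norm[OF w] by (simp add: comp_def)
  have sm': "summable (\<lambda>n. LINT x|leb01. norm (w n x))"
    using sm by (simp add: integral_leb01[OF wn])
  have "(\<integral>\<^sup>+x. (\<Sum>n. ennreal (norm (w n x))) \<partial>leb01) = (\<Sum>n. \<integral>\<^sup>+x. ennreal (norm (w n x)) \<partial>leb01)"
    using wi by (intro nn_integral_suminf) auto
  also have "\<dots> = (\<Sum>n. ennreal (LINT x|leb01. norm (w n x)))"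
    using wi by (simp add: nn_integral_eq_integral)
  also have "\<dots> = ennreal (\<Sum>n. LINT x|leb01. norm (w n x))"
    using sm' by (intro suminf_ennreal2) auto
  finally have "(\<integral>\<^sup>+x. (\<Sum>n. ennreal (norm (w n x))) \<partial>leb01) \<noteq> \<infinity>" by simp
  then have "AE x in leb01. (\<Sum>n. ennreal (norm (w n x))) \<noteq> \<infinity>"
    using wi by (intro nn_integral_noteq_infinite) auto
  then have AE: "AE x in leb01. summable (\<lambda>n. norm (w n x))"
    by eventually_elim (auto intro: summable_suminf_not_top)
  define v where "v = (\<lambda>x. \<Sum>n. w n x)"
  have vi: "integrable leb01 v" unfolding v_def using wi AE sm' by (rule integrable_suminf)
  have wni: "\<And>n. integrable leb01 (\<lambda>x. norm (w n x))" using wi by (rule integrable_norm)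
  have bi: "integrable leb01 (\<lambda>x. \<Sum>n. norm (w n x))"
    using wni AE sm' by (intro integrable_suminf) auto
  have lim: "(\<lambda>n. LINT x|leb01. norm (v x - (\<Sum>i<n. w i x))) \<longlonglongrightarrow> (LINT x|leb01. (0::real))"
  proof (rule integral_dominated_convergence[where w = "\<lambda>x. 2 * (\<Sum>n. norm (w n x))"])
    show "integrable leb01 (\<lambda>x. 2 * (\<Sum>n. norm (w n x)))" using bi by simp
    show "(\<lambda>x. norm (v x - (\<Sum>i<n. w i x))) \<in> borel_measurable leb01" for n
      using borel_measurable_integrable[OF vi] borel_measurable_integrable[OF wi] by measurable
    show "AE x in leb01. (\<lambda>n. norm (v x - (\<Sum>i<n. w i x))) \<longlonglongrightarrow> 0"
      using AE
    proof eventually_elim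
      case (elim x)
      have "(\<lambda>n. v x - (\<Sum>i<n. w i x)) \<longlonglongrightarrow> v x - v x"
        unfolding v_def by (rule tendsto_diff[OF tendsto_const summable_LIMSEQ[OF summable_norm_cancel[OF elim]]])
      then show ?case by (simp add: tendsto_norm_zero_iff)
    qed
    show "AE x in leb01. norm (norm (v x - (\<Sum>i<n. w i x))) \<le> 2 * (\<Sum>n. norm (w n x))" for n
      using AE
    proof eventually_elim
      case (elim x)
      have "norm (v x) \<le> (\<Sum>n. norm (w n x))" unfolding v_def by (rule summable_norm[OF elim])
      moreover have "norm (\<Sum>i<n. w i x) \<le> (\<Sum>n. norm (w n x))"
        using sum_le_suminf[OF elim, of "{..<n}"] by (intro order_trans[OF norm_sum]) auto
      ultimately show ?case using norm_triangle_ineq4[of "v x" "\<Sum>i<n. w i x"] by simp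
    qed
  qed simp
  have vai: "v absolutely_integrable_on {0..1}" using vi by (simp add: abs_int_iff_integrable)
  have dn: "(\<lambda>x. norm (v x - (\<Sum>i<n. w i x))) absolutely_integrable_on {0..1}" for n
  proof -
    have "(\<lambda>x. \<Sum>i<n. w i x) absolutely_integrable_on {0..1}" using w by (intro absolutely_integrable_sum) auto
    with vai have "(\<lambda>x. v x - (\<Sum>i<n. w i x)) absolutely_integrable_on {0..1}" by (rule set_integral_diff(1))
    from absolutely_integrable_norm[OF this] show ?thesis by (simp add: comp_def)
  qed
  show thesis
    by (rule that[OF vai]) (use lim in \<open>simp add: integral_leb01[OF dn]\<close>)
qed

context
  fixes s p :: real and q :: ennreal
  assumes p: "p \<ge> 1" and s: "s > 0" and q: "q \<ge> 1"
begin

abbreviation (input) "BV \<equiv> besov_space s p q"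
abbreviation (input) "BM \<equiv> cn s p q"

lemma BV_iff: "\<psi> \<in> BV \<longleftrightarrow> \<psi> absolutely_integrable_on {0..1} \<and> lq_finite q (bl s p \<psi>)"
  using besov_space_eq[OF p s q] by simp

lemma BM_eq: "BM \<psi> = lq_norm q (bl s p \<psi>)"
  by (rule cn_def[OF p s q])

lemma lqb_BM: "\<psi> \<in> BV \<Longrightarrow> lqb q (bl s p \<psi>) (BM \<psi>)"
  unfolding BM_eq by (rule lqb_lq_norm[OF q bl_nonneg]) (simp add: BV_iff)

lemma BV_I: "\<psi> absolutely_integrable_on {0..1} \<Longrightarrow> lqb q (bl s p \<psi>) B \<Longrightarrow> \<psi> \<in> BV"
  unfolding BV_iff using lq_finite_iff[OF q, of "bl s p \<psi>"] bl_nonneg by blast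

lemma BM_le: "lqb q (bl s p \<psi>) B \<Longrightarrow> BM \<psi> \<le> B"
  unfolding BM_eq by (rule lq_norm_le[OF q bl_nonneg])

lemma BM_nonneg: "\<psi> \<in> BV \<Longrightarrow> 0 \<le> BM \<psi>"
  using lqb_BM lqb_nonneg[OF q] by blast

lemma lqb_bl_add:
  assumes "u \<in> BV" "v \<in> BV"
  shows "lqb q (bl s p (\<lambda>x. u x + v x)) (BM u + BM v)"
  by (rule lqb_mono[OF q lqb_add[OF q lqb_BM[OF assms(1)] lqb_BM[OF assms(2)] bl_nonneg bl_nonneg] bl_nonneg])
    (use assms in \<open>auto simp: BV_iff intro: bl_add[OF p]\<close>)

lemma lqb_bl_scale:
  assumes "u \<in> BV"
  shows "lqb q (bl s p (\<lambda>x. c * u x)) (norm c * BM u)"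
proof -
  have "bl s p (\<lambda>x. c * u x) = (\<lambda>k. norm c * bl s p u k)" by (rule ext) (rule bl_cmult[OF p])
  then show ?thesis using lqb_cmult[OF q lqb_BM[OF assms] bl_nonneg, of "norm c"] by simp
qed

lemma abs_int_cmult: "u absolutely_integrable_on {0..1} \<Longrightarrow> (\<lambda>x. c * u x) absolutely_integrable_on {0..1::real}"
  for u :: "real \<Rightarrow> complex"
  unfolding abs_int_iff_integrable by (rule integrable_mult_right)

lemma BV_scale: "u \<in> BV \<Longrightarrow> (\<lambda>x. c * u x) \<in> BV"
  by (rule BV_I[OF abs_int_cmult lqb_bl_scale]) (auto simp: BV_iff)

lemma BV_add: "u \<in> BV \<Longrightarrow> v \<in> BV \<Longrightarrow> (\<lambda>x. u x + v x) \<in> BV"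
  by (rule BV_I[OF set_integral_add(1) lqb_bl_add]) (auto simp: BV_iff)

lemma BM_scale:
  assumes u: "u \<in> BV"
  shows "BM (\<lambda>x. c * u x) = norm c * BM u"
proof (rule antisym)
  show "BM (\<lambda>x. c * u x) \<le> norm c * BM u" by (rule BM_le[OF lqb_bl_scale[OF u]])
  show "norm c * BM u \<le> BM (\<lambda>x. c * u x)"
  proof (cases "c = 0")
    case True
    then show ?thesis using BM_nonneg[OF BV_scale[OF u, of c]] by simp
  next
    case False
    have "BM (\<lambda>x. inverse c * (c * u x)) \<le> norm (inverse c) * BM (\<lambda>x. c * u x)"
      by (rule BM_le[OF lqb_bl_scale[OF BV_scale[OF u]]])
    moreover have "(\<lambda>x. inverse c * (c * u x)) = u" using False by (auto simp: mult.assoc[symmetric])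
    ultimately have "BM u \<le> norm (inverse c) * BM (\<lambda>x. c * u x)" by simp
    then have "norm c * BM u \<le> norm c * (norm (inverse c) * BM (\<lambda>x. c * u x))" by (rule mult_left_mono) simp
    also have "norm c * (norm (inverse c) * BM (\<lambda>x. c * u x)) = BM (\<lambda>x. c * u x)"
      using False by (simp add: norm_inverse)
    finally show ?thesis .
  qed
qed

text \<open>Levels above K vanish. The finitely many others are put under a geometric bound with an
  arbitrary ratio, so that \<open>lq_finite_geometric\<close> covers every q at once.\<close>

lemma step_in_BV: "step K v \<in> BV"
proof -
  have "bl s p (step K v) k \<le> (\<Sum>i\<le>K. bl s p (step K v) i * 2 ^ i) * (1 / 2) ^ k" for k
  proof (cases "k \<le> K")
    case True
    have "bl s p (step K v) k * 2 ^ k \<le> (\<Sum>i\<le>K. bl s p (step K v) i * 2 ^ i)"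
      using True bl_nonneg by (intro member_le_sum[where f = "\<lambda>i. bl s p (step K v) i * 2 ^ i"]) auto
    then have "bl s p (step K v) k * 2 ^ k * (1 / 2) ^ k \<le> (\<Sum>i\<le>K. bl s p (step K v) i * 2 ^ i) * (1 / 2) ^ k"
      by (rule mult_right_mono) simp
    then show ?thesis by (simp add: power_one_over)
  next
    case False
    then have "en p k (\<lambda>j. davg k j (step K v)) = en p k (\<lambda>j. 0 :: complex)"
      by (intro en_cong) (simp add: davg_step_0)
    then have "bl s p (step K v) k = 0" by (simp add: bl_def en_def lpn_zero)
    then show ?thesis using bl_nonneg by (auto intro!: mult_nonneg_nonneg sum_nonneg)
  qed
  then have "lq_finite q (bl s p (step K v))"
    using bl_nonneg by (intro lq_finite_geometric[OF q bl_nonneg, where r = "1 / 2"]) (auto intro!: sum_nonneg)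
  then show ?thesis by (simp add: BV_iff abs_int_step)
qed

text \<open>The geometric sum bounds the \<open>L^p\<close> norm by adding up the levels; the 2
  comes from \<open>Lp_space_abs_int\<close> with d equal to that norm.\<close>

definition L1_const :: real where
  "L1_const = 2 * (1 / (1 - 2 powr (- s)))"

lemma L1_le_BM:
  assumes u: "u \<in> BV"
  shows "integral {0..1} (\<lambda>x. norm (u x)) \<le> L1_const * BM u"
proof -
  define r where "r = 2 powr (- s)"
  have r: "0 < r" "r < 1" using s by (auto simp: r_def powr_less_one)
  have ai: "u absolutely_integrable_on {0..1}" and fin: "lq_finite q (bl s p u)" using u by (auto simp: BV_iff)
  have en: "en p k (\<lambda>j. davg k j u) \<le> r ^ k * BM u" for k
  proof -
    have "bl s p u k \<le> BM u" by (rule lqb_component[OF q lqb_BM[OF u] bl_nonneg])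
    then have "r ^ k * bl s p u k \<le> r ^ k * BM u" using r by (intro mult_left_mono) auto
    moreover have "r ^ k * 2 powr (real k * s) = 1"
      by (simp add: r_def powr_realpow[symmetric] powr_powr powr_add[symmetric] mult.commute)
    then have "r ^ k * bl s p u k = en p k (\<lambda>j. davg k j u)"
      by (simp add: bl_def mult.assoc[symmetric])
    ultimately show ?thesis by simp
  qed
  have g: "summable (\<lambda>k. r ^ k * BM u)" using r by (intro summable_mult2 summable_geometric) auto
  have sm: "summable (\<lambda>k. en p k (\<lambda>j. davg k j u))"
    by (rule summable_comparison_test[OF _ g], rule exI[of _ 0]) (use en in \<open>simp add: en_nonneg\<close>)
  have Lp: "Lp_norm leb01 p u \<le> (\<Sum>k. r ^ k * BM u)"
    using partial_series_Lp(3)[OF p ai sm] suminf_le[OF en sm g] by linarith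
  also have "(\<Sum>k. r ^ k * BM u) = (\<Sum>k. r ^ k) * BM u"
    using r by (intro suminf_mult2[symmetric] summable_geometric) simp
  also have "(\<Sum>k. r ^ k) = 1 / (1 - r)" using r by (intro suminf_geometric) simp
  finally have Lp: "2 * Lp_norm leb01 p u \<le> L1_const * BM u" by (simp add: L1_const_def r_def)
  have mem: "u \<in> Lp_space leb01 p" by (rule partial_series_Lp(1)[OF p ai sm])
  define l where "l = Lp_norm leb01 p u"
  have l0: "0 \<le> l" by (simp add: l_def Lp_norm_def)
  have "integral {0..1} (\<lambda>x. norm (u x)) \<le> 2 * l"
  proof (cases "l = 0")
    case True
    show ?thesis
    proof (rule field_le_epsilon)
      fix e :: real assume "e > 0"
      from Lp_space_abs_int(2)[OF p mem this] show "integral {0..1} (\<lambda>x. norm (u x)) \<le> 2 * l + e"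
        using True p by (simp add: l_def)
    qed
  next
    case False
    then have "0 < l" using l0 by simp
    from Lp_space_abs_int(2)[OF p mem this] have "integral {0..1} (\<lambda>x. norm (u x)) \<le> l + l powr (1 - p) * l powr p"
      by (simp add: l_def)
    also have "\<dots> = 2 * l" using \<open>0 < l\<close> by (simp add: powr_add[symmetric])
    finally show ?thesis .
  qed
  then show ?thesis using Lp by (simp add: l_def)
qed

text \<open>The limit is built in \<open>L^1\<close>, which the Besov norm dominates. The tails of
  the series bound the finite sections of the remainder; each level converges by
  \<open>bl_tendsto\<close>, and lower semicontinuity hands the bound to the remainder
  itself.\<close>

lemma BV_complete:
  assumes w: "\<And>n. w n \<in> BV" and sm: "summable (\<lambda>n. BM (w n))"
  shows "\<exists>v\<in>BV. (\<lambda>n. BM (\<lambda>x. v x - (\<Sum>i<n. w i x))) \<longlonglongrightarrow> 0"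
proof -
  have wai: "w n absolutely_integrable_on {0..1}" for n using w by (simp add: BV_iff)
  have nn: "0 \<le> integral {0..1} (\<lambda>x. norm (w n x))" for n
    using absolutely_integrable_norm[OF wai[of n]]
    by (intro integral_nonneg) (auto simp: comp_def absolutely_integrable_on_def)
  have smi: "summable (\<lambda>n. integral {0..1} (\<lambda>x. norm (w n x)))"
    by (rule summable_comparison_test[OF _ summable_mult[OF sm, of L1_const]], rule exI[of _ 0])
      (use L1_le_BM[OF w] nn in simp)
  obtain v where v: "v absolutely_integrable_on {0..1}"
    "(\<lambda>n. integral {0..1} (\<lambda>x. norm (v x - (\<Sum>i<n. w i x)))) \<longlonglongrightarrow> 0"
    by (rule L1_series_limit[OF wai smi])
  define t where "t = (\<lambda>n. \<Sum>k. BM (w (k + n)))"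
  have tlim: "t \<longlonglongrightarrow> 0" unfolding t_def using suminf_exist_split2[OF sm] .
  have sumV: "(\<lambda>x. \<Sum>i\<in>I. w i x) \<in> BV \<and> BM (\<lambda>x. \<Sum>i\<in>I. w i x) \<le> (\<Sum>i\<in>I. BM (w i))" if "finite I" for I
    using that
  proof (induction I rule: finite_induct)
    case empty
    have "(\<lambda>x. 0 * w 0 x) \<in> BV" "BM (\<lambda>x. 0 * w 0 x) = 0" using BV_scale[OF w[of 0], of 0] BM_scale[OF w[of 0], of 0] by auto
    then show ?case by simp
  next
    case (insert i I)
    have "BM (\<lambda>x. w i x + (\<Sum>i\<in>I. w i x)) \<le> BM (w i) + BM (\<lambda>x. \<Sum>i\<in>I. w i x)"
      using insert by (intro BM_le lqb_bl_add w) auto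
    then show ?case using insert BV_add[OF w] by auto
  qed
  have bound: "lqb q (bl s p (\<lambda>x. v x - (\<Sum>i<n. w i x))) (t n)" for n
  proof -
    define S where "S = (\<lambda>K x. \<Sum>i\<in>{n..<n + K}. w i x)"
    have SV: "S K \<in> BV" for K using sumV[of "{n..<n + K}"] by (simp add: S_def)
    have SM: "BM (S K) \<le> t n" for K
    proof -
      have "BM (S K) \<le> (\<Sum>i\<in>{n..<n + K}. BM (w i))" using sumV[of "{n..<n + K}"] by (simp add: S_def)
      also have "\<dots> = (\<Sum>i<K. BM (w (i + n)))"
        using sum.shift_bounds_nat_ivl[of "\<lambda>i. BM (w i)" 0 n K] by (simp add: atLeast0LessThan add.commute)
      also have "\<dots> \<le> t n"
        unfolding t_def using BM_nonneg[OF w] summable_ignore_initial_segment[OF sm] by (intro sum_le_suminf) auto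
      finally show ?thesis .
    qed
    have Seq: "v x - (\<Sum>i<n. w i x) - S K x = v x - (\<Sum>i<n + K. w i x)" for K x
    proof -
      have "(\<Sum>i<n. w i x) + S K x = (\<Sum>i<n + K. w i x)"
        using sum.atLeastLessThan_concat[of 0 n "n + K" "\<lambda>i. w i x"] by (simp add: S_def atLeast0LessThan)
      then show ?thesis by (simp only: diff_diff_eq)
    qed
    have dai: "(\<lambda>x. v x - (\<Sum>i<n. w i x)) absolutely_integrable_on {0..1}"
      using v(1) sumV[of "{..<n}"] by (intro set_integral_diff(1)) (auto simp: BV_iff)
    have "(\<lambda>K. integral {0..1} (\<lambda>x. norm (v x - (\<Sum>i<n + K. w i x)))) \<longlonglongrightarrow> 0"
      using LIMSEQ_ignore_initial_segment[OF v(2), of n] by (simp add: add.commute)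
    then have "(\<lambda>K. integral {0..1} (\<lambda>x. norm (v x - (\<Sum>i<n. w i x) - S K x))) \<longlonglongrightarrow> 0"
      by (simp only: Seq)
    then have "(\<lambda>K. bl s p (S K) k) \<longlonglongrightarrow> bl s p (\<lambda>x. v x - (\<Sum>i<n. w i x)) k" for k
      using SV by (intro bl_tendsto[OF p dai]) (auto simp: BV_iff)
    then show ?thesis
      by (rule lqb_limit[OF q lqb_mono[OF q lqb_BM[OF SV] bl_nonneg order_refl SM]]) (rule bl_nonneg)
  qed
  have dai: "(\<lambda>x. v x - (\<Sum>i<n. w i x)) absolutely_integrable_on {0..1}" for n
    using v(1) sumV[of "{..<n}"] by (intro set_integral_diff(1)) (auto simp: BV_iff)
  have dV: "(\<lambda>x. v x - (\<Sum>i<n. w i x)) \<in> BV" for n by (rule BV_I[OF dai bound])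
  have "v \<in> BV" using dV[of 0] by simp
  moreover have "(\<lambda>n. BM (\<lambda>x. v x - (\<Sum>i<n. w i x))) \<longlonglongrightarrow> 0"
    by (rule tendsto_sandwich[OF _ _ tendsto_const tlim])
      (use BM_nonneg[OF dV] BM_le[OF bound] in \<open>auto intro!: always_eventually\<close>)
  ultimately show ?thesis by blast
qed

lemma besov_norm_nonneg: "u \<in> BV \<Longrightarrow> 0 \<le> besov_norm s p q u"
  using cn_le[OF p s q, of u] equiv_const_pos[OF p s q] BM_nonneg[of u]
  by (metis mult_less_0_iff not_less order_trans less_le_not_le mult_pos_neg)

lemma besov_complete_seminormed: "complete_seminormed BV BM (besov_norm s p q) (equiv_const s)"
proof
  show "BV \<noteq> {}" using step_in_BV by blast
  show "(\<lambda>x. a * u x + b * v x) \<in> BV" if "u \<in> BV" "v \<in> BV" for u v a b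
    by (intro BV_add BV_scale that)
  show "0 \<le> BM u" if "u \<in> BV" for u by (rule BM_nonneg[OF that])
  show "BM (\<lambda>x. u x + v x) \<le> BM u + BM v" if "u \<in> BV" "v \<in> BV" for u v
    by (intro BM_le lqb_bl_add that)
  show "BM (\<lambda>x. c * u x) = norm c * BM u" if "u \<in> BV" for u c by (rule BM_scale[OF that])
  show "0 \<le> besov_norm s p q u" if "u \<in> BV" for u by (rule besov_norm_nonneg[OF that])
  show "besov_norm s p q u \<le> BM u" if "u \<in> BV" for u by (rule besov_norm_le[OF p s q that])
  show "BM u \<le> equiv_const s * besov_norm s p q u" if "u \<in> BV" for u by (rule cn_le[OF p s q that])
  show "\<exists>v\<in>BV. (\<lambda>n. BM (\<lambda>x. v x - (\<Sum>i<n. w i x))) \<longlonglongrightarrow> 0"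
    if "\<And>n. w n \<in> BV" "summable (\<lambda>n. BM (w n))" for w by (rule BV_complete[OF that])
qed

end

section \<open>Partial martingale sums as finite rank operators\<close>

lemma step_outside: "x \<notin> {0..1} \<Longrightarrow> step k v x = 0"
proof -
  assume x: "x \<notin> {0..1}"
  have "indicator (dyadic k j) x = (0::complex)" if "j < 2 ^ k" for j
    using dyadic_subset[OF that] x by (simp add: indicator_def subset_iff) blast
  then show ?thesis by (simp add: step_def)
qed

lemma partial_series_eq_step: "partial_series \<psi> (Suc K) = step K (\<lambda>j. avg K j \<psi>)"
proof
  fix x
  show "partial_series \<psi> (Suc K) x = step K (\<lambda>j. avg K j \<psi>) x"
  proof (cases "x \<in> {0..1}")
    case True
    then show ?thesis by (simp add: partial_series_Suc step_eq)
  next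
    case False
    then show ?thesis by (simp add: partial_series_def step_outside)
  qed
qed

section \<open>The essential spectral radius\<close>

text \<open>The first L differences add up to the conditional expectation onto generation L - 1, of
  rank \<open>2 ^ (L - 1)\<close>; for L = 0 the sum is empty, which natural subtraction alone would
  not show.\<close>

definition low_dim :: "nat \<Rightarrow> nat" where
  "low_dim L = (if L = 0 then 0 else 2 ^ (L - 1))"

definition low_basis :: "nat \<Rightarrow> nat \<Rightarrow> real \<Rightarrow> complex" where
  "low_basis L j = step (L - 1) (\<lambda>i. if i = j then 1 else 0)"

lemma partial_series_finite_rank:
  "partial_series \<psi> L = (\<lambda>x. \<Sum>j<low_dim L. avg (L - 1) j \<psi> * low_basis L j x)"
proof (cases L)
  case 0
  show ?thesis unfolding 0 by (intro ext) (simp add: partial_series_def low_dim_def)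
next
  case (Suc K)
  have "low_basis L j x = indicator (dyadic K j) x" if "j < 2 ^ K" for j x
    using that by (simp add: low_basis_def step_def Suc if_distrib[of "\<lambda>a. a * _"] cong: if_cong)
  then show ?thesis unfolding Suc partial_series_eq_step
    by (intro ext) (simp add: step_def low_dim_def Suc)
qed

context expanding_branches
begin

lemma TR_linear: "TR (\<lambda>x. a * u x + b * v x) = (\<lambda>x. a * TR u x + b * TR v x)"
proof
  fix x
  have "TR (\<lambda>x. a * u x + b * v x) x = TR (\<lambda>x. a * u x) x + TR (\<lambda>x. b * v x) x" by (rule transfer_add)
  then show "TR (\<lambda>x. a * u x + b * v x) x = a * TR u x + b * TR v x" by (simp only: transfer_cmult)
qed

lemma fJ_interval: "i \<in> \<Lambda> \<Longrightarrow> is_interval (f ` J i)"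
  using connected_continuous_image[OF f_cont[of i]] J_int[of i] by (simp add: is_interval_connected_1)

lemma g_inj: "i \<in> \<Lambda> \<Longrightarrow> inj_on (g i) (f ` J i)"
  using fg(2)[of i] by (intro inj_on_inverseI[where g = f]) simp

text \<open>Mass is preserved because the images of the inverse branches are the partition intervals
  themselves.\<close>

lemma TR_L1:
  assumes \<psi>: "\<psi> absolutely_integrable_on {0..1}"
  shows "TR \<psi> absolutely_integrable_on {0..1}" "integral {0..1} (TR \<psi>) = integral {0..1} \<psi>"
proof -
  note facts = finite_\<Lambda> \<psi> fJ_interval fJ01 g01 g_der g_inj
  show "TR \<psi> absolutely_integrable_on {0..1}" by (rule transfer_L1(1)[OF facts])
  have im: "g i ` f ` J i = J i" if "i \<in> \<Lambda>" for i
  proof (intro set_eqI iffI)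
    fix x assume "x \<in> g i ` f ` J i"
    then show "x \<in> J i" using fg(1)[OF that] by blast
  next
    fix x assume "x \<in> J i"
    then have "x = g i (f x)" "f x \<in> f ` J i" using gf[OF that] by auto
    then show "x \<in> g i ` f ` J i" by (rule image_eqI)
  qed
  have ai: "\<psi> absolutely_integrable_on J i" if "i \<in> \<Lambda>" for i
  proof (rule set_integrable_subset[OF \<psi> _ J_sub[OF that]])
    show "J i \<in> sets lebesgue"
      using J_int[OF that] J_sub[OF that] bounded_subset[OF bounded_closed_interval J_sub[OF that]]
      by (intro fmeasurableD measurable_convex) (auto simp: is_interval_convex_1)
  qed
  have int: "J i \<inter> {0..1} = J i" if "i \<in> \<Lambda>" for i using J_sub[OF that] by blast
  have "integral {0..1} (TR \<psi>) = (\<Sum>i\<in>\<Lambda>. integral (g i ` f ` J i) \<psi>)" by (rule transfer_L1(3)[OF facts])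
  also have "\<dots> = (\<Sum>i\<in>\<Lambda>. integral {0..1} (\<lambda>x. if x \<in> J i then \<psi> x else 0))"
    using int by (intro sum.cong refl) (simp add: im integral_restrict_Int)
  also have "\<dots> = integral {0..1} (\<lambda>x. \<Sum>i\<in>\<Lambda>. if x \<in> J i then \<psi> x else 0)"
  proof (intro integral_sum[symmetric] finite_\<Lambda>)
    fix i assume i: "i \<in> \<Lambda>"
    have "\<psi> integrable_on (J i \<inter> {0..1})" using ai[OF i] int[OF i] by (simp add: absolutely_integrable_on_def)
    then show "(\<lambda>x. if x \<in> J i then \<psi> x else 0) integrable_on {0..1}" by (simp add: integrable_restrict_Int)
  qed
  also have "\<dots> = integral {0..1} \<psi>"
  proof (rule Henstock_Kurzweil_Integration.integral_cong)
    fix x :: real assume x: "x \<in> {0..1}"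
    obtain i where i: "i \<in> \<Lambda>" "x \<in> J i" using J_cover[OF x] by blast
    have "(\<Sum>k\<in>\<Lambda>. if x \<in> J k then \<psi> x else 0) = (\<Sum>k\<in>\<Lambda>. if k = i then \<psi> x else 0)"
      using J_disj[OF _ i(1)] i by (intro sum.cong refl if_cong) auto
    then show "(\<Sum>k\<in>\<Lambda>. if x \<in> J k then \<psi> x else 0) = \<psi> x" using i finite_\<Lambda> by simp
  qed
  finally show "integral {0..1} (TR \<psi>) = integral {0..1} \<psi>" .
qed

context
  fixes s p :: real and q :: ennreal
  assumes p: "p \<ge> 1" and s: "0 < s" "s < \<beta>" and q: "q \<ge> 1" and \<beta>p: "\<beta> * p \<le> 1"
begin

interpretation B: complete_seminormed "besov_space s p q" "cn s p q" "besov_norm s p q" "equiv_const s"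
  by (rule besov_complete_seminormed[OF p s(1) q])

abbreviation (input) "BV' \<equiv> besov_space s p q"
abbreviation (input) "BM' \<equiv> cn s p q"

lemmas BV'_iff = BV_iff[OF p s(1) q]
lemmas BM'_eq = BM_eq[OF p s(1) q]
lemmas BV'_I = BV_I[OF p s(1) q]
lemmas BM'_le = BM_le[OF p s(1) q]

lemma low_basis_BV: "low_basis L j \<in> BV'"
  unfolding low_basis_def by (rule step_in_BV[OF p s(1) q])

lemma avg_bound:
  assumes u: "u \<in> BV'" and j: "j < 2 ^ K"
  shows "norm (avg K j u) \<le> 2 ^ K * (L1_const s * BM' u)"
proof -
  have ai: "u absolutely_integrable_on {0..1}" using u by (simp add: BV'_iff)
  have n: "(\<lambda>x. norm (u x)) absolutely_integrable_on {0..1}" using absolutely_integrable_norm[OF ai] by (simp add: comp_def)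
  have "norm (avg K j u) \<le> avg K j (\<lambda>x. norm (u x))" by (rule norm_avg_le[OF ai j])
  also have "\<dots> \<le> 2 ^ K * integral {0..1} (\<lambda>x. norm (u x))" by (rule avg_le_integral[OF n j]) simp
  also have "\<dots> \<le> 2 ^ K * (L1_const s * BM' u)" by (intro mult_left_mono L1_le_BM[OF p s(1) q u]) simp
  finally show ?thesis .
qed

text \<open>The high frequency estimate for n = 1, with the crude multiplicity
  \<open>card (nwords 1)\<close>, treats all but finitely many dimensions. On the rest the
  coefficients are averages, which the Besov norm controls, and the images of the basis lie in the
  space.\<close>

lemma TR_bounded:
  obtains Bd where "\<And>u. u \<in> BV' \<Longrightarrow> TR u \<in> BV'" "\<And>u. u \<in> BV' \<Longrightarrow> BM' (TR u) \<le> Bd * BM' u"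
proof -
  have card: "card {w \<in> nwords 1. x \<in> wdom w} \<le> card (nwords 1)" for x
    using finite_nwords by (intro card_mono) auto
  obtain L where L: "\<And>p s q \<psi>. p \<ge> 1 \<Longrightarrow> \<beta> * p \<le> 1 \<Longrightarrow> 0 < s \<Longrightarrow> s < \<beta> \<Longrightarrow> q \<ge> 1 \<Longrightarrow>
      \<psi> absolutely_integrable_on {0..1} \<Longrightarrow> lq_finite q (bl s p \<psi>) \<Longrightarrow>
      lqb q (bl s p ((TR ^^ 1) (\<lambda>x. \<psi> x - partial_series \<psi> L x)))
      (schur_const sys_const p s \<beta> * real (card (nwords 1)) powr (1 - 1 / p) * (2 * (1 / lam) ^ 1) powr (1 - 1 / p + s) * lq_norm q (bl s p \<psi>))"
    "\<And>p s q j v. p \<ge> 1 \<Longrightarrow> \<beta> * p \<le> 1 \<Longrightarrow> s < \<beta> \<Longrightarrow> q \<ge> 1 \<Longrightarrow> lq_finite q (bl s p ((TR ^^ 1) (step j v)))"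
    by (rule iterate_high_frequency[OF order_refl card]) blast
  define R where "R = schur_const sys_const p s \<beta> * real (card (nwords 1)) powr (1 - 1 / p) * (2 * (1 / lam) ^ 1) powr (1 - 1 / p + s)"
  have high: "lqb q (bl s p (TR (\<lambda>x. u x - partial_series u L x))) (R * BM' u)" if u: "u \<in> BV'" for u
    using L(1)[OF p \<beta>p s q, of u] u by (simp add: R_def BV'_iff BM'_eq)
  have TRe: "TR (low_basis L j) \<in> BV'" for j
    using L(2)[OF p \<beta>p s(2) q] TR_L1(1)[OF abs_int_step] by (simp add: BV'_iff low_basis_def)
  have highV: "TR (\<lambda>x. u x - partial_series u L x) \<in> BV'" if u: "u \<in> BV'" for u
    using u by (intro BV'_I[OF TR_L1(1) high[OF u]] set_integral_diff(1) abs_int_partial_series) (simp add: BV'_iff)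
  have split: "TR u = (\<lambda>x. TR (\<lambda>x. u x - partial_series u L x) x + (\<Sum>j<low_dim L. avg (L - 1) j u * TR (low_basis L j) x))" for u
  proof
    fix x
    have "TR (\<lambda>x. u x - partial_series u L x) x = TR u x - TR (partial_series u L) x" by (rule transfer_diff)
    also have "TR (partial_series u L) x = (\<Sum>j<low_dim L. TR (\<lambda>x. avg (L - 1) j u * low_basis L j x) x)"
      by (subst partial_series_finite_rank) (rule transfer_sum)
    also have "\<dots> = (\<Sum>j<low_dim L. avg (L - 1) j u * TR (low_basis L j) x)" by (simp only: transfer_cmult)
    finally show "TR u x = TR (\<lambda>x. u x - partial_series u L x) x + (\<Sum>j<low_dim L. avg (L - 1) j u * TR (low_basis L j) x)" by simp
  qed
  define Bd where "Bd = R + (\<Sum>j<low_dim L. 2 ^ (L - 1) * L1_const s * BM' (TR (low_basis L j)))"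
  have sumV: "(\<lambda>x. \<Sum>j<low_dim L. avg (L - 1) j u * TR (low_basis L j) x) \<in> BV'" for u
    by (intro B.V_sum B.V_scale TRe) simp
  have Msum: "BM' (\<lambda>x. \<Sum>j\<in>I. c j * w j x) \<le> (\<Sum>j\<in>I. norm (c j) * BM' (w j))" if "finite I" "\<And>j. w j \<in> BV'" for I :: "nat set" and c w
    using that(1)
  proof (induction I rule: finite_induct)
    case (insert j I)
    have "BM' (\<lambda>x. c j * w j x + (\<Sum>j\<in>I. c j * w j x)) \<le> BM' (\<lambda>x. c j * w j x) + BM' (\<lambda>x. \<Sum>j\<in>I. c j * w j x)"
      by (intro B.M_triangle B.V_sum B.V_scale that insert)
    then show ?case using insert B.M_scale[OF that(2), of "c j" j] by simp
  qed (simp add: B.M_zero)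
  show thesis
  proof (rule that)
    fix u assume u: "u \<in> BV'"
    show "TR u \<in> BV'" by (subst split) (intro B.V_add highV u sumV)
    have "BM' (TR u) \<le> BM' (TR (\<lambda>x. u x - partial_series u L x)) + BM' (\<lambda>x. \<Sum>j<low_dim L. avg (L - 1) j u * TR (low_basis L j) x)"
      by (subst split) (intro B.M_triangle highV u sumV)
    also have "BM' (TR (\<lambda>x. u x - partial_series u L x)) \<le> R * BM' u" by (rule BM'_le[OF high[OF u]])
    also have "BM' (\<lambda>x. \<Sum>j<low_dim L. avg (L - 1) j u * TR (low_basis L j) x)
        \<le> (\<Sum>j<low_dim L. norm (avg (L - 1) j u) * BM' (TR (low_basis L j)))"
      by (rule Msum) (use TRe in auto)
    also have "\<dots> \<le> (\<Sum>j<low_dim L. (2 ^ (L - 1) * (L1_const s * BM' u)) * BM' (TR (low_basis L j)))"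
      by (intro sum_mono mult_right_mono avg_bound u B.M_nonneg TRe) (auto simp: low_dim_def split: if_splits)
    also have "\<dots> = (\<Sum>j<low_dim L. 2 ^ (L - 1) * L1_const s * BM' (TR (low_basis L j))) * BM' u"
      unfolding sum_distrib_right by (intro sum.cong refl) (simp only: mult_ac)
    also have "R * BM' u + \<dots> = Bd * BM' u"
      by (simp only: Bd_def distrib_right)
    finally show "BM' (TR u) \<le> Bd * BM' u" by simp
  qed
qed

lemma TR_bounded_operator: "bounded_operator BV' (besov_norm s p q) TR"
proof -
  obtain Bd where "\<And>u. u \<in> BV' \<Longrightarrow> TR u \<in> BV'" "\<And>u. u \<in> BV' \<Longrightarrow> BM' (TR u) \<le> Bd * BM' u"
    by (rule TR_bounded) blast
  then show ?thesis by (intro B.bounded_operatorI[of TR Bd]) (auto simp: TR_linear)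
qed

text \<open>The gap between the claimed radius and \<open>norm z\<close> is spent twice: on \<eta>,
  the loss in the entropy bound for the preimages, and on n, which must be large enough to absorb
  the constant \<open>C2\<close>. The finite rank part is the partial martingale sum of order
  \<open>L\<close>.\<close>

lemma TR_fredholm:
  assumes z: "exp (h_top * (1 - 1 / p)) * lam powr (- (1 - 1 / p + s)) < norm z"
  shows "fredholm BV' (besov_norm s p q) (\<lambda>v x. z * v x - TR v x)"
proof -
  define t where "t = 1 - 1 / p"
  define \<sigma> where "\<sigma> = t + s"
  have t0: "0 \<le> t" using p by (simp add: t_def)
  have lam0: "0 < lam" using lam by simp
  define b0 where "b0 = exp (h_top * t) * lam powr (- \<sigma>)"
  have b0: "0 < b0" "b0 < norm z" using z lam0 by (auto simp: b0_def t_def \<sigma>_def)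
  obtain \<eta> where \<eta>: "\<eta> > 0" "exp (\<eta> * t) * b0 < norm z"
  proof -
    have "((\<lambda>\<eta>. exp (\<eta> * t) * b0) \<longlongrightarrow> exp (0 * t) * b0) (at_right 0)"
      by (intro tendsto_intros)
    then have "\<forall>\<^sub>F \<eta> in at_right 0. exp (\<eta> * t) * b0 < norm z"
      using b0 by (intro order_tendstoD(2)) auto
    moreover have "\<forall>\<^sub>F \<eta> in at_right (0::real). \<eta> > 0" by (rule eventually_at_right_less)
    ultimately have "\<forall>\<^sub>F \<eta> in at_right 0. \<eta> > 0 \<and> exp (\<eta> * t) * b0 < norm z" by eventually_elim simp
    then show thesis using that eventually_happens'[OF trivial_limit_at_right_real] by blast
  qed
  define b where "b = exp (\<eta> * t) * b0"
  \<comment> \<open>\<open>2 powr \<sigma>\<close> is the rounding loss of \<open>wexp\<close>; it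
    does not grow with n.\<close>
  define C2 where "C2 = \<bar>schur_const sys_const p s \<beta>\<bar> * 2 powr \<sigma>"
  have b: "0 < b" "b < norm z" using \<eta> b0 by (auto simp: b_def)
  have nz: "0 < norm z" using b by linarith
  have C2: "0 \<le> C2" by (simp add: C2_def)
  obtain n1 where n1: "C2 * (b / norm z) ^ n1 \<le> 1 / 2"
  proof -
    have "(\<lambda>n. C2 * (b / norm z) ^ n) \<longlonglongrightarrow> C2 * 0"
      using b nz by (intro tendsto_mult tendsto_const LIMSEQ_power_zero) simp
    then have "(\<lambda>n. C2 * (b / norm z) ^ n) \<longlonglongrightarrow> 0" by simp
    then have "\<forall>\<^sub>F n in sequentially. C2 * (b / norm z) ^ n < 1 / 2" by (rule order_tendstoD) simp
    then obtain n where "C2 * (b / norm z) ^ n < 1 / 2" unfolding eventually_sequentially by blast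
    then show thesis using that[of n] by simp
  qed
  obtain n N where n: "n \<ge> n1" "n \<ge> 1" and N: "\<And>x. card {w \<in> nwords n. x \<in> wdom w} \<le> N"
    "real N \<le> exp (real n * (h_top + \<eta>))"
    using multiplicity_entropy[OF \<eta>(1), of n1] by blast
  obtain L where L: "\<And>p s q \<psi>. p \<ge> 1 \<Longrightarrow> \<beta> * p \<le> 1 \<Longrightarrow> 0 < s \<Longrightarrow> s < \<beta> \<Longrightarrow> q \<ge> 1 \<Longrightarrow>
      \<psi> absolutely_integrable_on {0..1} \<Longrightarrow> lq_finite q (bl s p \<psi>) \<Longrightarrow>
      lqb q (bl s p ((TR ^^ n) (\<lambda>x. \<psi> x - partial_series \<psi> L x)))
      (schur_const sys_const p s \<beta> * real N powr (1 - 1 / p) * (2 * (1 / lam) ^ n) powr (1 - 1 / p + s) * lq_norm q (bl s p \<psi>))"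
    by (rule iterate_high_frequency[OF n(2) N(1)]) blast
  define R where "R = schur_const sys_const p s \<beta> * real N powr (1 - 1 / p) * (2 * (1 / lam) ^ n) powr (1 - 1 / p + s)"
  have "R \<le> \<bar>schur_const sys_const p s \<beta>\<bar> * exp (real n * (h_top + \<eta>)) powr t * (2 * (1 / lam) ^ n) powr \<sigma>"
    unfolding R_def t_def[symmetric] \<sigma>_def[symmetric]
    using N(2) t0 by (intro mult_right_mono mult_mono powr_mono2) auto
  also have "exp (real n * (h_top + \<eta>)) powr t = exp (\<eta> * t) ^ n * exp (h_top * t) ^ n"
    by (simp add: powr_def exp_of_nat_mult[symmetric] exp_add[symmetric] algebra_simps)
  also have "(2 * (1 / lam) ^ n) powr \<sigma> = 2 powr \<sigma> * (lam powr (- \<sigma>)) ^ n"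
  proof -
    have "(1 / lam) ^ n = lam powr (- real n)" using lam0 by (simp add: power_one_over powr_minus_divide powr_realpow)
    moreover have "(lam powr (- \<sigma>)) ^ n = lam powr (- \<sigma> * real n)" using lam0 by (simp add: powr_realpow[symmetric] powr_powr)
    ultimately show ?thesis by (simp add: powr_mult powr_powr mult.commute)
  qed
  also have "\<bar>schur_const sys_const p s \<beta>\<bar> * (exp (\<eta> * t) ^ n * exp (h_top * t) ^ n) * (2 powr \<sigma> * (lam powr (- \<sigma>)) ^ n) = C2 * b ^ n"
    by (simp add: C2_def b_def b0_def power_mult_distrib)
  finally have R: "R \<le> C2 * b ^ n" .
  have "C2 * (b / norm z) ^ n \<le> C2 * (b / norm z) ^ n1"
    using C2 b nz n by (intro mult_left_mono power_decreasing) auto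
  then have "C2 * (b / norm z) ^ n \<le> 1 / 2" using n1 by linarith
  then have "C2 * b ^ n \<le> 1 / 2 * norm z ^ n" using nz by (simp add: power_divide field_simps)
  then have Rz: "R \<le> 1 / 2 * norm z ^ n" using R by linarith
  obtain Bd where Bd: "\<And>u. u \<in> BV' \<Longrightarrow> TR u \<in> BV'" "\<And>u. u \<in> BV' \<Longrightarrow> BM' (TR u) \<le> Bd * BM' u"
    by (rule TR_bounded) blast
  show ?thesis
  proof (rule B.fredholm_finite_rank_perturbation[where B = Bd and D = "low_dim L" and e = "low_basis L"
        and \<phi> = "\<lambda>j u. avg (L - 1) j u" and n = n and r = "1 / 2"])
    show "avg (L - 1) j (\<lambda>x. a * u x + b * v x) = a * avg (L - 1) j u + b * avg (L - 1) j v"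
      if "j < low_dim L" "u \<in> BV'" "v \<in> BV'" for j u v a b
    proof -
      have j: "j < 2 ^ (L - 1)" using that(1) by (simp add: low_dim_def split: if_splits)
      have "(\<lambda>x. a * u x) \<in> BV'" "(\<lambda>x. b * v x) \<in> BV'" using that by (auto intro: B.V_scale)
      then have "avg (L - 1) j (\<lambda>x. a * u x + b * v x) = avg (L - 1) j (\<lambda>x. a * u x) + avg (L - 1) j (\<lambda>x. b * v x)"
        using j by (intro avg_add) (auto simp: BV'_iff)
      then show ?thesis by (simp only: avg_cmult)
    qed
    show "BM' ((TR ^^ n) (\<lambda>x. v x - (\<Sum>j<low_dim L. avg (L - 1) j v * low_basis L j x))) \<le> 1 / 2 * norm z ^ n * BM' v"
      if v: "v \<in> BV'" for v
    proof -
      have "lqb q (bl s p ((TR ^^ n) (\<lambda>x. v x - partial_series v L x))) (R * BM' v)"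
        using L[OF p \<beta>p s q, of v] v by (simp add: R_def BV'_iff BM'_eq)
      then have "BM' ((TR ^^ n) (\<lambda>x. v x - partial_series v L x)) \<le> R * BM' v" by (rule BM'_le)
      also have "\<dots> \<le> 1 / 2 * norm z ^ n * BM' v" by (intro mult_right_mono Rz B.M_nonneg v)
      finally show ?thesis by (simp only: partial_series_finite_rank)
    qed
    show "z \<noteq> 0" using nz by auto
  qed (use Bd TR_linear low_basis_BV in auto)
qed

lemma TR_ess_spectral_radius:
  "ess_spectral_radius BV' (besov_norm s p q) TR
    \<le> ennreal (exp (h_top * (1 - 1 / p)) * lam powr (- (1 - 1 / p + s)))"
  unfolding ess_spectral_radius_def
proof (rule SUP_least)
  fix z assume "z \<in> ess_spectrum BV' (besov_norm s p q) TR"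
  then have "\<not> exp (h_top * (1 - 1 / p)) * lam powr (- (1 - 1 / p + s)) < norm z"
    using TR_fredholm by (auto simp: ess_spectrum_def)
  then show "ennreal (norm z) \<le> ennreal (exp (h_top * (1 - 1 / p)) * lam powr (- (1 - 1 / p + s)))"
    by (intro ennreal_leI) simp
qed

text \<open>The integral is invariant under \<open>TR\<close>, hence vanishes on the range of \<open>1 - TR\<close>.\<close>

lemma TR_spectral_radius: "1 \<le> op_spectral_radius BV' (besov_norm s p q) TR"
proof -
  have "\<not> invertible_operator BV' (besov_norm s p q) (\<lambda>v x. 1 * v x - TR v x)"
  proof
    assume "invertible_operator BV' (besov_norm s p q) (\<lambda>v x. 1 * v x - TR v x)"
    then obtain S where S: "bounded_operator BV' (besov_norm s p q) S"
      "\<And>v. v \<in> BV' \<Longrightarrow> besov_norm s p q (\<lambda>x. (1 * S v x - TR (S v) x) - v x) = 0"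
      unfolding invertible_operator_def by blast
    define v where "v = step 0 (\<lambda>j. 1)"
    have v: "v \<in> BV'" unfolding v_def by (rule step_in_BV[OF p s(1) q])
    define u where "u = S v"
    have u: "u \<in> BV'" using S(1) v by (simp add: bounded_operator_def u_def)
    have TRu: "TR u \<in> BV'" using TR_bounded_operator u by (simp add: bounded_operator_def)
    define w where "w = (\<lambda>x. (1 * u x - TR u x) - v x)"
    have w: "w \<in> BV'" using B.V_diff[OF B.V_diff[OF u TRu] v] by (simp add: w_def)
    have "besov_norm s p q w = 0" using S(2)[OF v] by (simp add: w_def u_def)
    then have "BM' w = 0" using B.null_iff[OF w] by simp
    then have w0: "integral {0..1} (\<lambda>x. norm (w x)) \<le> 0" using L1_le_BM[OF p s(1) q w] by simp
    have ai: "u absolutely_integrable_on {0..1}" "TR u absolutely_integrable_on {0..1}" "v absolutely_integrable_on {0..1}" "w absolutely_integrable_on {0..1}"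
      using u TRu v w by (auto simp: BV'_iff)
    have io: "u integrable_on {0..1}" "TR u integrable_on {0..1}" "v integrable_on {0..1}" "w integrable_on {0..1}"
      using ai by (auto simp: absolutely_integrable_on_def)
    have "norm (integral {0..1} w) \<le> integral {0..1} (\<lambda>x. norm (w x))"
      using ai(4) by (intro integral_norm_bound_integral) (auto simp: absolutely_integrable_on_def)
    from order_trans[OF this w0] have "integral {0..1} w = 0" by simp
    moreover have "integral {0..1} w = integral {0..1} u - integral {0..1} (TR u) - integral {0..1} v"
      unfolding w_def using io by (simp add: integral_diff integrable_diff)
    moreover have "integral {0..1} (TR u) = integral {0..1} u" by (rule TR_L1(2)[OF ai(1)])
    ultimately have "integral {0..1} v = 0" by simp
    moreover have "integral {0..1} v = avg 0 0 v" by (simp add: avg_def cell_def)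
    moreover have "avg 0 0 v = 1" using avg_step[of 0 0 0 "\<lambda>j. 1"] by (simp add: v_def)
    ultimately show False by simp
  qed
  then have "1 \<in> op_spectrum BV' (besov_norm s p q) TR" by (simp add: op_spectrum_def)
  then have "ennreal (norm (1::complex)) \<le> op_spectral_radius BV' (besov_norm s p q) TR"
    unfolding op_spectral_radius_def by (rule SUP_upper)
  then show ?thesis by simp
qed

end

lemma TR_quasi_compact:
  assumes s: "0 < s" "s < \<beta>" and q: "q \<ge> 1" and lam1: "lam > 1"
  shows "\<exists>p\<^sub>0>1. \<forall>p. 1 \<le> p \<and> p < p\<^sub>0 \<and> \<beta> * p \<le> 1 \<longrightarrow> quasi_compact (besov_space s p q) (besov_norm s p q) TR"
proof -
  have ll: "0 < ln lam" using lam1 by simp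
  \<comment> \<open>With t = 1 - 1/p, which is at most p - 1, the condition p < p0 gives
    \<open>t * (|h_top| + 1) < s * ln lam\<close> and hence
    \<open>h_top * t < (t + s) * ln lam\<close>. The summand 1 in the denominator avoids division by
    zero.\<close>
  define p0 where "p0 = 1 + s * ln lam / (\<bar>h_top\<bar> + 1)"
  have "p0 > 1" using s ll by (simp add: p0_def)
  moreover have "quasi_compact (besov_space s p q) (besov_norm s p q) TR"
    if p: "1 \<le> p" "p < p0" "\<beta> * p \<le> 1" for p
  proof -
    define t where "t = 1 - 1 / p"
    have t0: "0 \<le> t" using p by (simp add: t_def)
    have "p * (1 - 1 / p) = p - 1" using p by (simp add: right_diff_distrib)
    moreover have "1 * t \<le> p * t" using p t0 by (intro mult_right_mono) auto
    ultimately have "t \<le> p - 1" by (simp add: t_def)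
    also have "p - 1 < s * ln lam / (\<bar>h_top\<bar> + 1)" using p by (simp add: p0_def)
    finally have "t * (\<bar>h_top\<bar> + 1) < s * ln lam" by (simp add: pos_less_divide_eq)
    moreover have "h_top * t \<le> t * (\<bar>h_top\<bar> + 1)"
      using t0 mult_left_mono[of h_top "\<bar>h_top\<bar> + 1" t] by (simp add: mult.commute)
    ultimately have "h_top * t < s * ln lam" by linarith
    moreover have "0 \<le> t * ln lam" using t0 ll by simp
    ultimately have neg: "h_top * t - (t + s) * ln lam < 0" by (simp add: algebra_simps)
    have "exp (h_top * t) * lam powr (- (t + s)) = exp (h_top * t - (t + s) * ln lam)"
      using lam1 by (simp add: powr_def exp_add[symmetric] algebra_simps)
    then have "exp (h_top * t) * lam powr (- (t + s)) < 1" using neg by simp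
    then have "ennreal (exp (h_top * t) * lam powr (- (t + s))) < 1"
      by (simp add: ennreal_less_one_iff)
    then have "ess_spectral_radius (besov_space s p q) (besov_norm s p q) TR < 1"
      using TR_ess_spectral_radius[OF p(1) s q p(3)] unfolding t_def by (rule le_less_trans[rotated])
    then show ?thesis
      using TR_spectral_radius[OF p(1) s q p(3)] TR_bounded_operator[OF p(1) s q p(3)]
      by (auto simp: quasi_compact_def intro: less_le_trans)
  qed
  ultimately show ?thesis by blast
qed

end

section \<open>Inverse branches of a piecewise diffeomorphism\<close>

text \<open>Makes derivatives within the interval unique, also at endpoints that belong to it, so
  that \<open>vector_derivative\<close> is the derivative given by the smoothness
  hypothesis.\<close>

lemma interval_at_within_not_bot:
  assumes "connected (S :: real set)" "a \<in> S" "b \<in> S" "a \<noteq> b" "x \<in> S"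
  shows "at x within S \<noteq> bot"
proof -
  have "\<not> (\<exists>c. S = {c})" using assms by auto
  then have "x islimpt S" by (intro connected_imp_perfect[OF assms(1,5)]) blast
  then show ?thesis by (simp add: trivial_limit_within)
qed

lemma C1_holder_onE:
  assumes "C1_holder_on \<gamma> S f"
  obtains f' C where "\<And>x. x \<in> S \<Longrightarrow> (f has_real_derivative f' x) (at x within S)"
    and "\<And>x y. x \<in> S \<Longrightarrow> y \<in> S \<Longrightarrow> \<bar>f' x - f' y\<bar> \<le> C * \<bar>x - y\<bar> powr \<gamma>"
  using assms unfolding C1_holder_on_def holder_on_def
  by (elim exE conjE) (rule that, erule (1) bspec, drule (1) bspec, erule (1) bspec)

text \<open>The chain rule for the identity makes the two derivatives reciprocal. The expansion
  condition passes from difference quotients to the derivative in the limit, and an upper bound for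
  the derivative of f becomes a lower bound for that of its inverse.\<close>

lemma C1_holder_diffeo_facts:
  fixes f :: "real \<Rightarrow> real" and S :: "real set"
  defines "g \<equiv> the_inv_into S f"
  defines "d \<equiv> \<lambda>x. vector_derivative g (at x within f ` S)"
  assumes S: "is_interval S" "interior S \<noteq> {}" "S \<subseteq> {0..1}" "f ` S \<subseteq> {0..1}"
    and diffeo: "C1_holder_diffeo_on \<gamma> S f" and \<gamma>: "0 < \<beta>" "\<beta> \<le> \<gamma>"
    and expand: "\<And>x y. x \<in> S \<Longrightarrow> y \<in> S \<Longrightarrow> \<alpha> * \<bar>x - y\<bar> \<le> \<bar>f x - f y\<bar>"
  shows "\<exists>f' L H. 0 < L \<and> 0 \<le> H \<and>
    (\<forall>x\<in>S. vector_derivative f (at x within S) = f' x \<and> \<alpha> \<le> \<bar>f' x\<bar>) \<and>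
    (\<forall>x\<in>f ` S. (g has_field_derivative d x) (at x within f ` S) \<and> \<bar>d x\<bar> * \<bar>f' (g x)\<bar> = 1 \<and> 1 / L \<le> \<bar>d x\<bar>) \<and>
    (\<forall>x\<in>f ` S. \<forall>y\<in>f ` S. \<bar>d x - d y\<bar> \<le> H * \<bar>x - y\<bar> powr \<beta>)"
proof -
  have inj: "inj_on f S" using diffeo by (simp add: C1_holder_diffeo_on_def)
  have hol: "C1_holder_on \<gamma> S f" "C1_holder_on \<gamma> (f ` S) g"
    using diffeo by (simp_all add: C1_holder_diffeo_on_def g_def)
  obtain f' C where f': "\<And>x. x \<in> S \<Longrightarrow> (f has_real_derivative f' x) (at x within S)"
    and C: "\<And>x y. x \<in> S \<Longrightarrow> y \<in> S \<Longrightarrow> \<bar>f' x - f' y\<bar> \<le> C * \<bar>x - y\<bar> powr \<gamma>"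
    by (rule C1_holder_onE[OF hol(1)], rule that)
  obtain g' D where g': "\<And>x. x \<in> f ` S \<Longrightarrow> (g has_real_derivative g' x) (at x within f ` S)"
    and D: "\<And>x y. x \<in> f ` S \<Longrightarrow> y \<in> f ` S \<Longrightarrow> \<bar>g' x - g' y\<bar> \<le> D * \<bar>x - y\<bar> powr \<gamma>"
    by (rule C1_holder_onE[OF hol(2)], rule that)
  have gf: "g (f x) = x" if "x \<in> S" for x unfolding g_def using inj that by (rule the_inv_into_f_f)
  obtain a0 where "a0 \<in> interior S" using S(2) by blast
  then obtain e where e: "0 < e" "ball a0 e \<subseteq> S" unfolding mem_interior by blast
  have ab: "a0 \<in> S" "a0 + e / 2 \<in> S" "a0 \<noteq> a0 + e / 2"
    using e by (auto simp: subset_iff dist_real_def)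
  have conS: "connected S" using S(1) by (simp add: is_interval_connected_1)
  have fcont: "continuous_on S f" using f' by (rule DERIV_continuous_on)
  have conf: "connected (f ` S)" by (rule connected_continuous_image[OF fcont conS])
  have fab: "f a0 \<noteq> f (a0 + e / 2)" using inj ab by (auto dest: inj_onD)
  have nbS: "at x within S \<noteq> bot" if "x \<in> S" for x by (rule interval_at_within_not_bot[OF conS ab that])
  have nbf: "at x within f ` S \<noteq> bot" if "x \<in> f ` S" for x
    by (rule interval_at_within_not_bot[OF conf imageI[OF ab(1)] imageI[OF ab(2)] fab that])
  have vf: "vector_derivative f (at x within S) = f' x" if "x \<in> S" for x
    using f'[OF that] by (intro vector_derivative_within[OF nbS[OF that]]) (simp add: has_real_derivative_iff_has_vector_derivative)
  have dg: "d x = g' x" if "x \<in> f ` S" for x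
    unfolding d_def using g'[OF that]
    by (intro vector_derivative_within[OF nbf[OF that]]) (simp add: has_real_derivative_iff_has_vector_derivative)
  have prod: "g' (f x) * f' x = 1" if x: "x \<in> S" for x
  proof -
    have "(g \<circ> f has_real_derivative g' (f x) * f' x) (at x within S)"
      by (rule DERIV_image_chain[OF g'[OF imageI[OF x]] f'[OF x]])
    then have "((\<lambda>x. x) has_real_derivative g' (f x) * f' x) (at x within S)"
      by (rule has_field_derivative_transform_within[OF _ zero_less_one x]) (simp add: gf)
    moreover have "((\<lambda>x. x) has_real_derivative 1) (at x within S)" by (rule DERIV_ident)
    ultimately show ?thesis using nbS[OF x] by (rule has_field_derivative_unique)
  qed
  have lower: "\<alpha> \<le> \<bar>f' x\<bar>" if x: "x \<in> S" for x
  proof (rule tendsto_lowerbound[OF _ _ nbS[OF x]])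
    have "((\<lambda>y. (f y - f x) / (y - x)) \<longlongrightarrow> f' x) (at x within S)"
      using f'[OF x] by (simp add: has_field_derivative_iff)
    then show "((\<lambda>y. \<bar>(f y - f x) / (y - x)\<bar>) \<longlongrightarrow> \<bar>f' x\<bar>) (at x within S)" by (rule tendsto_rabs)
    have "\<alpha> \<le> \<bar>(f y - f x) / (y - x)\<bar>" if "y \<in> S" "y \<noteq> x" for y
      using expand[OF that(1) x] that(2) by (simp add: abs_divide pos_le_divide_eq)
    then show "\<forall>\<^sub>F y in at x within S. \<alpha> \<le> \<bar>(f y - f x) / (y - x)\<bar>"
      by (auto simp: eventually_at_filter intro!: always_eventually)
  qed
  have le1: "\<bar>x - y\<bar> \<le> 1" if "x \<in> {0..1}" "y \<in> {0..1}" for x y :: real using that by auto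
  \<comment> \<open>The interval need not be closed, so the bound comes from the Hoelder condition
    around \<open>a0\<close> and not from compactness.\<close>
  define L where "L = \<bar>f' a0\<bar> + \<bar>C\<bar> + 1"
  have L: "0 < L" "\<bar>f' x\<bar> \<le> L" if "x \<in> S" for x
  proof -
    have "\<bar>x - a0\<bar> powr \<gamma> \<le> 1 powr \<gamma>" using le1[of x a0] subsetD[OF S(3) that] subsetD[OF S(3) ab(1)] \<gamma> by (intro powr_mono2) auto
    then have "\<bar>C\<bar> * \<bar>x - a0\<bar> powr \<gamma> \<le> \<bar>C\<bar> * 1" by (intro mult_left_mono) auto
    moreover have "C * \<bar>x - a0\<bar> powr \<gamma> \<le> \<bar>C\<bar> * \<bar>x - a0\<bar> powr \<gamma>" by (intro mult_right_mono) auto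
    ultimately show "\<bar>f' x\<bar> \<le> L" using C[OF that ab(1)] unfolding L_def by linarith
  qed (simp add: L_def)
  have L0: "0 < L" by (simp add: L_def)
  have main: "(g has_field_derivative d x) (at x within f ` S) \<and> \<bar>d x\<bar> * \<bar>f' (g x)\<bar> = 1 \<and> 1 / L \<le> \<bar>d x\<bar>"
    if x: "x \<in> f ` S" for x
  proof -
    obtain y where y: "y \<in> S" "x = f y" using x by blast
    have gx: "g x = y" using gf y by simp
    have "d x * f' y = 1" using prod[OF y(1)] dg[OF x] y(2) by simp
    then have p: "\<bar>d x\<bar> * \<bar>f' y\<bar> = 1" by (metis abs_mult abs_one)
    have "1 = \<bar>d x\<bar> * \<bar>f' y\<bar>" using p by simp
    also have "\<dots> \<le> \<bar>d x\<bar> * L" using L(2)[OF y(1)] by (intro mult_left_mono) auto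
    finally have "1 / L \<le> \<bar>d x\<bar>" using L0 by (simp add: pos_divide_le_eq)
    then show ?thesis using p gx g'[OF x] dg[OF x] by simp
  qed
  have hold: "\<bar>d x - d y\<bar> \<le> \<bar>D\<bar> * \<bar>x - y\<bar> powr \<beta>" if x: "x \<in> f ` S" and y: "y \<in> f ` S" for x y
  proof -
    have "\<bar>d x - d y\<bar> \<le> D * \<bar>x - y\<bar> powr \<gamma>" using D[OF x y] by (simp add: dg x y)
    also have "\<dots> \<le> \<bar>D\<bar> * \<bar>x - y\<bar> powr \<gamma>" by (intro mult_right_mono) auto
    \<comment> \<open>The Hoelder exponent may be lowered because distances in the unit interval are
      at most 1.\<close>
    also have "\<bar>x - y\<bar> powr \<gamma> \<le> \<bar>x - y\<bar> powr \<beta>" using le1[of x y] subsetD[OF S(4) x] subsetD[OF S(4) y] \<gamma> by (intro powr_mono') auto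
    then have "\<bar>D\<bar> * \<bar>x - y\<bar> powr \<gamma> \<le> \<bar>D\<bar> * \<bar>x - y\<bar> powr \<beta>" by (intro mult_left_mono) auto
    finally show ?thesis .
  qed
  show ?thesis
  proof (rule exI[of _ f'], rule exI[of _ L], rule exI[of _ "\<bar>D\<bar>"], intro conjI)
    show "\<forall>x\<in>S. vector_derivative f (at x within S) = f' x \<and> \<alpha> \<le> \<bar>f' x\<bar>" using vf lower by blast
    show "\<forall>x\<in>f ` S. (g has_field_derivative d x) (at x within f ` S) \<and> \<bar>d x\<bar> * \<bar>f' (g x)\<bar> = 1 \<and> 1 / L \<le> \<bar>d x\<bar>"
      using main by blast
    show "\<forall>x\<in>f ` S. \<forall>y\<in>f ` S. \<bar>d x - d y\<bar> \<le> \<bar>D\<bar> * \<bar>x - y\<bar> powr \<beta>" using hold by blast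
  qed (use L0 in auto)
qed

lemma transfer_operator_eq:
  assumes "finite \<Lambda>"
  shows "transfer_operator \<Lambda> J f = transfer \<Lambda> (\<lambda>i. f ` J i) (\<lambda>i. the_inv_into (J i) f)
    (\<lambda>i x. vector_derivative (the_inv_into (J i) f) (at x within f ` J i))"
  by (intro ext) (simp add: transfer_operator_def transfer_def sum.inter_filter[OF assms] cong: conj_cong)

lemma expanding_branchesI:
  fixes f :: "real \<Rightarrow> real" and \<Lambda> :: "'i set" and J :: "'i \<Rightarrow> real set"
  assumes f: "continuous_on {0..1} f" "f ` {0..1} \<subseteq> {0..1}"
    and part: "interval_partition \<Lambda> J" and \<beta>: "\<beta> > 0" "\<beta> \<le> \<gamma>"
    and diffeo: "\<And>i. i \<in> \<Lambda> \<Longrightarrow> C1_holder_diffeo_on \<gamma> (J i) f"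
    and \<alpha>: "\<alpha> > 1"
    and expand: "\<And>i x y. i \<in> \<Lambda> \<Longrightarrow> x \<in> J i \<Longrightarrow> y \<in> J i \<Longrightarrow> \<bar>f x - f y\<bar> \<ge> \<alpha> * \<bar>x - y\<bar>"
  obtains Lc Hc where "expanding_branches \<Lambda> J f (\<lambda>i. the_inv_into (J i) f)
      (\<lambda>i x. vector_derivative (the_inv_into (J i) f) (at x within f ` J i)) \<alpha> (min_expansion \<Lambda> J f) Lc Hc \<beta>"
    and "min_expansion \<Lambda> J f \<ge> \<alpha>"
proof -
  define g where "g = (\<lambda>i. the_inv_into (J i) f)"
  define d where "d = (\<lambda>i x. vector_derivative (g i) (at x within f ` J i))"
  define lam where "lam = min_expansion \<Lambda> J f"
  have fin: "finite \<Lambda>" and Ji: "\<And>i. i \<in> \<Lambda> \<Longrightarrow> is_interval (J i)" "\<And>i. i \<in> \<Lambda> \<Longrightarrow> interior (J i) \<noteq> {}"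
    and disj: "disjoint_family_on J \<Lambda>" and un: "(\<Union>i\<in>\<Lambda>. J i) = {0..1}"
    using part by (auto simp: interval_partition_def)
  have Jsub: "J i \<subseteq> {0..1}" if "i \<in> \<Lambda>" for i using un that by blast
  have fJ: "f ` J i \<subseteq> {0..1}" if "i \<in> \<Lambda>" for i using Jsub[OF that] f(2) by blast
  have inj: "inj_on f (J i)" if "i \<in> \<Lambda>" for i using diffeo[OF that] by (simp add: C1_holder_diffeo_on_def)
  define Q where "Q = (\<lambda>i f' L H. 0 < L \<and> 0 \<le> H \<and>
    (\<forall>x\<in>J i. vector_derivative f (at x within J i) = f' x \<and> \<alpha> \<le> \<bar>f' x\<bar>) \<and>
    (\<forall>x\<in>f ` J i. (g i has_field_derivative d i x) (at x within f ` J i) \<and> \<bar>d i x\<bar> * \<bar>f' (g i x)\<bar> = 1 \<and> 1 / L \<le> \<bar>d i x\<bar>) \<and>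
    (\<forall>x\<in>f ` J i. \<forall>y\<in>f ` J i. \<bar>d i x - d i y\<bar> \<le> H * \<bar>x - y\<bar> powr \<beta>))"
  have "\<exists>f' L H. Q i f' L H" if i: "i \<in> \<Lambda>" for i
    unfolding Q_def g_def d_def
    by (rule C1_holder_diffeo_facts[OF Ji(1)[OF i] Ji(2)[OF i] Jsub[OF i] fJ[OF i] diffeo[OF i] \<beta> expand[OF i]])
  then have "\<forall>i\<in>\<Lambda>. \<exists>z. Q i (fst z) (fst (snd z)) (snd (snd z))" by fastforce
  from bchoice[OF this] obtain z where z: "\<And>i. i \<in> \<Lambda> \<Longrightarrow> Q i (fst (z i)) (fst (snd (z i))) (snd (snd (z i)))" by blast
  define f' where "f' = (\<lambda>i. fst (z i))"
  define L where "L = (\<lambda>i. fst (snd (z i)))"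
  define H where "H = (\<lambda>i. snd (snd (z i)))"
  have Qi: "0 < L i" "0 \<le> H i" "\<And>x. x \<in> J i \<Longrightarrow> vector_derivative f (at x within J i) = f' i x"
    "\<And>x. x \<in> J i \<Longrightarrow> \<alpha> \<le> \<bar>f' i x\<bar>"
    "\<And>x. x \<in> f ` J i \<Longrightarrow> (g i has_field_derivative d i x) (at x within f ` J i)"
    "\<And>x. x \<in> f ` J i \<Longrightarrow> \<bar>d i x\<bar> * \<bar>f' i (g i x)\<bar> = 1"
    "\<And>x. x \<in> f ` J i \<Longrightarrow> 1 / L i \<le> \<bar>d i x\<bar>"
    "\<And>x y. x \<in> f ` J i \<Longrightarrow> y \<in> f ` J i \<Longrightarrow> \<bar>d i x - d i y\<bar> \<le> H i * \<bar>x - y\<bar> powr \<beta>"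
    if "i \<in> \<Lambda>" for i
    using z[OF that] unfolding Q_def f'_def L_def H_def by blast+
  have gJ: "g i x \<in> J i" "f (g i x) = x" if "i \<in> \<Lambda>" "x \<in> f ` J i" for i x
    unfolding g_def using inj[OF that(1)] that(2)
    by (auto simp: f_the_inv_into_f intro: the_inv_into_into)
  let ?X = "{\<bar>vector_derivative f (at x within J i)\<bar> | i x. i \<in> \<Lambda> \<and> x \<in> J i}"
  \<comment> \<open>Nonemptiness is needed before the infimum in \<open>min_expansion\<close> can be
    bounded from below by \<alpha>.\<close>
  have "0 \<in> (\<Union>i\<in>\<Lambda>. J i)" unfolding un by simp
  then obtain i0 where "i0 \<in> \<Lambda>" "0 \<in> J i0" by blast
  then have ne: "?X \<noteq> {}" by blast
  have lam\<alpha>: "\<alpha> \<le> lam"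
    unfolding lam_def min_expansion_def
  proof (rule cInf_greatest[OF ne])
    fix y assume "y \<in> ?X"
    then obtain i x where "y = \<bar>vector_derivative f (at x within J i)\<bar>" "i \<in> \<Lambda>" "x \<in> J i" by blast
    then show "\<alpha> \<le> y" using Qi(3,4) by simp
  qed
  have laml: "lam \<le> \<bar>f' i x\<bar>" if "i \<in> \<Lambda>" "x \<in> J i" for i x
    unfolding lam_def min_expansion_def
  proof (rule cInf_lower)
    show "\<bar>f' i x\<bar> \<in> ?X" using Qi(3)[OF that] that by (intro CollectI exI[of _ i] exI[of _ x]) simp
    show "bdd_below ?X" by (rule bdd_belowI[of _ 0]) auto
  qed
  define Lc where "Lc = 1 + (\<Sum>i\<in>\<Lambda>. L i)"
  define Hc where "Hc = (\<Sum>i\<in>\<Lambda>. H i)"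
  have Lle: "L i \<le> Lc" if "i \<in> \<Lambda>" for i
    using member_le_sum[of i \<Lambda> L] fin that Qi(1) by (force simp: Lc_def)
  have Hle: "H i \<le> Hc" if "i \<in> \<Lambda>" for i
    unfolding Hc_def using fin that Qi(2) by (intro member_le_sum) auto
  have Lc0: "0 < Lc" unfolding Lc_def using Qi(1) by (intro add_pos_nonneg sum_nonneg) (auto intro: less_imp_le)
  have Hc0: "0 \<le> Hc" unfolding Hc_def using Qi(2) by (intro sum_nonneg) auto
  have "expanding_branches \<Lambda> J f g d \<alpha> lam Lc Hc \<beta>"
  proof (unfold_locales, goal_cases)
    case 1 show ?case by (rule fin)
  next
    case (2 i) then show ?case by (rule Ji(1))
  next
    case (3 i) then show ?case by (rule Jsub)
  next
    case (4 i j x) then show ?case using disj by (auto simp: disjoint_family_on_def)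
  next
    case (5 x) then show ?case using un by blast
  next
    case (6 x) then show ?case using f(2) by blast
  next
    case (7 i) then show ?case using continuous_on_subset[OF f(1) Jsub] by blast
  next
    case (8 i x) then show ?case by (rule gJ(1))
  next
    case (9 i x) then show ?case by (rule gJ(2))
  next
    case (10 i x) then show ?case unfolding g_def using inj by (intro the_inv_into_f_f)
  next
    case (11 i x) then show ?case by (rule Qi(5))
  next
    case (12 i x)
    have "lam * \<bar>d i x\<bar> \<le> \<bar>f' i (g i x)\<bar> * \<bar>d i x\<bar>" using laml[OF 12(1) gJ(1)[OF 12]] by (intro mult_right_mono) auto
    also have "\<dots> = 1" using Qi(6)[OF 12] by (simp add: mult.commute)
    finally show ?case using lam\<alpha> \<alpha> by (simp add: pos_le_divide_eq mult.commute)
  next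
    case (13 i x)
    have "1 / Lc \<le> 1 / L i" using Lle[OF 13(1)] Qi(1)[OF 13(1)] Lc0 by (intro divide_left_mono) auto
    then show ?case using Qi(7)[OF 13] by linarith
  next
    case (14 i x y)
    have "H i * \<bar>x - y\<bar> powr \<beta> \<le> Hc * \<bar>x - y\<bar> powr \<beta>" using Hle[OF 14(1)] by (intro mult_right_mono) auto
    then show ?case using Qi(8)[OF 14] by linarith
  next
    case (15 i x y) then show ?case by (rule expand)
  next
    case 16 show ?case by (rule \<alpha>)
  next
    case 17 show ?case using lam\<alpha> \<alpha> by simp
  next
    case 18 show ?case by (rule Lc0)
  next
    case 19 show ?case by (rule Hc0)
  next
    case 20 show ?case by (rule \<beta>(1))
  qed
  then show thesis using that[of Lc Hc] lam\<alpha> unfolding g_def d_def lam_def by blast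
qed

theorem theorem8p1:
  fixes f :: "real \<Rightarrow> real" and \<Lambda> :: "'i set" and J :: "'i \<Rightarrow> real set"
    and \<alpha> \<beta> \<epsilon> s :: real and q :: ennreal
  assumes "continuous_on {0..1} f" and "f ` {0..1} \<subseteq> {0..1}"
    and "interval_partition \<Lambda> J"
    and "\<beta> > 0" and "\<epsilon> > 0"
    and "\<And>i. i \<in> \<Lambda> \<Longrightarrow> C1_holder_diffeo_on (\<beta> + \<epsilon>) (J i) f"
    and "\<alpha> > 1"
    and "\<And>i x y. i \<in> \<Lambda> \<Longrightarrow> x \<in> J i \<Longrightarrow> y \<in> J i \<Longrightarrow> \<bar>f x - f y\<bar> \<ge> \<alpha> * \<bar>x - y\<bar>"
    and "q \<ge> 1" and "0 < s" and "s < \<beta>"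
  shows "(\<forall>p p'_inv::real. 1 \<le> p \<and> \<beta> < 1 / p \<and> 1 / p + p'_inv = 1 \<longrightarrow>
            bounded_operator (besov_space s p q) (besov_norm s p q) (transfer_operator \<Lambda> J f) \<and>
            ess_spectral_radius (besov_space s p q) (besov_norm s p q) (transfer_operator \<Lambda> J f)
              \<le> ennreal (exp (real_of_ereal (topological_entropy f {0..1}) * p'_inv)
                         * min_expansion \<Lambda> J f powr (- (p'_inv + s)))) \<and>
         (\<exists>p\<^sub>0>1. \<forall>p. 1 \<le> p \<and> p < p\<^sub>0 \<and> \<beta> < 1 / p \<longrightarrow>
            quasi_compact (besov_space s p q) (besov_norm s p q) (transfer_operator \<Lambda> J f))"
proof -
  have \<beta>\<epsilon>: "\<beta> \<le> \<beta> + \<epsilon>" using assms(5) by simp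
  obtain Lc Hc where E: "expanding_branches \<Lambda> J f (\<lambda>i. the_inv_into (J i) f)
      (\<lambda>i x. vector_derivative (the_inv_into (J i) f) (at x within f ` J i)) \<alpha> (min_expansion \<Lambda> J f) Lc Hc \<beta>"
    and lam_ge: "min_expansion \<Lambda> J f \<ge> \<alpha>"
    by (rule expanding_branchesI[OF assms(1-4) \<beta>\<epsilon> assms(6-8)])
  interpret expanding_branches \<Lambda> J f "\<lambda>i. the_inv_into (J i) f"
    "\<lambda>i x. vector_derivative (the_inv_into (J i) f) (at x within f ` J i)" \<alpha> "min_expansion \<Lambda> J f" Lc Hc \<beta>
    by (rule E)
  have T: "transfer_operator \<Lambda> J f = TR" by (rule transfer_operator_eq[OF finite_\<Lambda>])
  have \<beta>p: "\<beta> * p \<le> 1" if "1 \<le> p" "\<beta> < 1 / p" for p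
    using that by (simp add: pos_less_divide_eq less_imp_le)
  have lam1: "min_expansion \<Lambda> J f > 1" using lam_ge assms(7) by simp
  show ?thesis
  proof (intro conjI allI impI)
    fix p p'_inv :: real assume "1 \<le> p \<and> \<beta> < 1 / p \<and> 1 / p + p'_inv = 1"
    then have p: "1 \<le> p" "\<beta> * p \<le> 1" and p': "p'_inv = 1 - 1 / p" using \<beta>p by auto
    show "bounded_operator (besov_space s p q) (besov_norm s p q) (transfer_operator \<Lambda> J f)"
      unfolding T by (rule TR_bounded_operator[OF p(1) assms(10,11,9) p(2)])
    show "ess_spectral_radius (besov_space s p q) (besov_norm s p q) (transfer_operator \<Lambda> J f)
        \<le> ennreal (exp (real_of_ereal (topological_entropy f {0..1}) * p'_inv)
          * min_expansion \<Lambda> J f powr (- (p'_inv + s)))"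
      unfolding T p' using TR_ess_spectral_radius[OF p(1) assms(10,11,9) p(2)] by (simp only: h_top_def)
  next
    obtain p0 where "p0 > 1" "\<forall>p. 1 \<le> p \<and> p < p0 \<and> \<beta> * p \<le> 1 \<longrightarrow> quasi_compact (besov_space s p q) (besov_norm s p q) TR"
      using TR_quasi_compact[OF assms(10,11,9) lam1] by blast
    then show "\<exists>p\<^sub>0>1. \<forall>p. 1 \<le> p \<and> p < p\<^sub>0 \<and> \<beta> < 1 / p \<longrightarrow>
        quasi_compact (besov_space s p q) (besov_norm s p q) (transfer_operator \<Lambda> J f)"
      unfolding T using \<beta>p by (intro exI[of _ p0]) auto
  qed
qed

end
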